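(* Suppose that the six standing conditions (quasi-uniform partition, local basis, data generating process, loss function, simplified setup, approximation error) listed in the context hold, that $\rho(y,\eta(\theta);q)$ is convex with respect to $\theta$ with left or right derivative $\psi(y,\eta(\theta);q)\eta^{(1)}(\theta)$, that $\mathcal{B}=\mathbb{R}^K$ in the definition of $\widehat{\boldsymbol\beta}(q)$, and that $m>d/2$. Furthermore, assume that one of the following two conditions holds: (i) $\frac{(\log n)^{\frac{\nu}{\nu-1}}}{nh^{\frac{2\nu}{\nu-1}d}}=o(1)$, or (ii) $\frac{(\log n)^{3/2}}{nh^{2d}}=o(1)$ and $\overline\psi(\mathbf x_i,y_i)$ is sub-Gaussian conditional on $\mathbf x_i$. Then $$\sup_{q\in\mathcal{Q}}\|\widehat{\boldsymbol\beta}(q)-\boldsymbol\beta_0(q)\|=o_{\mathbb P}(1),$$ $$\sup_{\mathbf x\in\mathcal{X}}\sup_{q\in\mathcal{Q}}|\widehat\mu^{(\mathbf v)}(\mathbf x,q)-\mu_0^{(\mathbf v)}(\mathbf x,q)|=o_{\mathbb P}(h^{-|\mathbf v|}),$$ $$\sup_{q\in\mathcal{Q}}\int\big(\widehat\mu^{(\mathbf v)}(\mathbf x,q)-\mu_0^{(\mathbf v)}(\mathbf x,q)\big)^2f_X(\mathbf x)\,d\mathbf x=o_{\mathbb P}(h^{d-2|\mathbf v|}).$$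
   Context: **Notation.** Limits are as $n\to\infty$; $d,m$ are fixed, while $K,\Delta,\mathbf p,h$ depend on $n$. $a_n\lesssim b_n$ means $\limsup_n|a_n/b_n|<\infty$. $a\wedge b=\min\{a,b\}$, $a\vee b=\max\{a,b\}$. $\|\cdot\|$ is the Euclidean norm. For a multi-index $\mathbf v$, $|\mathbf v|$ is the sum of its entries and $f^{(\mathbf v)}$ the corresponding partial derivative (in $\mathbf x$ for functions of $(\mathbf x,q)$). A random variable $\xi$ is sub-Gaussian conditional on $\mathbf X$ if for some constant $\sigma^2>0$, $\mathbb P(|\xi|\ge t\mid\mathbf X=\mathbf x)\le2\exp(-t^2/\sigma^2)$ for all $t\ge0$, $\mathbf x\in\mathcal{X}$. A function $f$ is $\alpha$-Hölder on a set if $|f(x_1)-f(x_2)|\le C\|x_1-x_2\|^\alpha$ there for some constant $C>0$. $\mathbf 1(\cdot)$ is the indicator. **Setting.** $(y_1,\mathbf x_1),\dots,(y_n,\mathbf x_n)$ are i.i.d. copies of $(Y,\mathbf X)\in\mathcal{Y}\times\mathcal{X}\subseteq\mathbb{R}\times\mathbb{R}^d$. The loss is $\rho:\mathcal{Y}\times\mathcal{E}\times\mathcal{Q}\to\mathbb{R}$ with $\mathcal{E}\subseteq\mathbb{R}$ open connected and $\mathcal{Q}\subseteq\mathbb{R}$ connected compact; $\eta:\mathbb{R}\to\mathcal{E}$ is strictly monotonic. The parameter $\mu_0:\mathcal{X}\times\mathcal{Q}\to\mathbb{R}$ satisfies $$\mu_0(\cdot,q)\in\arg\min_{\mu}\mathbb{E}[\rho(y_i,\eta(\mu(\mathbf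 x_i));q)]\qquad(\ast)$$ over measurable $\mu:\mathcal{X}\to\mathbb{R}$ (the (local) minimum is assumed achieved). The estimator is $\widehat\mu(\mathbf x,q)=\mathbf p(\mathbf x)^\top\widehat{\boldsymbol\beta}(q)$, $\widehat{\boldsymbol\beta}(q)\in\arg\min_{\mathbf b\in\mathcal{B}}\sum_{i=1}^n\rho(y_i,\eta(\mathbf p(\mathbf x_i)^\top\mathbf b);q)$, with $\mathcal{B}\subseteq\mathbb{R}^K$ the feasible set, and $\widehat\mu^{(\mathbf v)}(\mathbf x,q)=\mathbf p^{(\mathbf v)}(\mathbf x)^\top\widehat{\boldsymbol\beta}(q)$. Here $\mathbf p=(p_1,\dots,p_K)^\top$ is a dictionary of $K$ locally supported basis functions of order $m$ based on a partition $\Delta=\{\delta_l:1\le l\le\kappa\}$ of open disjoint polyhedra in $\mathcal{X}$ such that the closure of their union covers $\mathcal{X}$. **Quasi-uniform partition.** The ratio of the sizes of inscribed and circumscribed balls of each $\delta\in\Delta$ is bounded away from zero uniformly in $\delta\in\Delta$, and $\max_{\delta\in\Delta}\mathrm{diam}(\delta)/\min_{\delta\in\Delta}\mathrm{diam}(\delta)\lesssim1$. With $h=\max_{\delta\in\Delta}\mathrm{diam}(\delta)$: $h=o(1)$ and $\log(1/h)\lesssim\log n$. **Local basis.** (A function is active on $\delta$ if it is not identically zero on $\delta$.) (i) For each $k$, the union of elements of $\Delta$ on which $p_k$ is active is a connected set, denoted $\mathcal{H}_k$; for all $k$, both the number of elements of $\Delta$ in $\mathcal{H}_k$ and the number of basis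 functions active on $\mathcal{H}_k$ are bounded by a constant. (ii) For any $\mathbf a=(a_1,\dots,a_K)^\top\in\mathbb{R}^K$, $a_k^2h^d\lesssim\mathbf a^\top\int_{\mathcal{H}_k}\mathbf p(\mathbf x)\mathbf p(\mathbf x)^\top d\mathbf x\,\mathbf a$ for $k=1,\dots,K$. (iii) $|\mathbf v|<m$, and there is an integer $\varsigma\in[|\mathbf v|,m)$ such that for all multi-indices $\boldsymbol\varsigma$ with $|\boldsymbol\varsigma|\le\varsigma$, $h^{-|\boldsymbol\varsigma|}\lesssim\inf_{\delta\in\Delta}\inf_{\mathbf x\in\mathrm{cl}(\delta)}\|\mathbf p^{(\boldsymbol\varsigma)}(\mathbf x)\|\le\sup_{\delta\in\Delta}\sup_{\mathbf x\in\mathrm{cl}(\delta)}\|\mathbf p^{(\boldsymbol\varsigma)}(\mathbf x)\|\lesssim h^{-|\boldsymbol\varsigma|}$, $\mathrm{cl}$ denoting closure. **Data generating process.** (i) $((y_i,\mathbf x_i):1\le i\le n)$ is a random sample satisfying $(\ast)$. (ii) $\mathbf x_i$ has a Lebesgue density $f_X$ that is continuous and bounded away from zero on its support $\mathcal{X}\subset\mathbb{R}^d$, where $\mathcal{X}$ is the closure of an open, connected and bounded set. (iii) The conditional distribution of $y_i$ given $\mathbf x_i$ has a conditional density $f_{Y|X}(y|\mathbf x)$ with support $\mathcal{Y}_{\mathbf x}$ with respect to some sigma-finite measure $\mathfrak{M}$, and $\sup_{\mathbf x\in\mathcal{X}}\sup_{y\in\mathcal{Y}_{\mathbf x}}f_{Y|X}(y|\mathbf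 x)<\infty$. (iv) $\mathbf x\mapsto\mu_0(\mathbf x,q)$ is $m\ge1$ times continuously differentiable for every $q\in\mathcal{Q}$; $\mu_0(\cdot,q)$ and its derivatives of order at most $m$ are bounded uniformly over $(\mathbf x,q)\in\mathcal{X}\times\mathcal{Q}$; and $\sup_{\mathbf x\in\mathcal{X}}\sup_{q_1\ne q_2}|\mu_0(\mathbf x,q_1)-\mu_0(\mathbf x,q_2)|/|q_1-q_2|\lesssim1$. **Loss function.** Let $B_q(\mathbf x)=\{\zeta:|\zeta-\mu_0(\mathbf x,q)|\le r\}$ for some fixed (small enough) constant $r>0$. (i) $\mathcal{Q}\subseteq\mathbb{R}$ is connected compact; for each $q\in\mathcal{Q}$, $y\in\mathcal{Y}$ and some open connected $\mathcal{E}\subseteq\mathbb{R}$ not depending on $y$, $\eta\mapsto\rho(y,\eta;q)$ is absolutely continuous on closed bounded intervals within $\mathcal{E}$ and admits an a.e. derivative $\psi(y,\eta;q)$. (ii) $\mathbb{E}[\psi(y_i,\eta(\mu_0(\mathbf x_i,q));q)|\mathbf x_i]=0$; the function $\mathbb{E}[\psi(y_i,\eta(\mu_0(\mathbf x_i,q));q)^2|\mathbf x_i=\mathbf x]$ is continuous in both arguments $(\mathbf x,q)\in\mathcal{X}\times\mathcal{Q}$, bounded away from zero, and Lipschitz in $q$ uniformly in $\mathbf x$; there is a positive measurable envelope $\overline\psi(\mathbf x_i,y_i)$ with $\sup_{q\in\mathcal{Q}}|\psi(y_i,\eta(\mu_0(\mathbf x_i,q));q)|\le\overline\psi(\mathbf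 x_i,y_i)$ and $\sup_{\mathbf x\in\mathcal{X}}\mathbb{E}[\overline\psi(\mathbf x_i,y_i)^\nu|\mathbf x_i=\mathbf x]<\infty$ for some $\nu>2$. (iii) $\eta(\cdot)$ is strictly monotonic and twice continuously differentiable; for some fixed $\alpha\in(0,1]$, any $(\mathbf x,q)\in\mathcal{X}\times\mathcal{Q}$ and $\zeta_1,\zeta_2\in B_q(\mathbf x)$ (constants in $\lesssim$ not depending on $\mathbf x,q,\zeta_1,\zeta_2$): if $\mathfrak{M}$ is Lebesgue measure, with $I=[\eta(\zeta_1)\wedge\eta(\zeta_2),\eta(\zeta_1)\vee\eta(\zeta_2)]$, $$\sup_{\lambda\in[0,1]}\sup_{y\notin I}|\psi(y,\eta(\zeta_1+\lambda(\zeta_2-\zeta_1));q)-\psi(y,\eta(\zeta_2);q)|\lesssim|\zeta_1-\zeta_2|^\alpha,$$ $$\sup_{\lambda\in[0,1]}\sup_{y\in I}|\psi(y,\eta(\zeta_1+\lambda(\zeta_2-\zeta_1));q)-\psi(y,\eta(\zeta_2);q)|\lesssim1;$$ if $\mathfrak{M}$ is not Lebesgue measure, $\sup_{\lambda\in[0,1]}\sup_{y\in\mathcal{Y}}|\psi(y,\eta(\zeta_1+\lambda(\zeta_2-\zeta_1));q)-\psi(y,\eta(\zeta_2);q)|\lesssim|\zeta_1-\zeta_2|^\alpha$. (iv) $\Psi(\mathbf x,\eta;q)=\mathbb{E}[\psi(y_i,\eta;q)|\mathbf x_i=\mathbf x]$ is twice continuously differentiable in $\eta$; with $\Psi_k=\frac{\partial^k}{\partial\eta^k}\Psi$,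 $\sup_{\mathbf x\in\mathcal{X},q\in\mathcal{Q}}\sup_{\zeta\in B_q(\mathbf x)}|\Psi_k(\mathbf x,\eta(\zeta);q)|<\infty$ for $k=1,2$, and $\inf_{\mathbf x\in\mathcal{X},q\in\mathcal{Q}}\inf_{\zeta\in B_q(\mathbf x)}\Psi_1(\mathbf x,\eta(\zeta);q)(\eta^{(1)}(\zeta))^2>0$. **Simplified setup.** (i) $q\mapsto\mu_0(\mathbf x,q)$ is non-decreasing. (ii) $\rho(y,\eta;q)=\sum_{j=1}^4\rho_j(y,\eta;q)$ with $\rho_1=(f_1(y)+D_1\eta)\mathbf 1(y\le\eta)$, $\rho_2=(f_2(y)+D_2\eta)\mathbf 1(y\le q)$, $\rho_3=(f_3(y)+D_3\eta)q$, $\rho_4=\mathcal{T}(y,\eta)$, where $f_j$ are fixed continuous functions, $D_j$ universal constants, $\mathcal{T}$ a fixed continuous function. (iii) With $\tau(y,\eta)=\frac{\partial}{\partial\eta}\mathcal{T}(y,\eta)$, $\eta\mapsto\mathbb{E}[\tau(y_i,\eta)|\mathbf x_i=\mathbf x]$ is differentiable, and $\tau(y,\eta)$ and $\frac{\partial}{\partial\eta}\mathbb{E}[\tau(y_i,\eta)|\mathbf x_i=\mathbf x]$ are continuous in their arguments and $\alpha$-Hölder continuous ($\alpha\in(0,1]$) in $\eta$ for $\eta$ in any fixed compact subset of $\mathcal{E}$, with Hölder constants independent of $(y,\mathbf x)$. (iv) $\sup_{q\in\mathcal{Q}}|\tau(y,\eta(\mu_0(\mathbf x,q)))|\le\bar\tau(\mathbf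 x,y)$ with $\sup_{\mathbf x\in\mathcal{X}}\mathbb{E}[\bar\tau(\mathbf x_i,y_i)^\nu|\mathbf x_i=\mathbf x]<\infty$ for some $\nu>2$. (v) If $D_1\ne0$, then $F_{Y|X}$ is differentiable with Lebesgue density $f_{Y|X}$, $f_{Y|X}$ is continuous in both arguments, and $y\mapsto f_{Y|X}(y|\mathbf x)$ is continuously differentiable. **Approximation error.** There exists $\boldsymbol\beta_0(q)\in\mathbb{R}^K$ such that for all $\boldsymbol\varsigma$ with $|\boldsymbol\varsigma|\le\varsigma$ ($\varsigma$ from the local basis condition), $\sup_{q\in\mathcal{Q}}\sup_{\mathbf x\in\mathcal{X}}|\mu_0^{(\boldsymbol\varsigma)}(\mathbf x,q)-\boldsymbol\beta_0(q)^\top\mathbf p^{(\boldsymbol\varsigma)}(\mathbf x)|\lesssim h^{m-|\boldsymbol\varsigma|}$. The symbols $\alpha$, $\nu$ denote the constants in these conditions. *)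

theory Defs
  imports "HOL-Probability.Probability" "HOL-Library.Landau_Symbols"
begin

text \<open>A vector of \<open>\<real>\<^sup>K\<close>, where \<open>K\<close> varies with the sample size, is a function on indices vanishing from
  \<open>K\<close> on; its Euclidean norm is \<^term>\<open>L2_set b {..<K}\<close>. A multi-index is a function \<^typ>\<open>'d \<Rightarrow> nat\<close>.

  A relation \<open>a\<^sub>n \<lesssim> b\<^sub>n\<close> between plain sequences is \<open>a \<in> O(b)\<close>. When the two sides depend on further
  variables, it is written out with one constant, uniform in these variables, for all
  sufficiently large \<open>n\<close>.\<close>

definition euclid :: "nat \<Rightarrow> (nat \<Rightarrow> real) set" where
  "euclid K = {b. \<forall>k\<ge>K. b k = 0}"

definition msize :: "('d::finite \<Rightarrow> nat) \<Rightarrow> nat" where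
  "msize v = (\<Sum>i\<in>UNIV. v i)"

text \<open>\<open>partials_on U r D\<close>: on the open set \<open>U\<close>, the functions \<open>D v\<close> with \<open>|v| \<le> r\<close> are the iterated
  partial derivatives of \<open>D 0\<close> (whatever the order of differentiation).\<close>

definition partials_on ::
    "(real^'d) set \<Rightarrow> nat \<Rightarrow> (('d::finite \<Rightarrow> nat) \<Rightarrow> real^'d \<Rightarrow> real) \<Rightarrow> bool" where
  "partials_on U r D \<longleftrightarrow>
     (\<forall>v i. msize v < r \<longrightarrow>
        (\<forall>x\<in>U. ((\<lambda>t. D v (x + t *\<^sub>R axis i 1)) has_real_derivative D (v(i := Suc (v i))) x) (at 0)))"

definition holder_with :: "real \<Rightarrow> real \<Rightarrow> real set \<Rightarrow> (real \<Rightarrow> real) \<Rightarrow> bool" where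
  "holder_with C \<alpha> S f \<longleftrightarrow> (\<forall>s\<in>S. \<forall>t\<in>S. \<bar>f s - f t\<bar> \<le> C * \<bar>s - t\<bar> powr \<alpha>)"

definition abs_continuous_on :: "real \<Rightarrow> real \<Rightarrow> (real \<Rightarrow> real) \<Rightarrow> bool" where
  "abs_continuous_on a b f \<longleftrightarrow>
     (\<forall>\<epsilon>>0. \<exists>\<delta>>0. \<forall>I. finite I \<and> (\<forall>(s, t)\<in>I. a \<le> s \<and> s \<le> t \<and> t \<le> b) \<and>
        disjoint_family_on (\<lambda>(s, t). {s<..<t}) I \<and> (\<Sum>(s, t)\<in>I. t - s) < \<delta> \<longrightarrow>
        (\<Sum>(s, t)\<in>I. \<bar>f t - f s\<bar>) < \<epsilon>)"

text \<open>\<open>\<xi>\<^sub>n = o\<^sub>P(a\<^sub>n)\<close> for nonnegative \<open>\<xi>\<^sub>n\<close> and positive \<open>a\<^sub>n\<close>. The suprema over uncountable sets to which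
  this is applied need not be measurable, hence the outer probability; it is the probability for
  events.\<close>

definition small_o_prob ::
    "'w measure \<Rightarrow> (nat \<Rightarrow> 'w \<Rightarrow> ereal) \<Rightarrow> (nat \<Rightarrow> real) \<Rightarrow> bool" where
  "small_o_prob M \<xi> a \<longleftrightarrow>
     (\<forall>\<epsilon>>0. (\<lambda>n. outer_measure_of M {\<omega> \<in> space M. \<xi> n \<omega> > ereal (\<epsilon> * a n)}) \<longlonglongrightarrow> 0)"

text \<open>The conditional law of \<open>Y\<close> given \<open>X = x\<close>, as a measure on \<open>\<Y>\<close>. Integrals against it are the
  conditional expectations given \<open>X = x\<close>, defined for every \<open>x\<close> through the conditional density
  \<open>f x\<close> with respect to \<open>N\<close>.\<close>

definition cond_law ::
    "real measure \<Rightarrow> real set \<Rightarrow> ('x \<Rightarrow> real \<Rightarrow> real) \<Rightarrow> 'x \<Rightarrow> real measure" where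
  "cond_law N Y f x = restrict_space (density N (\<lambda>y. ennreal (f x y))) Y"

definition cond_sub_gaussian ::
    "'x set \<Rightarrow> ('x \<Rightarrow> real measure) \<Rightarrow> ('x \<Rightarrow> real \<Rightarrow> real) \<Rightarrow> bool" where
  "cond_sub_gaussian X L \<xi> \<longleftrightarrow>
     (\<exists>\<sigma>2>0. \<forall>x\<in>X. \<forall>t\<ge>0.
        measure (L x) {y \<in> space (L x). \<bar>\<xi> x y\<bar> \<ge> t} \<le> 2 * exp (- (t\<^sup>2) / \<sigma>2))"


definition open_polyhedron :: "'a::euclidean_space set \<Rightarrow> bool" where
  "open_polyhedron S \<longleftrightarrow> S \<noteq> {} \<and> (\<exists>P. polyhedron P \<and> S = interior P)"

definition polyhedral_partition :: "'a::euclidean_space set \<Rightarrow> 'a set set \<Rightarrow> bool" where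
  "polyhedral_partition X \<Delta> \<longleftrightarrow>
     finite \<Delta> \<and> (\<forall>\<delta>\<in>\<Delta>. open_polyhedron \<delta> \<and> \<delta> \<subseteq> X) \<and> disjoint \<Delta> \<and> X \<subseteq> closure (\<Union>\<Delta>)"

definition inradius :: "'a::metric_space set \<Rightarrow> real" where
  "inradius S = Sup {r. \<exists>c. ball c r \<subseteq> S}"

definition circumradius :: "'a::metric_space set \<Rightarrow> real" where
  "circumradius S = Inf {r. \<exists>c. S \<subseteq> cball c r}"

definition mesh :: "'a::metric_space set set \<Rightarrow> real" where
  "mesh \<Delta> = Max (diameter ` \<Delta>)"

definition quasi_uniform_partition :: "(nat \<Rightarrow> 'a::euclidean_space set set) \<Rightarrow> bool" where
  "quasi_uniform_partition \<Delta> \<longleftrightarrow>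
     (\<exists>c>0. \<forall>\<^sub>F n in sequentially. \<forall>\<delta>\<in>\<Delta> n. inradius \<delta> / circumradius \<delta> \<ge> c) \<and>
     (\<lambda>n. Max (diameter ` \<Delta> n) / Min (diameter ` \<Delta> n)) \<in> O(\<lambda>_. 1) \<and>
     (\<lambda>n. mesh (\<Delta> n)) \<in> o(\<lambda>_. 1) \<and>
     (\<lambda>n. ln (1 / mesh (\<Delta> n))) \<in> O(\<lambda>n. ln (real n))"

definition active_on :: "('a \<Rightarrow> real) \<Rightarrow> 'a set \<Rightarrow> bool" where
  "active_on f S \<longleftrightarrow> (\<exists>x\<in>S. f x \<noteq> 0)"

definition active_region :: "'a set set \<Rightarrow> ('a \<Rightarrow> real) \<Rightarrow> 'a set" where
  "active_region \<Delta> f = \<Union>{\<delta> \<in> \<Delta>. active_on f \<delta>}"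

text \<open>\<open>p n k\<close> is the \<open>k\<close>-th basis function at sample size \<open>n\<close>, and \<open>dp n k v\<close> its partial derivative of
  multi-index \<open>v\<close>. Basis functions may be non-smooth, even discontinuous, across the common boundary
  of two cells. So \<open>dp n k v\<close> is the classical derivative inside the cells; on their boundaries its
  values are given by some convention (say, continuous extension from one of the adjacent cells)
  and are only subject to the bounds that are assumed up to the boundary.\<close>

definition dictionary ::
    "(real^'d) set \<Rightarrow> (real^'d) set set \<Rightarrow> nat \<Rightarrow> nat \<Rightarrow> (nat \<Rightarrow> real^'d \<Rightarrow> real) \<Rightarrow>
     (nat \<Rightarrow> ('d::finite \<Rightarrow> nat) \<Rightarrow> real^'d \<Rightarrow> real) \<Rightarrow> bool" where
  "dictionary X \<Delta> s K p dp \<longleftrightarrow>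
     (\<forall>k<K. p k \<in> borel_measurable (restrict_space borel X) \<and>
        (\<forall>x\<in>X. dp k (\<lambda>_. 0) x = p k x) \<and>
        (\<forall>\<delta>\<in>\<Delta>. partials_on \<delta> s (dp k)))"

text \<open>The cells being open and disjoint, the connectedness of the active region is that of its closure,
  i.e. of the union of the closed active cells.\<close>

definition local_basis ::
    "nat \<Rightarrow> ('d::finite \<Rightarrow> nat) \<Rightarrow> nat \<Rightarrow> (nat \<Rightarrow> (real^'d) set set) \<Rightarrow> (nat \<Rightarrow> nat) \<Rightarrow>
     (nat \<Rightarrow> nat \<Rightarrow> real^'d \<Rightarrow> real) \<Rightarrow> (nat \<Rightarrow> nat \<Rightarrow> ('d \<Rightarrow> nat) \<Rightarrow> real^'d \<Rightarrow> real) \<Rightarrow> bool" where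
  "local_basis m v s \<Delta> K p dp \<longleftrightarrow>
     (\<forall>n. \<forall>k<K n. connected (closure (active_region (\<Delta> n) (p n k)))) \<and>
     (\<exists>C. \<forall>\<^sub>F n in sequentially. \<forall>k<K n.
        card {\<delta> \<in> \<Delta> n. \<delta> \<subseteq> active_region (\<Delta> n) (p n k)} \<le> C \<and>
        card {j. j < K n \<and> active_on (p n j) (active_region (\<Delta> n) (p n k))} \<le> C) \<and>
     (\<exists>C. \<forall>\<^sub>F n in sequentially. \<forall>k<K n. \<forall>a\<in>euclid (K n).
        (a k)\<^sup>2 * mesh (\<Delta> n) ^ CARD('d) \<le>
        C * (\<Sum>i<K n. \<Sum>j<K n. a i *
               (LINT x:active_region (\<Delta> n) (p n k)|lborel. p n i x * p n j x) * a j)) \<and>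
     msize v < m \<and> msize v \<le> s \<and> s < m \<and>
     (\<forall>u. msize u \<le> s \<longrightarrow>
        (\<exists>c>0. \<exists>C. \<forall>\<^sub>F n in sequentially. \<forall>\<delta>\<in>\<Delta> n. \<forall>x\<in>closure \<delta>.
           c * mesh (\<Delta> n) powi (- int (msize u)) \<le> L2_set (\<lambda>k. dp n k u x) {..<K n} \<and>
           L2_set (\<lambda>k. dp n k u x) {..<K n} \<le> C * mesh (\<Delta> n) powi (- int (msize u))))"


text \<open>Competitors with a non-integrable loss are left out, as their expected loss need not make sense.\<close>

definition population_minimizer ::
    "'w measure \<Rightarrow> ('w \<Rightarrow> real^'d) \<Rightarrow> ('w \<Rightarrow> real) \<Rightarrow> (real^'d) set \<Rightarrow>
     (real \<Rightarrow> real \<Rightarrow> real \<Rightarrow> real) \<Rightarrow> (real \<Rightarrow> real) \<Rightarrow> real \<Rightarrow> (real^'d \<Rightarrow> real) \<Rightarrow> bool" where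
  "population_minimizer M x y X \<rho> \<eta> q \<mu> \<longleftrightarrow>
     is_arg_min (\<lambda>\<mu>. \<integral>\<omega>. \<rho> (y \<omega>) (\<eta> (\<mu> (x \<omega>))) q \<partial>M)
       (\<lambda>\<mu>. \<mu> \<in> borel_measurable (restrict_space borel X) \<and>
            integrable M (\<lambda>\<omega>. \<rho> (y \<omega>) (\<eta> (\<mu> (x \<omega>))) q)) \<mu>"

text \<open>\<open>d\<mu> v x q\<close> is the partial derivative of \<open>\<mu>0 \<cdot> q\<close> of multi-index \<open>v\<close>. On the closed set \<open>X\<close>, being \<open>m\<close>
  times continuously differentiable means that the partial derivatives in the interior extend
  continuously to \<open>X\<close>.\<close>

definition data_generating_process ::
    "'w measure \<Rightarrow> (nat \<Rightarrow> 'w \<Rightarrow> real^'d) \<Rightarrow> (nat \<Rightarrow> 'w \<Rightarrow> real) \<Rightarrow>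
     (real^'d) set \<Rightarrow> real set \<Rightarrow> real set \<Rightarrow>
     (real \<Rightarrow> real \<Rightarrow> real \<Rightarrow> real) \<Rightarrow> (real \<Rightarrow> real) \<Rightarrow>
     nat \<Rightarrow> (real^'d \<Rightarrow> real \<Rightarrow> real) \<Rightarrow> (('d::finite \<Rightarrow> nat) \<Rightarrow> real^'d \<Rightarrow> real \<Rightarrow> real) \<Rightarrow>
     (real^'d \<Rightarrow> real) \<Rightarrow> real measure \<Rightarrow> (real^'d \<Rightarrow> real \<Rightarrow> real) \<Rightarrow> bool" where
  "data_generating_process M x y X Y Q \<rho> \<eta> m \<mu>0 d\<mu> fX N fYX \<longleftrightarrow>
     prob_space M \<and>
     prob_space.indep_vars M (\<lambda>_. borel) (\<lambda>i \<omega>. (x i \<omega>, y i \<omega>)) UNIV \<and>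
     (\<forall>i. \<forall>\<omega>\<in>space M. x i \<omega> \<in> X \<and> y i \<omega> \<in> Y) \<and>
     (\<forall>i. \<forall>q\<in>Q. population_minimizer M (x i) (y i) X \<rho> \<eta> q (\<lambda>z. \<mu>0 z q)) \<and>
     (\<forall>i. distributed M lborel (x i) (\<lambda>z. ennreal (fX z))) \<and>
     (\<exists>U. open U \<and> connected U \<and> bounded U \<and> U \<noteq> {} \<and> X = closure U) \<and>
     continuous_on X fX \<and> (\<exists>c>0. \<forall>z\<in>X. fX z \<ge> c) \<and> (\<forall>z. z \<notin> X \<longrightarrow> fX z = 0) \<and>
     sigma_finite_measure N \<and> sets N = sets borel \<and>
     (\<forall>z\<in>X. \<forall>t. fYX z t \<ge> 0 \<and> (t \<notin> Y \<longrightarrow> fYX z t = 0)) \<and>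
     (\<forall>z\<in>X. prob_space (cond_law N Y fYX z)) \<and>
     (\<forall>i. distributed M (lborel \<Otimes>\<^sub>M N) (\<lambda>\<omega>. (x i \<omega>, y i \<omega>))
            (\<lambda>(z, t). ennreal (fX z * fYX z t))) \<and>
     (\<exists>C. \<forall>z\<in>X. \<forall>t. fYX z t \<le> C) \<and>
     m \<ge> 1 \<and>
     (\<forall>q\<in>Q. (\<forall>z\<in>X. d\<mu> (\<lambda>_. 0) z q = \<mu>0 z q) \<and>
        partials_on (interior X) m (\<lambda>u z. d\<mu> u z q) \<and>
        (\<forall>u. msize u \<le> m \<longrightarrow> continuous_on X (\<lambda>z. d\<mu> u z q))) \<and>
     (\<exists>C. \<forall>u. msize u \<le> m \<longrightarrow> (\<forall>z\<in>X. \<forall>q\<in>Q. \<bar>d\<mu> u z q\<bar> \<le> C)) \<and>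
     (\<exists>C. \<forall>z\<in>X. C-lipschitz_on Q (\<mu>0 z))"


text \<open>Here \<open>L x\<close> is the conditional law of \<open>Y\<close> given \<open>X = x\<close>. The measurability of \<open>\<psi>\<close> and the
  integrability of \<open>\<psi> \<cdot> e q\<close> are implicit in the use of its conditional expectations. As to the square of
  \<open>\<psi>\<close>, it is integrable since its integral, being bounded away from zero, is not the default value 0.\<close>

definition loss_function ::
    "(real^'d) set \<Rightarrow> real set \<Rightarrow> real set \<Rightarrow> real set \<Rightarrow>
     (real \<Rightarrow> real \<Rightarrow> real \<Rightarrow> real) \<Rightarrow> (real \<Rightarrow> real \<Rightarrow> real \<Rightarrow> real) \<Rightarrow> (real \<Rightarrow> real) \<Rightarrow>
     (real^'d \<Rightarrow> real \<Rightarrow> real) \<Rightarrow> real measure \<Rightarrow> (real^'d \<Rightarrow> real measure) \<Rightarrow>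
     (real^'d \<Rightarrow> real \<Rightarrow> real) \<Rightarrow> real \<Rightarrow> real \<Rightarrow> real \<Rightarrow> bool" where
  "loss_function X Y E Q \<rho> \<psi> \<eta> \<mu>0 N L \<psi>bar r \<alpha> \<nu> \<longleftrightarrow>
    (let B = (\<lambda>q x. {\<zeta>. \<bar>\<zeta> - \<mu>0 x q\<bar> \<le> r});
         \<sigma>2 = (\<lambda>x q. \<integral>y. (\<psi> y (\<eta> (\<mu>0 x q)) q)\<^sup>2 \<partial>L x);
         \<Psi> = (\<lambda>x e q. \<integral>y. \<psi> y e q \<partial>L x);
         \<Psi>1 = (\<lambda>x e q. deriv (\<lambda>e. \<Psi> x e q) e);
         \<Psi>2 = (\<lambda>x e q. deriv (\<lambda>e. \<Psi>1 x e q) e)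
     in
     r > 0 \<and>
     connected Q \<and> compact Q \<and> open E \<and> connected E \<and>
     (\<forall>q\<in>Q. (\<lambda>(y, e). \<psi> y e q) \<in> borel_measurable (restrict_space borel (Y \<times> E))) \<and>
     (\<forall>q\<in>Q. \<forall>y\<in>Y. (\<forall>a b. {a..b} \<subseteq> E \<longrightarrow> abs_continuous_on a b (\<lambda>e. \<rho> y e q)) \<and>
        (AE e in lborel. e \<in> E \<longrightarrow> ((\<lambda>e. \<rho> y e q) has_real_derivative \<psi> y e q) (at e))) \<and>
     (\<forall>q\<in>Q. AE x in lborel. x \<in> X \<longrightarrow> (\<integral>y. \<psi> y (\<eta> (\<mu>0 x q)) q \<partial>L x) = 0) \<and>
     continuous_on (X \<times> Q) (\<lambda>(x, q). \<sigma>2 x q) \<and>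
     (\<exists>c>0. \<forall>x\<in>X. \<forall>q\<in>Q. \<sigma>2 x q \<ge> c) \<and>
     (\<exists>C. \<forall>x\<in>X. C-lipschitz_on Q (\<sigma>2 x)) \<and>
     (\<lambda>(x, y). \<psi>bar x y) \<in> borel_measurable (restrict_space borel (X \<times> Y)) \<and>
     (\<forall>x\<in>X. \<forall>y\<in>Y. \<psi>bar x y > 0 \<and> (\<forall>q\<in>Q. \<bar>\<psi> y (\<eta> (\<mu>0 x q)) q\<bar> \<le> \<psi>bar x y)) \<and>
     \<nu> > 2 \<and>
     (\<exists>C::real. \<forall>x\<in>X. (\<integral>\<^sup>+y. ennreal (\<psi>bar x y powr \<nu>) \<partial>L x) \<le> ennreal C) \<and>
     (monotone (<) (<) \<eta> \<or> monotone (<) (>) \<eta>) \<and>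
     \<eta> differentiable_on UNIV \<and> deriv \<eta> differentiable_on UNIV \<and>
     continuous_on UNIV (deriv (deriv \<eta>)) \<and>
     0 < \<alpha> \<and> \<alpha> \<le> 1 \<and>
     (\<exists>C. \<forall>x\<in>X. \<forall>q\<in>Q. \<forall>\<zeta>1\<in>B q x. \<forall>\<zeta>2\<in>B q x.
        let I = {min (\<eta> \<zeta>1) (\<eta> \<zeta>2)..max (\<eta> \<zeta>1) (\<eta> \<zeta>2)};
            D = (\<lambda>l y. \<bar>\<psi> y (\<eta> (\<zeta>1 + l * (\<zeta>2 - \<zeta>1))) q - \<psi> y (\<eta> \<zeta>2) q\<bar>)
        in if N = lborel
           then (\<forall>l\<in>{0..1}. (\<forall>y\<in>Y - I. D l y \<le> C * \<bar>\<zeta>1 - \<zeta>2\<bar> powr \<alpha>) \<and>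
                             (\<forall>y\<in>Y \<inter> I. D l y \<le> C))
           else (\<forall>l\<in>{0..1}. \<forall>y\<in>Y. D l y \<le> C * \<bar>\<zeta>1 - \<zeta>2\<bar> powr \<alpha>)) \<and>
     (\<forall>x\<in>X. \<forall>q\<in>Q.
        (\<forall>e\<in>E. integrable (L x) (\<lambda>y. \<psi> y e q)) \<and>
        (\<lambda>e. \<Psi> x e q) differentiable_on E \<and> (\<lambda>e. \<Psi>1 x e q) differentiable_on E \<and>
        continuous_on E (\<lambda>e. \<Psi>2 x e q)) \<and>
     (\<exists>C. \<forall>x\<in>X. \<forall>q\<in>Q. \<forall>\<zeta>\<in>B q x. \<bar>\<Psi>1 x (\<eta> \<zeta>) q\<bar> \<le> C \<and> \<bar>\<Psi>2 x (\<eta> \<zeta>) q\<bar> \<le> C) \<and>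
     (\<exists>c>0. \<forall>x\<in>X. \<forall>q\<in>Q. \<forall>\<zeta>\<in>B q x. \<Psi>1 x (\<eta> \<zeta>) q * (deriv \<eta> \<zeta>)\<^sup>2 \<ge> c))"


definition simplified_setup ::
    "(real^'d) set \<Rightarrow> real set \<Rightarrow> real set \<Rightarrow> real set \<Rightarrow>
     (real \<Rightarrow> real \<Rightarrow> real \<Rightarrow> real) \<Rightarrow> (real \<Rightarrow> real) \<Rightarrow> (real^'d \<Rightarrow> real \<Rightarrow> real) \<Rightarrow>
     real measure \<Rightarrow> (real^'d \<Rightarrow> real \<Rightarrow> real) \<Rightarrow> real \<Rightarrow> real \<Rightarrow> bool" where
  "simplified_setup X Y E Q \<rho> \<eta> \<mu>0 N fYX \<alpha> \<nu> \<longleftrightarrow>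
     (\<forall>x\<in>X. mono_on Q (\<mu>0 x)) \<and>
     (\<exists>f1 f2 f3 D1 D2 D3 \<T> \<tau>bar.
       let L = cond_law N Y fYX;
           \<tau> = (\<lambda>y e. deriv (\<T> y) e);
           T = (\<lambda>x e. \<integral>y. \<tau> y e \<partial>L x)
       in
       continuous_on Y f1 \<and> continuous_on Y f2 \<and> continuous_on Y f3 \<and>
       continuous_on (Y \<times> E) (\<lambda>(y, e). \<T> y e) \<and>
       (\<forall>y\<in>Y. \<forall>e\<in>E. \<forall>q\<in>Q.
          \<rho> y e q = (f1 y + D1 * e) * of_bool (y \<le> e) + (f2 y + D2 * e) * of_bool (y \<le> q)
                   + (f3 y + D3 * e) * q + \<T> y e) \<and>
       (\<forall>y\<in>Y. \<T> y differentiable_on E) \<and>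
       continuous_on (Y \<times> E) (\<lambda>(y, e). \<tau> y e) \<and>
       (\<forall>x\<in>X. (\<forall>e\<in>E. integrable (L x) (\<lambda>y. \<tau> y e)) \<and> T x differentiable_on E) \<and>
       continuous_on (X \<times> E) (\<lambda>(x, e). deriv (T x) e) \<and>
       (\<forall>S. compact S \<and> S \<subseteq> E \<longrightarrow>
          (\<exists>C>0. (\<forall>y\<in>Y. holder_with C \<alpha> S (\<tau> y)) \<and> (\<forall>x\<in>X. holder_with C \<alpha> S (deriv (T x))))) \<and>
       (\<lambda>(x, y). \<tau>bar x y) \<in> borel_measurable (restrict_space borel (X \<times> Y)) \<and>
       (\<forall>x\<in>X. \<forall>y\<in>Y. \<forall>q\<in>Q. \<bar>\<tau> y (\<eta> (\<mu>0 x q))\<bar> \<le> \<tau>bar x y) \<and>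
       (\<exists>C::real. \<forall>x\<in>X. (\<integral>\<^sup>+y. ennreal (\<tau>bar x y powr \<nu>) \<partial>L x) \<le> ennreal C) \<and>
       (D1 \<noteq> (0::real) \<longrightarrow>
          N = lborel \<and>
          (\<forall>x\<in>X. \<forall>y\<in>Y.
             ((\<lambda>t. measure (L x) {u \<in> space (L x). u \<le> t}) has_real_derivative fYX x y)
               (at y within Y)) \<and>
          continuous_on (X \<times> Y) (\<lambda>(x, y). fYX x y) \<and>
          (\<exists>g. \<forall>x\<in>X. (\<forall>y\<in>Y. (fYX x has_real_derivative g x y) (at y within Y)) \<and>
             continuous_on Y (g x))))"


definition approximation_error ::
    "(real^'d) set \<Rightarrow> real set \<Rightarrow> nat \<Rightarrow> nat \<Rightarrow> (nat \<Rightarrow> (real^'d) set set) \<Rightarrow> (nat \<Rightarrow> nat) \<Rightarrow>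
     (nat \<Rightarrow> nat \<Rightarrow> ('d::finite \<Rightarrow> nat) \<Rightarrow> real^'d \<Rightarrow> real) \<Rightarrow>
     (('d \<Rightarrow> nat) \<Rightarrow> real^'d \<Rightarrow> real \<Rightarrow> real) \<Rightarrow> (nat \<Rightarrow> real \<Rightarrow> nat \<Rightarrow> real) \<Rightarrow> bool" where
  "approximation_error X Q m s \<Delta> K dp d\<mu> \<beta>0 \<longleftrightarrow>
     (\<forall>n. \<forall>q\<in>Q. \<beta>0 n q \<in> euclid (K n)) \<and>
     (\<forall>u. msize u \<le> s \<longrightarrow>
        (\<exists>C. \<forall>\<^sub>F n in sequentially. \<forall>q\<in>Q. \<forall>x\<in>X.
           \<bar>d\<mu> u x q - (\<Sum>k<K n. \<beta>0 n q k * dp n k u x)\<bar> \<le> C * mesh (\<Delta> n) ^ (m - msize u)))"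

definition m_estimate ::
    "(real \<Rightarrow> real \<Rightarrow> real \<Rightarrow> real) \<Rightarrow> (real \<Rightarrow> real) \<Rightarrow> nat \<Rightarrow> (nat \<Rightarrow> 'x) \<Rightarrow> (nat \<Rightarrow> real) \<Rightarrow>
     nat \<Rightarrow> (nat \<Rightarrow> 'x \<Rightarrow> real) \<Rightarrow> (nat \<Rightarrow> real) set \<Rightarrow> real \<Rightarrow> (nat \<Rightarrow> real) \<Rightarrow> bool" where
  "m_estimate \<rho> \<eta> n x y K p B q b \<longleftrightarrow>
     is_arg_min (\<lambda>b. \<Sum>i<n. \<rho> (y i) (\<eta> (\<Sum>k<K. p k (x i) * b k)) q) (\<lambda>b. b \<in> B) b"

end

theory Submission
  imports Defs
begin

text \<open>
  Since the empirical objective is convex, it suffices that with probability tending to one it is larger on the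
  sphere of a small fixed radius \<open>\<delta>\<close> around a centre close to \<open>\<beta>\<^sub>0(q)\<close> than at the centre, for all \<open>q\<close>
  simultaneously. The centres are \<open>\<beta>\<^sub>0(q\<^sub>j)\<close> for a grid \<open>q\<^sub>j\<close> of mesh \<open>h\<^sup>2\<^sup>d\<close>; they are legitimate because
  \<open>\<parallel>\<beta>\<^sub>0(q) - \<beta>\<^sub>0(q\<^sub>j)\<parallel> = O(h powr (m - d/2))\<close>, which is where \<open>m > d/2\<close> enters.

  Let \<open>V\<close> be the second moment of \<open>p(X)\<^sup>T u\<close>, which is at least of order \<open>h\<^sup>d\<close> for \<open>\<parallel>u\<parallel> = \<delta>\<close>. The mean increment of the
  loss is at least of order \<open>V\<close>, the strong convexity of the conditional expectation beating the approximation error,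
  and its second moment is at most of order \<open>V\<close>. After truncation of the score at a level \<open>T\<close>, a one-sided
  exponential inequality bounds the probability that the empirical increment is small by
  \<open>exp (- a * n * h\<^sup>d / T)\<close>. As the increments are Lipschitz in \<open>u\<close>, a union bound over a net of the sphere in dimension
  \<open>K = O(h\<^sup>-\<^sup>d)\<close> and over the grid finishes the proof of the first claim.
  The other two follow from the upper bounds on the derivatives of the basis functions.
\<close>

section \<open>Convexity, concentration and nets\<close>

text \<open>All errors are measured against \<open>h ^ d\<close>, the least possible order of the
  mean increment. For a fixed \<open>q\<close> the tail inequality would do; the obstacle is that
  \<open>q\<close> runs over a continuum on which the loss jumps, through the indicator of
  \<open>y \<le> q\<close>. Between consecutive grid points these jumps are majorised by a single
  indicator, so that one random variable per grid cell and net direction serves all \<open>q\<close>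
  of the cell. The probability of this indicator has to be of the order of the cell length, although
  the conditional distribution function is not assumed to be smooth in general; the first-order
  condition at the two grid points supplies it. The step \<open>h ^ (2 * d)\<close> then makes the
  loss from the jumps smaller than \<open>h ^ d\<close> by a further factor \<open>h ^ d\<close>.
  Keeping the second moment in the exponential inequality, instead of the crude bound by the square
  of \<open>T\<close>, makes the exponent linear in \<open>h ^ d\<close>. What truncation discards
  is handled by Markov's inequality on one event common to all cells and directions.\<close>

lemma convex_on_one_sided_derivative_ge:
  fixes f :: "real \<Rightarrow> real"
  assumes cvx: "convex_on UNIV f"
    and d: "(f has_real_derivative d) (at_left a) \<or> (f has_real_derivative d) (at_right a)"
  shows "f b - f a \<ge> d * (b - a)"
proof (cases "b = a")
  case False
  have swap: "(f u - f t) / (u - t) = (f t - f u) / (t - u)" for u t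
    by (metis minus_diff_eq minus_divide_divide)
  \<comment> \<open>Slopes seen from \<open>t\<close> increase in the other endpoint, also across
    \<open>t\<close>. So the quotient at \<open>b\<close> bounds those on either side of
    \<open>a\<close>, and their limit from whichever side the derivative exists.\<close>
  have slope: "(f u - f t) / (u - t) \<le> (f w - f t) / (w - t)" if neq: "u < w" "u \<noteq> t" "w \<noteq> t" for u w t
  proof -
    consider "t < u" | "u < t" "t < w" | "w < t" using neq by linarith
    then show ?thesis
    proof cases
      case 1 then show ?thesis using convex_on_slope_le(1)[OF cvx, of t w u] neq
        unfolding swap[of t] by simp
    next
      case 2
      have "(f u - f t) / (u - t) \<le> (f u - f w) / (u - w)" "(f u - f w) / (u - w) \<le> (f t - f w) / (t - w)"
        using convex_on_slope_le[OF cvx, of u w t] 2 by auto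
      then show ?thesis unfolding swap[of t w] by linarith
    next
      case 3 then show ?thesis using convex_on_slope_le(2)[OF cvx, of u t w] neq
        by simp
    qed
  qed
  have lim: "((\<lambda>w. (f w - f a) / (w - a)) \<longlongrightarrow> d) (at_left a) \<or> ((\<lambda>w. (f w - f a) / (w - a)) \<longlongrightarrow> d) (at_right a)"
    using d by (simp add: has_field_derivative_iff)
  show ?thesis
  proof (cases "b > a")
    case True
    have "d \<le> (f b - f a) / (b - a)"
      using lim
    proof
      assume l: "((\<lambda>w. (f w - f a) / (w - a)) \<longlongrightarrow> d) (at_left a)"
      have "\<forall>\<^sub>F w in at_left a. (f w - f a) / (w - a) \<le> (f b - f a) / (b - a)"
        using eventually_at_left_real[of "a - 1" a] by (rule eventually_mono) (use True slope in auto)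
      then show ?thesis by (intro tendsto_upperbound[OF l]) auto
    next
      assume l: "((\<lambda>w. (f w - f a) / (w - a)) \<longlongrightarrow> d) (at_right a)"
      have "\<forall>\<^sub>F w in at_right a. (f w - f a) / (w - a) \<le> (f b - f a) / (b - a)"
        using eventually_at_right_real[OF True] by (rule eventually_mono) (use True slope in auto)
      then show ?thesis by (intro tendsto_upperbound[OF l]) auto
    qed
    then show ?thesis using True by (simp add: field_simps)
  next
    case F: False
    with False have ba: "b < a" by simp
    have "d \<ge> (f b - f a) / (b - a)"
      using lim
    proof
      assume l: "((\<lambda>w. (f w - f a) / (w - a)) \<longlongrightarrow> d) (at_left a)"
      have "\<forall>\<^sub>F w in at_left a. (f w - f a) / (w - a) \<ge> (f b - f a) / (b - a)"
        using eventually_at_left_real[OF ba] by (rule eventually_mono) (use ba slope in auto)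
      then show ?thesis by (intro tendsto_lowerbound[OF l]) auto
    next
      assume l: "((\<lambda>w. (f w - f a) / (w - a)) \<longlongrightarrow> d) (at_right a)"
      have "\<forall>\<^sub>F w in at_right a. (f w - f a) / (w - a) \<ge> (f b - f a) / (b - a)"
        using eventually_at_right_real[OF less_add_one] by (rule eventually_mono) (use ba slope in auto)
      then show ?thesis by (intro tendsto_lowerbound[OF l]) auto
    qed
    then show ?thesis using ba by (simp add: field_simps)
  qed
qed auto

text \<open>Only \<open>t \<le> 1\<close> is asked, so that \<open>l\<close> is constrained by the
  lower bound of \<open>Z\<close> alone when this is applied to \<open>- l * Z\<close>. For negative
  \<open>t\<close> the claim is multiplied by \<open>exp (- t)\<close>, whose second-order Taylor
  polynomial already suffices.\<close>

lemma exp_le_quadratic: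
  fixes t :: real
  assumes "t \<le> 1" shows "exp t \<le> 1 + t + t\<^sup>2"
proof (cases "t \<ge> 0")
  case True then show ?thesis using exp_bound[of t] assms by simp
next
  case False
  have "1 \<le> (1 + t + t\<^sup>2) * exp (- t)"
  proof -
    define w where "w = - t"
    have "w > 0" using False by (simp add: w_def)
    have "(1 - w + w * w) * (1 + w + w * w / 2) = 1 + w * w / 2 + w * w * w / 2 + w * w * w * w / 2"
      by (simp add: field_simps)
    also have "\<dots> \<ge> 1" using \<open>w > 0\<close> by simp
    finally have "1 \<le> (1 + t + t\<^sup>2) * (1 + (-t) + (-t)\<^sup>2/2)"
      by (simp add: w_def power2_eq_square)
    also have "\<dots> \<le> (1 + t + t\<^sup>2) * exp (- t)"
    proof (rule mult_left_mono)
      show "1 + (-t) + (-t)\<^sup>2/2 \<le> exp (-t)"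
        using exp_lower_Taylor_quadratic[of "-t"] False by simp
      show "0 \<le> 1 + t + t\<^sup>2"
        using sum_squares_ge_zero[of "t+1/2" 0] by (simp add: power2_eq_square field_simps)
    qed
    finally show ?thesis .
  qed
  then show ?thesis by (simp add: exp_minus field_simps)
qed

text \<open>Chernoff's method with \<open>exp (- l * Z)\<close>. As \<open>exp_le_quadratic\<close>
  retains the second moment, \<open>m2\<close> and not \<open>B\<^sup>2\<close> multiplies
  \<open>l\<^sup>2\<close>: when \<open>m1\<close> and \<open>m2\<close> are both of order
  \<open>V\<close>, a small \<open>l\<close> of order \<open>1 / B\<close> gives an exponent of
  order \<open>n * V / B\<close>.\<close>

lemma (in prob_space) indep_sum_lower_tail:
  fixes Z :: "nat \<Rightarrow> 'a \<Rightarrow> real"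
  assumes ind: "indep_vars (\<lambda>_. borel) Z UNIV"
    and bdd: "\<And>i \<omega>. \<omega> \<in> space M \<Longrightarrow> \<bar>Z i \<omega>\<bar> \<le> B"
    and mean: "\<And>i. expectation (Z i) \<ge> m1"
    and sq: "\<And>i. expectation (\<lambda>\<omega>. (Z i \<omega>)\<^sup>2) \<le> m2"
    and lam: "l > 0" "l * B \<le> 1"
  shows "prob {\<omega>\<in>space M. (\<Sum>i<n. Z i \<omega>) \<le> real n * s} \<le> exp (- real n * (l * (m1 - s) - l\<^sup>2 * m2))"
proof (cases "n = 0")
  case True then show ?thesis by simp
next
  case False
  have rv[measurable]: "\<And>i. random_variable borel (Z i)" using ind by (auto simp: indep_vars_def)
  have intZ: "integrable M (Z i)" for i
    by (rule integrable_const_bound[where B=B]) (use bdd in auto)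
  have intZ2: "integrable M (\<lambda>\<omega>. (Z i \<omega>)\<^sup>2)" for i
    by (rule integrable_const_bound[where B="B\<^sup>2"]) (use bdd in \<open>auto simp: abs_le_square_iff[symmetric] intro!: AE_I2 order.trans[OF bdd abs_ge_self]\<close>)
  have intE: "integrable M (\<lambda>\<omega>. exp (- l * Z i \<omega>))" for i
  proof (rule integrable_const_bound[where B="exp (l * B)"])
    show "AE \<omega> in M. norm (exp (- l * Z i \<omega>)) \<le> exp (l * B)"
    proof (rule AE_I2)
      fix \<omega> assume "\<omega> \<in> space M"
      then have "- Z i \<omega> \<le> B" using bdd[of \<omega> i] by linarith
      then show "norm (exp (- l * Z i \<omega>)) \<le> exp (l * B)" using lam mult_left_mono[of "- Z i \<omega>" B l] by simp
    qed
  qed simp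
  have mgf: "expectation (\<lambda>\<omega>. exp (- l * Z i \<omega>)) \<le> exp (- l * m1 + l\<^sup>2 * m2)" for i
  proof -
    have "expectation (\<lambda>\<omega>. exp (- l * Z i \<omega>)) \<le> expectation (\<lambda>\<omega>. 1 + (- l) * Z i \<omega> + l\<^sup>2 * (Z i \<omega>)\<^sup>2)"
    proof (rule integral_mono[OF intE])
      show "integrable M (\<lambda>\<omega>. 1 + (- l) * Z i \<omega> + l\<^sup>2 * (Z i \<omega>)\<^sup>2)" using intZ intZ2 by auto
      fix \<omega> assume "\<omega> \<in> space M"
      then have "- Z i \<omega> \<le> B" using bdd[of \<omega> i] by linarith
      then have "- l * Z i \<omega> \<le> 1" using lam mult_left_mono[of "- Z i \<omega>" B l] by simp
      from exp_le_quadratic[OF this] show "exp (- l * Z i \<omega>) \<le> 1 + (- l) * Z i \<omega> + l\<^sup>2 * (Z i \<omega>)\<^sup>2"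
        by (simp add: power_mult_distrib)
    qed
    also have "\<dots> = 1 + (- l) * expectation (Z i) + l\<^sup>2 * expectation (\<lambda>\<omega>. (Z i \<omega>)\<^sup>2)"
      using intZ intZ2 by (simp add: prob_space)
    also have "\<dots> \<le> 1 + (- l * m1 + l\<^sup>2 * m2)"
    proof -
      have "l * m1 \<le> l * expectation (Z i)" using mean[of i] lam(1) by simp
      moreover have "l\<^sup>2 * expectation (\<lambda>\<omega>. (Z i \<omega>)\<^sup>2) \<le> l\<^sup>2 * m2" by (intro mult_left_mono sq) simp
      ultimately show ?thesis by linarith
    qed
    also have "\<dots> \<le> exp (- l * m1 + l\<^sup>2 * m2)" by (rule exp_ge_add_one_self)
    finally show ?thesis .
  qed
  have ind': "indep_vars (\<lambda>_. borel) (\<lambda>i \<omega>. exp (- l * Z i \<omega>)) {..<n}"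
    by (rule indep_vars_compose2[OF indep_vars_subset[OF ind subset_UNIV], where Y="\<lambda>_ z. exp (- l * z)"]) simp
  have prodint: "integrable M (\<lambda>\<omega>. \<Prod>i<n. exp (- l * Z i \<omega>))"
    by (rule indep_vars_integrable[OF _ ind']) (use intE in auto)
  have "{\<omega>\<in>space M. (\<Sum>i<n. Z i \<omega>) \<le> real n * s} = {\<omega>\<in>space M. (\<Prod>i<n. exp (- l * Z i \<omega>)) \<ge> exp (- l * (real n * s))}"
    using lam by (auto simp: exp_sum[symmetric] sum_distrib_left[symmetric] sum_negf)
  also have "prob \<dots> \<le> expectation (\<lambda>\<omega>. \<Prod>i<n. exp (- l * Z i \<omega>)) / exp (- l * (real n * s))"
    by (rule integral_Markov_inequality_measure[where A="{}", OF prodint]) (auto intro!: prod_nonneg)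
  also have "expectation (\<lambda>\<omega>. \<Prod>i<n. exp (- l * Z i \<omega>)) = (\<Prod>i<n. expectation (\<lambda>\<omega>. exp (- l * Z i \<omega>)))"
    by (rule indep_vars_lebesgue_integral[OF _ ind']) (use intE in auto)
  also have "(\<Prod>i<n. expectation (\<lambda>\<omega>. exp (- l * Z i \<omega>))) \<le> (\<Prod>i<n. exp (- l * m1 + l\<^sup>2 * m2))"
    by (intro prod_mono) (use mgf in \<open>auto intro!: integral_nonneg_AE\<close>)
  also have "(\<Prod>i<n. exp (- l * m1 + l\<^sup>2 * m2)) / exp (- l * (real n * s)) = exp (- real n * (l * (m1 - s) - l\<^sup>2 * m2))"
    by (simp add: exp_of_nat_mult[symmetric] exp_diff[symmetric] algebra_simps)
  finally show ?thesis by (simp add: divide_right_mono)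
qed

lemma le_one_plus_powr:
  fixes a p :: real
  assumes "a \<ge> 0" "p \<ge> 1" shows "a \<le> 1 + a powr p"
proof (cases "a \<le> 1")
  case True then show ?thesis by (simp add: add_increasing2)
next
  case False then show ?thesis using powr_mono[OF assms(2), of a] assms by simp
qed

lemma abs_le_L2_set: "finite A \<Longrightarrow> k \<in> A \<Longrightarrow> \<bar>f k\<bar> \<le> L2_set f A"
  using member_le_L2_set[of A k "\<lambda>k. \<bar>f k\<bar>"] by (simp add: L2_set_def)

lemma L2_set_diff_triangle:
  "L2_set (\<lambda>k. a k - c k) A \<le> L2_set (\<lambda>k. a k - b k) A + L2_set (\<lambda>k. b k - c k) A"
  using L2_set_triangle_ineq[of "\<lambda>k. a k - b k" "\<lambda>k. b k - c k" A] by simp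

lemma L2_set_le_add_diff: "L2_set a A \<le> L2_set b A + L2_set (\<lambda>k. a k - b k) A"
  using L2_set_triangle_ineq[of b "\<lambda>k. a k - b k" A] by simp

lemma L2_set_diff_commute: "L2_set (\<lambda>k. a k - b k) A = L2_set (\<lambda>k. b k - a k) (A :: nat set)"
  by (simp add: L2_set_def power2_commute)

lemma L2_set_le_sqrt_mult:
  assumes "\<And>k. k \<in> A \<Longrightarrow> \<bar>f k\<bar> \<le> c" "finite A" "c \<ge> 0"
  shows "L2_set f A \<le> sqrt (card A) * c"
proof -
  have "(\<Sum>k\<in>A. (f k)\<^sup>2) \<le> (\<Sum>k\<in>A. c\<^sup>2)"
    using assms by (intro sum_mono) (simp add: abs_le_square_iff[symmetric])
  then show ?thesis unfolding L2_set_def using assms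
    by (auto simp: real_sqrt_mult intro!: real_le_lsqrt simp: power_mult_distrib)
qed

text \<open>Coordinates are rounded down to multiples of \<open>\<epsilon>\<close>. The factor
  \<open>sqrt K\<close> in the radius is harmless where the net is used: there
  \<open>\<epsilon>\<close> is a power of the sample size, and only the logarithm of the cardinality
  matters.\<close>

lemma euclid_ball_net:
  assumes "\<epsilon> > 0" "R \<ge> 1" "\<epsilon> \<le> 1"
  obtains U where "finite U" "U \<subseteq> euclid K" "real (card U) \<le> (5 * R / \<epsilon>) ^ K"
    "\<And>u. L2_set u {..<K} \<le> R \<Longrightarrow> \<exists>u'\<in>U. L2_set (\<lambda>k. u k - u' k) {..<K} \<le> sqrt K * \<epsilon>"
proof -
  define m where "m = \<lceil>R / \<epsilon>\<rceil>"
  define \<phi> where "\<phi> g = (\<lambda>k. if k < K then \<epsilon> * real_of_int (g k) else 0)" for g :: "nat \<Rightarrow> int"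
  define U where "U = \<phi> ` ({..<K} \<rightarrow>\<^sub>E {-m..m})"
  have fin: "finite ({..<K} \<rightarrow>\<^sub>E {-m..m})" by (intro finite_PiE) auto
  have m: "real_of_int m \<le> R / \<epsilon> + 1" "R / \<epsilon> \<le> m" "R / \<epsilon> \<ge> 1"
    using assms unfolding m_def by (linarith, linarith, simp add: pos_le_divide_eq)
  then have m0: "m \<ge> 0" by linarith
  show ?thesis
  proof
    show "finite U" unfolding U_def using fin by simp
    show "U \<subseteq> euclid K" unfolding U_def by (rule image_subsetI) (simp add: euclid_def \<phi>_def)
    have "card U \<le> card ({..<K} \<rightarrow>\<^sub>E {-m..m})" unfolding U_def by (rule card_image_le[OF fin])
    also have "\<dots> = nat (2 * m + 1) ^ K" by (simp add: card_PiE)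
    finally have "real (card U) \<le> real (nat (2 * m + 1)) ^ K" by (metis of_nat_le_iff of_nat_power)
    also have "\<dots> \<le> (5 * R / \<epsilon>) ^ K"
    \<comment> \<open>\<open>2 * m + 1 \<le> 2 * R / \<epsilon> + 3\<close>, and
      \<open>R / \<epsilon> \<ge> 1\<close> turns this into
      \<open>5 * R / \<epsilon>\<close>.\<close>
    proof (rule power_mono)
      have "real (nat (2 * m + 1)) = 2 * real_of_int m + 1" using m0 by simp
      also have "\<dots> \<le> 5 * R / \<epsilon>" using m(1,3) by argo
      finally show "real (nat (2 * m + 1)) \<le> 5 * R / \<epsilon>" .
    qed simp
    finally show "real (card U) \<le> (5 * R / \<epsilon>) ^ K" .
    fix u assume u: "L2_set u {..<K} \<le> R"
    define g where "g = (\<lambda>k\<in>{..<K}. \<lfloor>u k / \<epsilon>\<rfloor>)"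
    have "g k \<in> {-m..m}" if "k < K" for k
    proof -
      have "\<bar>u k\<bar> \<le> R"
        using abs_le_L2_set[of "{..<K}" k u] that u by simp
      then have "\<bar>u k / \<epsilon>\<bar> \<le> R / \<epsilon>" using assms by (simp add: divide_right_mono)
      then have "u k / \<epsilon> \<le> m" "- m \<le> u k / \<epsilon>" using m by linarith+
      then show ?thesis using that unfolding g_def by (auto simp: le_floor_iff floor_le_iff)
    qed
    then have "\<phi> g \<in> U" unfolding U_def g_def by (intro imageI restrict_PiE_iff[THEN iffD2]) auto
    moreover have "\<bar>u k - \<phi> g k\<bar> \<le> \<epsilon>" if "k < K" for k
    proof -
      have "\<bar>u k / \<epsilon> - \<lfloor>u k / \<epsilon>\<rfloor>\<bar> \<le> 1" by linarith
      moreover have "u k - \<phi> g k = \<epsilon> * (u k / \<epsilon> - \<lfloor>u k / \<epsilon>\<rfloor>)"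
        using that assms by (simp add: \<phi>_def g_def algebra_simps)
      ultimately show ?thesis using assms by (simp add: abs_mult)
    qed
    ultimately show "\<exists>u'\<in>U. L2_set (\<lambda>k. u k - u' k) {..<K} \<le> sqrt K * \<epsilon>"
      using assms by (intro bexI[of _ "\<phi> g"]) (use L2_set_le_sqrt_mult[of "{..<K}" "\<lambda>k. u k - \<phi> g k" \<epsilon>] in auto)
  qed
qed

text \<open>If a minimizer lay outside the open ball, then at the point where the segment from
  \<open>b0\<close> to it meets the sphere convexity would give a value at most \<open>F b0\<close>.
  This confines every minimizer, whichever the estimator picks.\<close>

lemma convex_argmin_localized:
  assumes cvx: "\<And>a b t. a \<in> euclid K \<Longrightarrow> b \<in> euclid K \<Longrightarrow> 0 \<le> t \<Longrightarrow> t \<le> 1 \<Longrightarrow>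
      F (\<lambda>k. (1 - t) * a k + t * b k) \<le> (1 - t) * F a + t * F b"
    and min: "is_arg_min F (\<lambda>b. b \<in> euclid K) b"
    and b0: "b0 \<in> euclid K" and "\<delta> > 0"
    and sphere: "\<And>u. u \<in> euclid K \<Longrightarrow> L2_set u {..<K} = \<delta> \<Longrightarrow> F (\<lambda>k. b0 k + u k) > (F b0 :: real)"
  shows "L2_set (\<lambda>k. b k - b0 k) {..<K} < \<delta>"
proof (rule ccontr)
  define D where "D = L2_set (\<lambda>k. b k - b0 k) {..<K}"
  assume "\<not> ?thesis"
  then have D: "D \<ge> \<delta>" "D > 0" using \<open>\<delta> > 0\<close> by (auto simp: D_def)
  define t where "t = \<delta> / D"
  have t: "0 < t" "t \<le> 1" using D \<open>\<delta> > 0\<close> by (auto simp: t_def)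
  have b: "b \<in> euclid K" and Fb: "F b \<le> F b0" using min b0 by (auto simp: is_arg_min_linorder)
  define u where "u = (\<lambda>k. t * (b k - b0 k))"
  have u: "u \<in> euclid K" using b b0 by (auto simp: u_def euclid_def)
  have "L2_set u {..<K} = t * D" unfolding u_def D_def using t by (simp add: L2_set_right_distrib)
  then have "L2_set u {..<K} = \<delta>" using D by (simp add: t_def)
  from sphere[OF u this] have "F b0 < F (\<lambda>k. (1 - t) * b0 k + t * b k)"
    by (simp add: u_def algebra_simps)
  also have "\<dots> \<le> (1 - t) * F b0 + t * F b" using cvx[OF b0 b] t by auto
  also have "\<dots> \<le> (1 - t) * F b0 + t * F b0" using Fb t by auto
  finally show False by (simp add: algebra_simps)
qed

lemma outer_measure_of_le_measure:
  assumes "A \<subseteq> B" "B \<in> sets M"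
  shows "outer_measure_of M A \<le> emeasure M B"
  using assms by (metis outer_measure_of_eq outer_measure_of_mono)

text \<open>The suprema in question need not be measurable; it is enough to find measurable
  exceptional events, whose measure dominates the outer probability.\<close>

lemma small_o_probI:
  assumes "prob_space M"
    and "\<And>\<epsilon> e. \<epsilon> > 0 \<Longrightarrow> e > 0 \<Longrightarrow> \<forall>\<^sub>F n in sequentially. \<exists>B\<in>sets M. measure M B \<le> e \<and> (\<forall>\<omega>\<in>space M - B. \<xi> n \<omega> \<le> ereal (\<epsilon> * a n))"
  shows "small_o_prob M \<xi> a"
  unfolding small_o_prob_def
proof (intro allI impI tendsto_zero_ennreal)
  interpret prob_space M by fact
  fix \<epsilon> e :: real assume \<epsilon>: "\<epsilon> > 0" and e: "e > 0"
  have "\<forall>\<^sub>F n in sequentially. \<exists>B\<in>sets M. measure M B \<le> e/2 \<and> (\<forall>\<omega>\<in>space M - B. \<xi> n \<omega> \<le> ereal (\<epsilon> * a n))"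
    using assms(2)[OF \<epsilon>, of "e/2"] e by simp
  then show "\<forall>\<^sub>F n in sequentially. outer_measure_of M {\<omega> \<in> space M. \<xi> n \<omega> > ereal (\<epsilon> * a n)} < ennreal e"
  proof eventually_elim
    case (elim n)
    then obtain B where B: "B \<in> sets M" "measure M B \<le> e/2" "\<forall>\<omega>\<in>space M - B. \<xi> n \<omega> \<le> ereal (\<epsilon> * a n)" by blast
    have "outer_measure_of M {\<omega> \<in> space M. \<xi> n \<omega> > ereal (\<epsilon> * a n)} \<le> emeasure M B"
      by (rule outer_measure_of_le_measure[OF _ B(1)]) (use B(3) in force)
    also have "\<dots> \<le> ennreal (e/2)" using B(2) by (simp add: emeasure_eq_measure ennreal_leI)
    also have "\<dots> < ennreal e" using e by (simp add: ennreal_less_iff)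
    finally show ?case .
  qed
qed

text \<open>The family \<open>D\<close> is linked to the function by \<open>partials_on\<close>
  only, whence the induction on the order: if a derivative of order one less vanishes on the open
  set, so do its difference quotients near \<open>z\<close>. This is what makes inactive basis
  functions drop out of the derivatives on a cell.\<close>

lemma partials_vanish:
  assumes "open U" "partials_on U s D" "\<And>z. z \<in> U \<Longrightarrow> D (\<lambda>_. 0) z = 0" and "msize u \<le> s" "z \<in> U"
  shows "D u z = 0"
  using assms(4,5)
proof (induction "msize u" arbitrary: u z)
  case 0
  then have "u = (\<lambda>_. 0)" by (auto simp: msize_def fun_eq_iff)
  then show ?case using assms(3) 0 by simp
next
  case (Suc j)
  then obtain i where i: "u i > 0" unfolding msize_def by (metis Zero_not_Suc gr0I sum.neutral)
  define w where "w = u(i := u i - 1)"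
  have uw: "u = w(i := Suc (w i))" using i by (auto simp: w_def)
  have "msize u = Suc (msize w)"
    unfolding uw msize_def by (simp add: sum.remove[of UNIV i])
  then have w: "msize w = j" "msize w < s" using Suc by auto
  have zero: "D w z' = 0" if "z' \<in> U" for z' using Suc(1)[of w z'] w that by simp
  have "((\<lambda>t. D w (z + t *\<^sub>R axis i 1)) has_real_derivative D u z) (at 0)"
    using assms(2) w(2) Suc(4) unfolding partials_on_def uw by blast
  moreover have "((\<lambda>t. D w (z + t *\<^sub>R axis i 1)) has_real_derivative 0) (at 0)"
  proof (rule DERIV_cong_ev[THEN iffD2, OF refl _ refl DERIV_const])
    have "((\<lambda>t. z + t *\<^sub>R axis i (1::real)) \<longlongrightarrow> z + 0 *\<^sub>R axis i 1) (nhds 0)"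
      by (intro tendsto_intros filterlim_ident)
    then have "\<forall>\<^sub>F t in nhds 0. z + t *\<^sub>R axis i 1 \<in> U"
      using assms(1) Suc(4) by (auto simp: tendsto_def)
    then show "\<forall>\<^sub>F t in nhds 0. D w (z + t *\<^sub>R axis i 1) = 0"
      by (rule eventually_mono) (rule zero)
  qed
  ultimately show ?case by (rule DERIV_unique)
qed

lemma convex_open_polyhedron: "open_polyhedron S \<Longrightarrow> convex S"
  unfolding open_polyhedron_def by (auto intro: convex_interior polyhedron_imp_convex)

text \<open>Here \<open>g0\<close> and \<open>g1\<close> are the conditional mean scores at the start and at the midpoint of an
  increment \<open>t\<close>, at distance \<open>a\<close> from the conditional minimizer. Replacing the increment of a convex function by
  two subgradient bounds costs only a constant factor in the curvature and avoids differentiating under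
  the integral.\<close>

lemma midpoint_lower_bound:
  fixes a t g0 g1 c C :: real
  assumes "c > 0" "C \<ge> 0" "\<bar>g0\<bar> \<le> C * \<bar>a\<bar>" "\<bar>g1\<bar> \<le> C * \<bar>a + t/2\<bar>" "g1 * (a + t/2) \<ge> c * (a + t/2)\<^sup>2"
  shows "g0 * (t/2) + g1 * (t/2) \<ge> c/8 * t\<^sup>2 - (2 * C + c) * (\<bar>t\<bar> * \<bar>a\<bar>)"
proof -
  have g0: "g0 * (t/2) \<ge> - (C/2 * (\<bar>t\<bar> * \<bar>a\<bar>))"
  proof -
    have "\<bar>g0 * (t/2)\<bar> \<le> (C * \<bar>a\<bar>) * (\<bar>t\<bar>/2)"
      unfolding abs_mult using assms(3) by (intro mult_mono) auto
    then show ?thesis by (simp add: mult_ac)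
  qed
  have nn: "\<bar>t\<bar> * \<bar>a\<bar> \<ge> 0" by simp
  show ?thesis
  \<comment> \<open>Either the midpoint lies on the side of \<open>t\<close>, at distance at least
    \<open>\<bar>t\<bar> / 4\<close> from the minimizer, and the score there gives the curvature; or
    \<open>t\<^sup>2 \<le> 4 * \<bar>t\<bar> * \<bar>a\<bar>\<close>, and the quadratic term is
    absorbed by the error.\<close>
  proof (cases "\<bar>a\<bar> < \<bar>t\<bar> / 4")
    case True
    have "g1 * (t/2) \<ge> c/8 * t\<^sup>2"
    proof (cases "t > 0")
      case t: True
      then have p: "a + t/2 \<ge> t/4" using True by linarith
      then have "g1 * (a + t/2) \<ge> (c * (a + t/2)) * (a + t/2)" using assms(5) by (simp add: power2_eq_square mult_ac)
      then have "g1 \<ge> c * (a + t/2)" using p t by (simp add: mult_le_cancel_right)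
      also have "c * (a + t/2) \<ge> c * (t/4)" using p assms(1) by simp
      finally have "g1 * (t/2) \<ge> c * (t/4) * (t/2)" using t by (intro mult_right_mono) auto
      then show ?thesis by (simp add: power2_eq_square)
    next
      case False
      then have t: "t < 0" using True by linarith
      then have p: "a + t/2 \<le> t/4" using True by linarith
      then have "g1 * (a + t/2) \<ge> (c * (a + t/2)) * (a + t/2)" using assms(5) by (simp add: power2_eq_square mult_ac)
      then have "g1 \<le> c * (a + t/2)" using p t by (simp add: mult_le_cancel_right)
      also have "c * (a + t/2) \<le> c * (t/4)" using p assms(1) by simp
      finally have "g1 * (t/2) \<ge> c * (t/4) * (t/2)" using t by (intro mult_right_mono_neg) auto
      then show ?thesis by (simp add: power2_eq_square)
    qed
    moreover have "C/2 * (\<bar>t\<bar> * \<bar>a\<bar>) \<le> (2 * C + c) * (\<bar>t\<bar> * \<bar>a\<bar>)" using assms(1,2) nn by (intro mult_right_mono) auto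
    ultimately show ?thesis using g0 by linarith
  next
    case False
    have "\<bar>g1 * (t/2)\<bar> \<le> (C * \<bar>a + t/2\<bar>) * (\<bar>t\<bar>/2)"
      unfolding abs_mult using assms(4) by (intro mult_mono) auto
    also have "\<dots> \<le> (C * (3 * \<bar>a\<bar>)) * (\<bar>t\<bar>/2)"
      using False assms(2) by (intro mult_right_mono mult_left_mono) auto
    finally have "g1 * (t/2) \<ge> - (3*C/2 * (\<bar>t\<bar> * \<bar>a\<bar>))" by (simp add: mult_ac)
    moreover have "c/8 * t\<^sup>2 \<le> c * (\<bar>t\<bar> * \<bar>a\<bar>)"
    proof -
      have "t\<^sup>2 = \<bar>t\<bar> * \<bar>t\<bar>" by (simp add: power2_eq_square)
      also have "\<dots> \<le> \<bar>t\<bar> * (4 * \<bar>a\<bar>)" using False by (intro mult_left_mono) auto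
      finally have "c/8 * t\<^sup>2 \<le> c/8 * (\<bar>t\<bar> * (4 * \<bar>a\<bar>))" using assms(1) by (intro mult_left_mono) auto
      also have "\<dots> \<le> c * (\<bar>t\<bar> * \<bar>a\<bar>)" using assms(1) by simp
      finally show ?thesis .
    qed
    ultimately show ?thesis using g0 by (simp add: algebra_simps)
  qed
qed

section \<open>The conditional increment of the loss\<close>

text \<open>No quantity here depends on the partition, so the constants obtained in this locale are
  uniform in the sample size.\<close>

locale regression_model =
  fixes M :: "'w measure"
    and x :: "nat \<Rightarrow> 'w \<Rightarrow> real^'d::finite" and y :: "nat \<Rightarrow> 'w \<Rightarrow> real"
    and X :: "(real^'d) set" and Y E Q :: "real set"
    and \<rho> \<psi> :: "real \<Rightarrow> real \<Rightarrow> real \<Rightarrow> real" and \<eta> :: "real \<Rightarrow> real"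
    and \<mu>0 :: "real^'d \<Rightarrow> real \<Rightarrow> real" and d\<mu> :: "('d \<Rightarrow> nat) \<Rightarrow> real^'d \<Rightarrow> real \<Rightarrow> real"
    and fX :: "real^'d \<Rightarrow> real" and N :: "real measure" and fYX :: "real^'d \<Rightarrow> real \<Rightarrow> real"
    and \<psi>bar :: "real^'d \<Rightarrow> real \<Rightarrow> real" and r \<alpha> \<nu> :: real and m :: nat
  assumes Y_borel: "Y \<in> sets borel" and eta_range: "range \<eta> \<subseteq> E"
    and dgp: "data_generating_process M x y X Y Q \<rho> \<eta> m \<mu>0 d\<mu> fX N fYX"
    and loss: "loss_function X Y E Q \<rho> \<psi> \<eta> \<mu>0 N (cond_law N Y fYX) \<psi>bar r \<alpha> \<nu>"
    and simple: "simplified_setup X Y E Q \<rho> \<eta> \<mu>0 N fYX \<alpha> \<nu>"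
    and cvx: "\<And>t q. t \<in> Y \<Longrightarrow> q \<in> Q \<Longrightarrow> convex_on UNIV (\<lambda>\<theta>. \<rho> t (\<eta> \<theta>) q)"
    and one_sided: "\<And>t q. t \<in> Y \<Longrightarrow> q \<in> Q \<Longrightarrow>
      (\<forall>\<theta>. ((\<lambda>\<theta>. \<rho> t (\<eta> \<theta>) q) has_real_derivative \<psi> t (\<eta> \<theta>) q * deriv \<eta> \<theta>) (at_left \<theta>)) \<or>
      (\<forall>\<theta>. ((\<lambda>\<theta>. \<rho> t (\<eta> \<theta>) q) has_real_derivative \<psi> t (\<eta> \<theta>) q * deriv \<eta> \<theta>) (at_right \<theta>))"
begin

abbreviation "L \<equiv> cond_law N Y fYX"

definition "\<Psi> z e q = (\<integral>t. \<psi> t e q \<partial>L z)"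

text \<open>The conditional mean of the one-sided derivative of the loss in \<open>\<theta>\<close>;
  formally, the derivative of the conditional risk as a function of \<open>\<zeta>\<close>.\<close>

definition "G z q \<zeta> = \<Psi> z (\<eta> \<zeta>) q * deriv \<eta> \<zeta>"

lemma dgp_facts:
  shows "prob_space M"
    "prob_space.indep_vars M (\<lambda>_. borel) (\<lambda>i \<omega>. (x i \<omega>, y i \<omega>)) UNIV"
    "\<forall>i. \<forall>\<omega>\<in>space M. x i \<omega> \<in> X \<and> y i \<omega> \<in> Y"
    "\<forall>i. distributed M lborel (x i) (\<lambda>z. ennreal (fX z))"
    "\<exists>U. open U \<and> connected U \<and> bounded U \<and> U \<noteq> {} \<and> X = closure U"
    "continuous_on X fX" "\<exists>c>0. \<forall>z\<in>X. fX z \<ge> c" "\<forall>z. z \<notin> X \<longrightarrow> fX z = 0"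
    "sigma_finite_measure N" "sets N = sets borel"
    "\<forall>z\<in>X. \<forall>t. fYX z t \<ge> 0 \<and> (t \<notin> Y \<longrightarrow> fYX z t = 0)"
    "\<forall>z\<in>X. prob_space (L z)"
    "\<forall>i. distributed M (lborel \<Otimes>\<^sub>M N) (\<lambda>\<omega>. (x i \<omega>, y i \<omega>))
            (\<lambda>(z, t). ennreal (fX z * fYX z t))"
    "\<exists>C. \<forall>u. msize u \<le> m \<longrightarrow> (\<forall>z\<in>X. \<forall>q\<in>Q. \<bar>d\<mu> u z q\<bar> \<le> C)"
    "\<exists>C. \<forall>z\<in>X. C-lipschitz_on Q (\<mu>0 z)"
  using dgp unfolding data_generating_process_def by - (elim conjE, assumption)+

lemma dmu_zero: "\<forall>q\<in>Q. \<forall>z\<in>X. d\<mu> (\<lambda>_. 0) z q = \<mu>0 z q"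
proof -
  have "\<forall>q\<in>Q. (\<forall>z\<in>X. d\<mu> (\<lambda>_. 0) z q = \<mu>0 z q) \<and>
      partials_on (interior X) m (\<lambda>u z. d\<mu> u z q) \<and>
      (\<forall>u. msize u \<le> m \<longrightarrow> continuous_on X (\<lambda>z. d\<mu> u z q))"
    using dgp unfolding data_generating_process_def by (elim conjE) assumption
  then show ?thesis by blast
qed

lemma loss_facts:
  shows "r > 0" "compact Q" "connected Q" "open E"
    "\<forall>q\<in>Q. AE z in lborel. z \<in> X \<longrightarrow> \<Psi> z (\<eta> (\<mu>0 z q)) q = 0"
    "(\<lambda>(x, y). \<psi>bar x y) \<in> borel_measurable (restrict_space borel (X \<times> Y))"
    "\<forall>z\<in>X. \<forall>t\<in>Y. \<psi>bar z t > 0 \<and> (\<forall>q\<in>Q. \<bar>\<psi> t (\<eta> (\<mu>0 z q)) q\<bar> \<le> \<psi>bar z t)"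
    "\<nu> > 2"
    "\<exists>C::real. \<forall>z\<in>X. (\<integral>\<^sup>+t. ennreal (\<psi>bar z t powr \<nu>) \<partial>L z) \<le> ennreal C"
    "monotone (<) (<) \<eta> \<or> monotone (<) (>) \<eta>"
    "\<eta> differentiable_on UNIV" "deriv \<eta> differentiable_on UNIV"
    "0 < \<alpha>"
  using loss unfolding loss_function_def Let_def \<Psi>_def by - (elim conjE, assumption)+

lemma Psi_facts:
  shows "\<forall>z\<in>X. \<forall>q\<in>Q. \<forall>e\<in>E. integrable (L z) (\<lambda>t. \<psi> t e q)"
    "\<forall>z\<in>X. \<forall>q\<in>Q. (\<lambda>e. \<Psi> z e q) differentiable_on E"
proof -
  have "\<forall>z\<in>X. \<forall>q\<in>Q. (\<forall>e\<in>E. integrable (L z) (\<lambda>t. \<psi> t e q)) \<and>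
        (\<lambda>e. \<Psi> z e q) differentiable_on E \<and> (\<lambda>e. deriv (\<lambda>e. \<Psi> z e q) e) differentiable_on E \<and>
        continuous_on E (\<lambda>e. deriv (\<lambda>e. deriv (\<lambda>e. \<Psi> z e q) e) e)"
    using loss unfolding loss_function_def Let_def \<Psi>_def by (elim conjE) assumption
  then show "\<forall>z\<in>X. \<forall>q\<in>Q. \<forall>e\<in>E. integrable (L z) (\<lambda>t. \<psi> t e q)"
    "\<forall>z\<in>X. \<forall>q\<in>Q. (\<lambda>e. \<Psi> z e q) differentiable_on E"
    by blast+
qed

lemma Psi1_bounds:
  shows
    "\<exists>C. \<forall>z\<in>X. \<forall>q\<in>Q. \<forall>\<zeta>\<in>{\<zeta>. \<bar>\<zeta> - \<mu>0 z q\<bar> \<le> r}. \<bar>deriv (\<lambda>e. \<Psi> z e q) (\<eta> \<zeta>)\<bar> \<le> C"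
    "\<exists>c>0. \<forall>z\<in>X. \<forall>q\<in>Q. \<forall>\<zeta>\<in>{\<zeta>. \<bar>\<zeta> - \<mu>0 z q\<bar> \<le> r}. deriv (\<lambda>e. \<Psi> z e q) (\<eta> \<zeta>) * (deriv \<eta> \<zeta>)\<^sup>2 \<ge> c"
proof -
  note * = loss[unfolded loss_function_def Let_def, folded \<Psi>_def]
  have "\<exists>C. \<forall>z\<in>X. \<forall>q\<in>Q. \<forall>\<zeta>\<in>{\<zeta>. \<bar>\<zeta> - \<mu>0 z q\<bar> \<le> r}. \<bar>deriv (\<lambda>e. \<Psi> z e q) (\<eta> \<zeta>)\<bar> \<le> C \<and>
      \<bar>deriv (\<lambda>e. deriv (\<lambda>e. \<Psi> z e q) e) (\<eta> \<zeta>)\<bar> \<le> C"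
    using * by (elim conjE) assumption
  then show "\<exists>C. \<forall>z\<in>X. \<forall>q\<in>Q. \<forall>\<zeta>\<in>{\<zeta>. \<bar>\<zeta> - \<mu>0 z q\<bar> \<le> r}. \<bar>deriv (\<lambda>e. \<Psi> z e q) (\<eta> \<zeta>)\<bar> \<le> C"
    by blast
  show "\<exists>c>0. \<forall>z\<in>X. \<forall>q\<in>Q. \<forall>\<zeta>\<in>{\<zeta>. \<bar>\<zeta> - \<mu>0 z q\<bar> \<le> r}. deriv (\<lambda>e. \<Psi> z e q) (\<eta> \<zeta>) * (deriv \<eta> \<zeta>)\<^sup>2 \<ge> c"
    using * by (elim conjE) assumption
qed

lemma score_smooth:
    "\<exists>C. \<forall>z\<in>X. \<forall>q\<in>Q. \<forall>\<zeta>1\<in>{\<zeta>. \<bar>\<zeta> - \<mu>0 z q\<bar> \<le> r}. \<forall>\<zeta>2\<in>{\<zeta>. \<bar>\<zeta> - \<mu>0 z q\<bar> \<le> r}.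
        let I = {min (\<eta> \<zeta>1) (\<eta> \<zeta>2)..max (\<eta> \<zeta>1) (\<eta> \<zeta>2)};
            D = (\<lambda>l t. \<bar>\<psi> t (\<eta> (\<zeta>1 + l * (\<zeta>2 - \<zeta>1))) q - \<psi> t (\<eta> \<zeta>2) q\<bar>)
        in if N = lborel
           then (\<forall>l\<in>{0..1}. (\<forall>t\<in>Y - I. D l t \<le> C * \<bar>\<zeta>1 - \<zeta>2\<bar> powr \<alpha>) \<and>
                             (\<forall>t\<in>Y \<inter> I. D l t \<le> C))
           else (\<forall>l\<in>{0..1}. \<forall>t\<in>Y. D l t \<le> C * \<bar>\<zeta>1 - \<zeta>2\<bar> powr \<alpha>)"
proof -
  note * = loss[unfolded loss_function_def Let_def, folded \<Psi>_def]
  show ?thesis unfolding Let_def using * by (elim conjE) assumption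
qed

lemma mu0_bounded: "\<exists>C. \<forall>z\<in>X. \<forall>q\<in>Q. \<bar>\<mu>0 z q\<bar> \<le> C"
proof -
  obtain C where "\<And>u z q. msize u \<le> m \<Longrightarrow> z \<in> X \<Longrightarrow> q \<in> Q \<Longrightarrow> \<bar>d\<mu> u z q\<bar> \<le> C"
    using dgp_facts(14) by blast
  from this[of "\<lambda>_. 0"] show ?thesis using dmu_zero by (auto simp: msize_def)
qed

section \<open>Bounds on the link function and on the conditional score\<close>

lemma eta_deriv: "(\<eta> has_real_derivative deriv \<eta> \<zeta>) (at \<zeta>)"
proof -
  have "\<eta> differentiable (at \<zeta>)" using loss_facts(11) unfolding differentiable_on_def by simp
  then show ?thesis using DERIV_deriv_iff_real_differentiable by blast
qed

lemma continuous_deriv_eta: "continuous_on S (deriv \<eta>)"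
  using continuous_on_subset[OF differentiable_imp_continuous_on[OF loss_facts(12)]] by simp

lemma continuous_eta: "continuous_on S \<eta>"
  using continuous_on_subset[OF differentiable_imp_continuous_on[OF loss_facts(11)]] by simp

lemma deriv_eta_sign: "(\<forall>\<zeta>. deriv \<eta> \<zeta> \<ge> 0) \<or> (\<forall>\<zeta>. deriv \<eta> \<zeta> \<le> 0)"
  using loss_facts(10)
proof
  assume "monotone (<) (<) \<eta>"
  then have "mono \<eta>" by (auto simp: monotone_def mono_def order_le_less)
  then show ?thesis using mono_on_imp_deriv_nonneg[OF _ eta_deriv, of UNIV] by auto
next
  assume "monotone (<) (>) \<eta>"
  then have "mono (\<lambda>z. - \<eta> z)" by (auto simp: monotone_def mono_def order_le_less)
  then show ?thesis using mono_on_imp_deriv_nonneg[OF _ DERIV_minus[OF eta_deriv], of UNIV] by auto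
qed

text \<open>The lower bound comes from the curvature condition: the derivative of
  \<open>\<Psi>\<close> times the squared derivative of \<open>\<eta>\<close> is bounded away from
  zero while the first factor is bounded. The upper bound comes from compactness, since
  \<open>\<mu>0\<close> is bounded and all neighbourhoods lie in one bounded interval.\<close>

lemma eta_deriv_bounds:
  "\<exists>c>0. \<exists>C>0. \<forall>z\<in>X. \<forall>q\<in>Q. \<forall>\<zeta>. \<bar>\<zeta> - \<mu>0 z q\<bar> \<le> r \<longrightarrow> c \<le> \<bar>deriv \<eta> \<zeta>\<bar> \<and> \<bar>deriv \<eta> \<zeta>\<bar> \<le> C"
proof -
  obtain C0 where C0: "\<And>z q. z \<in> X \<Longrightarrow> q \<in> Q \<Longrightarrow> \<bar>\<mu>0 z q\<bar> \<le> C0" using mu0_bounded by blast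
  have "compact (deriv \<eta> ` {-C0-r..C0+r})"
    by (intro compact_continuous_image continuous_deriv_eta) auto
  then obtain C where C: "\<forall>\<zeta>\<in>{-C0-r..C0+r}. \<bar>deriv \<eta> \<zeta>\<bar> \<le> C"
    unfolding real_norm_def[symmetric] by (metis bounded_iff compact_imp_bounded imageI)
  obtain C1 where C1: "\<And>z q \<zeta>. z \<in> X \<Longrightarrow> q \<in> Q \<Longrightarrow> \<bar>\<zeta> - \<mu>0 z q\<bar> \<le> r \<Longrightarrow> \<bar>deriv (\<lambda>e. \<Psi> z e q) (\<eta> \<zeta>)\<bar> \<le> C1"
    using Psi1_bounds(1) by blast
  obtain c where c: "c > 0" "\<And>z q \<zeta>. z \<in> X \<Longrightarrow> q \<in> Q \<Longrightarrow> \<bar>\<zeta> - \<mu>0 z q\<bar> \<le> r \<Longrightarrow> deriv (\<lambda>e. \<Psi> z e q) (\<eta> \<zeta>) * (deriv \<eta> \<zeta>)\<^sup>2 \<ge> c"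
    using Psi1_bounds(2) by blast
  define c' where "c' = sqrt (c / (\<bar>C1\<bar> + 1))"
  have "c' > 0" using c(1) by (simp add: c'_def)
  moreover have "c' \<le> \<bar>deriv \<eta> \<zeta>\<bar> \<and> \<bar>deriv \<eta> \<zeta>\<bar> \<le> \<bar>C\<bar> + 1"
    if "z \<in> X" "q \<in> Q" "\<bar>\<zeta> - \<mu>0 z q\<bar> \<le> r" for z q \<zeta>
  proof
    have "c \<le> deriv (\<lambda>e. \<Psi> z e q) (\<eta> \<zeta>) * (deriv \<eta> \<zeta>)\<^sup>2" using c(2) that by blast
    also have "\<dots> \<le> (\<bar>C1\<bar> + 1) * (deriv \<eta> \<zeta>)\<^sup>2" using C1[OF that] by (intro mult_right_mono) auto
    finally have "c / (\<bar>C1\<bar> + 1) \<le> (deriv \<eta> \<zeta>)\<^sup>2" by (simp add: field_simps)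
    then have "c' \<le> sqrt ((deriv \<eta> \<zeta>)\<^sup>2)" unfolding c'_def by (rule real_sqrt_le_mono)
    then show "c' \<le> \<bar>deriv \<eta> \<zeta>\<bar>" by simp
    have "\<bar>deriv \<eta> \<zeta>\<bar> \<le> C" using C0[OF that(1,2)] that(3) by (intro C[rule_format]) auto
    then show "\<bar>deriv \<eta> \<zeta>\<bar> \<le> \<bar>C\<bar> + 1" by simp
  qed
  moreover have "\<bar>C\<bar> + 1 > 0" by simp
  ultimately show ?thesis by meson
qed

lemma Psi_deriv:
  assumes "z \<in> X" "q \<in> Q"
  shows "((\<lambda>\<zeta>. \<Psi> z (\<eta> \<zeta>) q) has_real_derivative deriv (\<lambda>e. \<Psi> z e q) (\<eta> \<zeta>) * deriv \<eta> \<zeta>) (at \<zeta>)"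
proof -
  have "\<eta> \<zeta> \<in> E" using eta_range by auto
  then have "(\<lambda>e. \<Psi> z e q) differentiable (at (\<eta> \<zeta>) within E)"
    using Psi_facts(2) assms unfolding differentiable_on_def by blast
  then have "(\<lambda>e. \<Psi> z e q) differentiable (at (\<eta> \<zeta>))"
    using at_within_open[OF \<open>\<eta> \<zeta> \<in> E\<close> loss_facts(4)] by simp
  then have "((\<lambda>e. \<Psi> z e q) has_real_derivative deriv (\<lambda>e. \<Psi> z e q) (\<eta> \<zeta>)) (at (\<eta> \<zeta>))"
    using DERIV_deriv_iff_real_differentiable by blast
  from DERIV_chain2[OF this eta_deriv] show ?thesis .
qed

text \<open>As the conditional mean score vanishes at \<open>\<mu>0 z q\<close>, the mean value
  theorem makes \<open>G\<close> a multiple of \<open>\<zeta> - \<mu>0 z q\<close>. The multiplier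
  contains \<open>deriv \<eta> \<xi> * deriv \<eta> \<zeta>\<close>, whereas the curvature condition
  has a square: the signs agree by monotonicity, and the ratio of the two derivatives costs the
  factor \<open>a / A\<close>. The mean-zero condition is available for almost every
  \<open>z\<close> only, hence its place among the premises.\<close>

lemma G_bounds:
  "\<exists>c>0. \<exists>C>0. \<forall>q\<in>Q. \<forall>z\<in>X. \<Psi> z (\<eta> (\<mu>0 z q)) q = 0 \<longrightarrow>
     (\<forall>\<zeta>. \<bar>\<zeta> - \<mu>0 z q\<bar> \<le> r \<longrightarrow> \<bar>G z q \<zeta>\<bar> \<le> C * \<bar>\<zeta> - \<mu>0 z q\<bar> \<and>
         G z q \<zeta> * (\<zeta> - \<mu>0 z q) \<ge> c * (\<zeta> - \<mu>0 z q)\<^sup>2)"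
proof -
  obtain a A where a: "a > 0" "A > 0" "\<And>z q \<zeta>. z \<in> X \<Longrightarrow> q \<in> Q \<Longrightarrow> \<bar>\<zeta> - \<mu>0 z q\<bar> \<le> r \<Longrightarrow> a \<le> \<bar>deriv \<eta> \<zeta>\<bar> \<and> \<bar>deriv \<eta> \<zeta>\<bar> \<le> A"
    using eta_deriv_bounds by blast
  obtain C1 where C1: "\<And>z q \<zeta>. z \<in> X \<Longrightarrow> q \<in> Q \<Longrightarrow> \<bar>\<zeta> - \<mu>0 z q\<bar> \<le> r \<Longrightarrow> \<bar>deriv (\<lambda>e. \<Psi> z e q) (\<eta> \<zeta>)\<bar> \<le> C1"
    using Psi1_bounds(1) by blast
  obtain c where c: "c > 0" "\<And>z q \<zeta>. z \<in> X \<Longrightarrow> q \<in> Q \<Longrightarrow> \<bar>\<zeta> - \<mu>0 z q\<bar> \<le> r \<Longrightarrow> deriv (\<lambda>e. \<Psi> z e q) (\<eta> \<zeta>) * (deriv \<eta> \<zeta>)\<^sup>2 \<ge> c"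
    using Psi1_bounds(2) by blast
  define c' where "c' = c * (a / A)"
  define C' where "C' = (\<bar>C1\<bar> + 1) * A * A"
  have pos: "c' > 0" "C' > 0" using a c by (auto simp: c'_def C'_def)
  have "\<bar>G z q \<zeta>\<bar> \<le> C' * \<bar>\<zeta> - \<mu>0 z q\<bar> \<and> G z q \<zeta> * (\<zeta> - \<mu>0 z q) \<ge> c' * (\<zeta> - \<mu>0 z q)\<^sup>2"
    if z: "z \<in> X" and q: "q \<in> Q" and 0: "\<Psi> z (\<eta> (\<mu>0 z q)) q = 0" and \<zeta>: "\<bar>\<zeta> - \<mu>0 z q\<bar> \<le> r" for z q \<zeta>
  proof (cases "\<zeta> = \<mu>0 z q")
    case True then show ?thesis using 0 by (simp add: G_def)
  next
    case False
    define D where "D \<xi> = deriv (\<lambda>e. \<Psi> z e q) (\<eta> \<xi>)" for \<xi>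
    have "\<exists>\<xi>. \<bar>\<xi> - \<mu>0 z q\<bar> \<le> r \<and> \<Psi> z (\<eta> \<zeta>) q - \<Psi> z (\<eta> (\<mu>0 z q)) q = (\<zeta> - \<mu>0 z q) * (D \<xi> * deriv \<eta> \<xi>)"
    proof (cases "\<zeta> > \<mu>0 z q")
      case True
      from MVT2[OF True Psi_deriv[OF z q]] \<zeta> show ?thesis unfolding D_def by force
    next
      case F: False
      then have "\<zeta> < \<mu>0 z q" using False by simp
      from MVT2[OF this Psi_deriv[OF z q]] obtain \<xi> where \<xi>: "\<zeta> < \<xi>" "\<xi> < \<mu>0 z q"
         "\<Psi> z (\<eta> (\<mu>0 z q)) q - \<Psi> z (\<eta> \<zeta>) q = (\<mu>0 z q - \<zeta>) * (D \<xi> * deriv \<eta> \<xi>)" unfolding D_def by blast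
      have "\<Psi> z (\<eta> \<zeta>) q - \<Psi> z (\<eta> (\<mu>0 z q)) q = (\<zeta> - \<mu>0 z q) * (D \<xi> * deriv \<eta> \<xi>)"
        using \<xi>(3) by (simp add: algebra_simps)
      then show ?thesis using \<xi>(1,2) \<zeta> by (intro exI[of _ \<xi>]) auto
    qed
    then obtain \<xi> where \<xi>: "\<bar>\<xi> - \<mu>0 z q\<bar> \<le> r" "\<Psi> z (\<eta> \<zeta>) q = (\<zeta> - \<mu>0 z q) * (D \<xi> * deriv \<eta> \<xi>)"
      using 0 by auto
    have G: "G z q \<zeta> = (D \<xi> * deriv \<eta> \<xi> * deriv \<eta> \<zeta>) * (\<zeta> - \<mu>0 z q)" by (simp add: G_def \<xi>(2) mult_ac)
    note b1 = a(3)[OF z q \<xi>(1)] and b2 = a(3)[OF z q \<zeta>]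
    have "D \<xi> * (deriv \<eta> \<xi>)\<^sup>2 \<ge> c" unfolding D_def using c(2)[OF z q \<xi>(1)] .
    then have Dpos: "D \<xi> > 0" using c(1) by (smt (verit) mult_nonpos_nonneg zero_le_power2)
    have "deriv \<eta> \<xi> * deriv \<eta> \<zeta> = \<bar>deriv \<eta> \<xi>\<bar> * \<bar>deriv \<eta> \<zeta>\<bar>"
      using deriv_eta_sign by (auto simp: abs_of_nonpos)
    then have P: "D \<xi> * deriv \<eta> \<xi> * deriv \<eta> \<zeta> = D \<xi> * (\<bar>deriv \<eta> \<xi>\<bar> * \<bar>deriv \<eta> \<zeta>\<bar>)" by simp
    have "c' \<le> (D \<xi> * (deriv \<eta> \<xi>)\<^sup>2) * (a / A)"
      unfolding c'_def using \<open>D \<xi> * (deriv \<eta> \<xi>)\<^sup>2 \<ge> c\<close> a by (intro mult_right_mono) auto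
    also have "\<dots> = D \<xi> * (\<bar>deriv \<eta> \<xi>\<bar> * (\<bar>deriv \<eta> \<xi>\<bar> / A * a))" by (simp add: power2_eq_square)
    also have "\<dots> \<le> D \<xi> * (\<bar>deriv \<eta> \<xi>\<bar> * (1 * \<bar>deriv \<eta> \<zeta>\<bar>))"
      using Dpos b1 b2 a by (intro mult_left_mono mult_mono) auto
    finally have lo: "c' \<le> D \<xi> * deriv \<eta> \<xi> * deriv \<eta> \<zeta>" unfolding P by simp
    have "D \<xi> * (\<bar>deriv \<eta> \<xi>\<bar> * \<bar>deriv \<eta> \<zeta>\<bar>) \<le> (\<bar>C1\<bar> + 1) * (A * A)"
      using C1[OF z q \<xi>(1)] b1 b2 a Dpos unfolding D_def[symmetric] by (intro mult_mono) auto
    then have hi: "\<bar>D \<xi> * deriv \<eta> \<xi> * deriv \<eta> \<zeta>\<bar> \<le> C'" unfolding C'_def P using Dpos by (simp add: mult_ac)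
    show ?thesis unfolding G
    proof
      show "\<bar>D \<xi> * deriv \<eta> \<xi> * deriv \<eta> \<zeta> * (\<zeta> - \<mu>0 z q)\<bar> \<le> C' * \<bar>\<zeta> - \<mu>0 z q\<bar>"
        unfolding abs_mult[of _ "\<zeta> - \<mu>0 z q"] using hi by (rule mult_right_mono) simp
      have "c' * (\<zeta> - \<mu>0 z q)\<^sup>2 \<le> (D \<xi> * deriv \<eta> \<xi> * deriv \<eta> \<zeta>) * (\<zeta> - \<mu>0 z q)\<^sup>2"
        using lo by (rule mult_right_mono) simp
      then show "c' * (\<zeta> - \<mu>0 z q)\<^sup>2 \<le> D \<xi> * deriv \<eta> \<xi> * deriv \<eta> \<zeta> * (\<zeta> - \<mu>0 z q) * (\<zeta> - \<mu>0 z q)"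
        by (simp add: power2_eq_square mult_ac)
    qed
  qed
  with pos show ?thesis by blast
qed

lemma subgradient:
  assumes "t \<in> Y" "q \<in> Q"
  shows "\<rho> t (\<eta> b) q - \<rho> t (\<eta> a) q \<ge> \<psi> t (\<eta> a) q * deriv \<eta> a * (b - a)"
  by (rule convex_on_one_sided_derivative_ge[OF cvx[OF assms]]) (use one_sided[OF assms] in auto)

text \<open>The smoothness condition, with \<open>\<mu>0 z q\<close> as its second point, compares
  the score with the envelope. Both of its regimes yield a constant on the bounded neighbourhood, so
  jumps of the score do no harm; the \<open>1\<close> added to the envelope absorbs this
  constant.\<close>

lemma score_bound:
  "\<exists>C>0. \<forall>z\<in>X. \<forall>q\<in>Q. \<forall>t\<in>Y. \<forall>\<zeta>. \<bar>\<zeta> - \<mu>0 z q\<bar> \<le> r \<longrightarrow> \<bar>\<psi> t (\<eta> \<zeta>) q * deriv \<eta> \<zeta>\<bar> \<le> C * (\<psi>bar z t + 1)"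
proof -
  obtain a A where a: "a > 0" "A > 0" "\<And>z q \<zeta>. z \<in> X \<Longrightarrow> q \<in> Q \<Longrightarrow> \<bar>\<zeta> - \<mu>0 z q\<bar> \<le> r \<Longrightarrow> a \<le> \<bar>deriv \<eta> \<zeta>\<bar> \<and> \<bar>deriv \<eta> \<zeta>\<bar> \<le> A"
    using eta_deriv_bounds by blast
  from score_smooth obtain C where C: "\<forall>z\<in>X. \<forall>q\<in>Q. \<forall>\<zeta>1\<in>{\<zeta>. \<bar>\<zeta> - \<mu>0 z q\<bar> \<le> r}. \<forall>\<zeta>2\<in>{\<zeta>. \<bar>\<zeta> - \<mu>0 z q\<bar> \<le> r}.
        let I = {min (\<eta> \<zeta>1) (\<eta> \<zeta>2)..max (\<eta> \<zeta>1) (\<eta> \<zeta>2)};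
            D = (\<lambda>l t. \<bar>\<psi> t (\<eta> (\<zeta>1 + l * (\<zeta>2 - \<zeta>1))) q - \<psi> t (\<eta> \<zeta>2) q\<bar>)
        in if N = lborel
           then (\<forall>l\<in>{0..1}. (\<forall>t\<in>Y - I. D l t \<le> C * \<bar>\<zeta>1 - \<zeta>2\<bar> powr \<alpha>) \<and>
                             (\<forall>t\<in>Y \<inter> I. D l t \<le> C))
           else (\<forall>l\<in>{0..1}. \<forall>t\<in>Y. D l t \<le> C * \<bar>\<zeta>1 - \<zeta>2\<bar> powr \<alpha>)" by (rule exE)
  define C' where "C' = \<bar>C\<bar> * (r powr \<alpha> + 1) + 1"
  have C'1: "C' \<ge> 1" using loss_facts(1) by (simp add: C'_def)
  have "\<bar>\<psi> t (\<eta> \<zeta>) q * deriv \<eta> \<zeta>\<bar> \<le> (C' * A) * (\<psi>bar z t + 1)"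
    if z: "z \<in> X" and q: "q \<in> Q" and t: "t \<in> Y" and \<zeta>: "\<bar>\<zeta> - \<mu>0 z q\<bar> \<le> r" for z q t \<zeta>
  proof -
    have "\<bar>\<mu>0 z q - \<mu>0 z q\<bar> \<le> r" using loss_facts(1) by simp
    then have \<mu>: "\<mu>0 z q \<in> {\<zeta>. \<bar>\<zeta> - \<mu>0 z q\<bar> \<le> r}" by simp
    have "\<zeta> \<in> {\<zeta>. \<bar>\<zeta> - \<mu>0 z q\<bar> \<le> r}" using \<zeta> by simp
    \<comment> \<open>The choice \<open>l = 0\<close> leaves the score at the first point,
      \<open>\<zeta>\<close>.\<close>
    from C[THEN bspec, OF z, THEN bspec, OF q, THEN bspec, OF this, THEN bspec, OF \<mu>] have
      "\<bar>\<psi> t (\<eta> \<zeta>) q - \<psi> t (\<eta> (\<mu>0 z q)) q\<bar> \<le> C * \<bar>\<zeta> - \<mu>0 z q\<bar> powr \<alpha> \<or> \<bar>\<psi> t (\<eta> \<zeta>) q - \<psi> t (\<eta> (\<mu>0 z q)) q\<bar> \<le> C"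
      using t unfolding Let_def by (cases "N = lborel") (auto dest!: bspec[where A="{0..1}" and x="0::real"])
    moreover have "C * \<bar>\<zeta> - \<mu>0 z q\<bar> powr \<alpha> \<le> C'"
    proof -
      have "C * \<bar>\<zeta> - \<mu>0 z q\<bar> powr \<alpha> \<le> \<bar>C\<bar> * (r powr \<alpha> + 1)"
        using \<zeta> loss_facts(13) powr_mono2[of \<alpha> "\<bar>\<zeta> - \<mu>0 z q\<bar>" r] by (intro mult_mono) auto
      then show ?thesis by (simp add: C'_def)
    qed
    moreover have "C \<le> C'"
    proof -
      have "C * 1 \<le> \<bar>C\<bar> * (r powr \<alpha> + 1)" by (intro mult_mono) auto
      then show ?thesis by (simp add: C'_def)
    qed
    ultimately have "\<bar>\<psi> t (\<eta> \<zeta>) q - \<psi> t (\<eta> (\<mu>0 z q)) q\<bar> \<le> C'" by linarith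
    moreover have "\<bar>\<psi> t (\<eta> (\<mu>0 z q)) q\<bar> \<le> \<psi>bar z t" "\<psi>bar z t > 0" using loss_facts(7) z q t by auto
    ultimately have "\<bar>\<psi> t (\<eta> \<zeta>) q\<bar> \<le> C' + \<psi>bar z t" by linarith
    also have "\<dots> \<le> C' * (\<psi>bar z t + 1)"
      using C'1 mult_right_mono[OF C'1, of "\<psi>bar z t"] \<open>\<psi>bar z t > 0\<close> by (simp add: algebra_simps)
    finally have "\<bar>\<psi> t (\<eta> \<zeta>) q\<bar> * \<bar>deriv \<eta> \<zeta>\<bar> \<le> C' * (\<psi>bar z t + 1) * A"
      using a(3)[OF z q \<zeta>] C'1 \<open>\<psi>bar z t > 0\<close> by (intro mult_mono) auto
    then show ?thesis by (simp add: abs_mult mult_ac)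
  qed
  moreover have "C' * A > 0" using C'1 a by simp
  ultimately show ?thesis by blast
qed

text \<open>The subgradient inequality at either endpoint gives one side of the bound, so that the
  derivative of the loss never has to be integrated along the segment.\<close>

lemma rho_lipschitz:
  "\<exists>C>0. \<forall>z\<in>X. \<forall>q\<in>Q. \<forall>t\<in>Y. \<forall>\<zeta> \<zeta>'. \<bar>\<zeta> - \<mu>0 z q\<bar> \<le> r \<longrightarrow> \<bar>\<zeta>' - \<mu>0 z q\<bar> \<le> r \<longrightarrow>
    \<bar>\<rho> t (\<eta> \<zeta>') q - \<rho> t (\<eta> \<zeta>) q\<bar> \<le> C * (\<psi>bar z t + 1) * \<bar>\<zeta>' - \<zeta>\<bar>"
proof -
  obtain C where C: "C > 0" "\<And>z q t \<zeta>. z \<in> X \<Longrightarrow> q \<in> Q \<Longrightarrow> t \<in> Y \<Longrightarrow> \<bar>\<zeta> - \<mu>0 z q\<bar> \<le> r \<Longrightarrow> \<bar>\<psi> t (\<eta> \<zeta>) q * deriv \<eta> \<zeta>\<bar> \<le> C * (\<psi>bar z t + 1)"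
    using score_bound by blast
  have "\<bar>\<rho> t (\<eta> \<zeta>') q - \<rho> t (\<eta> \<zeta>) q\<bar> \<le> C * (\<psi>bar z t + 1) * \<bar>\<zeta>' - \<zeta>\<bar>"
    if z: "z \<in> X" "q \<in> Q" "t \<in> Y" and a: "\<bar>\<zeta> - \<mu>0 z q\<bar> \<le> r" "\<bar>\<zeta>' - \<mu>0 z q\<bar> \<le> r" for z q t \<zeta> \<zeta>'
  proof -
    have *: "\<rho> t (\<eta> b) q - \<rho> t (\<eta> a) q \<ge> - (C * (\<psi>bar z t + 1) * \<bar>b - a\<bar>)" if "\<bar>a - \<mu>0 z q\<bar> \<le> r" for a b
    proof -
      have "\<bar>\<psi> t (\<eta> a) q * deriv \<eta> a * (b - a)\<bar> \<le> C * (\<psi>bar z t + 1) * \<bar>b - a\<bar>"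
        unfolding abs_mult[of _ "b - a"] using C(2)[OF z that] by (rule mult_right_mono) simp
      then show ?thesis using subgradient[OF z(3,2), where a=a and b=b] by linarith
    qed
    from *[OF a(1), of \<zeta>'] *[OF a(2), of \<zeta>] show ?thesis by (simp add: abs_minus_commute abs_le_iff)
  qed
  with C(1) show ?thesis by blast
qed

section \<open>Integration against the law of one observation\<close>

lemma X_closed: "closed X" and X_bounded: "bounded X" and X_nonempty: "X \<noteq> {}"
  using dgp_facts(5) by (auto intro: bounded_closure)

lemma X_compact: "compact X"
  using X_closed X_bounded compact_eq_bounded_closed by blast

lemma X_borel[measurable]: "X \<in> sets borel"
  using X_closed by simp

lemma sets_cond_law: "sets (L z) = sets (restrict_space borel Y)"
  unfolding cond_law_def by (intro sets_restrict_space_cong) (simp add: dgp_facts(10))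

lemma space_cond_law: "space (L z) = Y"
  using sets_eq_imp_space_eq[OF sets_cond_law[of z]] by (simp add: space_restrict_space)

lemma XY_borel: "X \<times> Y \<in> sets borel"
  unfolding borel_prod[symmetric] by (rule pair_measureI[OF X_borel Y_borel])

text \<open>Measurability of the loss is drawn from its explicit form: continuous functions and
  indicators of half-planes.\<close>

lemma measurable_rho:
  assumes "q \<in> Q"
  shows "(\<lambda>(t, e). \<rho> t e q) \<in> borel_measurable (restrict_space borel (Y \<times> E))"
proof -
  obtain f1 f2 f3 :: "real \<Rightarrow> real" and D1 D2 D3 :: real and \<T> :: "real \<Rightarrow> real \<Rightarrow> real" where
    cont: "continuous_on Y f1" "continuous_on Y f2" "continuous_on Y f3"
       "continuous_on (Y \<times> E) (\<lambda>(y, e). \<T> y e)" and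
    eq: "\<forall>y\<in>Y. \<forall>e\<in>E. \<forall>q\<in>Q.
          \<rho> y e q = (f1 y + D1 * e) * of_bool (y \<le> e) + (f2 y + D2 * e) * of_bool (y \<le> q)
                   + (f3 y + D3 * e) * q + \<T> y e"
    using simple unfolding simplified_setup_def Let_def by (elim conjE exE) (rule that; assumption)
  let ?R = "restrict_space borel (Y \<times> E) :: (real \<times> real) measure"
  have [measurable]: "(\<lambda>p. f1 (fst p)) \<in> borel_measurable ?R" "(\<lambda>p. f2 (fst p)) \<in> borel_measurable ?R"
    "(\<lambda>p. f3 (fst p)) \<in> borel_measurable ?R" "(\<lambda>p. \<T> (fst p) (snd p)) \<in> borel_measurable ?R"
    by (intro borel_measurable_continuous_on_restrict continuous_on_compose2[OF cont(1)] continuous_on_compose2[OF cont(2)]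
      continuous_on_compose2[OF cont(3)] continuous_on_fst continuous_on_id; force)+
      (use borel_measurable_continuous_on_restrict[OF cont(4)] in \<open>simp add: case_prod_beta'\<close>)
  have [measurable]: "fst \<in> borel_measurable ?R" "snd \<in> borel_measurable ?R"
    by (intro measurable_restrict_space1; simp add: borel_prod[symmetric])+
  have "(\<lambda>p. (f1 (fst p) + D1 * snd p) * of_bool (fst p \<le> snd p) + (f2 (fst p) + D2 * snd p) * of_bool (fst p \<le> q)
                   + (f3 (fst p) + D3 * snd p) * q + \<T> (fst p) (snd p)) \<in> borel_measurable ?R"
    by measurable
  then show ?thesis
    by (rule measurable_cong[THEN iffD1, rotated]) (use eq assms in \<open>auto simp: space_restrict_space\<close>)
qed

lemma measurable_rho_comp:
  assumes "q \<in> Q" and \<theta>: "\<theta> \<in> borel_measurable (restrict_space borel X)"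
  shows "(\<lambda>(z, t). \<rho> t (\<eta> (\<theta> z)) q) \<in> borel_measurable (restrict_space borel (X \<times> Y))"
proof -
  have f: "fst \<in> measurable (restrict_space borel (X \<times> Y)) (restrict_space borel X)"
    by (rule measurable_restrict_space3) (auto simp: borel_prod[symmetric])
  have [measurable]: "snd \<in> borel_measurable (restrict_space borel (X \<times> Y))"
    by (intro measurable_restrict_space1) (simp add: borel_prod[symmetric])
  have [measurable]: "\<eta> \<in> borel_measurable borel"
    using borel_measurable_continuous_onI[OF continuous_eta] .
  have [measurable]: "(\<lambda>p. \<theta> (fst p)) \<in> borel_measurable (restrict_space borel (X \<times> Y))"
    using measurable_compose[OF f \<theta>] .
  have "(\<lambda>p. (snd p, \<eta> (\<theta> (fst p)))) \<in> measurable (restrict_space borel (X \<times> Y)) (borel \<Otimes>\<^sub>M borel)"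
    by measurable
  then have "(\<lambda>p. (snd p, \<eta> (\<theta> (fst p)))) \<in> measurable (restrict_space borel (X \<times> Y)) (restrict_space borel (Y \<times> E))"
    using eta_range unfolding borel_prod by (intro measurable_restrict_space2) (auto simp: space_restrict_space)
  from measurable_compose[OF this measurable_rho[OF assms(1)]] show ?thesis by (simp add: case_prod_beta')
qed

lemma measurable_section:
  assumes "g \<in> measurable (restrict_space borel (X \<times> Y)) K" "z \<in> X"
  shows "(\<lambda>t. g (z, t)) \<in> measurable (L z) K"
proof -
  have "Pair z \<in> measurable (restrict_space borel Y) (restrict_space borel (X \<times> Y))"
    using assms(2) by (intro measurable_restrict_space3) (auto simp: borel_prod[symmetric])
  from measurable_compose[OF this assms(1)] show ?thesis
    by (simp add: measurable_cong_sets[OF sets_cond_law refl])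
qed

lemma measurable_data: "(\<lambda>\<omega>. (x i \<omega>, y i \<omega>)) \<in> measurable M (restrict_space borel (X \<times> Y))"
proof -
  interpret prob_space M by (rule dgp_facts)
  have "random_variable borel (\<lambda>\<omega>. (x i \<omega>, y i \<omega>))" using dgp_facts(2) by (auto simp: indep_vars_def)
  then show ?thesis using dgp_facts(3) by (intro measurable_restrict_space2) auto
qed

text \<open>\<open>g\<close> is measurable on \<open>X \<times> Y\<close> only; its extension by
  zero is measurable everywhere and has the same preimages along the data.\<close>

lemma indep_data:
  fixes g :: "(real^'d) \<times> real \<Rightarrow> real"
  assumes "g \<in> borel_measurable (restrict_space borel (X \<times> Y))"
  shows "prob_space.indep_vars M (\<lambda>_. borel) (\<lambda>i \<omega>. g (x i \<omega>, y i \<omega>)) UNIV"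
proof -
  interpret prob_space M by (rule dgp_facts)
  define g' where "g' p = indicator (X \<times> Y) p *\<^sub>R g p" for p
  have "g' \<in> borel_measurable borel"
    using assms XY_borel unfolding g'_def by (subst (asm) borel_measurable_restrict_space_iff) auto
  then have "indep_vars (\<lambda>_. borel) (\<lambda>i \<omega>. g' (x i \<omega>, y i \<omega>)) UNIV"
    by (intro indep_vars_compose2[OF dgp_facts(2), where Y="\<lambda>_. g'"]) auto
  moreover have eq: "g' (x i \<omega>, y i \<omega>) = g (x i \<omega>, y i \<omega>)" if "\<omega> \<in> space M" for i \<omega>
    using dgp_facts(3) that by (simp add: g'_def)
  have "(\<lambda>\<omega>. g' (x i \<omega>, y i \<omega>)) -` A \<inter> space M = (\<lambda>\<omega>. g (x i \<omega>, y i \<omega>)) -` A \<inter> space M" for i A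
    using eq by auto
  moreover have "random_variable borel (\<lambda>\<omega>. g (x i \<omega>, y i \<omega>))" for i
    using measurable_compose[OF measurable_data assms] .
  ultimately show ?thesis unfolding indep_vars_def2 by simp
qed

lemma fX_nonneg: "fX z \<ge> 0"
  using dgp_facts(7,8) by (cases "z \<in> X") force+

lemma joint_density_nonneg: "fX z * fYX z t \<ge> 0"
  using fX_nonneg[of z] dgp_facts(8,11) by (cases "z \<in> X") auto

text \<open>Measurability is known for the joint density. Its section at \<open>z\<close> is divided
  by \<open>fX z\<close>, which is positive on \<open>X\<close>.\<close>

lemma density_measurable_section:
  assumes "z \<in> X"
  shows "(\<lambda>t. fYX z t) \<in> borel_measurable N"
proof -
  have "(\<lambda>p. fX (fst p) * fYX (fst p) (snd p)) \<in> borel_measurable (lborel \<Otimes>\<^sub>M N)"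
    by (rule distributed_real_measurable[where M=M and X="\<lambda>\<omega>. (x 0 \<omega>, y 0 \<omega>)"])
       (use dgp_facts(13) joint_density_nonneg in \<open>auto simp: case_prod_beta'\<close>)
  from measurable_compose[OF measurable_Pair1' this, of z] have "(\<lambda>t. fX z * fYX z t) \<in> borel_measurable N" by simp
  then have "(\<lambda>t. inverse (fX z) * (fX z * fYX z t)) \<in> borel_measurable N" by (rule borel_measurable_times[OF borel_measurable_const])
  moreover have "fX z \<noteq> 0" using dgp_facts(7) assms by force
  ultimately show ?thesis by (simp add: mult.assoc[symmetric])
qed

lemma sets_lborel_N: "sets (lborel \<Otimes>\<^sub>M N) = sets (borel :: ((real^'d) \<times> real) measure)"
  unfolding borel_prod[symmetric] by (intro sets_pair_measure_cong) (auto simp: dgp_facts(10))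

lemma nn_integral_cond_law:
  assumes z: "z \<in> X" and g: "g \<in> borel_measurable (L z)"
  shows "(\<integral>\<^sup>+t. g t \<partial>L z) = (\<integral>\<^sup>+t. ennreal (fYX z t) * (g t * indicator Y t) \<partial>N)"
proof -
  have gm: "(\<lambda>t. g t * indicator Y t) \<in> borel_measurable N"
    using g Y_borel dgp_facts(10)
    by (simp add: measurable_cong_sets[OF sets_cond_law refl] borel_measurable_restrict_space_iff_ennreal measurable_cong_sets[OF dgp_facts(10) refl])
  have "(\<integral>\<^sup>+t. g t \<partial>L z) = (\<integral>\<^sup>+t. g t * indicator Y t \<partial>density N (\<lambda>y. ennreal (fYX z y)))"
    unfolding cond_law_def using Y_borel dgp_facts(10) by (subst nn_integral_restrict_space) auto
  also have "\<dots> = (\<integral>\<^sup>+t. ennreal (fYX z t) * (g t * indicator Y t) \<partial>N)"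
    using density_measurable_section[OF z] gm by (intro nn_integral_density) auto
  finally show ?thesis .
qed

text \<open>Tonelli for the joint density. Outside \<open>X\<close>, where nothing is known of
  \<open>L z\<close>, both sides vanish with \<open>fX\<close>.\<close>

lemma nn_integral_data:
  assumes g: "g \<in> borel_measurable (restrict_space borel (X \<times> Y))"
  shows "(\<integral>\<^sup>+\<omega>. g (x i \<omega>, y i \<omega>) \<partial>M) = (\<integral>\<^sup>+z. ennreal (fX z) * (\<integral>\<^sup>+t. g (z, t) \<partial>L z) \<partial>lborel)"
proof -
  interpret N: sigma_finite_measure N by (rule dgp_facts)
  define g' where "g' p = g p * indicator (X \<times> Y) p" for p
  have g'm: "g' \<in> borel_measurable (lborel \<Otimes>\<^sub>M N)"
    using g XY_borel unfolding g'_def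
    by (subst (asm) borel_measurable_restrict_space_iff_ennreal) (auto simp: measurable_cong_sets[OF sets_lborel_N refl])
  have fm: "(\<lambda>(z, t). ennreal (fX z * fYX z t)) \<in> borel_measurable (lborel \<Otimes>\<^sub>M N)"
    using distributed_borel_measurable[OF dgp_facts(13)[rule_format]] .
  have "(\<integral>\<^sup>+\<omega>. g (x i \<omega>, y i \<omega>) \<partial>M) = (\<integral>\<^sup>+\<omega>. g' (x i \<omega>, y i \<omega>) \<partial>M)"
    using dgp_facts(3) by (intro nn_integral_cong) (auto simp: g'_def)
  also have "\<dots> = (\<integral>\<^sup>+p. (\<lambda>(z, t). ennreal (fX z * fYX z t)) p * g' p \<partial>(lborel \<Otimes>\<^sub>M N))"
    using distributed_nn_integral[OF dgp_facts(13)[rule_format] g'm] by simp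
  also have "\<dots> = (\<integral>\<^sup>+z. \<integral>\<^sup>+t. ennreal (fX z * fYX z t) * g' (z, t) \<partial>N \<partial>lborel)"
    using fm g'm by (subst N.nn_integral_fst[symmetric]) auto
  also have "\<dots> = (\<integral>\<^sup>+z. ennreal (fX z) * (\<integral>\<^sup>+t. g (z, t) \<partial>L z) \<partial>lborel)"
  proof (rule nn_integral_cong)
    fix z :: "real^'d"
    show "(\<integral>\<^sup>+t. ennreal (fX z * fYX z t) * g' (z, t) \<partial>N) = ennreal (fX z) * (\<integral>\<^sup>+t. g (z, t) \<partial>L z)"
    proof (cases "z \<in> X")
      case False then show ?thesis using dgp_facts(8) by simp
    next
      case True
      have gs: "(\<lambda>t. g (z, t)) \<in> borel_measurable (L z)" by (rule measurable_section[OF g True])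
      then have gm: "(\<lambda>t. g (z, t) * indicator Y t) \<in> borel_measurable N"
        using Y_borel
        by (simp add: measurable_cong_sets[OF sets_cond_law refl] borel_measurable_restrict_space_iff_ennreal measurable_cong_sets[OF dgp_facts(10) refl])
      have "(\<integral>\<^sup>+t. ennreal (fX z * fYX z t) * g' (z, t) \<partial>N) = (\<integral>\<^sup>+t. ennreal (fX z) * (ennreal (fYX z t) * (g (z, t) * indicator Y t)) \<partial>N)"
        using True fX_nonneg by (intro nn_integral_cong) (simp add: ennreal_mult' g'_def mult.assoc indicator_times)
      also have "\<dots> = ennreal (fX z) * (\<integral>\<^sup>+t. ennreal (fYX z t) * (g (z, t) * indicator Y t) \<partial>N)"
        using gm density_measurable_section[OF True] by (intro nn_integral_cmult) auto
      also have "\<dots> = ennreal (fX z) * (\<integral>\<^sup>+t. g (z, t) \<partial>L z)"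
        by (subst nn_integral_cond_law[OF True gs]) simp
      finally show ?thesis .
    qed
  qed
  finally show ?thesis .
qed

lemma fX_measurable[measurable]: "fX \<in> borel_measurable borel"
  using distributed_real_measurable[OF _ dgp_facts(4)[rule_format, of 0]] fX_nonneg by simp

lemma nn_integral_fX: "(\<integral>\<^sup>+z. ennreal (fX z) \<partial>lborel) = 1"
proof -
  interpret prob_space M by (rule dgp_facts)
  have "(\<integral>\<^sup>+z. ennreal (fX z) * 1 \<partial>lborel) = (\<integral>\<^sup>+\<omega>. 1 \<partial>M)"
    by (rule distributed_nn_integral[OF dgp_facts(4)[rule_format, of 0]]) simp
  then show ?thesis by (simp add: emeasure_space_1)
qed

lemma nn_integral_data_le:
  assumes g: "g \<in> borel_measurable (restrict_space borel (X \<times> Y))"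
    and b: "\<And>z. z \<in> X \<Longrightarrow> (\<integral>\<^sup>+t. g (z, t) \<partial>L z) \<le> C"
  shows "(\<integral>\<^sup>+\<omega>. g (x i \<omega>, y i \<omega>) \<partial>M) \<le> C"
proof -
  have "(\<integral>\<^sup>+\<omega>. g (x i \<omega>, y i \<omega>) \<partial>M) \<le> (\<integral>\<^sup>+z. ennreal (fX z) * C \<partial>lborel)"
    unfolding nn_integral_data[OF g]
  proof (rule nn_integral_mono)
    fix z :: "real^'d"
    show "ennreal (fX z) * (\<integral>\<^sup>+t. g (z, t) \<partial>L z) \<le> ennreal (fX z) * C"
      using b[of z] dgp_facts(8) by (cases "z \<in> X") (auto intro: mult_left_mono)
  qed
  also have "\<dots> = C" by (subst nn_integral_multc) (auto simp: nn_integral_fX)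
  finally show ?thesis .
qed

text \<open>Inequalities between conditional means pass to the unconditional ones by applying this
  to the difference of the two sides. The premise is asked for almost every \<open>z\<close> only,
  so that the mean-zero condition can be used to prove it.\<close>

lemma expectation_data_nonneg:
  fixes g :: "(real^'d) \<times> real \<Rightarrow> real"
  assumes g: "g \<in> borel_measurable (restrict_space borel (X \<times> Y))"
    and int: "integrable M (\<lambda>\<omega>. g (x i \<omega>, y i \<omega>))"
    and ge: "AE z in lborel. z \<in> X \<longrightarrow> (\<integral>t. g (z, t) \<partial>L z) \<ge> 0"
  shows "(\<integral>\<omega>. g (x i \<omega>, y i \<omega>) \<partial>M) \<ge> 0"
proof -
  interpret N: sigma_finite_measure N by (rule dgp_facts)
  interpret P: pair_sigma_finite lborel N ..
  define g' where "g' p = indicator (X \<times> Y) p *\<^sub>R g p" for p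
  define f where "f = (\<lambda>p. fX (fst p) * fYX (fst p) (snd p))"
  have g'm: "g' \<in> borel_measurable (lborel \<Otimes>\<^sub>M N)"
    using g XY_borel unfolding g'_def
    by (subst (asm) borel_measurable_restrict_space_iff) (auto simp: measurable_cong_sets[OF sets_lborel_N refl])
  have D: "distributed M (lborel \<Otimes>\<^sub>M N) (\<lambda>\<omega>. (x i \<omega>, y i \<omega>)) (\<lambda>p. ennreal (f p))"
    using dgp_facts(13)[rule_format, of i] by (simp add: f_def case_prod_beta')
  have fnn: "f p \<ge> 0" for p using joint_density_nonneg by (simp add: f_def)
  have eq: "g (x i \<omega>, y i \<omega>) = g' (x i \<omega>, y i \<omega>)" if "\<omega> \<in> space M" for \<omega>
    using dgp_facts(3) that by (simp add: g'_def)
  have "integrable M (\<lambda>\<omega>. g' (x i \<omega>, y i \<omega>))" using int eq by (simp cong: Bochner_Integration.integrable_cong)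
  then have int': "integrable (lborel \<Otimes>\<^sub>M N) (\<lambda>p. f p * g' p)"
    using distributed_integrable[OF D g'm] fnn by simp
  have "(\<integral>\<omega>. g (x i \<omega>, y i \<omega>) \<partial>M) = (\<integral>\<omega>. g' (x i \<omega>, y i \<omega>) \<partial>M)"
    by (intro Bochner_Integration.integral_cong eq) auto
  also have "\<dots> = (\<integral>p. f p * g' p \<partial>(lborel \<Otimes>\<^sub>M N))"
    using distributed_integral[OF D g'm] fnn by simp
  also have "\<dots> = (\<integral>z. \<integral>t. f (z, t) * g' (z, t) \<partial>N \<partial>lborel)"
    using P.integral_fst'[OF int'] by simp
  also have "\<dots> \<ge> 0"
  proof (rule integral_nonneg_AE)
    show "AE z in lborel. 0 \<le> (\<integral>t. f (z, t) * g' (z, t) \<partial>N)"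
      using ge
    proof eventually_elim
      case (elim z)
      show ?case
      proof (cases "z \<in> X")
        case False then show ?thesis by (simp add: f_def dgp_facts(8)[rule_format])
      next
        case True
        have gs: "(\<lambda>t. g (z, t)) \<in> borel_measurable (L z)" by (rule measurable_section[OF g True])
        then have gm: "(\<lambda>t. indicator Y t *\<^sub>R g (z, t)) \<in> borel_measurable N"
          using Y_borel
          by (simp add: measurable_cong_sets[OF sets_cond_law refl] borel_measurable_restrict_space_iff measurable_cong_sets[OF dgp_facts(10) refl])
        have "(\<integral>t. g (z, t) \<partial>L z) = (\<integral>t. indicator Y t *\<^sub>R g (z, t) \<partial>density N (\<lambda>y. ennreal (fYX z y)))"
          unfolding cond_law_def using Y_borel dgp_facts(10) by (intro integral_restrict_space) auto
        also have "\<dots> = (\<integral>t. fYX z t *\<^sub>R (indicator Y t *\<^sub>R g (z, t)) \<partial>N)"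
          using density_measurable_section[OF True] gm dgp_facts(11) True by (intro integral_density) auto
        finally have "(\<integral>t. f (z, t) * g' (z, t) \<partial>N) = fX z * (\<integral>t. g (z, t) \<partial>L z)"
          using True by (subst integral_mult_right_zero[symmetric]) (auto simp: f_def g'_def indicator_times mult.assoc intro!: Bochner_Integration.integral_cong)
        then show ?thesis using elim True fX_nonneg by simp
      qed
    qed
  qed
  finally show ?thesis .
qed

lemma psibar_measurable: "(\<lambda>p. \<psi>bar (fst p) (snd p)) \<in> borel_measurable (restrict_space borel (X \<times> Y))"
  using loss_facts(6) by (simp add: case_prod_beta')

lemma psibar_nonneg: "z \<in> X \<Longrightarrow> t \<in> Y \<Longrightarrow> \<psi>bar z t \<ge> 0"
  using loss_facts(7) by (force intro: less_imp_le)

lemma psibar_section: "z \<in> X \<Longrightarrow> \<psi>bar z \<in> borel_measurable (L z)"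
  using measurable_section[OF psibar_measurable] by simp

lemma psibar_integrable:
  assumes z: "z \<in> X" shows "integrable (L z) (\<psi>bar z)"
proof -
  interpret L: prob_space "L z" using dgp_facts(12) z by blast
  obtain C where C: "\<And>z. z \<in> X \<Longrightarrow> (\<integral>\<^sup>+t. ennreal (\<psi>bar z t powr \<nu>) \<partial>L z) \<le> ennreal C"
    using loss_facts(9) by blast
  have "integrable (L z) (\<lambda>t. \<psi>bar z t powr \<nu>)"
  proof (rule integrableI_nonneg)
    show "(\<integral>\<^sup>+t. ennreal (\<psi>bar z t powr \<nu>) \<partial>L z) < \<infinity>" using C[OF z] by (rule order.strict_trans1) simp
  qed (use psibar_section[OF z] in auto)
  then have "integrable (L z) (\<lambda>t. 1 + \<psi>bar z t powr \<nu>)" by simp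
  then show ?thesis
  proof (rule Bochner_Integration.integrable_bound)
    show "AE t in L z. norm (\<psi>bar z t) \<le> norm (1 + \<psi>bar z t powr \<nu>)"
      using le_one_plus_powr psibar_nonneg[OF z] loss_facts(8)
      by (intro AE_I2) (auto simp: space_cond_law)
  qed (rule psibar_section[OF z])
qed

section \<open>Conditional mean increments and the dependence on the quantile index\<close>

lemma rho_diff_integrable:
  assumes z: "z \<in> X" and q: "q \<in> Q" and "\<bar>\<zeta> - \<mu>0 z q\<bar> \<le> r" "\<bar>\<zeta>' - \<mu>0 z q\<bar> \<le> r"
  shows "integrable (L z) (\<lambda>t. \<rho> t (\<eta> \<zeta>') q - \<rho> t (\<eta> \<zeta>) q)"
proof -
  interpret L: prob_space "L z" using dgp_facts(12) z by blast
  obtain C where C: "C > 0" "\<And>z q t \<zeta> \<zeta>'. z \<in> X \<Longrightarrow> q \<in> Q \<Longrightarrow> t \<in> Y \<Longrightarrow> \<bar>\<zeta> - \<mu>0 z q\<bar> \<le> r \<Longrightarrow> \<bar>\<zeta>' - \<mu>0 z q\<bar> \<le> r \<Longrightarrow>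
      \<bar>\<rho> t (\<eta> \<zeta>') q - \<rho> t (\<eta> \<zeta>) q\<bar> \<le> C * (\<psi>bar z t + 1) * \<bar>\<zeta>' - \<zeta>\<bar>"
    using rho_lipschitz by blast
  have m: "(\<lambda>t. \<rho> t (\<eta> \<zeta>) q) \<in> borel_measurable (L z)" for \<zeta>
    using measurable_section[OF measurable_rho_comp[OF q, of "\<lambda>_. \<zeta>"] z] by simp
  show ?thesis
  proof (rule Bochner_Integration.integrable_bound)
    show "integrable (L z) (\<lambda>t. C * (\<psi>bar z t + 1) * \<bar>\<zeta>' - \<zeta>\<bar>)"
      using psibar_integrable[OF z] by (intro integrable_mult_left integrable_mult_right Bochner_Integration.integrable_add) auto
    show "AE t in L z. norm (\<rho> t (\<eta> \<zeta>') q - \<rho> t (\<eta> \<zeta>) q) \<le> norm (C * (\<psi>bar z t + 1) * \<bar>\<zeta>' - \<zeta>\<bar>)"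
      using C(2)[OF z q _ assms(3,4)] by (intro AE_I2) (force simp: space_cond_law)
  qed (use m in simp)
qed

text \<open>Subgradient inequalities at the two endpoints, integrated: \<open>G\<close> serves as
  the derivative of the convex conditional risk, which itself is never differentiated.\<close>

lemma rho_diff_integral_bounds:
  assumes z: "z \<in> X" and q: "q \<in> Q" and "\<bar>\<zeta> - \<mu>0 z q\<bar> \<le> r" "\<bar>\<zeta>' - \<mu>0 z q\<bar> \<le> r"
  shows "G z q \<zeta> * (\<zeta>' - \<zeta>) \<le> (\<integral>t. \<rho> t (\<eta> \<zeta>') q - \<rho> t (\<eta> \<zeta>) q \<partial>L z)"
    and "(\<integral>t. \<rho> t (\<eta> \<zeta>') q - \<rho> t (\<eta> \<zeta>) q \<partial>L z) \<le> G z q \<zeta>' * (\<zeta>' - \<zeta>)"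
proof -
  have i: "integrable (L z) (\<lambda>t. \<psi> t (\<eta> \<zeta>) q)" for \<zeta>
    using Psi_facts(1) z q eta_range by blast
  have G: "G z q \<zeta> * c = (\<integral>t. \<psi> t (\<eta> \<zeta>) q * deriv \<eta> \<zeta> * c \<partial>L z)" for \<zeta> c
    by (simp add: G_def \<Psi>_def)
  show "G z q \<zeta> * (\<zeta>' - \<zeta>) \<le> (\<integral>t. \<rho> t (\<eta> \<zeta>') q - \<rho> t (\<eta> \<zeta>) q \<partial>L z)"
    unfolding G using rho_diff_integrable[OF assms] i subgradient[OF _ q]
    by (intro integral_mono) (auto simp: space_cond_law)
  show "(\<integral>t. \<rho> t (\<eta> \<zeta>') q - \<rho> t (\<eta> \<zeta>) q \<partial>L z) \<le> G z q \<zeta>' * (\<zeta>' - \<zeta>)"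
    unfolding G
  proof (intro integral_mono)
    fix t assume "t \<in> space (L z)"
    then show "\<rho> t (\<eta> \<zeta>') q - \<rho> t (\<eta> \<zeta>) q \<le> \<psi> t (\<eta> \<zeta>') q * deriv \<eta> \<zeta>' * (\<zeta>' - \<zeta>)"
      using subgradient[OF _ q, of t \<zeta>' \<zeta>] by (simp add: space_cond_law algebra_simps)
  qed (use rho_diff_integrable[OF assms] i in auto)
qed

text \<open>The increment is cut at the midpoint and each half is bounded by the subgradient at its
  start. The subgradient at \<open>\<theta>\<close> alone would give no curvature; the one at the
  midpoint does, the score there having grown in proportion to \<open>t\<close> unless
  \<open>\<theta>\<close> is far from the minimizer.\<close>

lemma rho_diff_conditional_lower_bound:
  "\<exists>c>0. \<exists>C>0. \<forall>q\<in>Q. \<forall>z\<in>X. \<Psi> z (\<eta> (\<mu>0 z q)) q = 0 \<longrightarrow>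
     (\<forall>\<theta> t. \<bar>\<theta> - \<mu>0 z q\<bar> \<le> r \<longrightarrow> \<bar>\<theta> + t - \<mu>0 z q\<bar> \<le> r \<longrightarrow>
       (\<integral>u. \<rho> u (\<eta> (\<theta> + t)) q - \<rho> u (\<eta> \<theta>) q \<partial>L z) \<ge> c * t\<^sup>2 - C * (\<bar>t\<bar> * \<bar>\<theta> - \<mu>0 z q\<bar>))"
proof -
  obtain c C where cC: "c > 0" "C > 0" and b: "\<And>q z \<zeta>. q \<in> Q \<Longrightarrow> z \<in> X \<Longrightarrow> \<Psi> z (\<eta> (\<mu>0 z q)) q = 0 \<Longrightarrow> \<bar>\<zeta> - \<mu>0 z q\<bar> \<le> r \<Longrightarrow>
      \<bar>G z q \<zeta>\<bar> \<le> C * \<bar>\<zeta> - \<mu>0 z q\<bar> \<and> G z q \<zeta> * (\<zeta> - \<mu>0 z q) \<ge> c * (\<zeta> - \<mu>0 z q)\<^sup>2"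
    using G_bounds by blast
  have "(\<integral>u. \<rho> u (\<eta> (\<theta> + t)) q - \<rho> u (\<eta> \<theta>) q \<partial>L z) \<ge> c/8 * t\<^sup>2 - (2 * C + c) * (\<bar>t\<bar> * \<bar>\<theta> - \<mu>0 z q\<bar>)"
    if q: "q \<in> Q" and z: "z \<in> X" and 0: "\<Psi> z (\<eta> (\<mu>0 z q)) q = 0" and
      \<theta>: "\<bar>\<theta> - \<mu>0 z q\<bar> \<le> r" "\<bar>\<theta> + t - \<mu>0 z q\<bar> \<le> r" for q z \<theta> t
  proof -
    define a where "a = \<theta> - \<mu>0 z q"
    have mid: "\<bar>\<theta> + t/2 - \<mu>0 z q\<bar> \<le> r" using \<theta> by linarith
    note b0 = b[OF q z 0 \<theta>(1)] and b1 = b[OF q z 0 mid]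
    have "c/8 * t\<^sup>2 - (2 * C + c) * (\<bar>t\<bar> * \<bar>a\<bar>) \<le> G z q \<theta> * (t/2) + G z q (\<theta> + t/2) * (t/2)"
      using b0 b1 cC by (intro midpoint_lower_bound) (auto simp: a_def algebra_simps)
    also have "\<dots> \<le> (\<integral>u. \<rho> u (\<eta> (\<theta> + t/2)) q - \<rho> u (\<eta> \<theta>) q \<partial>L z) + (\<integral>u. \<rho> u (\<eta> (\<theta> + t)) q - \<rho> u (\<eta> (\<theta> + t/2)) q \<partial>L z)"
      using rho_diff_integral_bounds(1)[OF z q \<theta>(1) mid] rho_diff_integral_bounds(1)[OF z q mid \<theta>(2)] by (intro add_mono) auto
    also have "\<dots> = (\<integral>u. \<rho> u (\<eta> (\<theta> + t)) q - \<rho> u (\<eta> \<theta>) q \<partial>L z)"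
      by (subst Bochner_Integration.integral_add[symmetric]) (auto intro!: rho_diff_integrable z q \<theta> mid)
    finally show ?thesis unfolding a_def .
  qed
  moreover have "c/8 > 0" "2 * C + c > 0" using cC by auto
  ultimately show ?thesis by blast
qed

lemma eta_diff_lower_bound:
  "\<exists>c>0. \<forall>z\<in>X. \<forall>q\<in>Q. \<forall>t. \<bar>t\<bar> \<le> r \<longrightarrow> \<bar>\<eta> (\<mu>0 z q + t) - \<eta> (\<mu>0 z q)\<bar> \<ge> c * \<bar>t\<bar>"
proof -
  obtain a A where a: "a > 0" "A > 0" "\<And>z q \<zeta>. z \<in> X \<Longrightarrow> q \<in> Q \<Longrightarrow> \<bar>\<zeta> - \<mu>0 z q\<bar> \<le> r \<Longrightarrow> a \<le> \<bar>deriv \<eta> \<zeta>\<bar> \<and> \<bar>deriv \<eta> \<zeta>\<bar> \<le> A"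
    using eta_deriv_bounds by blast
  have "\<bar>\<eta> (\<mu>0 z q + t) - \<eta> (\<mu>0 z q)\<bar> \<ge> a * \<bar>t\<bar>" if z: "z \<in> X" "q \<in> Q" "\<bar>t\<bar> \<le> r" for z q t
  proof -
    consider "t = 0" | "t > 0" | "t < 0" by linarith
    then show ?thesis
    proof cases
      case 2
      from MVT2[of "\<mu>0 z q" "\<mu>0 z q + t" \<eta> "deriv \<eta>"] eta_deriv 2 obtain \<xi> where
        "\<mu>0 z q < \<xi>" "\<xi> < \<mu>0 z q + t" "\<eta> (\<mu>0 z q + t) - \<eta> (\<mu>0 z q) = t * deriv \<eta> \<xi>" by auto
      then show ?thesis using a(3)[OF z(1,2), of \<xi>] z(3) 2 by (simp add: abs_mult)
    next
      case 3
      from MVT2[of "\<mu>0 z q + t" "\<mu>0 z q" \<eta> "deriv \<eta>"] eta_deriv 3 obtain \<xi> where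
        "\<xi> < \<mu>0 z q" "\<mu>0 z q + t < \<xi>" "\<eta> (\<mu>0 z q) - \<eta> (\<mu>0 z q + t) = - t * deriv \<eta> \<xi>" by auto
      then show ?thesis using a(3)[OF z(1,2), of \<xi>] z(3) 3 abs_minus_commute[of "\<eta> (\<mu>0 z q + t)"] by (simp add: abs_mult)
    qed simp
  qed
  with a(1) show ?thesis by blast
qed

text \<open>In the mixed difference everything that depends on only one of \<open>e\<close> and
  \<open>q\<close> cancels; the products of \<open>e\<close> with the indicator of
  \<open>u \<le> q\<close> and with \<open>q\<close> survive.\<close>

lemma rho_quantile_difference:
  "\<exists>D2 D3. \<forall>u\<in>Y. \<forall>e\<in>E. \<forall>e'\<in>E. \<forall>q\<in>Q. \<forall>q'\<in>Q. (\<rho> u e' q' - \<rho> u e q') - (\<rho> u e' q - \<rho> u e q) =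
    (e' - e) * (D2 * (of_bool (u \<le> q') - of_bool (u \<le> q)) + D3 * (q' - q))"
proof -
  obtain f1 f2 f3 :: "real \<Rightarrow> real" and D1 D2 D3 :: real and \<T> :: "real \<Rightarrow> real \<Rightarrow> real" where
    eq: "\<forall>y\<in>Y. \<forall>e\<in>E. \<forall>q\<in>Q.
          \<rho> y e q = (f1 y + D1 * e) * of_bool (y \<le> e) + (f2 y + D2 * e) * of_bool (y \<le> q)
                   + (f3 y + D3 * e) * q + \<T> y e"
    using simple unfolding simplified_setup_def Let_def by (elim conjE exE) (rule that, assumption)
  show ?thesis
    by (rule exI[of _ D2], rule exI[of _ D3]) (simp add: eq algebra_simps)
qed

text \<open>The coefficients of \<open>\<eta> * 1(y \<le> q)\<close> and \<open>\<eta> * q\<close> in the loss of the simplified setup. They need not be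
  unique, e.g. if \<open>Q\<close> is a singleton, hence the choice.\<close>

definition "D2 = (SOME D2. \<exists>D3. \<forall>u\<in>Y. \<forall>e\<in>E. \<forall>e'\<in>E. \<forall>q\<in>Q. \<forall>q'\<in>Q. (\<rho> u e' q' - \<rho> u e q') - (\<rho> u e' q - \<rho> u e q) =
    (e' - e) * (D2 * (of_bool (u \<le> q') - of_bool (u \<le> q)) + D3 * (q' - q)))"

definition "D3 = (SOME D3. \<forall>u\<in>Y. \<forall>e\<in>E. \<forall>e'\<in>E. \<forall>q\<in>Q. \<forall>q'\<in>Q. (\<rho> u e' q' - \<rho> u e q') - (\<rho> u e' q - \<rho> u e q) =
    (e' - e) * (D2 * (of_bool (u \<le> q') - of_bool (u \<le> q)) + D3 * (q' - q)))"

lemma rho_q_variation: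
  assumes "u \<in> Y" "e \<in> E" "e' \<in> E" "q \<in> Q" "q' \<in> Q"
  shows "(\<rho> u e' q' - \<rho> u e q') - (\<rho> u e' q - \<rho> u e q) =
    (e' - e) * (D2 * (of_bool (u \<le> q') - of_bool (u \<le> q)) + D3 * (q' - q))"
proof -
  note a = someI_ex[OF rho_quantile_difference, folded D2_def]
  note b = someI_ex[OF a, folded D3_def]
  show ?thesis using b assms by blast
qed

lemma mu0_lipschitz: "\<exists>C>0. \<forall>z\<in>X. \<forall>q\<in>Q. \<forall>q'\<in>Q. \<bar>\<mu>0 z q - \<mu>0 z q'\<bar> \<le> C * \<bar>q - q'\<bar>"
proof -
  obtain C where C: "\<And>z. z \<in> X \<Longrightarrow> C-lipschitz_on Q (\<mu>0 z)" using dgp_facts(15) by blast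
  then have "\<bar>\<mu>0 z q - \<mu>0 z q'\<bar> \<le> (\<bar>C\<bar> + 1) * \<bar>q - q'\<bar>" if "z \<in> X" "q \<in> Q" "q' \<in> Q" for z q q'
  proof -
    have "\<bar>\<mu>0 z q - \<mu>0 z q'\<bar> \<le> C * \<bar>q - q'\<bar>"
      using lipschitz_onD[OF C[OF that(1)] that(2,3)] by (simp add: dist_real_def)
    also have "\<dots> \<le> (\<bar>C\<bar> + 1) * \<bar>q - q'\<bar>" by (rule mult_right_mono) auto
    finally show ?thesis .
  qed
  moreover have "\<bar>C\<bar> + 1 > 0" by simp
  ultimately show ?thesis by blast
qed

text \<open>The conditional distribution function of \<open>Y\<close> may be discontinuous; that it is Lipschitz on \<open>Q\<close>
  when \<open>D2 \<noteq> 0\<close> comes from the mean-zero condition at \<open>q\<close> and at \<open>q'\<close>. It is tested with the increments of the loss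
  over \<open>\<plusminus>(q' - q)\<close>, so that the kinks of the loss play no role.\<close>

lemma quantile_probability_bound:
  "\<exists>C>0. \<exists>s0>0. \<forall>q\<in>Q. \<forall>q'\<in>Q. \<forall>z\<in>X. q < q' \<longrightarrow> q' - q \<le> s0 \<longrightarrow> \<Psi> z (\<eta> (\<mu>0 z q)) q = 0 \<longrightarrow>
     \<Psi> z (\<eta> (\<mu>0 z q')) q' = 0 \<longrightarrow> \<bar>D2\<bar> * measure (L z) {u\<in>Y. q < u \<and> u \<le> q'} \<le> C * (q' - q)"
proof -
  obtain c0 C where cC: "c0 > 0" "C > 0" and b: "\<And>q z \<zeta>. q \<in> Q \<Longrightarrow> z \<in> X \<Longrightarrow> \<Psi> z (\<eta> (\<mu>0 z q)) q = 0 \<Longrightarrow> \<bar>\<zeta> - \<mu>0 z q\<bar> \<le> r \<Longrightarrow>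
      \<bar>G z q \<zeta>\<bar> \<le> C * \<bar>\<zeta> - \<mu>0 z q\<bar> \<and> G z q \<zeta> * (\<zeta> - \<mu>0 z q) \<ge> c0 * (\<zeta> - \<mu>0 z q)\<^sup>2"
    using G_bounds by blast
  obtain c where c: "c > 0" "\<And>z q t. z \<in> X \<Longrightarrow> q \<in> Q \<Longrightarrow> \<bar>t\<bar> \<le> r \<Longrightarrow> \<bar>\<eta> (\<mu>0 z q + t) - \<eta> (\<mu>0 z q)\<bar> \<ge> c * \<bar>t\<bar>"
    using eta_diff_lower_bound by blast
  obtain K where K: "K > 0" "\<And>z q q'. z \<in> X \<Longrightarrow> q \<in> Q \<Longrightarrow> q' \<in> Q \<Longrightarrow> \<bar>\<mu>0 z q - \<mu>0 z q'\<bar> \<le> K * \<bar>q - q'\<bar>"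
    using mu0_lipschitz by blast
  \<comment> \<open>Keeps both endpoints of the increment within \<open>r\<close> of both
    \<open>\<mu>0 z q\<close> and \<open>\<mu>0 z q'\<close>, which differ by at most
    \<open>K * s\<close>.\<close>
  define s0 where "s0 = r / (1 + K)"
  define C' where "C' = C * (1 + K) / c + \<bar>D3\<bar>"
  have pos: "s0 > 0" "C' > 0" using loss_facts(1) K cC c by (auto simp: s0_def C'_def intro!: add_pos_nonneg)
  have "\<bar>D2\<bar> * measure (L z) {u\<in>Y. q < u \<and> u \<le> q'} \<le> C' * (q' - q)"
    if q: "q \<in> Q" and q': "q' \<in> Q" and z: "z \<in> X" and less: "q < q'" and s0: "q' - q \<le> s0" and zq: "\<Psi> z (\<eta> (\<mu>0 z q)) q = 0"
       and zq': "\<Psi> z (\<eta> (\<mu>0 z q')) q' = 0" for q q' z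
  proof -
    interpret L: prob_space "L z" using dgp_facts(12) z by blast
    define s where "s = q' - q"
    have s: "s > 0" "(1 + K) * s \<le> r" using less s0 K(1) by (auto simp: s_def s0_def field_simps)
    have s': "s + K * s \<le> r" "K * s > 0" using s K(1) by (auto simp: algebra_simps)
    define P where "P = measure (L z) {u\<in>Y. q < u \<and> u \<le> q'}"
    define A where "A = D2 * P + D3 * s"
    let ?\<theta> = "\<mu>0 z q"
    have \<mu>': "\<bar>?\<theta> - \<mu>0 z q'\<bar> \<le> K * s" using K(2)[OF z q q'] less by (simp add: s_def)
    \<comment> \<open>\<open>A\<close> is the conditional mean of the bracket in
      \<open>rho_q_variation\<close>, so the left side is the difference of the mean increments for
      \<open>q'\<close> and for \<open>q\<close>. Bounding the former from above and the latter from
      below leaves \<open>G\<close> for \<open>q'\<close> at a point no farther than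
      \<open>(1 + K) * s\<close> from its zero, and \<open>G\<close> for \<open>q\<close> at its
      zero.\<close>
    have key: "(\<eta> (?\<theta> + t) - \<eta> ?\<theta>) * A \<le> C * (1 + K) * s * s" if t: "\<bar>t\<bar> = s" for t
    proof -
      have r1: "\<bar>?\<theta> - \<mu>0 z q\<bar> \<le> r" "\<bar>?\<theta> + t - \<mu>0 z q\<bar> \<le> r" "\<bar>?\<theta> - \<mu>0 z q'\<bar> \<le> r" "\<bar>?\<theta> + t - \<mu>0 z q'\<bar> \<le> r"
        using s s' \<mu>' t by auto
      have Pm: "{u\<in>Y. q < u \<and> u \<le> q'} \<in> sets (L z)"
      proof -
        have "{u\<in>Y. q < u \<and> u \<le> q'} = Y \<inter> {q<..q'}" by auto
        moreover have "{q<..q'} \<in> sets borel" by simp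
        ultimately show ?thesis unfolding sets_cond_law sets_restrict_space by (rule image_eqI)
      qed
      have ind: "of_bool (u \<le> q') - of_bool (u \<le> q) = (indicator {u\<in>Y. q < u \<and> u \<le> q'} u :: real)" if "u \<in> Y" for u
        using that less by (auto simp: indicator_def)
      have "(\<integral>u. \<rho> u (\<eta> (?\<theta> + t)) q' - \<rho> u (\<eta> ?\<theta>) q' \<partial>L z) - (\<integral>u. \<rho> u (\<eta> (?\<theta> + t)) q - \<rho> u (\<eta> ?\<theta>) q \<partial>L z)
        = (\<integral>u. (\<rho> u (\<eta> (?\<theta> + t)) q' - \<rho> u (\<eta> ?\<theta>) q') - (\<rho> u (\<eta> (?\<theta> + t)) q - \<rho> u (\<eta> ?\<theta>) q) \<partial>L z)"
        by (intro Bochner_Integration.integral_diff[symmetric] rho_diff_integrable z q q' r1)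
      also have "\<dots> = (\<integral>u. (\<eta> (?\<theta> + t) - \<eta> ?\<theta>) * (D2 * indicator {u\<in>Y. q < u \<and> u \<le> q'} u + D3 * s) \<partial>L z)"
      proof (intro Bochner_Integration.integral_cong refl)
        fix u assume "u \<in> space (L z)"
        then have u: "u \<in> Y" by (simp add: space_cond_law)
        have E: "\<eta> \<zeta> \<in> E" for \<zeta> using eta_range by auto
        show "\<rho> u (\<eta> (?\<theta> + t)) q' - \<rho> u (\<eta> ?\<theta>) q' - (\<rho> u (\<eta> (?\<theta> + t)) q - \<rho> u (\<eta> ?\<theta>) q) =
          (\<eta> (?\<theta> + t) - \<eta> ?\<theta>) * (D2 * indicator {u\<in>Y. q < u \<and> u \<le> q'} u + D3 * s)"
          using rho_q_variation[OF u E E q q'] unfolding ind[OF u] s_def .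
      qed
      also have "\<dots> = (\<eta> (?\<theta> + t) - \<eta> ?\<theta>) * A"
      proof -
        have "integrable (L z) (\<lambda>u. D2 * indicator {u\<in>Y. q < u \<and> u \<le> q'} u)"
          using Pm by (intro integrable_mult_right integrable_real_indicator) (auto simp: L.emeasure_eq_measure)
        then show ?thesis using Pm by (simp add: A_def P_def L.prob_space)
      qed
      finally have "(\<eta> (?\<theta> + t) - \<eta> ?\<theta>) * A = (\<integral>u. \<rho> u (\<eta> (?\<theta> + t)) q' - \<rho> u (\<eta> ?\<theta>) q' \<partial>L z) - (\<integral>u. \<rho> u (\<eta> (?\<theta> + t)) q - \<rho> u (\<eta> ?\<theta>) q \<partial>L z)" ..
      also have "\<dots> \<le> G z q' (?\<theta> + t) * (?\<theta> + t - ?\<theta>) - G z q ?\<theta> * (?\<theta> + t - ?\<theta>)"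
        using rho_diff_integral_bounds(2)[OF z q' r1(3,4)] rho_diff_integral_bounds(1)[OF z q r1(1,2)] by linarith
      also have "\<dots> = G z q' (?\<theta> + t) * t" using zq by (simp add: G_def)
      also have "\<dots> \<le> \<bar>G z q' (?\<theta> + t)\<bar> * \<bar>t\<bar>" by (metis abs_ge_self abs_mult)
      also have "\<dots> \<le> (C * ((1 + K) * s)) * s"
      proof (rule mult_mono)
        have "\<bar>G z q' (?\<theta> + t)\<bar> \<le> C * \<bar>?\<theta> + t - \<mu>0 z q'\<bar>" using b[OF q' z zq' r1(4)] by simp
        also have "\<dots> \<le> C * ((1 + K) * s)" using t \<mu>' cC(2) by (intro mult_left_mono) (auto simp: algebra_simps)
        finally show "\<bar>G z q' (?\<theta> + t)\<bar> \<le> C * ((1 + K) * s)" .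
      qed (use t s cC K in auto)
      finally show ?thesis by (simp add: mult_ac)
    qed
    have "c * s * \<bar>A\<bar> \<le> C * (1 + K) * s * s"
    proof -
      have mono: "(\<eta> (?\<theta> + s) - \<eta> ?\<theta>) * (\<eta> (?\<theta> - s) - \<eta> ?\<theta>) \<le> 0"
        using loss_facts(10) s(1) by (auto simp: monotone_def mult_le_0_iff less_imp_le)
      \<comment> \<open>As \<open>\<eta>\<close> is monotone, its increments over \<open>s\<close>
        and \<open>- s\<close> have opposite signs. One of them has a nonnegative product with
        \<open>A\<close>, and for this one \<open>key\<close> bounds
        \<open>\<bar>A\<bar>\<close>.\<close>
      obtain t where t: "\<bar>t\<bar> = s" "(\<eta> (?\<theta> + t) - \<eta> ?\<theta>) * A \<ge> 0"
      proof (cases "(\<eta> (?\<theta> + s) - \<eta> ?\<theta>) * A \<ge> 0")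
        case True then show ?thesis using that[of s] s by simp
      next
        case False
        then have "(\<eta> (?\<theta> + (- s)) - \<eta> ?\<theta>) * A \<ge> 0" using mono
          by (auto simp: not_le mult_less_0_iff mult_le_0_iff zero_le_mult_iff)
        then show ?thesis using that[of "- s"] s by simp
      qed
      have "c * s * \<bar>A\<bar> \<le> \<bar>\<eta> (?\<theta> + t) - \<eta> ?\<theta>\<bar> * \<bar>A\<bar>"
        using c(2)[OF z q, of t] t s s' by (intro mult_right_mono) auto
      also have "\<dots> = (\<eta> (?\<theta> + t) - \<eta> ?\<theta>) * A" using t(2) by (simp add: abs_mult[symmetric])
      also have "\<dots> \<le> C * (1 + K) * s * s" by (rule key[OF t(1)])
      finally show ?thesis .
    qed
    then have "\<bar>A\<bar> * (s * c) \<le> (C * (1 + K) * s / c) * (s * c)" using c(1) by (simp add: mult_ac)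
    then have "\<bar>A\<bar> \<le> C * (1 + K) * s / c" using s(1) c(1) mult_pos_pos by (subst (asm) mult_le_cancel_right_pos) auto
    moreover have "\<bar>D2\<bar> * P \<le> \<bar>A\<bar> + \<bar>D3\<bar> * s"
    proof -
      have "P \<ge> 0" by (simp add: P_def)
      then have "\<bar>D2\<bar> * P = \<bar>A - D3 * s\<bar>" by (simp add: A_def abs_mult)
      also have "\<dots> \<le> \<bar>A\<bar> + \<bar>D3 * s\<bar>" by (rule abs_triangle_ineq4)
      finally show ?thesis using s(1) by (simp add: abs_mult)
    qed
    ultimately show ?thesis unfolding C'_def P_def s_def[symmetric] by (simp add: algebra_simps add_divide_distrib)
  qed
  with pos show ?thesis by blast
qed

section \<open>Moments and truncated tails of the envelope\<close>

lemma psibar_moment: "\<exists>C\<ge>0. \<forall>z\<in>X. integrable (L z) (\<lambda>t. (\<psi>bar z t + 1)\<^sup>2) \<and> (\<integral>t. (\<psi>bar z t + 1)\<^sup>2 \<partial>L z) \<le> C"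
  and psibar_square_integrable: "integrable M (\<lambda>\<omega>. (\<psi>bar (x i \<omega>) (y i \<omega>) + 1)\<^sup>2)"
proof -
  interpret M: prob_space M by (rule dgp_facts)
  obtain C where C: "\<And>z. z \<in> X \<Longrightarrow> (\<integral>\<^sup>+t. ennreal (\<psi>bar z t powr \<nu>) \<partial>L z) \<le> ennreal C"
    using loss_facts(9) by blast
  have sq: "(a + 1)\<^sup>2 \<le> 4 + 2 * a powr \<nu>" if "a \<ge> 0" for a :: real
  proof -
    have "a\<^sup>2 \<le> 1 + (a\<^sup>2) powr (\<nu>/2)" using loss_facts(8) by (intro le_one_plus_powr) auto
    also have "(a\<^sup>2) powr (\<nu>/2) = a powr \<nu>"
    proof (cases "a = 0")
      case False
      then have "a\<^sup>2 = a powr 2" using that by simp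
      then show ?thesis by (simp only: powr_powr) simp
    qed simp
    finally have "a\<^sup>2 \<le> 1 + a powr \<nu>" .
    moreover have "(a + 1)\<^sup>2 \<le> 2 * a\<^sup>2 + 2" using sum_squares_ge_zero[of "a - 1" 0] by (simp add: power2_eq_square algebra_simps)
    ultimately show ?thesis by linarith
  qed
  have meas: "(\<lambda>p. (\<psi>bar (fst p) (snd p) + 1)\<^sup>2) \<in> borel_measurable (restrict_space borel (X \<times> Y))"
    using psibar_measurable by simp
  have nn: "(\<integral>\<^sup>+t. ennreal ((\<psi>bar z t + 1)\<^sup>2) \<partial>L z) \<le> ennreal (4 + 2 * \<bar>C\<bar>)" if z: "z \<in> X" for z
  proof -
    interpret L: prob_space "L z" using dgp_facts(12) z by blast
    note [measurable] = psibar_section[OF z]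
    have "(\<integral>\<^sup>+t. ennreal ((\<psi>bar z t + 1)\<^sup>2) \<partial>L z) \<le> (\<integral>\<^sup>+t. ennreal 4 + ennreal 2 * ennreal (\<psi>bar z t powr \<nu>) \<partial>L z)"
    proof (rule nn_integral_mono)
      fix t assume "t \<in> space (L z)"
      then have "(\<psi>bar z t + 1)\<^sup>2 \<le> 4 + 2 * \<psi>bar z t powr \<nu>" using psibar_nonneg[OF z] by (intro sq) (simp add: space_cond_law)
      then have "ennreal ((\<psi>bar z t + 1)\<^sup>2) \<le> ennreal (4 + 2 * \<psi>bar z t powr \<nu>)" by (rule ennreal_leI)
      also have "\<dots> = ennreal 4 + ennreal 2 * ennreal (\<psi>bar z t powr \<nu>)" by (subst ennreal_plus) (auto simp: ennreal_mult simp del: ennreal_numeral)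
      finally show "ennreal ((\<psi>bar z t + 1)\<^sup>2) \<le> ennreal 4 + ennreal 2 * ennreal (\<psi>bar z t powr \<nu>)" .
    qed
    also have "\<dots> = ennreal 4 + ennreal 2 * (\<integral>\<^sup>+t. ennreal (\<psi>bar z t powr \<nu>) \<partial>L z)"
      by (subst nn_integral_add) (auto simp: nn_integral_cmult L.emeasure_space_1 simp del: ennreal_numeral)
    also have "\<dots> \<le> ennreal 4 + ennreal 2 * ennreal \<bar>C\<bar>"
      using order.trans[OF C[OF z] ennreal_leI[OF abs_ge_self]] by (intro add_left_mono mult_left_mono) auto
    also have "\<dots> = ennreal (4 + 2 * \<bar>C\<bar>)" by (simp add: ennreal_plus ennreal_mult del: ennreal_numeral)
    finally show ?thesis .
  qed
  have "integrable (L z) (\<lambda>t. (\<psi>bar z t + 1)\<^sup>2) \<and> (\<integral>t. (\<psi>bar z t + 1)\<^sup>2 \<partial>L z) \<le> 4 + 2 * \<bar>C\<bar>" if z: "z \<in> X" for z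
  proof
    note [measurable] = psibar_section[OF z]
    show i: "integrable (L z) (\<lambda>t. (\<psi>bar z t + 1)\<^sup>2)"
      by (rule integrableI_nonneg) (auto intro: order.strict_trans1[OF nn[OF z]])
    show "(\<integral>t. (\<psi>bar z t + 1)\<^sup>2 \<partial>L z) \<le> 4 + 2 * \<bar>C\<bar>"
      using nn[OF z] by (subst (asm) nn_integral_eq_integral[OF i]) (simp_all only: ennreal_le_iff, auto)
  qed
  then show "\<exists>C\<ge>0. \<forall>z\<in>X. integrable (L z) (\<lambda>t. (\<psi>bar z t + 1)\<^sup>2) \<and> (\<integral>t. (\<psi>bar z t + 1)\<^sup>2 \<partial>L z) \<le> C"
    by (intro exI[of _ "4 + 2 * \<bar>C\<bar>"]) auto
  show "integrable M (\<lambda>\<omega>. (\<psi>bar (x i \<omega>) (y i \<omega>) + 1)\<^sup>2)"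
  proof (rule integrableI_nonneg)
    show "(\<lambda>\<omega>. (\<psi>bar (x i \<omega>) (y i \<omega>) + 1)\<^sup>2) \<in> borel_measurable M"
      using measurable_compose[OF measurable_data meas] by simp
    have "(\<integral>\<^sup>+\<omega>. ennreal ((\<psi>bar (x i \<omega>) (y i \<omega>) + 1)\<^sup>2) \<partial>M) \<le> ennreal (4 + 2 * \<bar>C\<bar>)"
      using nn_integral_data_le[of "\<lambda>p. ennreal ((\<psi>bar (fst p) (snd p) + 1)\<^sup>2)" _ i] meas nn by simp
    then show "(\<integral>\<^sup>+\<omega>. ennreal ((\<psi>bar (x i \<omega>) (y i \<omega>) + 1)\<^sup>2) \<partial>M) < \<infinity>" by (rule order.strict_trans1) simp
  qed simp
qed

text \<open>Increments of the loss have the random Lipschitz factor \<open>\<psi>bar + 1\<close>;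
  this is its part beyond the truncation level.\<close>

abbreviation "excess T i \<omega> \<equiv> (\<psi>bar (x i \<omega>) (y i \<omega>) + 1) * of_bool (\<psi>bar (x i \<omega>) (y i \<omega>) > T)"

text \<open>Where \<open>\<psi>bar > T\<close>, the envelope is at most
  \<open>T powr (1 - \<nu>)\<close> times its power of order \<open>\<nu>\<close>, whose conditional
  mean is bounded. The added \<open>1\<close> costs a factor 2, as \<open>T \<ge> 1\<close>.\<close>

lemma tail_polynomial:
  "\<exists>C>0. \<forall>T\<ge>1. \<forall>i. (\<integral>\<^sup>+\<omega>. ennreal (excess T i \<omega>) \<partial>M)
     \<le> ennreal (C * T powr (1 - \<nu>))"
proof -
  obtain C where C: "\<And>z. z \<in> X \<Longrightarrow> (\<integral>\<^sup>+t. ennreal (\<psi>bar z t powr \<nu>) \<partial>L z) \<le> ennreal C"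
    using loss_facts(9) by blast
  have "(\<integral>\<^sup>+\<omega>. ennreal (excess T i \<omega>) \<partial>M)
     \<le> ennreal ((2 * (\<bar>C\<bar> + 1)) * T powr (1 - \<nu>))" if T: "T \<ge> 1" for T i
  proof -
    have "(\<integral>\<^sup>+t. ennreal ((\<psi>bar z t + 1) * of_bool (\<psi>bar z t > T)) \<partial>L z) \<le> ennreal ((2 * (\<bar>C\<bar> + 1)) * T powr (1 - \<nu>))" if z: "z \<in> X" for z
    proof -
      note [measurable] = psibar_section[OF z]
      have "(\<integral>\<^sup>+t. ennreal ((\<psi>bar z t + 1) * of_bool (\<psi>bar z t > T)) \<partial>L z) \<le> (\<integral>\<^sup>+t. ennreal (2 * T powr (1 - \<nu>)) * ennreal (\<psi>bar z t powr \<nu>) \<partial>L z)"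
      proof (rule nn_integral_mono)
        fix t
        show "ennreal ((\<psi>bar z t + 1) * of_bool (\<psi>bar z t > T)) \<le> ennreal (2 * T powr (1 - \<nu>)) * ennreal (\<psi>bar z t powr \<nu>)"
        proof (cases "\<psi>bar z t > T")
          case True
          let ?a = "\<psi>bar z t"
          have "?a powr (1 - \<nu>) * ?a powr \<nu> = ?a" using True T by (simp add: powr_add[symmetric])
          moreover have "?a powr (1 - \<nu>) * ?a powr \<nu> \<le> T powr (1 - \<nu>) * ?a powr \<nu>"
            using True T loss_facts(8) powr_mono2'[of "1 - \<nu>" T ?a] by (intro mult_right_mono) auto
          ultimately have "?a + 1 \<le> 2 * (T powr (1 - \<nu>) * ?a powr \<nu>)" using True T by linarith
          then show ?thesis using True by (auto simp: ennreal_mult[symmetric] mult.assoc intro!: ennreal_leI)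
        qed simp
      qed
      also have "\<dots> = ennreal (2 * T powr (1 - \<nu>)) * (\<integral>\<^sup>+t. ennreal (\<psi>bar z t powr \<nu>) \<partial>L z)"
        by (rule nn_integral_cmult) simp
      also have "\<dots> \<le> ennreal (2 * T powr (1 - \<nu>)) * ennreal (\<bar>C\<bar> + 1)"
        by (intro mult_left_mono order.trans[OF C[OF z]] ennreal_leI) auto
      also have "\<dots> = ennreal ((2 * (\<bar>C\<bar> + 1)) * T powr (1 - \<nu>))" by (subst ennreal_mult[symmetric]) (auto simp: mult_ac)
      finally show ?thesis .
    qed
    moreover have "(\<lambda>p. ennreal ((\<psi>bar (fst p) (snd p) + 1) * of_bool (\<psi>bar (fst p) (snd p) > T))) \<in> borel_measurable (restrict_space borel (X \<times> Y))"
      using psibar_measurable by measurable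
    ultimately show ?thesis
      using nn_integral_data_le[of "\<lambda>p. ennreal ((\<psi>bar (fst p) (snd p) + 1) * of_bool (\<psi>bar (fst p) (snd p) > T))" _ i] by simp
  qed
  moreover have "2 * (\<bar>C\<bar> + 1) > 0" by simp
  ultimately show ?thesis by blast
qed

text \<open>On the tail event \<open>b \<le> a * b\<^sup>2 + 1 / a\<close> for
  \<open>b = \<psi>bar + 1\<close>; the second moment pays for the first term and the sub-Gaussian
  probability for the second. The free parameter \<open>a\<close> is later set to the order of the
  bound that is wanted.\<close>

lemma tail_sub_gaussian:
  assumes "cond_sub_gaussian X L \<psi>bar"
  shows "\<exists>\<sigma>2>0. \<exists>C>0. \<forall>T\<ge>1. \<forall>a>0. \<forall>i.
    (\<integral>\<^sup>+\<omega>. ennreal (excess T i \<omega>) \<partial>M)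
     \<le> ennreal (C * (a + exp (- (T\<^sup>2) / \<sigma>2) / a))"
proof -
  obtain \<sigma>2 where \<sigma>2: "\<sigma>2 > 0" and tail: "\<And>z t. z \<in> X \<Longrightarrow> t \<ge> 0 \<Longrightarrow> measure (L z) {y \<in> space (L z). \<bar>\<psi>bar z y\<bar> \<ge> t} \<le> 2 * exp (- (t\<^sup>2) / \<sigma>2)"
    using assms unfolding cond_sub_gaussian_def by blast
  obtain C where C: "C \<ge> 0" "\<And>z. z \<in> X \<Longrightarrow> integrable (L z) (\<lambda>t. (\<psi>bar z t + 1)\<^sup>2)" "\<And>z. z \<in> X \<Longrightarrow> (\<integral>t. (\<psi>bar z t + 1)\<^sup>2 \<partial>L z) \<le> C"
    using psibar_moment by blast
  have "(\<integral>\<^sup>+\<omega>. ennreal (excess T i \<omega>) \<partial>M)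
     \<le> ennreal ((C + 2) * (a + exp (- (T\<^sup>2) / \<sigma>2) / a))" if T: "T \<ge> 1" and a: "a > 0" for T a i
  proof -
    have "(\<integral>\<^sup>+t. ennreal ((\<psi>bar z t + 1) * of_bool (\<psi>bar z t > T)) \<partial>L z) \<le> ennreal ((C + 2) * (a + exp (- (T\<^sup>2) / \<sigma>2) / a))" if z: "z \<in> X" for z
    proof -
      interpret L: prob_space "L z" using dgp_facts(12) z by blast
      note [measurable] = psibar_section[OF z]
      let ?S = "{t \<in> space (L z). \<bar>\<psi>bar z t\<bar> \<ge> T}"
      let ?f = "\<lambda>t. a * (\<psi>bar z t + 1)\<^sup>2 + 1 / a * indicator ?S t"
      have S: "?S \<in> sets (L z)" by measurable
      have int: "integrable (L z) ?f" using C(2)[OF z] S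
        by (intro Bochner_Integration.integrable_add integrable_mult_right integrable_real_indicator) (auto simp: L.emeasure_eq_measure)
      have "(\<integral>\<^sup>+t. ennreal ((\<psi>bar z t + 1) * of_bool (\<psi>bar z t > T)) \<partial>L z) \<le> (\<integral>\<^sup>+t. ennreal (?f t) \<partial>L z)"
      proof (intro nn_integral_mono ennreal_leI)
        fix t assume t: "t \<in> space (L z)"
        show "(\<psi>bar z t + 1) * of_bool (\<psi>bar z t > T) \<le> ?f t"
        proof (cases "\<psi>bar z t > T")
          case True
          let ?b = "\<psi>bar z t + 1"
          have "?b \<le> a * ?b\<^sup>2 + 1 / a"
          proof -
            have "0 \<le> (a * ?b - 1)\<^sup>2" by simp
            then have "2 * (a * ?b) \<le> (a * ?b)\<^sup>2 + 1" by (simp add: power2_eq_square algebra_simps)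
            moreover have "a * ?b \<ge> 0" using a True T by simp
            ultimately have "a * ?b \<le> (a * ?b)\<^sup>2 + 1" by linarith
            then have "(a * ?b) / a \<le> ((a * ?b)\<^sup>2 + 1) / a" using a by (intro divide_right_mono) auto
            then show ?thesis using a by (simp add: power2_eq_square add_divide_distrib mult_ac)
          qed
          then show ?thesis using True T t by simp
        next
          case False then show ?thesis using a by simp
        qed
      qed
      also have "\<dots> = ennreal (\<integral>t. ?f t \<partial>L z)" using a by (intro nn_integral_eq_integral int) auto
      also have "(\<integral>t. ?f t \<partial>L z) = a * (\<integral>t. (\<psi>bar z t + 1)\<^sup>2 \<partial>L z) + 1 / a * measure (L z) ?S"
        using C(2)[OF z] S by (subst Bochner_Integration.integral_add) (auto simp: L.emeasure_eq_measure intro!: integrable_mult_right)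
      also have "ennreal \<dots> \<le> ennreal (a * C + 1 / a * (2 * exp (- (T\<^sup>2) / \<sigma>2)))"
        using C(3)[OF z] tail[OF z, of T] a T by (intro ennreal_leI add_mono mult_left_mono) auto
      also have "\<dots> \<le> ennreal ((C + 2) * (a + exp (- (T\<^sup>2) / \<sigma>2) / a))"
      proof (rule ennreal_leI)
        have "a * C \<le> (C + 2) * a" "1 / a * (2 * exp (- (T\<^sup>2) / \<sigma>2)) \<le> (C + 2) * (exp (- (T\<^sup>2) / \<sigma>2) / a)"
          using a C(1) by (auto simp: algebra_simps divide_right_mono)
        then show "a * C + 1 / a * (2 * exp (- (T\<^sup>2) / \<sigma>2)) \<le> (C + 2) * (a + exp (- (T\<^sup>2) / \<sigma>2) / a)"
          by (simp only: distrib_left)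
      qed
      finally show ?thesis .
    qed
    moreover have "(\<lambda>p. ennreal ((\<psi>bar (fst p) (snd p) + 1) * of_bool (\<psi>bar (fst p) (snd p) > T))) \<in> borel_measurable (restrict_space borel (X \<times> Y))"
      using psibar_measurable by measurable
    ultimately show ?thesis
      using nn_integral_data_le[of "\<lambda>p. ennreal ((\<psi>bar (fst p) (snd p) + 1) * of_bool (\<psi>bar (fst p) (snd p) > T))" _ i] by simp
  qed
  moreover have "C + 2 > 0" using C(1) by simp
  ultimately show ?thesis using \<sigma>2 by blast
qed

lemma measurable_x: "x i \<in> measurable M (restrict_space borel X)"
proof -
  have "fst \<in> measurable (restrict_space borel (X \<times> Y)) (restrict_space borel X)"
    by (rule measurable_restrict_space3) (auto simp: borel_prod[symmetric])
  from measurable_compose[OF measurable_data this] show ?thesis by simp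
qed

lemma psibar_data_measurable: "(\<lambda>\<omega>. \<psi>bar (x i \<omega>) (y i \<omega>)) \<in> borel_measurable M"
  using measurable_compose[OF measurable_data psibar_measurable] by simp

lemma psibar_data_nonneg: "\<omega> \<in> space M \<Longrightarrow> \<psi>bar (x i \<omega>) (y i \<omega>) \<ge> 0"
  using dgp_facts(3) psibar_nonneg by blast

lemma psibar_data_integrable: "integrable M (\<lambda>\<omega>. \<psi>bar (x i \<omega>) (y i \<omega>) + 1)"
proof (rule Bochner_Integration.integrable_bound[OF psibar_square_integrable])
  show "AE \<omega> in M. norm (\<psi>bar (x i \<omega>) (y i \<omega>) + 1) \<le> norm ((\<psi>bar (x i \<omega>) (y i \<omega>) + 1)\<^sup>2)"
  proof (rule AE_I2)
    fix \<omega> assume "\<omega> \<in> space M"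
    then have "\<psi>bar (x i \<omega>) (y i \<omega>) + 1 \<ge> 1" using psibar_data_nonneg by simp
    then show "norm (\<psi>bar (x i \<omega>) (y i \<omega>) + 1) \<le> norm ((\<psi>bar (x i \<omega>) (y i \<omega>) + 1)\<^sup>2)"
      using self_le_power[of "\<psi>bar (x i \<omega>) (y i \<omega>) + 1" 2] by simp
  qed
qed (use psibar_data_measurable in simp)

text \<open>For almost every \<open>z\<close> the mean-zero condition holds at both \<open>q\<close>
  and \<open>q'\<close>, so the conditional bound can be integrated. The factor
  \<open>\<bar>D2\<bar>\<close> stays in front, as it accompanies the indicator wherever the loss
  jumps in \<open>q\<close>.\<close>

lemma quantile_probability:
  "\<exists>C>0. \<exists>s0>0. \<forall>q\<in>Q. \<forall>q'\<in>Q. \<forall>i. q \<le> q' \<longrightarrow> q' - q \<le> s0 \<longrightarrow>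
     \<bar>D2\<bar> * (\<integral>\<omega>. of_bool (q < y i \<omega> \<and> y i \<omega> \<le> q') \<partial>M) \<le> C * (q' - q)"
proof -
  interpret M: prob_space M by (rule dgp_facts)
  obtain C s0 where C: "C > 0" "s0 > 0" and b': "\<forall>q\<in>Q. \<forall>q'\<in>Q. \<forall>z\<in>X. q < q' \<longrightarrow> q' - q \<le> s0 \<longrightarrow> \<Psi> z (\<eta> (\<mu>0 z q)) q = 0 \<longrightarrow>
     \<Psi> z (\<eta> (\<mu>0 z q')) q' = 0 \<longrightarrow> \<bar>D2\<bar> * measure (L z) {u\<in>Y. q < u \<and> u \<le> q'} \<le> C * (q' - q)"
    using quantile_probability_bound by (elim exE conjE) (rule that)
  note b = b'[rule_format]
  have "\<bar>D2\<bar> * (\<integral>\<omega>. of_bool (q < y i \<omega> \<and> y i \<omega> \<le> q') \<partial>M) \<le> C * (q' - q)"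
    if q: "q \<in> Q" "q' \<in> Q" and le: "q \<le> q'" "q' - q \<le> s0" for q q' i
  proof (cases "q = q'")
    case True
    then have "(\<lambda>\<omega>. of_bool (q < y i \<omega> \<and> y i \<omega> \<le> q') :: real) = (\<lambda>_. 0)" by auto
    then show ?thesis using True by simp
  next
    case False
    then have less: "q < q'" using le by simp
    let ?g = "\<lambda>p :: (real^'d) \<times> real. C * (q' - q) - \<bar>D2\<bar> * of_bool (q < snd p \<and> snd p \<le> q')"
    have [measurable]: "snd \<in> borel_measurable (restrict_space (borel :: ((real^'d) \<times> real) measure) (X \<times> Y))"
      by (intro measurable_restrict_space1) (simp add: borel_prod[symmetric])
    have gm: "?g \<in> borel_measurable (restrict_space borel (X \<times> Y))" by measurable
    have [measurable]: "(\<lambda>\<omega>. y i \<omega>) \<in> borel_measurable M"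
      using measurable_compose[OF measurable_data, of snd borel i] by simp
    have ib: "integrable M (\<lambda>\<omega>. of_bool (q < y i \<omega> \<and> y i \<omega> \<le> q') :: real)"
      by (rule M.integrable_const_bound[where B=1]) auto
    have "0 \<le> (\<integral>\<omega>. ?g (x i \<omega>, y i \<omega>) \<partial>M)"
    proof (rule expectation_data_nonneg[OF gm])
      show "integrable M (\<lambda>\<omega>. ?g (x i \<omega>, y i \<omega>))" using ib by simp
      show "AE z in lborel. z \<in> X \<longrightarrow> 0 \<le> (\<integral>t. ?g (z, t) \<partial>L z)"
        using loss_facts(5)[rule_format, OF q(1)] loss_facts(5)[rule_format, OF q(2)]
      proof eventually_elim
        case (elim z)
        show ?case
        proof
          assume z: "z \<in> X"
          interpret L: prob_space "L z" using dgp_facts(12) z by blast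
          let ?S = "{u\<in>Y. q < u \<and> u \<le> q'}"
          have "?S = Y \<inter> {q<..q'}" by auto
          moreover have "{q<..q'} \<in> sets borel" by simp
          ultimately have S: "?S \<in> sets (L z)" unfolding sets_cond_law sets_restrict_space by (rule image_eqI)
          have "(\<integral>t. ?g (z, t) \<partial>L z) = (\<integral>t. C * (q' - q) - \<bar>D2\<bar> * indicator ?S t \<partial>L z)"
            by (intro Bochner_Integration.integral_cong refl) (auto simp: space_cond_law indicator_def)
          also have "\<dots> = C * (q' - q) - \<bar>D2\<bar> * measure (L z) ?S"
          proof -
            have "integrable (L z) (\<lambda>t. \<bar>D2\<bar> * indicator ?S t)"
              using S by (intro integrable_mult_right integrable_real_indicator) (auto simp: L.emeasure_eq_measure)
            then show ?thesis using S by (simp add: L.prob_space)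
          qed
          finally show "0 \<le> (\<integral>t. ?g (z, t) \<partial>L z)" using b[OF q z less le(2)] elim z by simp
        qed
      qed
    qed
    also have "\<dots> = C * (q' - q) - \<bar>D2\<bar> * (\<integral>\<omega>. of_bool (q < y i \<omega> \<and> y i \<omega> \<le> q') \<partial>M)"
      using ib by (simp add: M.prob_space)
    finally show ?thesis by simp
  qed
  with C show ?thesis by blast
qed

lemma eta_bounded: "\<exists>C>0. \<forall>z\<in>X. \<forall>q\<in>Q. \<forall>\<zeta>. \<bar>\<zeta> - \<mu>0 z q\<bar> \<le> r \<longrightarrow> \<bar>\<eta> \<zeta>\<bar> \<le> C"
proof -
  obtain C0 where C0: "\<And>z q. z \<in> X \<Longrightarrow> q \<in> Q \<Longrightarrow> \<bar>\<mu>0 z q\<bar> \<le> C0" using mu0_bounded by blast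
  have "compact (\<eta> ` {-C0-r..C0+r})"
    by (intro compact_continuous_image continuous_eta) auto
  then obtain C where C: "\<forall>\<zeta>\<in>{-C0-r..C0+r}. \<bar>\<eta> \<zeta>\<bar> \<le> C"
    unfolding real_norm_def[symmetric] by (metis bounded_iff compact_imp_bounded imageI)
  have "\<bar>\<eta> \<zeta>\<bar> \<le> \<bar>C\<bar> + 1" if "z \<in> X" "q \<in> Q" "\<bar>\<zeta> - \<mu>0 z q\<bar> \<le> r" for z q \<zeta>
  proof -
    have "\<bar>\<eta> \<zeta>\<bar> \<le> C" using C0[OF that(1,2)] that(3) by (intro C[rule_format]) auto
    then show ?thesis by simp
  qed
  moreover have "\<bar>C\<bar> + 1 > 0" by simp
  ultimately show ?thesis by blast
qed

end

section \<open>The local basis and the increments along it\<close>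

locale partitioning_estimation = regression_model M x y X Y E Q \<rho> \<psi> \<eta> \<mu>0 d\<mu> fX N fYX \<psi>bar r \<alpha> \<nu> m
  for M :: "'w measure"
    and x :: "nat \<Rightarrow> 'w \<Rightarrow> real^'d::finite" and y :: "nat \<Rightarrow> 'w \<Rightarrow> real"
    and X :: "(real^'d) set" and Y E Q :: "real set"
    and \<rho> \<psi> :: "real \<Rightarrow> real \<Rightarrow> real \<Rightarrow> real" and \<eta> :: "real \<Rightarrow> real"
    and \<mu>0 :: "real^'d \<Rightarrow> real \<Rightarrow> real" and d\<mu> :: "('d \<Rightarrow> nat) \<Rightarrow> real^'d \<Rightarrow> real \<Rightarrow> real"
    and fX :: "real^'d \<Rightarrow> real" and N :: "real measure" and fYX :: "real^'d \<Rightarrow> real \<Rightarrow> real"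
    and \<psi>bar :: "real^'d \<Rightarrow> real \<Rightarrow> real" and r \<alpha> \<nu> :: real and m :: nat +
  fixes s :: nat and v :: "'d \<Rightarrow> nat"
    and K :: "nat \<Rightarrow> nat" and \<Delta> :: "nat \<Rightarrow> (real^'d) set set"
    and p :: "nat \<Rightarrow> nat \<Rightarrow> real^'d \<Rightarrow> real"
    and dp :: "nat \<Rightarrow> nat \<Rightarrow> ('d \<Rightarrow> nat) \<Rightarrow> real^'d \<Rightarrow> real"
    and \<beta>0 :: "nat \<Rightarrow> real \<Rightarrow> nat \<Rightarrow> real"
  assumes partition: "\<And>n. polyhedral_partition X (\<Delta> n)"
    and dict: "\<And>n. dictionary X (\<Delta> n) s (K n) (p n) (dp n)"
    and quasi: "quasi_uniform_partition \<Delta>"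
    and basis: "local_basis m v s \<Delta> K p dp"
    and approx: "approximation_error X Q m s \<Delta> K dp d\<mu> \<beta>0"
    and smooth: "real m > real CARD('d) / 2"
begin

abbreviation "h n \<equiv> mesh (\<Delta> n)"

definition "lin n b z = (\<Sum>k<K n. p n k z * b k)"

lemma partition_facts:
  shows "finite (\<Delta> n)" "\<Delta> n \<noteq> {}" "\<delta> \<in> \<Delta> n \<Longrightarrow> open \<delta>" "\<delta> \<in> \<Delta> n \<Longrightarrow> \<delta> \<noteq> {}" "\<delta> \<in> \<Delta> n \<Longrightarrow> \<delta> \<subseteq> X"
    "\<delta> \<in> \<Delta> n \<Longrightarrow> \<delta>' \<in> \<Delta> n \<Longrightarrow> z \<in> \<delta> \<Longrightarrow> z \<in> \<delta>' \<Longrightarrow> \<delta> = \<delta>'"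
    "X = (\<Union>\<delta>\<in>\<Delta> n. closure \<delta>)"
proof -
  note * = partition[of n, unfolded polyhedral_partition_def]
  show fin: "finite (\<Delta> n)" using * by blast
  show "\<delta> \<in> \<Delta> n \<Longrightarrow> open \<delta>" "\<delta> \<in> \<Delta> n \<Longrightarrow> \<delta> \<noteq> {}" using * by (auto simp: open_polyhedron_def)
  show sub: "\<delta> \<in> \<Delta> n \<Longrightarrow> \<delta> \<subseteq> X" for \<delta> using * by blast
  show "\<delta> \<in> \<Delta> n \<Longrightarrow> \<delta>' \<in> \<Delta> n \<Longrightarrow> z \<in> \<delta> \<Longrightarrow> z \<in> \<delta>' \<Longrightarrow> \<delta> = \<delta>'" using * unfolding disjoint_def by (metis IntI empty_iff)
  have "X \<subseteq> (\<Union>\<delta>\<in>\<Delta> n. closure \<delta>)"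
  proof -
    have "closed (\<Union>\<delta>\<in>\<Delta> n. closure \<delta>)" using fin by (intro closed_UN) auto
    then have "closure (\<Union> (\<Delta> n)) \<subseteq> (\<Union>\<delta>\<in>\<Delta> n. closure \<delta>)"
      by (intro closure_minimal) (use closure_subset in blast)
    then show ?thesis using * by blast
  qed
  moreover have "(\<Union>\<delta>\<in>\<Delta> n. closure \<delta>) \<subseteq> X" using sub X_closed closure_minimal by blast
  ultimately show "X = (\<Union>\<delta>\<in>\<Delta> n. closure \<delta>)" by blast
  then show "\<Delta> n \<noteq> {}" using X_nonempty by auto
qed

lemma diameter_le_mesh: "\<delta> \<in> \<Delta> n \<Longrightarrow> diameter \<delta> \<le> h n"
  unfolding mesh_def using partition_facts(1) by (intro Max_ge) auto

lemma mesh_pos: "h n > 0"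
proof -
  obtain \<delta> where d: "\<delta> \<in> \<Delta> n" using partition_facts(2) by blast
  note o = partition_facts(3)[OF d] partition_facts(4)[OF d]
  have b: "bounded \<delta>" by (rule bounded_subset[OF X_bounded partition_facts(5)[OF d]])
  from o have "infinite \<delta>" using finite_imp_not_open by blast
  then obtain a b where ab: "a \<in> \<delta>" "b \<in> \<delta>" "a \<noteq> b"
    by (metis all_not_in_conv finite.emptyI finite_insert is_singletonI' is_singleton_the_elem)
  then have "0 < dist a b" by simp
  also have "\<dots> \<le> diameter \<delta>" using diameter_bounded_bound[OF b] ab by simp
  also have "\<dots> \<le> h n" by (rule diameter_le_mesh[OF d])
  finally show ?thesis .
qed

lemma mesh_tendsto_0: "h \<longlonglongrightarrow> 0"
  using quasi unfolding quasi_uniform_partition_def by (auto dest: smalloD_tendsto)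

lemma eventually_mesh_less: "e > 0 \<Longrightarrow> \<forall>\<^sub>F n in sequentially. h n < e"
  using order_tendstoD(2)[OF mesh_tendsto_0] by blast

lemma basis_facts:
  shows "\<exists>C. \<forall>\<^sub>F n in sequentially. \<forall>k<K n.
        card {\<delta> \<in> \<Delta> n. \<delta> \<subseteq> active_region (\<Delta> n) (p n k)} \<le> C \<and>
        card {j. j < K n \<and> active_on (p n j) (active_region (\<Delta> n) (p n k))} \<le> C"
    "\<exists>C. \<forall>\<^sub>F n in sequentially. \<forall>k<K n. \<forall>a\<in>euclid (K n).
        (a k)\<^sup>2 * h n ^ CARD('d) \<le>
        C * (\<Sum>i<K n. \<Sum>j<K n. a i *
               (LINT x:active_region (\<Delta> n) (p n k)|lborel. p n i x * p n j x) * a j)"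
    "msize v < m" "msize v \<le> s"
    "\<forall>u. msize u \<le> s \<longrightarrow>
        (\<exists>c>0. \<exists>C. \<forall>\<^sub>F n in sequentially. \<forall>\<delta>\<in>\<Delta> n. \<forall>x\<in>closure \<delta>.
           c * h n powi (- int (msize u)) \<le> L2_set (\<lambda>k. dp n k u x) {..<K n} \<and>
           L2_set (\<lambda>k. dp n k u x) {..<K n} \<le> C * h n powi (- int (msize u)))"
  using basis unfolding local_basis_def by - (elim conjE, assumption)+

text \<open>The condition is stated cell by cell up to the boundary, and the closed cells cover
  \<open>X\<close>.\<close>

lemma basis_derivative_bound:
  assumes "msize u \<le> s"
  shows "\<exists>C>0. \<forall>\<^sub>F n in sequentially. \<forall>z\<in>X. L2_set (\<lambda>k. dp n k u z) {..<K n} \<le> C * h n powi (- int (msize u))"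
proof -
  obtain c C where "\<forall>\<^sub>F n in sequentially. \<forall>\<delta>\<in>\<Delta> n. \<forall>x\<in>closure \<delta>.
           c * h n powi (- int (msize u)) \<le> L2_set (\<lambda>k. dp n k u x) {..<K n} \<and>
           L2_set (\<lambda>k. dp n k u x) {..<K n} \<le> C * h n powi (- int (msize u))"
    using basis_facts(5) assms by blast
  then have "\<forall>\<^sub>F n in sequentially. \<forall>z\<in>X. L2_set (\<lambda>k. dp n k u z) {..<K n} \<le> (\<bar>C\<bar> + 1) * h n powi (- int (msize u))"
  proof eventually_elim
    case (elim n)
    show ?case
    proof
      fix z assume "z \<in> X"
      then obtain \<delta> where "\<delta> \<in> \<Delta> n" "z \<in> closure \<delta>" using partition_facts(7)[of n] by auto
      with elim have "L2_set (\<lambda>k. dp n k u z) {..<K n} \<le> C * h n powi (- int (msize u))" by blast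
      also have "\<dots> \<le> (\<bar>C\<bar> + 1) * h n powi (- int (msize u))"
        using mesh_pos[of n] by (intro mult_right_mono) auto
      finally show "L2_set (\<lambda>k. dp n k u z) {..<K n} \<le> (\<bar>C\<bar> + 1) * h n powi (- int (msize u))" .
    qed
  qed
  moreover have "\<bar>C\<bar> + 1 > 0" by simp
  ultimately show ?thesis by blast
qed

lemma dict_facts:
  "k < K n \<Longrightarrow> p n k \<in> borel_measurable (restrict_space borel X)"
  "k < K n \<Longrightarrow> z \<in> X \<Longrightarrow> dp n k (\<lambda>_. 0) z = p n k z"
  "k < K n \<Longrightarrow> \<delta> \<in> \<Delta> n \<Longrightarrow> partials_on \<delta> s (dp n k)"
  using dict[of n] unfolding dictionary_def by auto

lemma basis_bound: "\<exists>C>0. \<forall>\<^sub>F n in sequentially. \<forall>z\<in>X. L2_set (\<lambda>k. p n k z) {..<K n} \<le> C"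
proof -
  obtain C where C: "C > 0" "\<forall>\<^sub>F n in sequentially. \<forall>z\<in>X. L2_set (\<lambda>k. dp n k (\<lambda>_. 0) z) {..<K n} \<le> C * h n powi (- int (msize (\<lambda>_::'d. 0)))"
    using basis_derivative_bound[of "\<lambda>_. 0"] by (auto simp: msize_def)
  have "L2_set (\<lambda>k. dp n k (\<lambda>_. 0) z) {..<K n} = L2_set (\<lambda>k. p n k z) {..<K n}" if "z \<in> X" for n z
    by (intro L2_set_cong) (auto simp: dict_facts(2) that)
  then show ?thesis using C by (auto simp: msize_def)
qed

section \<open>Linear combinations of basis functions and Gram bounds\<close>

lemma lin_measurable: "lin n b \<in> borel_measurable (restrict_space borel X)"
  unfolding lin_def[abs_def] using dict_facts(1) by (intro borel_measurable_sum borel_measurable_times) auto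

lemma lin_bound: "\<bar>lin n b z\<bar> \<le> L2_set (\<lambda>k. p n k z) {..<K n} * L2_set b {..<K n}"
proof -
  have "\<bar>lin n b z\<bar> \<le> (\<Sum>k<K n. \<bar>p n k z\<bar> * \<bar>b k\<bar>)" unfolding lin_def abs_mult[symmetric] by (rule sum_abs)
  also have "\<dots> \<le> L2_set (\<lambda>k. p n k z) {..<K n} * L2_set b {..<K n}" by (rule L2_set_mult_ineq)
  finally show ?thesis .
qed

lemma lin_add: "lin n (\<lambda>k. a k + b k) z = lin n a z + lin n b z"
  and lin_diff: "lin n (\<lambda>k. a k - b k) z = lin n a z - lin n b z"
  and lin_scale: "lin n (\<lambda>k. c * a k) z = c * lin n a z"
  unfolding lin_def by (simp_all add: algebra_simps sum.distrib sum_subtractf sum_distrib_left)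

lemma active_region_subset: "active_region (\<Delta> n) f \<subseteq> X"
  using partition_facts(5) by (auto simp: active_region_def)

lemma active_region_open: "open (active_region (\<Delta> n) f)"
  using partition_facts(3) by (auto simp: active_region_def)

lemma indicator_mult_measurable:
  fixes f :: "real^'d \<Rightarrow> real"
  assumes "f \<in> borel_measurable (restrict_space borel X)" "S \<subseteq> X" "S \<in> sets borel"
  shows "(\<lambda>z. indicator S z * f z) \<in> borel_measurable (borel :: (real^'d) measure)"
proof -
  have "(\<lambda>z. indicator S z * (indicator X z *\<^sub>R f z)) \<in> borel_measurable (borel :: (real^'d) measure)"
    using assms by (subst (asm) borel_measurable_restrict_space_iff) auto
  also have "(\<lambda>z. indicator S z * (indicator X z *\<^sub>R f z)) = (\<lambda>z. indicator S z * f z)"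
    using assms(2) by (auto simp: indicator_def fun_eq_iff)
  finally show ?thesis .
qed

lemma indicator_mult_integrable:
  fixes f :: "real^'d \<Rightarrow> real"
  assumes "f \<in> borel_measurable (restrict_space borel X)" "S \<subseteq> X" "S \<in> sets borel"
    and "\<And>z. z \<in> X \<Longrightarrow> \<bar>f z\<bar> \<le> C"
  shows "integrable lborel (\<lambda>z. indicator S z * f z)"
proof (rule Bochner_Integration.integrable_bound)
  have "emeasure lborel X < \<infinity>" using X_bounded emeasure_bounded_finite by blast
  then show "integrable lborel (\<lambda>z. indicator X z * C)" by (intro integrable_mult_left integrable_real_indicator) auto
  show "(\<lambda>z. indicator S z * f z) \<in> borel_measurable lborel" using indicator_mult_measurable[OF assms(1-3)] by simp
  show "AE z in lborel. norm (indicator S z * f z) \<le> norm (indicator X z * C)"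
    using assms(2,4) by (intro AE_I2) (force simp: indicator_def abs_mult)
qed

text \<open>Summing the local condition over \<open>k\<close> bounds the squared norm by the sum of
  the integrals over the active regions, and these regions overlap only boundedly often.\<close>

lemma gram_lower_bound_lborel:
  "\<exists>c>0. \<forall>\<^sub>F n in sequentially. \<forall>a\<in>euclid (K n).
     c * (L2_set a {..<K n})\<^sup>2 * h n ^ CARD('d) \<le> (\<integral>z. indicator X z * (lin n a z)\<^sup>2 \<partial>lborel)"
  (is "\<exists>c>0. \<forall>\<^sub>F n in sequentially. ?P c n")
proof -
  obtain C1 where C1: "\<forall>\<^sub>F n in sequentially. \<forall>k<K n.
        card {\<delta> \<in> \<Delta> n. \<delta> \<subseteq> active_region (\<Delta> n) (p n k)} \<le> C1 \<and>
        card {j. j < K n \<and> active_on (p n j) (active_region (\<Delta> n) (p n k))} \<le> C1"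
    using basis_facts(1) by blast
  obtain C2 where C2: "\<forall>\<^sub>F n in sequentially. \<forall>k<K n. \<forall>a\<in>euclid (K n).
        (a k)\<^sup>2 * h n ^ CARD('d) \<le>
        C2 * (\<Sum>i<K n. \<Sum>j<K n. a i *
               (LINT x:active_region (\<Delta> n) (p n k)|lborel. p n i x * p n j x) * a j)"
    using basis_facts(2) by blast
  obtain C3 where C3: "C3 > 0" "\<forall>\<^sub>F n in sequentially. \<forall>z\<in>X. L2_set (\<lambda>k. p n k z) {..<K n} \<le> C3"
    using basis_bound by blast
  define C where "C = (\<bar>C2\<bar> + 1) * (real C1 + 1)"
  have Cpos: "C > 0" unfolding C_def by (intro mult_pos_pos) auto
  have "\<forall>\<^sub>F n in sequentially. ?P (1 / C) n"
    using C1 C2 C3(2)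
  proof eventually_elim
    case (elim n)
    show ?case
    proof
      fix a assume a: "a \<in> euclid (K n)"
      let ?H = "\<lambda>k. active_region (\<Delta> n) (p n k)"
      have H: "?H k \<subseteq> X" "?H k \<in> sets borel" for k
        using active_region_subset active_region_open by (auto intro: borel_open)
      have pb: "\<bar>p n i z\<bar> \<le> C3" if "z \<in> X" "i < K n" for i z
        using order.trans[OF abs_le_L2_set[of "{..<K n}" i "\<lambda>k. p n k z"]] elim that by auto
      have int2: "integrable lborel (\<lambda>z. indicator (?H k) z * (p n i z * p n j z))" if "i < K n" "j < K n" for i j k
      proof (rule indicator_mult_integrable[OF _ H])
        fix z assume "z \<in> X"
        show "\<bar>p n i z * p n j z\<bar> \<le> C3 * C3"
          unfolding abs_mult using pb[OF \<open>z \<in> X\<close>] that C3(1) by (intro mult_mono) auto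
      qed (use dict_facts(1) that in auto)
      have lb: "\<bar>(lin n a z)\<^sup>2\<bar> \<le> (C3 * L2_set a {..<K n})\<^sup>2" if "z \<in> X" for z
      proof -
        have "\<bar>lin n a z\<bar> \<le> C3 * L2_set a {..<K n}"
          using lin_bound[of n a z] elim that by (meson L2_set_nonneg mult_right_mono order.trans)
        then show ?thesis using abs_le_square_iff[of "lin n a z" "C3 * L2_set a {..<K n}"] C3(1) by (simp add: abs_mult)
      qed
      have intl: "integrable lborel (\<lambda>z. indicator S z * (lin n a z)\<^sup>2)" if "S \<subseteq> X" "S \<in> sets borel" for S
        by (rule indicator_mult_integrable[OF _ that lb]) (use lin_measurable in auto)
      have quad: "(\<Sum>i<K n. \<Sum>j<K n. a i * (LINT x:?H k|lborel. p n i x * p n j x) * a j) = (\<integral>z. indicator (?H k) z * (lin n a z)\<^sup>2 \<partial>lborel)" for k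
      proof -
        have "(\<integral>z. indicator (?H k) z * (lin n a z)\<^sup>2 \<partial>lborel) = (\<integral>z. (\<Sum>i<K n. \<Sum>j<K n. a i * (indicator (?H k) z * (p n i z * p n j z)) * a j) \<partial>lborel)"
          unfolding lin_def power2_eq_square sum_product unfolding sum_distrib_left
          by (intro Bochner_Integration.integral_cong sum.cong refl) (simp add: mult_ac)
        also have "\<dots> = (\<Sum>i<K n. \<integral>z. (\<Sum>j<K n. a i * (indicator (?H k) z * (p n i z * p n j z)) * a j) \<partial>lborel)"
          using int2 by (intro Bochner_Integration.integral_sum Bochner_Integration.integrable_sum integrable_mult_left integrable_mult_right) auto
        also have "\<dots> = (\<Sum>i<K n. \<Sum>j<K n. \<integral>z. a i * (indicator (?H k) z * (p n i z * p n j z)) * a j \<partial>lborel)"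
          using int2 by (intro sum.cong refl Bochner_Integration.integral_sum Bochner_Integration.integrable_sum integrable_mult_left integrable_mult_right) auto
        also have "\<dots> = (\<Sum>i<K n. \<Sum>j<K n. a i * (LINT x:?H k|lborel. p n i x * p n j x) * a j)"
          by (simp add: set_lebesgue_integral_def)
        finally show ?thesis ..
      qed
      \<comment> \<open>If \<open>z\<close> lies in the active regions of both \<open>k\<close> and
        \<open>j\<close>, then, cells being disjoint, the cell of \<open>z\<close> is one on which
        both are active. So \<open>j\<close> is active on the region of \<open>k\<close>, and the
        number of such \<open>j\<close> is bounded.\<close>
      have overlap: "(\<Sum>k<K n. indicator (?H k) z) \<le> real C1" for z
      proof -
        have "(\<Sum>k<K n. indicator (?H k) z :: real) = real (card {k. k < K n \<and> z \<in> ?H k})"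
          by (simp add: indicator_def sum.If_cases Int_def conj_commute)
        also have "\<dots> \<le> real C1"
        proof (cases "{k. k < K n \<and> z \<in> ?H k} = {}")
          case True then show ?thesis by (simp only: card.empty)
        next
          case False
          then obtain k where k: "k < K n" "z \<in> ?H k" by blast
          then obtain \<delta> where \<delta>: "\<delta> \<in> \<Delta> n" "active_on (p n k) \<delta>" "z \<in> \<delta>" by (auto simp: active_region_def)
          have "{j. j < K n \<and> z \<in> ?H j} \<subseteq> {j. j < K n \<and> active_on (p n j) (?H k)}"
          proof safe
            fix j assume "j < K n" "z \<in> ?H j"
            then obtain \<delta>' where \<delta>': "\<delta>' \<in> \<Delta> n" "active_on (p n j) \<delta>'" "z \<in> \<delta>'" by (auto simp: active_region_def)
            then have "\<delta>' = \<delta>" using partition_facts(6) \<delta> by blast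
            then show "active_on (p n j) (?H k)" using \<delta> \<delta>' by (auto simp: active_on_def active_region_def)
          qed
          then have "card {j. j < K n \<and> z \<in> ?H j} \<le> card {j. j < K n \<and> active_on (p n j) (?H k)}" by (intro card_mono) auto
          also have "\<dots> \<le> C1" using elim k by blast
          finally show ?thesis by simp
        qed
        finally show ?thesis .
      qed
      have summand: "(a k)\<^sup>2 * h n ^ CARD('d) \<le> (\<bar>C2\<bar> + 1) * (\<integral>z. indicator (?H k) z * (lin n a z)\<^sup>2 \<partial>lborel)" if "k < K n" for k
      proof -
        have "(a k)\<^sup>2 * h n ^ CARD('d) \<le> C2 * (\<integral>z. indicator (?H k) z * (lin n a z)\<^sup>2 \<partial>lborel)"
          unfolding quad[symmetric] using elim a that by blast
        also have "\<dots> \<le> (\<bar>C2\<bar> + 1) * (\<integral>z. indicator (?H k) z * (lin n a z)\<^sup>2 \<partial>lborel)"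
          by (intro mult_right_mono Bochner_Integration.integral_nonneg_AE) auto
        finally show ?thesis .
      qed
      have "(L2_set a {..<K n})\<^sup>2 * h n ^ CARD('d) = (\<Sum>k<K n. (a k)\<^sup>2 * h n ^ CARD('d))"
        by (simp add: L2_set_def sum_nonneg sum_distrib_right)
      also have "\<dots> \<le> (\<Sum>k<K n. (\<bar>C2\<bar> + 1) * (\<integral>z. indicator (?H k) z * (lin n a z)\<^sup>2 \<partial>lborel))"
        using summand by (intro sum_mono) auto
      also have "\<dots> = (\<bar>C2\<bar> + 1) * (\<integral>z. (\<Sum>k<K n. indicator (?H k) z * (lin n a z)\<^sup>2) \<partial>lborel)"
        using intl[OF H] by (subst Bochner_Integration.integral_sum) (auto simp: sum_distrib_left)
      also have "\<dots> \<le> (\<bar>C2\<bar> + 1) * (\<integral>z. real C1 * (indicator X z * (lin n a z)\<^sup>2) \<partial>lborel)"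
      proof (intro mult_left_mono integral_mono)
        show "integrable lborel (\<lambda>z. \<Sum>k<K n. indicator (?H k) z * (lin n a z)\<^sup>2)" using intl[OF H] by (intro Bochner_Integration.integrable_sum) auto
        show "integrable lborel (\<lambda>z. real C1 * (indicator X z * (lin n a z)\<^sup>2))" using intl[of X] by auto
        fix z
        show "(\<Sum>k<K n. indicator (?H k) z * (lin n a z)\<^sup>2) \<le> real C1 * (indicator X z * (lin n a z)\<^sup>2)"
        proof (cases "z \<in> X")
          case True then show ?thesis using overlap[of z] by (simp add: sum_distrib_right[symmetric] mult_right_mono)
        next
          case False then have "z \<notin> ?H k" for k using H by blast
          then show ?thesis using False by simp
        qed
      qed auto
      also have "\<dots> \<le> C * (\<integral>z. indicator X z * (lin n a z)\<^sup>2 \<partial>lborel)"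
      proof -
        have nn: "(\<integral>z. indicator X z * (lin n a z)\<^sup>2 \<partial>lborel) \<ge> 0" by (intro Bochner_Integration.integral_nonneg_AE) auto
        have "(\<bar>C2\<bar> + 1) * (real C1 * (\<integral>z. indicator X z * (lin n a z)\<^sup>2 \<partial>lborel)) \<le> (\<bar>C2\<bar> + 1) * ((real C1 + 1) * (\<integral>z. indicator X z * (lin n a z)\<^sup>2 \<partial>lborel))"
          using nn by (intro mult_left_mono mult_right_mono) auto
        then show ?thesis by (simp add: C_def mult.assoc)
      qed
      finally show "1 / C * (L2_set a {..<K n})\<^sup>2 * h n ^ CARD('d) \<le> (\<integral>z. indicator X z * (lin n a z)\<^sup>2 \<partial>lborel)"
        using Cpos by (simp add: field_simps)
    qed
  qed
  moreover have "1 / C > 0" using Cpos by simp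
  ultimately show ?thesis by blast
qed

text \<open>Apply the lower Gram bound to the unit vectors and sum: \<open>\<Sum>k. (p n k)\<^sup>2\<close> is bounded.\<close>

lemma basis_size_bound: "\<exists>C>0. \<forall>\<^sub>F n in sequentially. real (K n) * h n ^ CARD('d) \<le> C"
proof -
  obtain c where c: "c > 0" "\<forall>\<^sub>F n in sequentially. \<forall>a\<in>euclid (K n).
     c * (L2_set a {..<K n})\<^sup>2 * h n ^ CARD('d) \<le> (\<integral>z. indicator X z * (lin n a z)\<^sup>2 \<partial>lborel)"
    using gram_lower_bound_lborel by blast
  obtain C3 where C3: "C3 > 0" "\<forall>\<^sub>F n in sequentially. \<forall>z\<in>X. L2_set (\<lambda>k. p n k z) {..<K n} \<le> C3"
    using basis_bound by blast
  define V where "V = measure lborel X"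
  have fin: "emeasure lborel X < \<infinity>" using X_bounded emeasure_bounded_finite by blast
  have "\<forall>\<^sub>F n in sequentially. real (K n) * h n ^ CARD('d) \<le> C3\<^sup>2 * V / c + 1"
    using c(2) C3(2)
  proof eventually_elim
    case (elim n)
    have pb: "\<bar>p n i z\<bar> \<le> C3" if "z \<in> X" "i < K n" for i z
      using order.trans[OF abs_le_L2_set[of "{..<K n}" i "\<lambda>k. p n k z"]] elim that by auto
    have int: "integrable lborel (\<lambda>z. indicator X z * (p n k z)\<^sup>2)" if "k < K n" for k
    proof (rule indicator_mult_integrable)
      fix z assume "z \<in> X"
      show "\<bar>(p n k z)\<^sup>2\<bar> \<le> C3\<^sup>2" using pb[OF \<open>z \<in> X\<close> that] C3(1) abs_le_square_iff[of "p n k z" C3] by simp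
    qed (use dict_facts(1) that in auto)
    have "c * h n ^ CARD('d) \<le> (\<integral>z. indicator X z * (p n k z)\<^sup>2 \<partial>lborel)" if k: "k < K n" for k
    proof -
      define a where "a = (\<lambda>j. if j = k then 1 else 0 :: real)"
      have "a \<in> euclid (K n)" using k by (auto simp: a_def euclid_def)
      moreover have "(L2_set a {..<K n})\<^sup>2 = 1"
      proof -
        have "(\<Sum>j<K n. (a j)\<^sup>2) = (\<Sum>j<K n. if j = k then 1 else 0)" by (intro sum.cong) (auto simp: a_def)
        then show ?thesis using k by (simp add: L2_set_def)
      qed
      moreover have "lin n a z = p n k z" for z using k by (simp add: lin_def a_def if_distrib[of "\<lambda>b. _ * b"] cong: if_cong)
      ultimately show ?thesis using elim(1) by force
    qed
    then have "(\<Sum>k<K n. c * h n ^ CARD('d)) \<le> (\<Sum>k<K n. \<integral>z. indicator X z * (p n k z)\<^sup>2 \<partial>lborel)" by (intro sum_mono) auto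
    also have "\<dots> = (\<integral>z. (\<Sum>k<K n. indicator X z * (p n k z)\<^sup>2) \<partial>lborel)"
      using int by (subst Bochner_Integration.integral_sum) auto
    also have "\<dots> \<le> (\<integral>z. indicator X z * C3\<^sup>2 \<partial>lborel)"
    proof (intro integral_mono)
      show "integrable lborel (\<lambda>z. \<Sum>k<K n. indicator X z * (p n k z)\<^sup>2)" using int by (intro Bochner_Integration.integrable_sum) auto
      show "integrable lborel (\<lambda>z. indicator X z * C3\<^sup>2)" using fin by (intro integrable_mult_left integrable_real_indicator) auto
      fix z
      have "(\<Sum>k<K n. (p n k z)\<^sup>2) \<le> C3\<^sup>2" if "z \<in> X"
      proof -
        have "(L2_set (\<lambda>k. p n k z) {..<K n})\<^sup>2 \<le> C3\<^sup>2" using elim(2) that by (intro power_mono) auto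
        then show ?thesis by (simp add: L2_set_def sum_nonneg)
      qed
      then show "(\<Sum>k<K n. indicator X z * (p n k z)\<^sup>2) \<le> indicator X z * C3\<^sup>2"
        by (auto simp: indicator_def)
    qed
    also have "\<dots> = V * C3\<^sup>2" using fin by (simp add: V_def)
    finally have "real (K n) * h n ^ CARD('d) \<le> C3\<^sup>2 * V / c" using c(1) by (simp add: field_simps)
    then show ?case by linarith
  qed
  moreover have "C3\<^sup>2 * V / c + 1 > 0" using c(1) by (intro add_nonneg_pos) (auto simp: V_def)
  ultimately show ?thesis by blast
qed

lemma expectation_lborel:
  fixes f :: "real^'d \<Rightarrow> real"
  assumes "f \<in> borel_measurable (restrict_space borel X)"
  shows "(\<integral>\<omega>. f (x i \<omega>) \<partial>M) = (\<integral>z. fX z * (indicator X z * f z) \<partial>lborel)"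
proof -
  have "(\<integral>\<omega>. f (x i \<omega>) \<partial>M) = (\<integral>\<omega>. indicator X (x i \<omega>) * f (x i \<omega>) \<partial>M)"
    using dgp_facts(3) by (intro Bochner_Integration.integral_cong) auto
  also have "\<dots> = (\<integral>z. fX z * (indicator X z * f z) \<partial>lborel)"
    using distributed_integral[OF dgp_facts(4)[rule_format, of i], of "\<lambda>z. indicator X z * f z"]
      indicator_mult_measurable[OF assms subset_refl X_borel] fX_nonneg by simp
  finally show ?thesis .
qed

text \<open>The density is bounded below on \<open>X\<close>, so the bound for Lebesgue measure
  carries over; its upper bound, from continuity on the compact \<open>X\<close>, gives
  integrability.\<close>

lemma gram_lower_bound:
  "\<exists>c>0. \<forall>\<^sub>F n in sequentially. \<forall>a\<in>euclid (K n). \<forall>i.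
     c * (L2_set a {..<K n})\<^sup>2 * h n ^ CARD('d) \<le> (\<integral>\<omega>. (lin n a (x i \<omega>))\<^sup>2 \<partial>M)"
  (is "\<exists>c>0. \<forall>\<^sub>F n in sequentially. ?P c n")
proof -
  obtain c where c: "c > 0" "\<forall>\<^sub>F n in sequentially. \<forall>a\<in>euclid (K n).
     c * (L2_set a {..<K n})\<^sup>2 * h n ^ CARD('d) \<le> (\<integral>z. indicator X z * (lin n a z)\<^sup>2 \<partial>lborel)"
    using gram_lower_bound_lborel by blast
  obtain C3 where C3: "C3 > 0" "\<forall>\<^sub>F n in sequentially. \<forall>z\<in>X. L2_set (\<lambda>k. p n k z) {..<K n} \<le> C3"
    using basis_bound by blast
  obtain f0 where f0: "f0 > 0" "\<And>z. z \<in> X \<Longrightarrow> fX z \<ge> f0" using dgp_facts(7) by blast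
  have "compact (fX ` X)" using X_compact dgp_facts(6) by (intro compact_continuous_image)
  then obtain F where F: "\<And>z. z \<in> X \<Longrightarrow> fX z \<le> F"
    using compact_imp_bounded bounded_imp_bdd_above by (metis bdd_above.E imageI)
  have "\<forall>\<^sub>F n in sequentially. ?P (f0 * c) n"
    using c(2) C3(2)
  proof eventually_elim
    case (elim n)
    show ?case
    proof (intro ballI allI)
      fix a i assume a: "a \<in> euclid (K n)"
      have lb: "\<bar>(lin n a z)\<^sup>2\<bar> \<le> (C3 * L2_set a {..<K n})\<^sup>2" if "z \<in> X" for z
      proof -
        have "\<bar>lin n a z\<bar> \<le> C3 * L2_set a {..<K n}"
          using lin_bound[of n a z] elim that by (meson L2_set_nonneg mult_right_mono order.trans)
        then show ?thesis using abs_le_square_iff[of "lin n a z" "C3 * L2_set a {..<K n}"] C3(1) by (simp add: abs_mult)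
      qed
      have intl: "integrable lborel (\<lambda>z. indicator X z * (lin n a z)\<^sup>2)"
        by (rule indicator_mult_integrable[OF _ subset_refl X_borel lb]) (use lin_measurable in auto)
      have intf: "integrable lborel (\<lambda>z. fX z * (indicator X z * (lin n a z)\<^sup>2))"
      proof (rule Bochner_Integration.integrable_bound)
        show "integrable lborel (\<lambda>z. F * (indicator X z * (lin n a z)\<^sup>2))" using intl by simp
        show "AE z in lborel. norm (fX z * (indicator X z * (lin n a z)\<^sup>2)) \<le> norm (F * (indicator X z * (lin n a z)\<^sup>2))"
          using F fX_nonneg by (intro AE_I2) (force simp: indicator_def abs_mult intro!: mult_right_mono)
      qed (use intl in simp)
      have "(f0 * c) * (L2_set a {..<K n})\<^sup>2 * h n ^ CARD('d) \<le> f0 * (\<integral>z. indicator X z * (lin n a z)\<^sup>2 \<partial>lborel)"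
        using elim(1) a f0 by (auto simp: mult.assoc)
      also have "\<dots> = (\<integral>z. f0 * (indicator X z * (lin n a z)\<^sup>2) \<partial>lborel)" by simp
      also have "\<dots> \<le> (\<integral>z. fX z * (indicator X z * (lin n a z)\<^sup>2) \<partial>lborel)"
        using intl intf f0 by (intro integral_mono) (auto simp: indicator_def intro!: mult_right_mono)
      also have "\<dots> = (\<integral>\<omega>. (lin n a (x i \<omega>))\<^sup>2 \<partial>M)"
        by (rule expectation_lborel[symmetric]) (use lin_measurable in auto)
      finally show "(f0 * c) * (L2_set a {..<K n})\<^sup>2 * h n ^ CARD('d) \<le> (\<integral>\<omega>. (lin n a (x i \<omega>))\<^sup>2 \<partial>M)" .
    qed
  qed
  moreover have "f0 * c > 0" using f0 c by simp
  ultimately show ?thesis by blast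
qed

lemma beta0_euclid: "q \<in> Q \<Longrightarrow> \<beta>0 n q \<in> euclid (K n)"
  using approx unfolding approximation_error_def by blast

lemma approx_derivative:
  assumes "msize u \<le> s"
  shows "\<exists>C>0. \<forall>\<^sub>F n in sequentially. \<forall>q\<in>Q. \<forall>z\<in>X.
     \<bar>d\<mu> u z q - (\<Sum>k<K n. \<beta>0 n q k * dp n k u z)\<bar> \<le> C * h n ^ (m - msize u)"
proof -
  obtain C where C: "\<forall>\<^sub>F n in sequentially. \<forall>q\<in>Q. \<forall>z\<in>X.
     \<bar>d\<mu> u z q - (\<Sum>k<K n. \<beta>0 n q k * dp n k u z)\<bar> \<le> C * h n ^ (m - msize u)"
    using approx assms unfolding approximation_error_def by blast
  have "C * h n ^ (m - msize u) \<le> (\<bar>C\<bar> + 1) * h n ^ (m - msize u)" for n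
    using mesh_pos[of n] by (intro mult_right_mono) auto
  then have "\<forall>\<^sub>F n in sequentially. \<forall>q\<in>Q. \<forall>z\<in>X.
     \<bar>d\<mu> u z q - (\<Sum>k<K n. \<beta>0 n q k * dp n k u z)\<bar> \<le> (\<bar>C\<bar> + 1) * h n ^ (m - msize u)"
    using C by (auto elim!: eventually_mono intro: order.trans)
  moreover have "\<bar>C\<bar> + 1 > 0" by simp
  ultimately show ?thesis by blast
qed

lemma approx_mu0: "\<exists>C>0. \<forall>\<^sub>F n in sequentially. \<forall>q\<in>Q. \<forall>z\<in>X. \<bar>lin n (\<beta>0 n q) z - \<mu>0 z q\<bar> \<le> C * h n ^ m"
proof -
  obtain C where C: "C > 0" "\<forall>\<^sub>F n in sequentially. \<forall>q\<in>Q. \<forall>z\<in>X.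
     \<bar>d\<mu> (\<lambda>_. 0) z q - (\<Sum>k<K n. \<beta>0 n q k * dp n k (\<lambda>_. 0) z)\<bar> \<le> C * h n ^ (m - msize (\<lambda>_::'d. 0))"
    using approx_derivative[of "\<lambda>_. 0"] by (auto simp: msize_def)
  have eq: "(\<Sum>k<K n. \<beta>0 n q k * dp n k (\<lambda>_. 0) z) = lin n (\<beta>0 n q) z" if "z \<in> X" for n q z
    unfolding lin_def using dict_facts(2) that by (intro sum.cong) (auto simp: mult.commute)
  have "\<forall>\<^sub>F n in sequentially. \<forall>q\<in>Q. \<forall>z\<in>X. \<bar>lin n (\<beta>0 n q) z - \<mu>0 z q\<bar> \<le> C * h n ^ m"
    using C(2) by eventually_elim (auto simp: eq msize_def dmu_zero abs_minus_commute)
  with C(1) show ?thesis by blast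
qed

text \<open>Regularity of \<open>\<beta>0 n\<close> in \<open>q\<close> is not assumed but derived:
  both linear combinations approximate \<open>\<mu>0\<close>, which is Lipschitz in
  \<open>q\<close>, so their difference is uniformly small, and the Gram bound passes this on to the
  coefficients at the price of \<open>h ^ d\<close>.\<close>

lemma beta0_modulus:
  "\<exists>C>0. \<forall>\<^sub>F n in sequentially. \<forall>q\<in>Q. \<forall>q'\<in>Q.
     (L2_set (\<lambda>k. \<beta>0 n q k - \<beta>0 n q' k) {..<K n})\<^sup>2 * h n ^ CARD('d) \<le> C * (h n ^ m + \<bar>q - q'\<bar>)\<^sup>2"
  (is "\<exists>C>0. \<forall>\<^sub>F n in sequentially. ?P C n")
proof -
  interpret prob_space M by (rule dgp_facts)
  obtain c where c: "c > 0" "\<forall>\<^sub>F n in sequentially. \<forall>a\<in>euclid (K n). \<forall>i.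
     c * (L2_set a {..<K n})\<^sup>2 * h n ^ CARD('d) \<le> (\<integral>\<omega>. (lin n a (x i \<omega>))\<^sup>2 \<partial>M)"
    using gram_lower_bound by blast
  obtain A where A: "A > 0" "\<forall>\<^sub>F n in sequentially. \<forall>q\<in>Q. \<forall>z\<in>X. \<bar>lin n (\<beta>0 n q) z - \<mu>0 z q\<bar> \<le> A * h n ^ m"
    using approx_mu0 by blast
  obtain B where B: "B > 0" "\<And>z q q'. z \<in> X \<Longrightarrow> q \<in> Q \<Longrightarrow> q' \<in> Q \<Longrightarrow> \<bar>\<mu>0 z q - \<mu>0 z q'\<bar> \<le> B * \<bar>q - q'\<bar>"
    using mu0_lipschitz by blast
  define C where "C = 2 * A + B"
  have "\<forall>\<^sub>F n in sequentially. ?P (C\<^sup>2 / c) n"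
    using c(2) A(2)
  proof eventually_elim
    case (elim n)
    show ?case
    proof (intro ballI)
      fix q q' assume q: "q \<in> Q" "q' \<in> Q"
      let ?a = "\<lambda>k. \<beta>0 n q k - \<beta>0 n q' k"
      have "?a \<in> euclid (K n)" using beta0_euclid[OF q(1), of n] beta0_euclid[OF q(2), of n] by (auto simp: euclid_def)
      then have "c * (L2_set ?a {..<K n})\<^sup>2 * h n ^ CARD('d) \<le> (\<integral>\<omega>. (lin n ?a (x 0 \<omega>))\<^sup>2 \<partial>M)" using elim(1) by blast
      also have "\<dots> \<le> (\<integral>\<omega>. (C * (h n ^ m + \<bar>q - q'\<bar>))\<^sup>2 \<partial>M)"
      proof (rule integral_mono_AE')
        show "AE \<omega> in M. (lin n ?a (x 0 \<omega>))\<^sup>2 \<le> (C * (h n ^ m + \<bar>q - q'\<bar>))\<^sup>2"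
        proof (rule AE_I2)
          fix \<omega> assume "\<omega> \<in> space M"
          then have z: "x 0 \<omega> \<in> X" using dgp_facts(3) by blast
          have nn: "h n ^ m \<ge> 0" using mesh_pos[of n] by simp
          have "\<bar>lin n ?a (x 0 \<omega>)\<bar> \<le> A * h n ^ m + A * h n ^ m + B * \<bar>q - q'\<bar>"
            unfolding lin_diff using elim(2)[rule_format, OF q(1) z] elim(2)[rule_format, OF q(2) z] B(2)[OF z q] by linarith
          also have "\<dots> \<le> C * (h n ^ m + \<bar>q - q'\<bar>)"
            unfolding C_def using A(1) B(1) nn by (simp add: algebra_simps)
          finally show "(lin n ?a (x 0 \<omega>))\<^sup>2 \<le> (C * (h n ^ m + \<bar>q - q'\<bar>))\<^sup>2"
            by (metis abs_ge_zero abs_le_square_iff abs_of_nonneg order.trans)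
        qed
      qed auto
      also have "\<dots> = C\<^sup>2 * (h n ^ m + \<bar>q - q'\<bar>)\<^sup>2" by (simp add: prob_space power_mult_distrib)
      finally show "(L2_set ?a {..<K n})\<^sup>2 * h n ^ CARD('d) \<le> (C\<^sup>2 / c) * (h n ^ m + \<bar>q - q'\<bar>)\<^sup>2"
        using c(1) by (simp add: field_simps)
    qed
  qed
  moreover have "C\<^sup>2 / c > 0" using A(1) B(1) c(1) by (simp add: C_def)
  ultimately show ?thesis by blast
qed

text \<open>Truncating the score at \<open>T\<close> leaves a tail of mean \<open>O(h ^ (2 * d))\<close>, and the union bound over a net of
  \<open>exp (O(h powr -d * ln n))\<close> points succeeds as soon as \<open>T * ln n = o(n * h ^ (2 * d))\<close>. Take
  \<open>T = h powr (- 2 * d / (\<nu> - 1))\<close> under the first rate condition and \<open>T\<close> of order \<open>sqrt (ln n)\<close> under the second.\<close>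

lemma truncation_level:
  assumes rate: "(\<lambda>n. ln (real n) powr (\<nu> / (\<nu> - 1)) / (real n * h n powr (2 * \<nu> / (\<nu> - 1) * real CARD('d))))
         \<in> o(\<lambda>_. 1) \<or>
       (\<lambda>n. ln (real n) powr (3 / 2) / (real n * h n ^ (2 * CARD('d)))) \<in> o(\<lambda>_. 1) \<and>
         cond_sub_gaussian X L \<psi>bar"
  shows "\<exists>T C. C > 0 \<and> (\<forall>\<^sub>F n in sequentially. T n \<ge> 1) \<and>
     (\<lambda>n. T n * ln (real n) / (real n * h n ^ (2 * CARD('d)))) \<longlonglongrightarrow> 0 \<and>
     (\<forall>\<^sub>F n in sequentially. \<forall>i. (\<integral>\<^sup>+\<omega>. ennreal (excess (T n) i \<omega>) \<partial>M)
        \<le> ennreal (C * h n ^ (2 * CARD('d))))"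
  using rate
proof
  let ?d = "real CARD('d)"
  assume r: "(\<lambda>n. ln (real n) powr (\<nu> / (\<nu> - 1)) / (real n * h n powr (2 * \<nu> / (\<nu> - 1) * ?d))) \<in> o(\<lambda>_. 1)"
  \<comment> \<open>The exponent makes \<open>T powr (1 - \<nu>)\<close> equal to
    \<open>h ^ (2 * d)\<close>; then \<open>T / h ^ (2 * d)\<close> is exactly the inverse of the
    power of \<open>h\<close> in the rate condition.\<close>
  define T where "T n = h n powr (- (2 * ?d / (\<nu> - 1)))" for n
  obtain C where C: "C > 0" "\<And>T i. T \<ge> 1 \<Longrightarrow> (\<integral>\<^sup>+\<omega>. ennreal (excess T i \<omega>) \<partial>M)
     \<le> ennreal (C * T powr (1 - \<nu>))"
    using tail_polynomial by blast
  have nu: "\<nu> > 2" by (rule loss_facts)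
  have hp: "h n ^ (2 * CARD('d)) = h n powr (2 * ?d)" for n
    using powr_realpow[OF mesh_pos[of n], of "2 * CARD('d)"] by simp
  have T1: "\<forall>\<^sub>F n in sequentially. T n \<ge> 1"
    using eventually_mesh_less[of 1, OF zero_less_one]
  proof eventually_elim
    case (elim n)
    have "h n powr 0 \<le> h n powr (- (2 * ?d / (\<nu> - 1)))"
      using elim mesh_pos[of n] nu by (intro powr_mono') auto
    then show ?case using mesh_pos[of n] by (simp add: T_def)
  qed
  have "\<forall>\<^sub>F n in sequentially. norm (T n * ln (real n) / (real n * h n ^ (2 * CARD('d)))) \<le> ln (real n) powr (\<nu> / (\<nu> - 1)) / (real n * h n powr (2 * \<nu> / (\<nu> - 1) * ?d))"
    using eventually_ge_at_top[of 3]
  proof eventually_elim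
    case (elim n)
    have ln1: "ln (real n) \<ge> 1" using elim exp_le by (subst ln_ge_iff) auto
    have "h n powr (2 * \<nu> / (\<nu> - 1) * ?d) = h n powr (2 * ?d + 2 * ?d / (\<nu> - 1))"
      using nu by (intro arg_cong[where f="\<lambda>a. h n powr a"]) (simp add: field_simps)
    also have "\<dots> = h n ^ (2 * CARD('d)) * h n powr (2 * ?d / (\<nu> - 1))"
      by (simp add: powr_add hp)
    finally have "T n / h n ^ (2 * CARD('d)) = 1 / h n powr (2 * \<nu> / (\<nu> - 1) * ?d)"
      using mesh_pos[of n] by (simp add: T_def powr_minus field_simps)
    then have "T n * ln (real n) / (real n * h n ^ (2 * CARD('d))) = ln (real n) / (real n * h n powr (2 * \<nu> / (\<nu> - 1) * ?d))"
      by (metis (no_types, opaque_lifting) divide_divide_eq_left mult.commute mult.right_neutral times_divide_eq_left times_divide_eq_right)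
    moreover have "ln (real n) \<le> ln (real n) powr (\<nu> / (\<nu> - 1))"
      using powr_mono[of 1 "\<nu> / (\<nu> - 1)" "ln (real n)"] ln1 nu by simp
    ultimately show ?case using ln1 mesh_pos[of n] by (simp add: divide_right_mono)
  qed
  then have lim: "(\<lambda>n. T n * ln (real n) / (real n * h n ^ (2 * CARD('d)))) \<longlonglongrightarrow> 0"
    by (rule Lim_null_comparison) (use smalloD_tendsto[OF r] in simp)
  have "T n powr (1 - \<nu>) = h n ^ (2 * CARD('d))" for n
  proof -
    have "T n powr (1 - \<nu>) = h n powr (2 * ?d)" unfolding T_def powr_powr
      using nu by (intro arg_cong[where f="\<lambda>a. h n powr a"]) (simp add: field_simps)
    then show ?thesis by (simp add: hp)
  qed
  then have "\<forall>\<^sub>F n in sequentially. \<forall>i. (\<integral>\<^sup>+\<omega>. ennreal (excess (T n) i \<omega>) \<partial>M)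
        \<le> ennreal (C * h n ^ (2 * CARD('d)))"
    using T1 C(2)[of "T _"] by (auto elim!: eventually_mono)
  with C(1) T1 lim show ?thesis by blast
next
  assume r: "(\<lambda>n. ln (real n) powr (3 / 2) / (real n * h n ^ (2 * CARD('d)))) \<in> o(\<lambda>_. 1) \<and> cond_sub_gaussian X L \<psi>bar"
  then have rl: "(\<lambda>n. ln (real n) powr (3 / 2) / (real n * h n ^ (2 * CARD('d)))) \<longlonglongrightarrow> 0"
    using smalloD_tendsto by fastforce
  obtain \<sigma>2 C where C: "\<sigma>2 > 0" "C > 0" "\<And>T a i. T \<ge> 1 \<Longrightarrow> a > 0 \<Longrightarrow>
    (\<integral>\<^sup>+\<omega>. ennreal (excess T i \<omega>) \<partial>M)
     \<le> ennreal (C * (a + exp (- (T\<^sup>2) / \<sigma>2) / a))"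
    using tail_sub_gaussian r by blast
  \<comment> \<open>The factor makes the square of \<open>T n\<close> at least
    \<open>2 * \<sigma>2 * ln n\<close>. So the exponential tail is at most the inverse square of
    \<open>n\<close>, hence at most \<open>h ^ (4 * d)\<close>, as
    \<open>n * h ^ (2 * d) \<ge> 1\<close>. The summand \<open>1\<close> secures
    \<open>T n \<ge> 1\<close>.\<close>
  define T where "T n = (1 + sqrt (2 * \<sigma>2)) * sqrt (ln (real n))" for n :: nat
  have ev: "\<forall>\<^sub>F n in sequentially. ln (real n) \<ge> 1 \<and> real n \<ge> 1 \<and> real n * h n ^ (2 * CARD('d)) \<ge> 1"
    using eventually_ge_at_top[of 3] order_tendstoD(2)[OF rl zero_less_one]
  proof eventually_elim
    case (elim n)
    have ln1: "ln (real n) \<ge> 1" using elim exp_le by (subst ln_ge_iff) auto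
    then have "1 \<le> ln (real n) powr (3/2)" by (intro ge_one_powr_ge_zero) auto
    also have "\<dots> \<le> real n * h n ^ (2 * CARD('d))" using elim mesh_pos[of n] by (simp add: field_simps)
    finally show ?case using ln1 elim by simp
  qed
  have T1: "\<forall>\<^sub>F n in sequentially. T n \<ge> 1"
    using ev
  proof eventually_elim
    case (elim n)
    have "1 * 1 \<le> (1 + sqrt (2 * \<sigma>2)) * sqrt (ln (real n))" using elim C(1) by (intro mult_mono) auto
    then show ?case by (simp add: T_def)
  qed
  have lim: "(\<lambda>n. T n * ln (real n) / (real n * h n ^ (2 * CARD('d)))) \<longlonglongrightarrow> 0"
  proof -
    have "(\<lambda>n. (1 + sqrt (2 * \<sigma>2)) * (ln (real n) powr (3 / 2) / (real n * h n ^ (2 * CARD('d))))) \<longlonglongrightarrow> 0"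
      using tendsto_mult_right_zero[OF rl] .
    moreover have "\<forall>\<^sub>F n in sequentially. (1 + sqrt (2 * \<sigma>2)) * (ln (real n) powr (3 / 2) / (real n * h n ^ (2 * CARD('d)))) = T n * ln (real n) / (real n * h n ^ (2 * CARD('d)))"
      using ev
    proof eventually_elim
      case (elim n)
      have "ln (real n) powr (3/2) = ln (real n) powr (1/2 + 1)" by simp
      also have "\<dots> = sqrt (ln (real n)) * ln (real n)" using elim by (subst powr_add) (simp add: powr_half_sqrt)
      finally show ?case by (simp add: T_def)
    qed
    ultimately show ?thesis by (rule Lim_transform_eventually)
  qed
  have "\<forall>\<^sub>F n in sequentially. \<forall>i. (\<integral>\<^sup>+\<omega>. ennreal (excess (T n) i \<omega>) \<partial>M)
        \<le> ennreal ((2 * C) * h n ^ (2 * CARD('d)))"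
    using T1 ev
  proof eventually_elim
    case (elim n)
    let ?a = "h n ^ (2 * CARD('d))"
    have a: "?a > 0" using mesh_pos[of n] by simp
    have n1: "real n \<ge> 1" "real n * ?a \<ge> 1" using elim by auto
    have "exp (- ((T n)\<^sup>2) / \<sigma>2) \<le> exp (- (2 * ln (real n)))"
    proof -
      have "2 * \<sigma>2 \<le> (1 + sqrt (2 * \<sigma>2))\<^sup>2" using C(1) by (simp add: power2_eq_square algebra_simps)
      then have "2 * \<sigma>2 * ln (real n) \<le> (T n)\<^sup>2" using elim by (simp add: T_def power_mult_distrib mult_right_mono)
      then show ?thesis using C(1) by (simp add: field_simps)
    qed
    also have "\<dots> = (exp (- ln (real n)))\<^sup>2" using exp_double[of "- ln (real n)"] by simp
    also have "exp (- ln (real n)) = 1 / real n" using n1(1) by (simp add: exp_minus inverse_eq_divide)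
    also have "(1 / real n)\<^sup>2 \<le> ?a\<^sup>2" using n1 by (intro power_mono) (auto simp: field_simps)
    finally have "exp (- ((T n)\<^sup>2) / \<sigma>2) / ?a \<le> ?a" using a by (simp add: power2_eq_square divide_le_eq)
    then have "C * (?a + exp (- ((T n)\<^sup>2) / \<sigma>2) / ?a) \<le> (2 * C) * ?a" using C(2) by simp
    then have "ennreal (C * (?a + exp (- ((T n)\<^sup>2) / \<sigma>2) / ?a)) \<le> ennreal ((2 * C) * ?a)" by (rule ennreal_leI)
    moreover have "T n \<ge> 1" using elim by simp
    ultimately show ?case using order.trans[OF C(3)[OF _ a]] by blast
  qed
  moreover have "2 * C > 0" using C(2) by simp
  ultimately show ?thesis using T1 lim by blast
qed

section \<open>Moments and lower tails of the loss increments\<close>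

definition "rdiff n q b u = (\<lambda>(z, t). \<rho> t (\<eta> (lin n b z + lin n u z)) q - \<rho> t (\<eta> (lin n b z)) q)"

lemma rdiff_measurable: "q \<in> Q \<Longrightarrow> rdiff n q b u \<in> borel_measurable (restrict_space borel (X \<times> Y))"
  using borel_measurable_diff[OF measurable_rho_comp[of q "\<lambda>z. lin n b z + lin n u z"] measurable_rho_comp[of q "lin n b"]]
    lin_measurable by (simp add: rdiff_def case_prod_beta')

text \<open>The radius \<open>r\<close> is shared equally between the error of the centre and the
  increment.\<close>

lemma rdiff_abs_le:
  "\<exists>C>0. \<forall>n q b u z t. q \<in> Q \<longrightarrow> z \<in> X \<longrightarrow> t \<in> Y \<longrightarrow> \<bar>lin n b z - \<mu>0 z q\<bar> \<le> r/2 \<longrightarrow> \<bar>lin n u z\<bar> \<le> r/2 \<longrightarrow>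
     \<bar>rdiff n q b u (z, t)\<bar> \<le> C * (\<psi>bar z t + 1) * \<bar>lin n u z\<bar>"
proof -
  obtain C where C: "C > 0" "\<And>z q t \<zeta> \<zeta>'. z \<in> X \<Longrightarrow> q \<in> Q \<Longrightarrow> t \<in> Y \<Longrightarrow> \<bar>\<zeta> - \<mu>0 z q\<bar> \<le> r \<Longrightarrow> \<bar>\<zeta>' - \<mu>0 z q\<bar> \<le> r \<Longrightarrow>
    \<bar>\<rho> t (\<eta> \<zeta>') q - \<rho> t (\<eta> \<zeta>) q\<bar> \<le> C * (\<psi>bar z t + 1) * \<bar>\<zeta>' - \<zeta>\<bar>"
    using rho_lipschitz by blast
  have "\<bar>rdiff n q b u (z, t)\<bar> \<le> C * (\<psi>bar z t + 1) * \<bar>lin n u z\<bar>"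
    if "q \<in> Q" "z \<in> X" "t \<in> Y" "\<bar>lin n b z - \<mu>0 z q\<bar> \<le> r/2" "\<bar>lin n u z\<bar> \<le> r/2" for n q b u z t
  proof -
    have "\<bar>lin n b z - \<mu>0 z q\<bar> \<le> r" "\<bar>lin n b z + lin n u z - \<mu>0 z q\<bar> \<le> r" using that(4,5) loss_facts(1) by linarith+
    from C(2)[OF that(2,1,3) this] show ?thesis by (simp add: rdiff_def)
  qed
  with C(1) show ?thesis by blast
qed

lemma lin_data_measurable: "(\<lambda>\<omega>. lin n u (x i \<omega>)) \<in> borel_measurable M"
  using measurable_compose[OF measurable_x lin_measurable] .

lemma lin_data_square_integrable:
  assumes "\<And>z. z \<in> X \<Longrightarrow> \<bar>lin n u z\<bar> \<le> B"
  shows "integrable M (\<lambda>\<omega>. (lin n u (x i \<omega>))\<^sup>2)"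
proof -
  interpret M: prob_space M by (rule dgp_facts)
  show ?thesis
  proof (rule M.integrable_const_bound[where B="B\<^sup>2"])
    show "AE \<omega> in M. norm ((lin n u (x i \<omega>))\<^sup>2) \<le> B\<^sup>2"
      using assms dgp_facts(3) by (intro AE_I2) (auto simp: abs_le_square_iff[symmetric] intro: order.trans[OF _ abs_ge_self])
  qed (use lin_data_measurable in simp)
qed

lemma lin_fst_measurable: "(\<lambda>p. lin n u (fst p)) \<in> borel_measurable (restrict_space borel (X \<times> Y))"
proof -
  have "fst \<in> measurable (restrict_space borel (X \<times> Y)) (restrict_space borel X)"
    by (rule measurable_restrict_space3) (auto simp: borel_prod[symmetric])
  from measurable_compose[OF this lin_measurable] show ?thesis .
qed

text \<open>The conditional lower bound, integrated. Its cross term between increment and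
  approximation error is split, so that only the square of the latter remains; in the application
  this is of order \<open>h ^ (2 * m)\<close>.\<close>

lemma rdiff_expectation:
  "\<exists>c>0. \<exists>C>0. \<forall>n q u i e. q \<in> Q \<longrightarrow> (\<forall>z\<in>X. \<bar>lin n (\<beta>0 n q) z - \<mu>0 z q\<bar> \<le> e) \<longrightarrow> e \<le> r/2 \<longrightarrow> (\<forall>z\<in>X. \<bar>lin n u z\<bar> \<le> r/2) \<longrightarrow>
    integrable M (\<lambda>\<omega>. rdiff n q (\<beta>0 n q) u (x i \<omega>, y i \<omega>)) \<and>
    (\<integral>\<omega>. rdiff n q (\<beta>0 n q) u (x i \<omega>, y i \<omega>) \<partial>M) \<ge> c * (\<integral>\<omega>. (lin n u (x i \<omega>))\<^sup>2 \<partial>M) - C * e\<^sup>2"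
proof -
  interpret M: prob_space M by (rule dgp_facts)
  obtain c C where cC: "c > 0" "C > 0" and low: "\<And>q z \<theta> t. q \<in> Q \<Longrightarrow> z \<in> X \<Longrightarrow> \<Psi> z (\<eta> (\<mu>0 z q)) q = 0 \<Longrightarrow> \<bar>\<theta> - \<mu>0 z q\<bar> \<le> r \<Longrightarrow> \<bar>\<theta> + t - \<mu>0 z q\<bar> \<le> r \<Longrightarrow>
       (\<integral>u. \<rho> u (\<eta> (\<theta> + t)) q - \<rho> u (\<eta> \<theta>) q \<partial>L z) \<ge> c * t\<^sup>2 - C * (\<bar>t\<bar> * \<bar>\<theta> - \<mu>0 z q\<bar>)"
    using rho_diff_conditional_lower_bound by blast
  obtain CL where CL: "CL > 0" "\<And>n q b u z t. q \<in> Q \<Longrightarrow> z \<in> X \<Longrightarrow> t \<in> Y \<Longrightarrow> \<bar>lin n b z - \<mu>0 z q\<bar> \<le> r/2 \<Longrightarrow> \<bar>lin n u z\<bar> \<le> r/2 \<Longrightarrow>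
     \<bar>rdiff n q b u (z, t)\<bar> \<le> CL * (\<psi>bar z t + 1) * \<bar>lin n u z\<bar>"
    using rdiff_abs_le by blast
  \<comment> \<open>From \<open>(c * \<bar>t\<bar> - C * e)\<^sup>2 \<ge> 0\<close>: half of the
    curvature absorbs the cross term, and \<open>C\<^sup>2 / (2 * c)\<close> is the price in front
    of \<open>e\<^sup>2\<close>.\<close>
  define C' where "C' = C\<^sup>2 / (2 * c)"
  have amgm: "c * t\<^sup>2 - C * (\<bar>t\<bar> * a) \<ge> c/2 * t\<^sup>2 - C' * e\<^sup>2" if "0 \<le> a" "a \<le> e" for t a e :: real
  proof -
    have "C * (\<bar>t\<bar> * a) \<le> C * (\<bar>t\<bar> * e)" using that cC by (intro mult_left_mono) auto
    moreover have "C * (\<bar>t\<bar> * e) \<le> c/2 * t\<^sup>2 + C' * e\<^sup>2"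
    proof -
      have "0 \<le> (c * \<bar>t\<bar> - C * e)\<^sup>2" by simp
      then have "2 * c * (C * (\<bar>t\<bar> * e)) \<le> c\<^sup>2 * t\<^sup>2 + C\<^sup>2 * e\<^sup>2" by (simp add: power2_diff power_mult_distrib mult_ac)
      then have "C * (\<bar>t\<bar> * e) \<le> (c\<^sup>2 * t\<^sup>2 + C\<^sup>2 * e\<^sup>2) / (2 * c)" using cC by (simp add: pos_le_divide_eq mult_ac)
      also have "\<dots> = c/2 * t\<^sup>2 + C' * e\<^sup>2" using cC by (simp add: C'_def add_divide_distrib power2_eq_square)
      finally show ?thesis .
    qed
    ultimately show ?thesis by linarith
  qed
  have "integrable M (\<lambda>\<omega>. rdiff n q (\<beta>0 n q) u (x i \<omega>, y i \<omega>)) \<and>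
    (\<integral>\<omega>. rdiff n q (\<beta>0 n q) u (x i \<omega>, y i \<omega>) \<partial>M) \<ge> c/2 * (\<integral>\<omega>. (lin n u (x i \<omega>))\<^sup>2 \<partial>M) - C' * e\<^sup>2"
    if q: "q \<in> Q" and e: "\<forall>z\<in>X. \<bar>lin n (\<beta>0 n q) z - \<mu>0 z q\<bar> \<le> e" "e \<le> r/2" and u: "\<forall>z\<in>X. \<bar>lin n u z\<bar> \<le> r/2" for n q u i e
  proof
    let ?R = "rdiff n q (\<beta>0 n q) u"
    show int: "integrable M (\<lambda>\<omega>. ?R (x i \<omega>, y i \<omega>))"
    proof (rule Bochner_Integration.integrable_bound)
      show "integrable M (\<lambda>\<omega>. CL * (\<psi>bar (x i \<omega>) (y i \<omega>) + 1) * (r/2))"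
        by (intro integrable_mult_left integrable_mult_right psibar_data_integrable)
      show "(\<lambda>\<omega>. ?R (x i \<omega>, y i \<omega>)) \<in> borel_measurable M" by (rule measurable_compose[OF measurable_data rdiff_measurable[OF q]])
      show "AE \<omega> in M. norm (?R (x i \<omega>, y i \<omega>)) \<le> norm (CL * (\<psi>bar (x i \<omega>) (y i \<omega>) + 1) * (r/2))"
      proof (rule AE_I2)
        fix \<omega> assume \<omega>: "\<omega> \<in> space M"
        then have xy: "x i \<omega> \<in> X" "y i \<omega> \<in> Y" using dgp_facts(3) by auto
        have "\<bar>?R (x i \<omega>, y i \<omega>)\<bar> \<le> CL * (\<psi>bar (x i \<omega>) (y i \<omega>) + 1) * \<bar>lin n u (x i \<omega>)\<bar>"
          using e u xy by (intro CL(2)[OF q xy]) (auto intro: order.trans)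
        also have "\<dots> \<le> CL * (\<psi>bar (x i \<omega>) (y i \<omega>) + 1) * (r/2)"
          using u xy CL(1) psibar_data_nonneg[OF \<omega>] by (intro mult_left_mono) auto
        finally show "norm (?R (x i \<omega>, y i \<omega>)) \<le> norm (CL * (\<psi>bar (x i \<omega>) (y i \<omega>) + 1) * (r/2))" by simp
      qed
    qed
    have int2: "integrable M (\<lambda>\<omega>. (lin n u (x i \<omega>))\<^sup>2)" using lin_data_square_integrable u by blast
    let ?g = "\<lambda>p. ?R p - (c/2 * (lin n u (fst p))\<^sup>2 - C' * e\<^sup>2)"
    have "0 \<le> (\<integral>\<omega>. ?g (x i \<omega>, y i \<omega>) \<partial>M)"
    proof (rule expectation_data_nonneg)
      show "?g \<in> borel_measurable (restrict_space borel (X \<times> Y))"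
        using rdiff_measurable[OF q] lin_fst_measurable by simp
      show "integrable M (\<lambda>\<omega>. ?g (x i \<omega>, y i \<omega>))" using int int2 by simp
      show "AE z in lborel. z \<in> X \<longrightarrow> 0 \<le> (\<integral>t. ?g (z, t) \<partial>L z)"
        using loss_facts(5)[rule_format, OF q]
      proof eventually_elim
        case (elim z)
        show ?case
        proof
          assume z: "z \<in> X"
          interpret L: prob_space "L z" using dgp_facts(12) z by blast
          have b1: "\<bar>lin n (\<beta>0 n q) z - \<mu>0 z q\<bar> \<le> r" "\<bar>lin n (\<beta>0 n q) z + lin n u z - \<mu>0 z q\<bar> \<le> r"
            using e(1)[rule_format, OF z] e(2) u[rule_format, OF z] loss_facts(1) by linarith+
          have iz: "integrable (L z) (\<lambda>t. ?R (z, t))" using rho_diff_integrable[OF z q b1] by (simp add: rdiff_def)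
          have "(\<integral>t. ?g (z, t) \<partial>L z) = (\<integral>t. ?R (z, t) \<partial>L z) - (c/2 * (lin n u z)\<^sup>2 - C' * e\<^sup>2)"
            using iz by (simp add: L.prob_space)
          moreover have "(\<integral>t. ?R (z, t) \<partial>L z) \<ge> c * (lin n u z)\<^sup>2 - C * (\<bar>lin n u z\<bar> * \<bar>lin n (\<beta>0 n q) z - \<mu>0 z q\<bar>)"
            using low[OF q z _ b1] elim z by (simp add: rdiff_def)
          moreover have "c * (lin n u z)\<^sup>2 - C * (\<bar>lin n u z\<bar> * \<bar>lin n (\<beta>0 n q) z - \<mu>0 z q\<bar>) \<ge> c/2 * (lin n u z)\<^sup>2 - C' * e\<^sup>2"
            using e(1) z by (intro amgm) auto
          ultimately show "0 \<le> (\<integral>t. ?g (z, t) \<partial>L z)" by linarith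
        qed
      qed
    qed
    also have "\<dots> = (\<integral>\<omega>. ?R (x i \<omega>, y i \<omega>) \<partial>M) - (c/2 * (\<integral>\<omega>. (lin n u (x i \<omega>))\<^sup>2 \<partial>M) - C' * e\<^sup>2)"
      using int int2 by (simp add: M.prob_space)
    finally show "(\<integral>\<omega>. ?R (x i \<omega>, y i \<omega>) \<partial>M) \<ge> c/2 * (\<integral>\<omega>. (lin n u (x i \<omega>))\<^sup>2 \<partial>M) - C' * e\<^sup>2" by simp
  qed
  moreover have "c/2 > 0" "C' > 0" using cC by (auto simp: C'_def)
  ultimately show ?thesis by blast
qed

text \<open>Given the regressor, \<open>lin n u\<close> is a constant and the envelope has a bounded
  second moment. This is why the second moment of the increments is of order \<open>V\<close>, free
  of the truncation level.\<close>

lemma weighted_second_moment: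
  "\<exists>C>0. \<forall>n u i. (\<forall>z\<in>X. \<bar>lin n u z\<bar> \<le> r/2) \<longrightarrow>
     integrable M (\<lambda>\<omega>. ((\<psi>bar (x i \<omega>) (y i \<omega>) + 1) * lin n u (x i \<omega>))\<^sup>2) \<and>
     (\<integral>\<omega>. ((\<psi>bar (x i \<omega>) (y i \<omega>) + 1) * lin n u (x i \<omega>))\<^sup>2 \<partial>M) \<le> C * (\<integral>\<omega>. (lin n u (x i \<omega>))\<^sup>2 \<partial>M)"
proof -
  interpret M: prob_space M by (rule dgp_facts)
  obtain C where C: "C \<ge> 0" "\<And>z. z \<in> X \<Longrightarrow> integrable (L z) (\<lambda>t. (\<psi>bar z t + 1)\<^sup>2)" "\<And>z. z \<in> X \<Longrightarrow> (\<integral>t. (\<psi>bar z t + 1)\<^sup>2 \<partial>L z) \<le> C"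
    using psibar_moment by blast
  have "integrable M (\<lambda>\<omega>. ((\<psi>bar (x i \<omega>) (y i \<omega>) + 1) * lin n u (x i \<omega>))\<^sup>2) \<and>
     (\<integral>\<omega>. ((\<psi>bar (x i \<omega>) (y i \<omega>) + 1) * lin n u (x i \<omega>))\<^sup>2 \<partial>M) \<le> (C + 1) * (\<integral>\<omega>. (lin n u (x i \<omega>))\<^sup>2 \<partial>M)"
    if u: "\<forall>z\<in>X. \<bar>lin n u z\<bar> \<le> r/2" for n u i
  proof
    have le: "(lin n u z)\<^sup>2 \<le> (r/2)\<^sup>2" if "z \<in> X" for z
      using u that loss_facts(1) abs_le_square_iff[of "lin n u z" "r/2"] by simp
    show int: "integrable M (\<lambda>\<omega>. ((\<psi>bar (x i \<omega>) (y i \<omega>) + 1) * lin n u (x i \<omega>))\<^sup>2)"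
    proof (rule Bochner_Integration.integrable_bound)
      show "integrable M (\<lambda>\<omega>. (\<psi>bar (x i \<omega>) (y i \<omega>) + 1)\<^sup>2 * (r/2)\<^sup>2)"
        by (intro integrable_mult_left psibar_square_integrable)
      show "AE \<omega> in M. norm (((\<psi>bar (x i \<omega>) (y i \<omega>) + 1) * lin n u (x i \<omega>))\<^sup>2) \<le> norm ((\<psi>bar (x i \<omega>) (y i \<omega>) + 1)\<^sup>2 * (r/2)\<^sup>2)"
        using le dgp_facts(3) by (intro AE_I2) (auto simp: power_mult_distrib abs_mult intro!: mult_left_mono)
    qed (use psibar_data_measurable lin_data_measurable in simp)
    have int2: "integrable M (\<lambda>\<omega>. (lin n u (x i \<omega>))\<^sup>2)" using lin_data_square_integrable u by blast
    let ?g = "\<lambda>p. (C + 1) * (lin n u (fst p))\<^sup>2 - ((\<psi>bar (fst p) (snd p) + 1) * lin n u (fst p))\<^sup>2"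
    have "0 \<le> (\<integral>\<omega>. ?g (x i \<omega>, y i \<omega>) \<partial>M)"
    proof (rule expectation_data_nonneg)
      show "?g \<in> borel_measurable (restrict_space borel (X \<times> Y))"
        using psibar_measurable lin_fst_measurable by simp
      show "integrable M (\<lambda>\<omega>. ?g (x i \<omega>, y i \<omega>))" using int int2 by simp
      show "AE z in lborel. z \<in> X \<longrightarrow> 0 \<le> (\<integral>t. ?g (z, t) \<partial>L z)"
      proof (intro AE_I2 impI)
        fix z assume z: "z \<in> X"
        interpret L: prob_space "L z" using dgp_facts(12) z by blast
        have "(\<integral>t. ?g (z, t) \<partial>L z) = (C + 1) * (lin n u z)\<^sup>2 - (\<integral>t. (\<psi>bar z t + 1)\<^sup>2 \<partial>L z) * (lin n u z)\<^sup>2"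
          using C(2)[OF z] by (simp add: L.prob_space power_mult_distrib)
        also have "\<dots> \<ge> 0" using C(3)[OF z] by (auto simp: left_diff_distrib[symmetric])
        finally show "0 \<le> (\<integral>t. ?g (z, t) \<partial>L z)" .
      qed
    qed
    also have "\<dots> = (C + 1) * (\<integral>\<omega>. (lin n u (x i \<omega>))\<^sup>2 \<partial>M) - (\<integral>\<omega>. ((\<psi>bar (x i \<omega>) (y i \<omega>) + 1) * lin n u (x i \<omega>))\<^sup>2 \<partial>M)"
      using int int2 by simp
    finally show "(\<integral>\<omega>. ((\<psi>bar (x i \<omega>) (y i \<omega>) + 1) * lin n u (x i \<omega>))\<^sup>2 \<partial>M) \<le> (C + 1) * (\<integral>\<omega>. (lin n u (x i \<omega>))\<^sup>2 \<partial>M)" by simp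
  qed
  moreover have "C + 1 > 0" using C(1) by simp
  ultimately show ?thesis by blast
qed

text \<open>A lower bound, up to small errors, of the increment of the loss for all \<open>q\<^sub>1\<close> between \<open>q\<close> and \<open>q'\<close>: it is
  truncated in order to be bounded, and the indicator makes up for the jump of the loss in its quantile argument.\<close>

definition "incr A n T q q' u = (\<lambda>p. of_bool (\<psi>bar (fst p) (snd p) \<le> T) * rdiff n q (\<beta>0 n q) u p - A * \<bar>D2\<bar> * of_bool (q < snd p \<and> snd p \<le> q'))"

lemma incr_measurable:
  assumes "q \<in> Q" shows "incr A n T q q' u \<in> borel_measurable (restrict_space borel (X \<times> Y))"
proof -
  have [measurable]: "snd \<in> borel_measurable (restrict_space (borel :: ((real^'d) \<times> real) measure) (X \<times> Y))"
    by (intro measurable_restrict_space1) (simp add: borel_prod[symmetric])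
  note [measurable] = psibar_measurable rdiff_measurable[OF assms]
  show ?thesis unfolding incr_def by measurable
qed

text \<open>Compared with \<open>rdiff\<close>, the mean loses the truncated part, a multiple of
  \<open>\<tau>\<close>, and the indicator, whose probability weighted by
  \<open>\<bar>D2\<bar>\<close> is \<open>O(h ^ (2 * d))\<close>; the squared approximation error
  gives \<open>h ^ (2 * m)\<close>. Only the uniform bound grows with \<open>T\<close>.\<close>

lemma increment_moments:
  assumes A: "A \<ge> 0"
  shows "\<exists>c>0. \<exists>C>0. \<forall>\<^sub>F n in sequentially. \<forall>T\<ge>1. \<forall>\<tau>\<ge>0. \<forall>q\<in>Q. \<forall>q'\<in>Q. \<forall>u i.
     q \<le> q' \<longrightarrow> q' - q \<le> h n ^ (2 * CARD('d)) \<longrightarrow> (\<forall>z\<in>X. \<bar>lin n u z\<bar> \<le> r/2) \<longrightarrow>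
     (\<integral>\<^sup>+\<omega>. ennreal (excess T i \<omega>) \<partial>M) \<le> ennreal \<tau> \<longrightarrow>
       (\<forall>\<omega>\<in>space M. \<bar>incr A n T q q' u (x i \<omega>, y i \<omega>)\<bar> \<le> C * T) \<and>
       (\<integral>\<omega>. incr A n T q q' u (x i \<omega>, y i \<omega>) \<partial>M) \<ge> c * (\<integral>\<omega>. (lin n u (x i \<omega>))\<^sup>2 \<partial>M) - C * (h n ^ (2 * m) + h n ^ (2 * CARD('d)) + \<tau>) \<and>
       (\<integral>\<omega>. (incr A n T q q' u (x i \<omega>, y i \<omega>))\<^sup>2 \<partial>M) \<le> C * ((\<integral>\<omega>. (lin n u (x i \<omega>))\<^sup>2 \<partial>M) + h n ^ (2 * CARD('d)))"
  (is "\<exists>c>0. \<exists>C>0. \<forall>\<^sub>F n in sequentially. ?P c C n")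
proof -
  interpret M: prob_space M by (rule dgp_facts)
  let ?D = "\<bar>D2\<bar>"
  obtain c C1 where c: "c > 0" and C1: "C1 > 0" and E: "\<And>n q u i e. q \<in> Q \<Longrightarrow> (\<forall>z\<in>X. \<bar>lin n (\<beta>0 n q) z - \<mu>0 z q\<bar> \<le> e) \<Longrightarrow> e \<le> r/2 \<Longrightarrow> (\<forall>z\<in>X. \<bar>lin n u z\<bar> \<le> r/2) \<Longrightarrow>
    integrable M (\<lambda>\<omega>. rdiff n q (\<beta>0 n q) u (x i \<omega>, y i \<omega>)) \<and>
    (\<integral>\<omega>. rdiff n q (\<beta>0 n q) u (x i \<omega>, y i \<omega>) \<partial>M) \<ge> c * (\<integral>\<omega>. (lin n u (x i \<omega>))\<^sup>2 \<partial>M) - C1 * e\<^sup>2"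
    using rdiff_expectation by blast
  obtain CL where CL: "CL > 0" "\<And>n q b u z t. q \<in> Q \<Longrightarrow> z \<in> X \<Longrightarrow> t \<in> Y \<Longrightarrow> \<bar>lin n b z - \<mu>0 z q\<bar> \<le> r/2 \<Longrightarrow> \<bar>lin n u z\<bar> \<le> r/2 \<Longrightarrow>
     \<bar>rdiff n q b u (z, t)\<bar> \<le> CL * (\<psi>bar z t + 1) * \<bar>lin n u z\<bar>"
    using rdiff_abs_le by blast
  obtain CW where CW: "CW > 0" "\<And>n u i. (\<forall>z\<in>X. \<bar>lin n u z\<bar> \<le> r/2) \<Longrightarrow>
     integrable M (\<lambda>\<omega>. ((\<psi>bar (x i \<omega>) (y i \<omega>) + 1) * lin n u (x i \<omega>))\<^sup>2) \<and>
     (\<integral>\<omega>. ((\<psi>bar (x i \<omega>) (y i \<omega>) + 1) * lin n u (x i \<omega>))\<^sup>2 \<partial>M) \<le> CW * (\<integral>\<omega>. (lin n u (x i \<omega>))\<^sup>2 \<partial>M)"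
    using weighted_second_moment by blast
  obtain CQ s0 where CQ0: "CQ > 0" "s0 > 0" "\<forall>q\<in>Q. \<forall>q'\<in>Q. \<forall>i. q \<le> q' \<longrightarrow> q' - q \<le> s0 \<longrightarrow>
     ?D * (\<integral>\<omega>. of_bool (q < y i \<omega> \<and> y i \<omega> \<le> q') \<partial>M) \<le> CQ * (q' - q)"
    using quantile_probability by (elim exE conjE) (rule that)
  note CQ = CQ0(1,2) CQ0(3)[rule_format]
  obtain Ca where Ca: "Ca > 0" "\<forall>\<^sub>F n in sequentially. \<forall>q\<in>Q. \<forall>z\<in>X. \<bar>lin n (\<beta>0 n q) z - \<mu>0 z q\<bar> \<le> Ca * h n ^ m"
    using approx_mu0 by blast
  have r: "r > 0" by (rule loss_facts)
  have m1: "m \<ge> 1" using smooth by (cases m) auto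
  \<comment> \<open>One bracket for each conclusion: the uniform bound, the mean and the second
    moment.\<close>
  define C where "C = (CL * r + A * ?D) + (C1 * Ca\<^sup>2 + A * CQ + CL * r) + (2 * CL\<^sup>2 * CW + 2 * (A\<^sup>2 * ?D) * CQ)"
  have p: "A * ?D \<ge> 0" "A * CQ \<ge> 0" "CL * r > 0" "C1 * Ca\<^sup>2 > 0" "2 * CL\<^sup>2 * CW > 0" "2 * (A\<^sup>2 * ?D) * CQ \<ge> 0"
    using A CQ CL r C1 Ca CW by auto
  have Cpos: "C > 0" and Cge: "CL * r + A * ?D \<le> C" "C1 * Ca\<^sup>2 \<le> C" "A * CQ \<le> C" "CL * r \<le> C" "2 * CL\<^sup>2 * CW \<le> C" "2 * (A\<^sup>2 * ?D) * CQ \<le> C"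
    unfolding C_def using p by linarith+
  have "\<forall>\<^sub>F n in sequentially. h n ^ m < r / (2 * Ca)"
    using order_tendstoD(2)[OF tendsto_power[OF mesh_tendsto_0, of m], of "r / (2 * Ca)"] r Ca(1) power_0_left[of m, where 'a=real] m1 by (auto split: if_splits)
  moreover have "\<forall>\<^sub>F n in sequentially. h n ^ (2 * CARD('d)) < s0"
    using order_tendstoD(2)[OF tendsto_power[OF mesh_tendsto_0, of "2 * CARD('d)"], of s0] CQ(2) by (simp add: zero_power)
  ultimately have "\<forall>\<^sub>F n in sequentially. ?P c C n"
    using Ca(2)
  proof eventually_elim
    case (elim n)
    let ?g = "h n ^ (2 * CARD('d))"
    have g: "?g > 0" using mesh_pos[of n] by simp
    define e where "e = Ca * h n ^ m"
    have e: "e \<le> r/2" using elim(1) Ca(1) by (simp add: e_def field_simps)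
    show ?case
    proof (intro allI ballI impI)
      fix T \<tau> q q' u i
      assume T: "T \<ge> (1::real)" and \<tau>: "\<tau> \<ge> (0::real)" and q: "q \<in> Q" "q' \<in> Q" "q \<le> q'" "q' - q \<le> ?g" and u: "\<forall>z\<in>X. \<bar>lin n u z\<bar> \<le> r/2"
        and tail: "(\<integral>\<^sup>+\<omega>. ennreal (excess T i \<omega>) \<partial>M) \<le> ennreal \<tau>"
      let ?R = "\<lambda>\<omega>. rdiff n q (\<beta>0 n q) u (x i \<omega>, y i \<omega>)"
      let ?Z = "\<lambda>\<omega>. incr A n T q q' u (x i \<omega>, y i \<omega>)"
      let ?p = "\<lambda>\<omega>. \<psi>bar (x i \<omega>) (y i \<omega>) + 1"
      let ?I = "\<lambda>\<omega>. of_bool (q < y i \<omega> \<and> y i \<omega> \<le> q') :: real"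
      let ?t = "\<lambda>\<omega>. ?p \<omega> * of_bool (\<psi>bar (x i \<omega>) (y i \<omega>) > T)"
      let ?V = "\<integral>\<omega>. (lin n u (x i \<omega>))\<^sup>2 \<partial>M"
      have eb: "\<forall>z\<in>X. \<bar>lin n (\<beta>0 n q) z - \<mu>0 z q\<bar> \<le> e" using elim(3) q(1) by (simp add: e_def)
      note ER = E[OF q(1) eb e u, of i]
      have xy: "x i \<omega> \<in> X" "y i \<omega> \<in> Y" if "\<omega> \<in> space M" for \<omega> using dgp_facts(3) that by auto
      have R1: "\<bar>?R \<omega>\<bar> \<le> CL * ?p \<omega> * \<bar>lin n u (x i \<omega>)\<bar>" if "\<omega> \<in> space M" for \<omega>
        using eb e u xy[OF that] by (intro CL(2)[OF q(1)]) (auto intro: order.trans)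
      have R2: "CL * ?p \<omega> * \<bar>lin n u (x i \<omega>)\<bar> \<le> CL * ?p \<omega> * (r/2)" if "\<omega> \<in> space M" for \<omega>
        using u xy[OF that] CL(1) psibar_data_nonneg[OF that, of i] by (intro mult_left_mono) auto
      have [measurable]: "(\<lambda>\<omega>. y i \<omega>) \<in> borel_measurable M"
        using measurable_compose[OF measurable_data, of snd borel i] by (simp add: measurable_restrict_space1 borel_prod[symmetric])
      note [measurable] = psibar_data_measurable
      have Zm: "?Z \<in> borel_measurable M" by (rule measurable_compose[OF measurable_data incr_measurable[OF q(1)]])
      have iI: "integrable M ?I" by (rule M.integrable_const_bound[where B=1]) auto
      have EI: "?D * (\<integral>\<omega>. ?I \<omega> \<partial>M) \<le> CQ * ?g"
      proof -
        have "?D * (\<integral>\<omega>. ?I \<omega> \<partial>M) \<le> CQ * (q' - q)" using elim(2) q(4) by (intro CQ(3)[OF q(1-3)]) simp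
        also have "\<dots> \<le> CQ * ?g" using q(4) CQ(1) by (intro mult_left_mono) auto
        finally show ?thesis .
      qed
      have it: "integrable M ?t" by (rule integrableI_nonneg) (auto intro: order.strict_trans1[OF tail] simp: psibar_data_nonneg)
      have Et: "(\<integral>\<omega>. ?t \<omega> \<partial>M) \<le> \<tau>"
        using tail \<tau> by (subst (asm) nn_integral_eq_integral[OF it]) (auto simp: psibar_data_nonneg)
      have Zb: "\<bar>?Z \<omega>\<bar> \<le> C * T" if \<omega>: "\<omega> \<in> space M" for \<omega>
      proof -
        have "\<bar>of_bool (\<psi>bar (x i \<omega>) (y i \<omega>) \<le> T) * ?R \<omega>\<bar> \<le> CL * r * T"
        proof (cases "\<psi>bar (x i \<omega>) (y i \<omega>) \<le> T")
          case True
          have "\<bar>?R \<omega>\<bar> \<le> CL * ?p \<omega> * (r/2)" using R1[OF \<omega>] R2[OF \<omega>] by linarith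
          also have "\<dots> \<le> CL * (2 * T) * (r/2)" using True T CL(1) r by (intro mult_right_mono mult_left_mono) auto
          finally show ?thesis using True by (simp add: mult_ac)
        qed (use CL(1) r T in auto)
        moreover have "\<bar>A * ?D * ?I \<omega>\<bar> \<le> A * ?D * T"
        proof -
          have "\<bar>A * ?D * ?I \<omega>\<bar> = A * ?D * ?I \<omega>" using A by (simp add: abs_mult)
          also have "\<dots> \<le> A * ?D * T" by (rule mult_left_mono) (use A T in auto)
          finally show ?thesis .
        qed
        moreover have "?Z \<omega> = of_bool (\<psi>bar (x i \<omega>) (y i \<omega>) \<le> T) * ?R \<omega> - A * ?D * ?I \<omega>" by (simp add: incr_def)
        ultimately have "\<bar>?Z \<omega>\<bar> \<le> CL * r * T + A * ?D * T" by linarith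
        also have "\<dots> \<le> C * T" using mult_right_mono[OF Cge(1), of T] T by (simp add: distrib_right)
        finally show ?thesis .
      qed
      have iZ: "integrable M ?Z" by (rule M.integrable_const_bound[where B="C * T", OF AE_I2 Zm]) (use Zb in simp)
      have low: "(\<integral>\<omega>. ?Z \<omega> \<partial>M) \<ge> c * ?V - C * (h n ^ (2 * m) + ?g + \<tau>)"
      proof -
        \<comment> \<open>Where the envelope exceeds \<open>T\<close>, \<open>rdiff\<close> itself
          is at most \<open>CL * r * ?t\<close>, so subtracting this makes up for its having been
          replaced by zero.\<close>
        have "(\<integral>\<omega>. ?R \<omega> - CL * r * ?t \<omega> - A * ?D * ?I \<omega> \<partial>M) \<le> (\<integral>\<omega>. ?Z \<omega> \<partial>M)"
        proof (rule integral_mono)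
          show "integrable M (\<lambda>\<omega>. ?R \<omega> - CL * r * ?t \<omega> - A * ?D * ?I \<omega>)"
            using ER it iI by (intro Bochner_Integration.integrable_diff integrable_mult_right) auto
          fix \<omega> assume \<omega>: "\<omega> \<in> space M"
          show "?R \<omega> - CL * r * ?t \<omega> - A * ?D * ?I \<omega> \<le> ?Z \<omega>"
          proof (cases "\<psi>bar (x i \<omega>) (y i \<omega>) \<le> T")
            case False
            have "\<bar>?R \<omega>\<bar> \<le> CL * ?p \<omega> * (r/2)" using R1[OF \<omega>] R2[OF \<omega>] by linarith
            also have "\<dots> \<le> CL * ?p \<omega> * r" using r CL(1) psibar_data_nonneg[OF \<omega>, of i] by (intro mult_left_mono) auto
            finally have "?R \<omega> \<le> CL * r * ?p \<omega>" by (simp add: mult_ac)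
            then show ?thesis using False by (simp add: incr_def)
          qed (simp add: incr_def)
        qed (rule iZ)
        also have "(\<integral>\<omega>. ?R \<omega> - CL * r * ?t \<omega> - A * ?D * ?I \<omega> \<partial>M) = (\<integral>\<omega>. ?R \<omega> \<partial>M) - CL * r * (\<integral>\<omega>. ?t \<omega> \<partial>M) - A * ?D * (\<integral>\<omega>. ?I \<omega> \<partial>M)"
          using ER it iI by (subst Bochner_Integration.integral_diff, simp, simp, subst Bochner_Integration.integral_diff, simp, simp) simp
        finally have "(\<integral>\<omega>. ?R \<omega> \<partial>M) - CL * r * (\<integral>\<omega>. ?t \<omega> \<partial>M) - A * (?D * (\<integral>\<omega>. ?I \<omega> \<partial>M)) \<le> (\<integral>\<omega>. ?Z \<omega> \<partial>M)" by (simp add: mult.assoc)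
        moreover have "(\<integral>\<omega>. ?R \<omega> \<partial>M) \<ge> c * ?V - C1 * e\<^sup>2" using ER by simp
        moreover have "C1 * e\<^sup>2 \<le> C * h n ^ (2 * m)"
        proof -
          have "C1 * e\<^sup>2 = C1 * Ca\<^sup>2 * h n ^ (2 * m)" by (simp add: e_def power_mult_distrib power_mult[symmetric] mult.commute[of m])
          also have "\<dots> \<le> C * h n ^ (2 * m)" using Cge(2) mesh_pos[of n] by (intro mult_right_mono) auto
          finally show ?thesis .
        qed
        moreover have "CL * r * (\<integral>\<omega>. ?t \<omega> \<partial>M) \<le> C * \<tau>"
        proof -
          have "CL * r * (\<integral>\<omega>. ?t \<omega> \<partial>M) \<le> CL * r * \<tau>" using Et CL(1) r by (intro mult_left_mono) auto
          also have "\<dots> \<le> C * \<tau>" using Cge(4) \<tau> by (intro mult_right_mono) auto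
          finally show ?thesis .
        qed
        moreover have "A * (?D * (\<integral>\<omega>. ?I \<omega> \<partial>M)) \<le> C * ?g"
        proof -
          have "A * (?D * (\<integral>\<omega>. ?I \<omega> \<partial>M)) \<le> A * (CQ * ?g)" using EI A by (intro mult_left_mono) auto
          also have "\<dots> \<le> C * ?g" using mult_right_mono[OF Cge(3), of ?g] g by (simp add: mult_ac)
          finally show ?thesis .
        qed
        ultimately show ?thesis by (simp add: distrib_left)
      qed
      have sq: "(\<integral>\<omega>. (?Z \<omega>)\<^sup>2 \<partial>M) \<le> C * (?V + ?g)"
      proof -
        have W: "integrable M (\<lambda>\<omega>. (?p \<omega> * lin n u (x i \<omega>))\<^sup>2)" "(\<integral>\<omega>. (?p \<omega> * lin n u (x i \<omega>))\<^sup>2 \<partial>M) \<le> CW * ?V"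
          using CW(2)[OF u, of i] by auto
        have "(\<integral>\<omega>. (?Z \<omega>)\<^sup>2 \<partial>M) \<le> (\<integral>\<omega>. 2 * CL\<^sup>2 * (?p \<omega> * lin n u (x i \<omega>))\<^sup>2 + 2 * (A * ?D)\<^sup>2 * ?I \<omega> \<partial>M)"
        proof (rule integral_mono)
          show "integrable M (\<lambda>\<omega>. (?Z \<omega>)\<^sup>2)"
          proof (rule M.integrable_const_bound[where B="(C * T)\<^sup>2", OF AE_I2])
            fix \<omega> assume "\<omega> \<in> space M"
            then show "norm ((?Z \<omega>)\<^sup>2) \<le> (C * T)\<^sup>2"
              using Zb[of \<omega>] abs_le_square_iff[of "?Z \<omega>" "C * T"] Cpos T by simp
          qed (use Zm in simp)
          show "integrable M (\<lambda>\<omega>. 2 * CL\<^sup>2 * (?p \<omega> * lin n u (x i \<omega>))\<^sup>2 + 2 * (A * ?D)\<^sup>2 * ?I \<omega>)"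
            using W(1) iI by (intro Bochner_Integration.integrable_add integrable_mult_right) auto
          fix \<omega> assume \<omega>: "\<omega> \<in> space M"
          define a where "a = of_bool (\<psi>bar (x i \<omega>) (y i \<omega>) \<le> T) * ?R \<omega>"
          define b where "b = A * ?D * ?I \<omega>"
          have "\<bar>a\<bar> \<le> \<bar>?R \<omega>\<bar>" by (simp add: a_def)
          also have "\<dots> \<le> CL * ?p \<omega> * \<bar>lin n u (x i \<omega>)\<bar>" by (rule R1[OF \<omega>])
          also have "\<dots> = \<bar>CL * (?p \<omega> * lin n u (x i \<omega>))\<bar>" using CL(1) psibar_data_nonneg[OF \<omega>, of i] by (simp add: abs_mult)
          finally have "a\<^sup>2 \<le> (CL * (?p \<omega> * lin n u (x i \<omega>)))\<^sup>2" by (simp add: abs_le_square_iff)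
          moreover have "b\<^sup>2 = (A * ?D)\<^sup>2 * ?I \<omega>" by (simp add: b_def power_mult_distrib)
          moreover have "(a - b)\<^sup>2 \<le> 2 * a\<^sup>2 + 2 * b\<^sup>2" using sum_squares_ge_zero[of "a + b" 0] by (simp add: power2_eq_square algebra_simps)
          moreover have "?Z \<omega> = a - b" by (simp add: incr_def a_def b_def)
          ultimately show "(?Z \<omega>)\<^sup>2 \<le> 2 * CL\<^sup>2 * (?p \<omega> * lin n u (x i \<omega>))\<^sup>2 + 2 * (A * ?D)\<^sup>2 * ?I \<omega>"
            by (simp add: power_mult_distrib)
        qed
        also have "\<dots> = 2 * CL\<^sup>2 * (\<integral>\<omega>. (?p \<omega> * lin n u (x i \<omega>))\<^sup>2 \<partial>M) + 2 * (A * ?D)\<^sup>2 * (\<integral>\<omega>. ?I \<omega> \<partial>M)"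
          using W(1) iI by (subst Bochner_Integration.integral_add) auto
        also have "\<dots> \<le> 2 * CL\<^sup>2 * (CW * ?V) + 2 * (A\<^sup>2 * ?D) * (CQ * ?g)"
        proof (rule add_mono)
          \<comment> \<open>\<open>EI\<close> bounds the expectation together with a single factor
            \<open>?D\<close>, so the square has to be split.\<close>
          have "2 * (A * ?D)\<^sup>2 * (\<integral>\<omega>. ?I \<omega> \<partial>M) = 2 * (A\<^sup>2 * ?D) * (?D * (\<integral>\<omega>. ?I \<omega> \<partial>M))"
            by (simp add: power2_eq_square mult_ac)
          also have "\<dots> \<le> 2 * (A\<^sup>2 * ?D) * (CQ * ?g)" using EI by (intro mult_left_mono) auto
          finally show "2 * (A * ?D)\<^sup>2 * (\<integral>\<omega>. ?I \<omega> \<partial>M) \<le> 2 * (A\<^sup>2 * ?D) * (CQ * ?g)" .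
        qed (use W(2) in \<open>auto intro!: mult_left_mono\<close>)
        also have "\<dots> \<le> C * ?V + C * ?g"
        proof (rule add_mono)
          have "2 * CL\<^sup>2 * CW * ?V \<le> C * ?V" using Cge(5) by (intro mult_right_mono integral_nonneg_AE) auto
          then show "2 * CL\<^sup>2 * (CW * ?V) \<le> C * ?V" by (simp only: mult.assoc)
          have "2 * (A\<^sup>2 * ?D) * CQ * ?g \<le> C * ?g" using Cge(6) g by (intro mult_right_mono) auto
          then show "2 * (A\<^sup>2 * ?D) * (CQ * ?g) \<le> C * ?g" by (simp only: mult.assoc)
        qed
        finally show ?thesis by (simp add: distrib_left)
      qed
      show "(\<forall>\<omega>\<in>space M. \<bar>?Z \<omega>\<bar> \<le> C * T) \<and> (\<integral>\<omega>. ?Z \<omega> \<partial>M) \<ge> c * ?V - C * (h n ^ (2 * m) + ?g + \<tau>) \<and> (\<integral>\<omega>. (?Z \<omega>)\<^sup>2 \<partial>M) \<le> C * (?V + ?g)"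
        using Zb low sq by blast
    qed
  qed
  with c Cpos show ?thesis by blast
qed

text \<open>If the envelope exceeds \<open>T\<close>, the excess term pays for everything. Otherwise
  the passage from \<open>u'\<close> to \<open>u\<close> costs the Lipschitz term, and that from
  \<open>q0\<close> to \<open>q\<close> costs, by \<open>rho_q_variation\<close>, an increment of
  \<open>\<eta>\<close>, which is at most \<open>A\<close>, times a jump and a linear term. The jump
  indicator increases with \<open>q\<close>, so its value at \<open>q1\<close> serves all
  \<open>q\<close> of the cell.\<close>

lemma rdiff_ge_incr:
  "\<exists>A>0. \<exists>C>0. \<forall>n T q0 q q1 u u' z t. T \<ge> 1 \<longrightarrow> q0 \<in> Q \<longrightarrow> q \<in> Q \<longrightarrow> q0 \<le> q \<longrightarrow> q \<le> q1 \<longrightarrow> z \<in> X \<longrightarrow> t \<in> Y \<longrightarrow>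
     \<bar>lin n (\<beta>0 n q0) z - \<mu>0 z q0\<bar> \<le> r/2 \<longrightarrow> \<bar>lin n (\<beta>0 n q0) z - \<mu>0 z q\<bar> \<le> r/2 \<longrightarrow> \<bar>lin n u z\<bar> \<le> r/2 \<longrightarrow> \<bar>lin n u' z\<bar> \<le> r/2 \<longrightarrow>
     rdiff n q (\<beta>0 n q0) u (z, t) \<ge> incr A n T q0 q1 u' (z, t)
       - C * (T + 1) * \<bar>lin n u z - lin n u' z\<bar> - C * ((\<psi>bar z t + 1) * of_bool (\<psi>bar z t > T)) - C * (q - q0)"
proof -
  obtain CL where CL: "CL > 0" "\<And>z q t \<zeta> \<zeta>'. z \<in> X \<Longrightarrow> q \<in> Q \<Longrightarrow> t \<in> Y \<Longrightarrow> \<bar>\<zeta> - \<mu>0 z q\<bar> \<le> r \<Longrightarrow> \<bar>\<zeta>' - \<mu>0 z q\<bar> \<le> r \<Longrightarrow>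
    \<bar>\<rho> t (\<eta> \<zeta>') q - \<rho> t (\<eta> \<zeta>) q\<bar> \<le> CL * (\<psi>bar z t + 1) * \<bar>\<zeta>' - \<zeta>\<bar>"
    using rho_lipschitz by blast
  obtain Ce where Ce: "Ce > 0" "\<And>z q \<zeta>. z \<in> X \<Longrightarrow> q \<in> Q \<Longrightarrow> \<bar>\<zeta> - \<mu>0 z q\<bar> \<le> r \<Longrightarrow> \<bar>\<eta> \<zeta>\<bar> \<le> Ce"
    using eta_bounded by blast
  have r: "r > 0" by (rule loss_facts)
  define A where "A = 2 * Ce"
  define C where "C = CL + CL * r + A * \<bar>D3\<bar>"
  have A: "A > 0" and p: "CL * r > 0" "A * \<bar>D3\<bar> \<ge> 0" using Ce(1) CL(1) r by (auto simp: A_def)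
  have Cpos: "C > 0" and Cge: "CL \<le> C" "CL * r \<le> C" "A * \<bar>D3\<bar> \<le> C" unfolding C_def using p CL(1) by linarith+
  have "rdiff n q (\<beta>0 n q0) u (z, t) \<ge> incr A n T q0 q1 u' (z, t)
       - C * (T + 1) * \<bar>lin n u z - lin n u' z\<bar> - C * ((\<psi>bar z t + 1) * of_bool (\<psi>bar z t > T)) - C * (q - q0)"
    if T: "T \<ge> 1" and q: "q0 \<in> Q" "q \<in> Q" "q0 \<le> q" "q \<le> q1" and zt: "z \<in> X" "t \<in> Y" and
      b: "\<bar>lin n (\<beta>0 n q0) z - \<mu>0 z q0\<bar> \<le> r/2" "\<bar>lin n (\<beta>0 n q0) z - \<mu>0 z q\<bar> \<le> r/2" and u: "\<bar>lin n u z\<bar> \<le> r/2" "\<bar>lin n u' z\<bar> \<le> r/2"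
    for n T q0 q q1 u u' z t
  proof -
    define a where "a = lin n (\<beta>0 n q0) z"
    have n1: "\<bar>a - \<mu>0 z q0\<bar> \<le> r" "\<bar>a + lin n u z - \<mu>0 z q0\<bar> \<le> r" "\<bar>a + lin n u' z - \<mu>0 z q0\<bar> \<le> r"
       "\<bar>a - \<mu>0 z q\<bar> \<le> r" "\<bar>a + lin n u z - \<mu>0 z q\<bar> \<le> r"
      using b u r unfolding a_def[symmetric] by linarith+
    have psi: "\<psi>bar z t \<ge> 0" by (rule psibar_nonneg[OF zt])
    have E: "\<eta> \<zeta> \<in> E" for \<zeta> using eta_range by auto
    let ?R = "rdiff n q (\<beta>0 n q0) u (z, t)"
    have qq: "C * (q - q0) \<ge> 0" "A * \<bar>D3\<bar> * (q - q0) \<le> C * (q - q0)" using Cpos q Cge(3) by (auto intro: mult_right_mono)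
    have uu: "C * (T + 1) * \<bar>lin n u z - lin n u' z\<bar> \<ge> 0" using Cpos T by simp
    show ?thesis
    proof (cases "\<psi>bar z t \<le> T")
      case False
      have "\<bar>?R\<bar> \<le> CL * (\<psi>bar z t + 1) * \<bar>lin n u z\<bar>"
        using CL(2)[OF zt(1) q(2) zt(2) n1(4,5)] by (simp add: rdiff_def a_def)
      also have "\<dots> \<le> CL * (\<psi>bar z t + 1) * r" using u(1) r CL(1) psi by (intro mult_left_mono) auto
      also have "\<dots> = CL * r * (\<psi>bar z t + 1)" by simp
      also have "\<dots> \<le> C * (\<psi>bar z t + 1)" using Cge(2) psi by (intro mult_right_mono) auto
      finally have "?R \<ge> - (C * (\<psi>bar z t + 1))" by linarith
      moreover have "incr A n T q0 q1 u' (z, t) \<le> 0" using False A by (simp add: incr_def)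
      ultimately show ?thesis using False uu qq(1) by simp
    next
      case True
      define R0 where "R0 = rdiff n q0 (\<beta>0 n q0) u (z, t)"
      define R1 where "R1 = rdiff n q0 (\<beta>0 n q0) u' (z, t)"
      have "\<bar>R0 - R1\<bar> \<le> CL * (\<psi>bar z t + 1) * \<bar>lin n u z - lin n u' z\<bar>"
        using CL(2)[OF zt(1) q(1) zt(2) n1(3,2)] by (simp add: R0_def R1_def rdiff_def a_def)
      also have "\<dots> \<le> C * (T + 1) * \<bar>lin n u z - lin n u' z\<bar>"
        using True CL(1) Cge(1) psi T by (intro mult_right_mono mult_mono) auto
      finally have R01: "R0 \<ge> R1 - C * (T + 1) * \<bar>lin n u z - lin n u' z\<bar>" by linarith
      define e where "e = \<eta> (a + lin n u z) - \<eta> a"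
      have e: "\<bar>e\<bar> \<le> A" using Ce(2)[OF zt(1) q(1) n1(1)] Ce(2)[OF zt(1) q(1) n1(2)] unfolding e_def A_def by linarith
      define I where "I = (of_bool (q0 < t \<and> t \<le> q) :: real)"
      have I: "of_bool (t \<le> q) - of_bool (t \<le> q0) = I" "I \<ge> 0" "I \<le> of_bool (q0 < t \<and> t \<le> q1)"
        using q(3,4) by (auto simp: I_def)
      have "?R - R0 = e * (D2 * I + D3 * (q - q0))"
        using rho_q_variation[OF zt(2) E E q(1,2), of "a + lin n u z" a] unfolding I(1) e_def by (simp add: R0_def rdiff_def a_def)
      also have "\<dots> \<ge> - (A * (\<bar>D2\<bar> * I + \<bar>D3\<bar> * (q - q0)))"
      proof -
        have "\<bar>e * (D2 * I + D3 * (q - q0))\<bar> \<le> A * (\<bar>D2\<bar> * I + \<bar>D3\<bar> * (q - q0))"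
          unfolding abs_mult
        proof (rule mult_mono[OF e])
          show "\<bar>D2 * I + D3 * (q - q0)\<bar> \<le> \<bar>D2\<bar> * I + \<bar>D3\<bar> * (q - q0)"
            using abs_triangle_ineq[of "D2 * I" "D3 * (q - q0)"] I(2) q(3) by (simp add: abs_mult)
        qed (use A in auto)
        then show ?thesis by linarith
      qed
      finally have "?R \<ge> R0 - A * \<bar>D2\<bar> * I - A * \<bar>D3\<bar> * (q - q0)" by (simp add: algebra_simps)
      moreover have "A * \<bar>D2\<bar> * I \<le> A * \<bar>D2\<bar> * of_bool (q0 < t \<and> t \<le> q1)" using A I(3) by (intro mult_left_mono) auto
      moreover have "incr A n T q0 q1 u' (z, t) = R1 - A * \<bar>D2\<bar> * of_bool (q0 < t \<and> t \<le> q1)" using True by (simp add: incr_def R1_def)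
      moreover have "C * ((\<psi>bar z t + 1) * of_bool (\<psi>bar z t > T)) = 0" using True by simp
      ultimately show ?thesis using R01 qq(2) by linarith
    qed
  qed
  with A Cpos show ?thesis by blast
qed

text \<open>Both errors are smaller than \<open>h ^ d\<close> by a factor \<open>h\<close>. For the
  squared bias this is \<open>m > d / 2\<close> again: \<open>2 * m\<close> is an integer above
  \<open>d\<close>, thus at least \<open>d + 1\<close>.\<close>

lemma power_mesh_le:
  assumes "h n \<le> 1" shows "h n ^ (2 * CARD('d)) \<le> h n ^ CARD('d) * h n" "h n ^ (2 * m) \<le> h n ^ CARD('d) * h n"
proof -
  have "h n ^ (2 * CARD('d)) \<le> h n ^ (CARD('d) + 1)"
    using assms mesh_pos[of n] zero_less_card_finite[where 'a='d] by (intro power_decreasing) auto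
  then show "h n ^ (2 * CARD('d)) \<le> h n ^ CARD('d) * h n" by (simp add: mult.commute)
  have "CARD('d) < 2 * m" using smooth by linarith
  then have "h n ^ (2 * m) \<le> h n ^ (CARD('d) + 1)"
    using assms mesh_pos[of n] by (intro power_decreasing) auto
  then show "h n ^ (2 * m) \<le> h n ^ CARD('d) * h n" by (simp add: mult.commute)
qed

text \<open>With a mean of order at least \<open>V\<close>, a second moment of order at most
  \<open>V\<close> and a range of order \<open>T\<close>, \<open>indep_sum_lower_tail\<close> with
  \<open>l\<close> of order \<open>1 / T\<close> has an exponent of order \<open>n * V / T\<close>;
  and \<open>V\<close> is at least of order \<open>h ^ d\<close>.\<close>

lemma increment_lower_tail:
  assumes A: "A \<ge> 0" and \<delta>: "\<delta> > 0" and C\<tau>: "C\<tau> \<ge> 0"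
  shows "\<exists>a>0. \<exists>b>0. \<forall>\<^sub>F n in sequentially. \<forall>T\<ge>1. \<forall>q\<in>Q. \<forall>q'\<in>Q. \<forall>u\<in>euclid (K n).
     q \<le> q' \<longrightarrow> q' - q \<le> h n ^ (2 * CARD('d)) \<longrightarrow> (\<forall>z\<in>X. \<bar>lin n u z\<bar> \<le> r/2) \<longrightarrow> \<delta> \<le> L2_set u {..<K n} \<longrightarrow>
     (\<forall>i. (\<integral>\<^sup>+\<omega>. ennreal (excess T i \<omega>) \<partial>M) \<le> ennreal (C\<tau> * h n ^ (2 * CARD('d)))) \<longrightarrow>
     measure M {\<omega>\<in>space M. (\<Sum>i<n. incr A n T q q' u (x i \<omega>, y i \<omega>)) \<le> real n * (b * h n ^ CARD('d))} \<le> exp (- a * (real n * h n ^ CARD('d) / T))"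
  (is "\<exists>a>0. \<exists>b>0. \<forall>\<^sub>F n in sequentially. ?P a b n")
proof -
  interpret M: prob_space M by (rule dgp_facts)
  obtain c C where c: "c > 0" and C: "C > 0" and mom: "\<forall>\<^sub>F n in sequentially. \<forall>T\<ge>1. \<forall>\<tau>\<ge>0. \<forall>q\<in>Q. \<forall>q'\<in>Q. \<forall>u i.
     q \<le> q' \<longrightarrow> q' - q \<le> h n ^ (2 * CARD('d)) \<longrightarrow> (\<forall>z\<in>X. \<bar>lin n u z\<bar> \<le> r/2) \<longrightarrow>
     (\<integral>\<^sup>+\<omega>. ennreal (excess T i \<omega>) \<partial>M) \<le> ennreal \<tau> \<longrightarrow>
       (\<forall>\<omega>\<in>space M. \<bar>incr A n T q q' u (x i \<omega>, y i \<omega>)\<bar> \<le> C * T) \<and>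
       (\<integral>\<omega>. incr A n T q q' u (x i \<omega>, y i \<omega>) \<partial>M) \<ge> c * (\<integral>\<omega>. (lin n u (x i \<omega>))\<^sup>2 \<partial>M) - C * (h n ^ (2 * m) + h n ^ (2 * CARD('d)) + \<tau>) \<and>
       (\<integral>\<omega>. (incr A n T q q' u (x i \<omega>, y i \<omega>))\<^sup>2 \<partial>M) \<le> C * ((\<integral>\<omega>. (lin n u (x i \<omega>))\<^sup>2 \<partial>M) + h n ^ (2 * CARD('d)))"
    using increment_moments[OF A] by (elim exE conjE) (rule that)
  obtain cg where cg: "cg > 0" "\<forall>\<^sub>F n in sequentially. \<forall>a\<in>euclid (K n). \<forall>i.
     cg * (L2_set a {..<K n})\<^sup>2 * h n ^ CARD('d) \<le> (\<integral>\<omega>. (lin n a (x i \<omega>))\<^sup>2 \<partial>M)"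
    using gram_lower_bound by blast
  define v0 where "v0 = cg * \<delta>\<^sup>2"
  have v0: "v0 > 0" using cg \<delta> by (simp add: v0_def)
  \<comment> \<open>\<open>V + h ^ (2 * d) \<le> (1 + 1 / v0) * V\<close>, because
    \<open>V \<ge> v0 * h ^ d\<close>.\<close>
  define D where "D = C * (1 + 1 / v0)"
  have D: "D > 0" using C v0 by (simp add: D_def add_pos_pos)
  \<comment> \<open>The first entry meets the constraint \<open>l * (C * T) \<le> 1\<close>. The
    second keeps the quadratic term at most half of \<open>l * (c / 4 * V)\<close>, where
    \<open>c / 4 * V\<close> is the gap between the mean \<open>c / 2 * V\<close> and the threshold
    \<open>c / 4 * V\<close>.\<close>
  define l0 where "l0 = min (1 / C) (c / (8 * D))"
  have l0: "l0 > 0" "l0 * C \<le> 1" "l0 * D \<le> c / 8"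
  proof -
    show "l0 > 0" using C D c by (simp add: l0_def)
    have "l0 \<le> 1 / C" by (simp add: l0_def)
    then show "l0 * C \<le> 1" using C by (simp add: field_simps)
    have "l0 \<le> c / (8 * D)" by (simp add: l0_def)
    then show "l0 * D \<le> c / 8" using D by (simp add: field_simps)
  qed
  define a where "a = l0 * c * v0 / 8"
  define b where "b = c * v0 / 4"
  have ab: "a > 0" "b > 0" using l0 c v0 by (auto simp: a_def b_def)
  \<comment> \<open>For smaller meshes the error terms take away at most half of the mean.\<close>
  define e0 where "e0 = min 1 (c * v0 / (2 * C * (2 + C\<tau>)))"
  have e0: "e0 > 0" using c v0 C C\<tau> by (simp add: e0_def)
  have "\<forall>\<^sub>F n in sequentially. ?P a b n"
    using mom cg(2) eventually_mesh_less[OF e0]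
  proof eventually_elim
    case (elim n)
    let ?d = "h n ^ CARD('d)" and ?g = "h n ^ (2 * CARD('d))"
    have h: "h n \<le> 1" "h n \<le> c * v0 / (2 * C * (2 + C\<tau>))" using elim(3) by (auto simp: e0_def)
    have d: "?d > 0" "?g > 0" using mesh_pos[of n] by auto
    show ?case
    proof (intro allI ballI impI)
      fix T q q' u
      assume T: "T \<ge> (1::real)" and q: "q \<in> Q" "q' \<in> Q" "q \<le> q'" "q' - q \<le> ?g" and u: "u \<in> euclid (K n)" "\<forall>z\<in>X. \<bar>lin n u z\<bar> \<le> r/2" "\<delta> \<le> L2_set u {..<K n}"
        and tail: "\<forall>i. (\<integral>\<^sup>+\<omega>. ennreal (excess T i \<omega>) \<partial>M) \<le> ennreal (C\<tau> * ?g)"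
      let ?Z = "\<lambda>i \<omega>. incr A n T q q' u (x i \<omega>, y i \<omega>)"
      define V where "V = (\<integral>\<omega>. (lin n u (x 0 \<omega>))\<^sup>2 \<partial>M)"
      have Vi: "(\<integral>\<omega>. (lin n u (x i \<omega>))\<^sup>2 \<partial>M) = V" for i
      proof -
        have "(\<lambda>z. (lin n u z)\<^sup>2) \<in> borel_measurable (restrict_space borel X)" using lin_measurable by simp
        from expectation_lborel[OF this] show ?thesis by (simp add: V_def)
      qed
      have V: "V \<ge> v0 * ?d"
      proof -
        have "cg * \<delta>\<^sup>2 * ?d \<le> cg * (L2_set u {..<K n})\<^sup>2 * ?d"
          using cg(1) u(3) \<delta> d by (intro mult_right_mono mult_left_mono power_mono) auto
        also have "\<dots> \<le> V" using elim(2)[rule_format, OF u(1), of 0] by (simp add: V_def)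
        finally show ?thesis by (simp add: v0_def)
      qed
      have Vpos: "V > 0" using V v0 d by (smt (verit) mult_pos_pos)
      have \<tau>0: "C\<tau> * ?g \<ge> 0" using C\<tau> d by simp
      note Z = elim(1)[rule_format, OF T \<tau>0 q(1,2,3,4) u(2)[rule_format] tail[rule_format]]
      have ind: "M.indep_vars (\<lambda>_. borel) ?Z UNIV" by (rule indep_data[OF incr_measurable[OF q(1)]])
      have small: "C * (h n ^ (2 * m) + ?g + C\<tau> * ?g) \<le> c / 2 * V"
      proof -
        have gg: "?g \<le> ?d * h n" "h n ^ (2 * m) \<le> ?d * h n" using power_mesh_le[OF h(1)] by auto
        have "C\<tau> * ?g \<le> C\<tau> * (?d * h n)" using gg(1) C\<tau> by (rule mult_left_mono)
        then have "h n ^ (2 * m) + ?g + C\<tau> * ?g \<le> (2 + C\<tau>) * (?d * h n)" using gg by (simp add: distrib_right)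
        then have "C * (h n ^ (2 * m) + ?g + C\<tau> * ?g) \<le> C * ((2 + C\<tau>) * (?d * h n))" using C by (intro mult_left_mono) auto
        also have "\<dots> = (2 * C * (2 + C\<tau>) * h n) * (?d / 2)" by simp
        also have "\<dots> \<le> (c * v0) * (?d / 2)"
        proof (rule mult_right_mono)
          have "2 * C * (2 + C\<tau>) > 0" using C C\<tau> by simp
          then show "2 * C * (2 + C\<tau>) * h n \<le> c * v0" using h(2) by (simp only: pos_le_divide_eq mult.commute[of "h n"])
        qed (use d in auto)
        also have "\<dots> = c / 2 * (v0 * ?d)" by simp
        also have "\<dots> \<le> c / 2 * V" using V c by (intro mult_left_mono) auto
        finally show ?thesis .
      qed
      have m1: "M.expectation (?Z i) \<ge> c / 2 * V" for i
        using Z[of i] small unfolding Vi by linarith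
      have m2: "M.expectation (\<lambda>\<omega>. (?Z i \<omega>)\<^sup>2) \<le> D * V" for i
      proof -
        have "?g \<le> ?d" using h(1) mesh_pos[of n] by (intro power_decreasing) auto
        also have "?d \<le> V / v0" using V v0 by (simp add: field_simps)
        finally have "C * (V + ?g) \<le> C * (V + V / v0)" using C by (intro mult_left_mono) auto
        also have "\<dots> = D * V" by (simp add: D_def algebra_simps)
        finally show ?thesis using Z[of i] unfolding Vi by linarith
      qed
      define l where "l = l0 / T"
      have l: "l > 0" "l \<le> l0" "l * (C * T) \<le> 1" using l0 T by (auto simp: l_def field_simps mult_left_le)
      \<comment> \<open>The threshold is raised in proportion to \<open>V\<close>, which may exceed
        \<open>h ^ d\<close> by far, so that its gap to the mean is a multiple of \<open>V\<close>
        as well.\<close>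
      have sub: "{\<omega>\<in>space M. (\<Sum>i<n. ?Z i \<omega>) \<le> real n * (b * ?d)} \<subseteq> {\<omega>\<in>space M. (\<Sum>i<n. ?Z i \<omega>) \<le> real n * (c / 4 * V)}"
      proof -
        have "b * ?d \<le> c / 4 * V" using V c by (simp add: b_def)
        then have "real n * (b * ?d) \<le> real n * (c / 4 * V)" by (intro mult_left_mono) auto
        then show ?thesis by auto
      qed
      have [measurable]: "?Z i \<in> borel_measurable M" for i using ind by (auto simp: M.indep_vars_def)
      have "measure M {\<omega>\<in>space M. (\<Sum>i<n. ?Z i \<omega>) \<le> real n * (b * ?d)} \<le> measure M {\<omega>\<in>space M. (\<Sum>i<n. ?Z i \<omega>) \<le> real n * (c / 4 * V)}"
        by (rule M.finite_measure_mono[OF sub]) measurable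
      also have "\<dots> \<le> exp (- real n * (l * (c / 2 * V - c / 4 * V) - l\<^sup>2 * (D * V)))"
        by (rule M.indep_sum_lower_tail[OF ind _ m1 m2 l(1,3)]) (use Z in auto)
      also have "\<dots> \<le> exp (- a * (real n * ?d / T))"
      proof -
        have "l\<^sup>2 * (D * V) = l * (l * D * V)" by (simp add: power2_eq_square)
        also have "\<dots> \<le> l * (c / 8 * V)"
        proof -
          have "l * D \<le> l0 * D" using l(2) D by (intro mult_right_mono) auto
          then have "l * D * V \<le> c / 8 * V" using l0(3) Vpos by (intro mult_right_mono) auto
          then show ?thesis using l(1) by (intro mult_left_mono) auto
        qed
        finally have "l * (c / 2 * V - c / 4 * V) - l\<^sup>2 * (D * V) \<ge> l * (c / 8 * V)" by (simp add: algebra_simps)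
        moreover have "l * (c / 8 * V) \<ge> l * (c / 8 * (v0 * ?d))" using l(1) c V by (intro mult_left_mono) auto
        moreover have "l * (c / 8 * (v0 * ?d)) = a * (?d / T)" by (simp add: l_def a_def)
        ultimately have "a * (?d / T) \<le> l * (c / 2 * V - c / 4 * V) - l\<^sup>2 * (D * V)" by linarith
        then have "real n * (a * (?d / T)) \<le> real n * (l * (c / 2 * V - c / 4 * V) - l\<^sup>2 * (D * V))" by (intro mult_left_mono) auto
        then show ?thesis by (simp add: mult_ac)
      qed
      finally show "measure M {\<omega>\<in>space M. (\<Sum>i<n. ?Z i \<omega>) \<le> real n * (b * ?d)} \<le> exp (- a * (real n * ?d / T))" .
    qed
  qed
  with ab show ?thesis by blast
qed

section \<open>Consistency\<close>

text \<open>\<open>n \<ge> 3 > exp 1\<close> gives \<open>ln n \<ge> 1\<close>. A rate below 1 then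
  gives \<open>T n \<le> n * h ^ (2 * d)\<close>, and with it a bound on inverse powers of the mesh
  that is polynomial in \<open>n\<close>.\<close>

lemma rate_facts:
  assumes T: "\<forall>\<^sub>F n in sequentially. T n \<ge> 1"
    and R: "(\<lambda>n. T n * ln (real n) / (real n * h n ^ (2 * CARD('d)))) \<longlonglongrightarrow> 0"
  shows "\<forall>\<^sub>F n in sequentially. n \<ge> 3 \<and> ln (real n) \<ge> 1 \<and> h n \<le> 1 \<and> T n \<ge> 1 \<and> T n \<le> real n * h n ^ (2 * CARD('d))"
  using T order_tendstoD(2)[OF R zero_less_one] eventually_ge_at_top[of 3] eventually_mesh_less[OF zero_less_one]
proof eventually_elim
  case (elim n)
  have ln1: "ln (real n) \<ge> 1" using elim(3) exp_le by (subst ln_ge_iff) auto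
  have pos: "real n * h n ^ (2 * CARD('d)) > 0" using elim(3) mesh_pos[of n] by simp
  have "T n * 1 \<le> T n * ln (real n)" using elim(1) ln1 by (intro mult_left_mono) auto
  also have "\<dots> \<le> real n * h n ^ (2 * CARD('d))" using elim(2) pos by (simp add: pos_divide_less_eq)
  finally show ?case using elim ln1 by simp
qed

text \<open>With \<open>S = n * h ^ d / T\<close> the rate says \<open>ln n / h ^ d = o(S)\<close>.
  The logarithm of the cardinality of the net is \<open>O(K * ln n)\<close> with
  \<open>K = O(h ^ (- d))\<close>, that of the grid is \<open>O(ln n)\<close>; both are negligible
  against \<open>a * S\<close>.\<close>

lemma union_bound_vanishes:
  assumes T: "\<forall>\<^sub>F n in sequentially. T n \<ge> 1"
    and R: "(\<lambda>n. T n * ln (real n) / (real n * h n ^ (2 * CARD('d)))) \<longlonglongrightarrow> 0"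
    and a: "a > 0" and w: "w \<ge> 0" and e: "e > 0"
  shows "\<forall>\<^sub>F n in sequentially. (w / h n ^ (2 * CARD('d)) + 1) * (5 * (real n)\<^sup>2) ^ K n * exp (- a * (real n * h n ^ CARD('d) / T n)) \<le> e"
proof -
  obtain CK where CK: "CK > 0" "\<forall>\<^sub>F n in sequentially. real (K n) * h n ^ CARD('d) \<le> CK"
    using basis_size_bound by blast
  define R' where "R' n = T n * ln (real n) / (real n * h n ^ (2 * CARD('d)))" for n
  \<comment> \<open>Chosen so that \<open>(w + 1) * exp (- (a / 2 * L0)) \<le> e\<close>. Half of
    the exponent is kept for this, the other half pays for the cardinalities.\<close>
  define L0 where "L0 = 2 / a * \<bar>ln ((w + 1) / e)\<bar> + 1"
  have L0: "L0 > 0" using a by (simp add: L0_def add_nonneg_pos)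
  have "exp (- (a / 2 * L0)) * (w + 1) \<le> e"
  proof -
    have "a / 2 * L0 \<ge> ln ((w + 1) / e)"
    proof -
      have "a / 2 * L0 = \<bar>ln ((w + 1) / e)\<bar> + a / 2" using a by (simp add: L0_def distrib_left)
      then show ?thesis using a by linarith
    qed
    then have "exp (- (a / 2 * L0)) \<le> exp (- ln ((w + 1) / e))" by simp
    also have "\<dots> = e / (w + 1)" using w e by (simp add: exp_minus)
    finally show ?thesis using w by (simp add: pos_le_divide_eq)
  qed
  note L0e = this
  \<comment> \<open>The first entry serves the cardinalities; the second makes
    \<open>S \<ge> L0\<close>, since \<open>R' n * S = ln n / h ^ d \<ge> 1\<close>.\<close>
  have R0: "\<forall>\<^sub>F n in sequentially. R' n < min (a / 2 / (4 * CK + 1)) (1 / L0)"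
    using order_tendstoD(2)[OF R, of "min (a / 2 / (4 * CK + 1)) (1 / L0)"] a CK(1) L0 by (simp add: R'_def)
  show ?thesis using rate_facts[OF T R] CK(2) R0
  proof eventually_elim
    case (elim n)
    let ?d = "h n ^ CARD('d)" and ?g = "h n ^ (2 * CARD('d))"
    have n: "n \<ge> 3" "ln (real n) \<ge> 1" "h n \<le> 1" "T n \<ge> 1" "T n \<le> real n * ?g" using elim(1) by auto
    have d: "?d > 0" "?g > 0" "?d \<le> 1" using mesh_pos[of n] n(3) by (auto simp: power_le_one)
    have g: "?g = ?d * ?d" by (simp add: power_add[symmetric] mult_2)
    define S where "S = real n * ?d / T n"
    have cancel: "t * l / (N * (D * D)) * (N * D / t) = l / D" if "t \<noteq> 0" "N \<noteq> 0" "D \<noteq> 0" for t l N D :: real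
      using that by (simp add: field_simps)
    have S: "R' n * S = ln (real n) / ?d" unfolding R'_def S_def g by (rule cancel) (use n d(1) mesh_pos[of n] in auto)
    have Spos: "S > 0" using n d by (simp add: S_def)
    have "1 \<le> ln (real n) / ?d" using n(2) d by (simp add: pos_le_divide_eq)
    also have "\<dots> = R' n * S" using S by simp
    also have "\<dots> \<le> 1 / L0 * S" using elim(3) Spos by (intro mult_right_mono) auto
    finally have SL: "S \<ge> L0" using L0 by (simp add: field_simps)
    have n1: "real n * ?g \<ge> 1" using n by linarith
    have c1: "w / ?g + 1 \<le> (w + 1) * real n"
    proof -
      have "w / ?g \<le> w * real n" using n1 d w by (simp add: pos_divide_le_eq mult.assoc mult_left_le_one_le) (metis mult.right_neutral mult_left_mono)
      then show ?thesis using n(1) by (simp add: distrib_right)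
    qed
    have c2: "(5 * (real n)\<^sup>2) ^ K n \<le> exp (4 * real (K n) * ln (real n))"
    proof -
      have "5 * (real n)\<^sup>2 \<le> (real n)\<^sup>2 * (real n)\<^sup>2"
      proof (rule mult_right_mono)
        have "3 * 3 \<le> real n * real n" using n(1) by (intro mult_mono) auto
        then show "5 \<le> (real n)\<^sup>2" by (simp add: power2_eq_square)
      qed simp
      also have "\<dots> = exp (ln (real n)) ^ 4" using n(1) by (simp add: power_add[symmetric])
      also have "\<dots> = exp (4 * ln (real n))" by (simp add: exp_of_nat_mult[symmetric])
      finally have "(5 * (real n)\<^sup>2) ^ K n \<le> exp (4 * ln (real n)) ^ K n" by (intro power_mono) auto
      also have "\<dots> = exp (4 * real (K n) * ln (real n))" by (simp add: exp_of_nat_mult[symmetric] mult_ac)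
      finally show ?thesis .
    qed
    have c3: "(4 * real (K n) + 1) * ln (real n) \<le> a / 2 * S"
    proof -
      have "(4 * real (K n) + 1) * ?d \<le> 4 * CK + 1" using elim(2) d by (simp add: distrib_right)
      then have "(4 * real (K n) + 1) * ?d * (ln (real n) / ?d) \<le> (4 * CK + 1) * (ln (real n) / ?d)"
        using n d by (intro mult_right_mono) auto
      then have "(4 * real (K n) + 1) * ln (real n) \<le> (4 * CK + 1) * (R' n * S)" using d mesh_pos[of n] by (simp add: S)
      also have "\<dots> = ((4 * CK + 1) * R' n) * S" by simp
      also have "\<dots> \<le> a / 2 * S"
      proof (rule mult_right_mono)
        have "R' n \<le> a / 2 / (4 * CK + 1)" using elim(3) by simp
        moreover have "4 * CK + 1 > 0" using CK(1) by simp
        ultimately show "(4 * CK + 1) * R' n \<le> a / 2" by (simp only: pos_le_divide_eq mult.commute[of "R' n"])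
      qed (use Spos in simp)
      finally show ?thesis .
    qed
    have "(w / ?g + 1) * (5 * (real n)\<^sup>2) ^ K n * exp (- a * S) \<le> ((w + 1) * real n) * exp (4 * real (K n) * ln (real n)) * exp (- a * S)"
      using c1 c2 w d by (intro mult_mono) auto
    also have "\<dots> = (w + 1) * exp ((4 * real (K n) + 1) * ln (real n) - a * S)"
    proof -
      have "exp ((4 * real (K n) + 1) * ln (real n) - a * S) = exp (ln (real n)) * exp (4 * real (K n) * ln (real n)) * exp (- a * S)"
        unfolding exp_add[symmetric] by (rule arg_cong[where f=exp]) (simp add: algebra_simps)
      also have "exp (ln (real n)) = real n" using n(1) by simp
      finally show ?thesis by (simp only: mult.assoc)
    qed
    also have "\<dots> \<le> (w + 1) * exp (- (a / 2 * L0))"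
    proof -
      have "a / 2 * L0 \<le> a / 2 * S" using SL a by (intro mult_left_mono) auto
      then have "(4 * real (K n) + 1) * ln (real n) - a * S \<le> - (a / 2 * L0)" using c3 by (simp add: field_simps)
      then show ?thesis using w by (intro mult_left_mono) auto
    qed
    also have "\<dots> \<le> e" using L0e by (simp add: mult.commute)
    finally show ?case by (simp add: S_def)
  qed
qed

text \<open>The exceptional event is fixed before \<open>q\<close> and before the estimate, so the
  bound is uniform in \<open>q\<close> and holds for every minimizer.\<close>

lemma consistency:
  assumes rate: "(\<lambda>n. ln (real n) powr (\<nu> / (\<nu> - 1)) / (real n * h n powr (2 * \<nu> / (\<nu> - 1) * real CARD('d))))
         \<in> o(\<lambda>_. 1) \<or>
       (\<lambda>n. ln (real n) powr (3 / 2) / (real n * h n ^ (2 * CARD('d)))) \<in> o(\<lambda>_. 1) \<and>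
         cond_sub_gaussian X L \<psi>bar"
    and \<epsilon>: "\<epsilon> > 0" and e: "e > 0"
  shows "\<forall>\<^sub>F n in sequentially. \<exists>B\<in>sets M. measure M B \<le> e \<and>
    (\<forall>\<omega>\<in>space M - B. \<forall>q\<in>Q. \<forall>b. m_estimate \<rho> \<eta> n (\<lambda>i. x i \<omega>) (\<lambda>i. y i \<omega>) (K n) (p n) (euclid (K n)) q b \<longrightarrow>
       L2_set (\<lambda>k. b k - \<beta>0 n q k) {..<K n} \<le> \<epsilon>)"
proof (cases "Q = {}")
  case True then show ?thesis by (intro always_eventually allI bexI[of _ "{}"]) (use e in auto)
next
  case False
  interpret M: prob_space M by (rule dgp_facts)
  let ?dim = "CARD('d)"
  \<comment> \<open>A compact connected set of reals is an interval, possibly empty; this is what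
    makes a grid on \<open>Q\<close> possible.\<close>
  obtain qa qb where Q: "Q = {qa..qb}" using connected_compact_interval_1[of Q] loss_facts(2,3) by blast
  then have qab: "qa \<le> qb" using False by simp
  obtain T C\<tau> where C\<tau>: "C\<tau> > 0" and T1: "\<forall>\<^sub>F n in sequentially. T n \<ge> 1"
    and R: "(\<lambda>n. T n * ln (real n) / (real n * h n ^ (2 * CARD('d)))) \<longlonglongrightarrow> 0"
    and tail: "\<forall>\<^sub>F n in sequentially. \<forall>i. (\<integral>\<^sup>+\<omega>. ennreal (excess (T n) i \<omega>) \<partial>M)
        \<le> ennreal (C\<tau> * h n ^ (2 * CARD('d)))"
    using truncation_level[OF rate] by (elim exE conjE) (rule that)
  obtain A C where A: "A > 0" and C: "C > 0" and cmp0: "\<forall>n T q0 q q1 u u' z t. T \<ge> 1 \<longrightarrow> q0 \<in> Q \<longrightarrow> q \<in> Q \<longrightarrow> q0 \<le> q \<longrightarrow> q \<le> q1 \<longrightarrow> z \<in> X \<longrightarrow> t \<in> Y \<longrightarrow>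
     \<bar>lin n (\<beta>0 n q0) z - \<mu>0 z q0\<bar> \<le> r/2 \<longrightarrow> \<bar>lin n (\<beta>0 n q0) z - \<mu>0 z q\<bar> \<le> r/2 \<longrightarrow> \<bar>lin n u z\<bar> \<le> r/2 \<longrightarrow> \<bar>lin n u' z\<bar> \<le> r/2 \<longrightarrow>
     rdiff n q (\<beta>0 n q0) u (z, t) \<ge> incr A n T q0 q1 u' (z, t)
       - C * (T + 1) * \<bar>lin n u z - lin n u' z\<bar> - C * ((\<psi>bar z t + 1) * of_bool (\<psi>bar z t > T)) - C * (q - q0)"
    using rdiff_ge_incr by (elim exE conjE) (rule that)
  note cmp = cmp0[rule_format]
  obtain Cp where Cp: "Cp > 0" "\<forall>\<^sub>F n in sequentially. \<forall>z\<in>X. L2_set (\<lambda>k. p n k z) {..<K n} \<le> Cp"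
    using basis_bound by blast
  obtain Ca where Ca: "Ca > 0" "\<forall>\<^sub>F n in sequentially. \<forall>q\<in>Q. \<forall>z\<in>X. \<bar>lin n (\<beta>0 n q) z - \<mu>0 z q\<bar> \<le> Ca * h n ^ m"
    using approx_mu0 by blast
  obtain Cl where Cl: "Cl > 0" "\<And>z q q'. z \<in> X \<Longrightarrow> q \<in> Q \<Longrightarrow> q' \<in> Q \<Longrightarrow> \<bar>\<mu>0 z q - \<mu>0 z q'\<bar> \<le> Cl * \<bar>q - q'\<bar>"
    using mu0_lipschitz by blast
  obtain CK where CK: "CK > 0" "\<forall>\<^sub>F n in sequentially. real (K n) * h n ^ CARD('d) \<le> CK"
    using basis_size_bound by blast
  obtain CB where CB: "CB > 0" "\<forall>\<^sub>F n in sequentially. \<forall>q\<in>Q. \<forall>q'\<in>Q.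
     (L2_set (\<lambda>k. \<beta>0 n q k - \<beta>0 n q' k) {..<K n})\<^sup>2 * h n ^ CARD('d) \<le> CB * (h n ^ m + \<bar>q - q'\<bar>)\<^sup>2"
    using beta0_modulus by blast
  have r: "r > 0" by (rule loss_facts)
  \<comment> \<open>At most 1 to lie in the ball covered by the net, at most half of the target, and
    so small that vectors of norm up to \<open>2 * \<delta>\<close> have combinations of size at
    most \<open>r / 2\<close>: net points near the sphere may be that long.\<close>
  define \<delta> where "\<delta> = min (min 1 (\<epsilon> / 2)) (r / (4 * Cp))"
  have \<delta>: "\<delta> > 0" "\<delta> \<le> 1" "\<delta> \<le> \<epsilon> / 2" "Cp * (2 * \<delta>) \<le> r / 2"
  proof -
    show "\<delta> > 0" "\<delta> \<le> 1" "\<delta> \<le> \<epsilon> / 2" using \<epsilon> r Cp(1) by (auto simp: \<delta>_def)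
    have "\<delta> \<le> r / (4 * Cp)" by (simp add: \<delta>_def)
    then show "Cp * (2 * \<delta>) \<le> r / 2" using Cp(1) by (simp add: field_simps)
  qed
  obtain a b where a: "a > 0" and b: "b > 0" and lower: "\<forall>\<^sub>F n in sequentially. \<forall>T\<ge>1. \<forall>q\<in>Q. \<forall>q'\<in>Q. \<forall>u\<in>euclid (K n).
     q \<le> q' \<longrightarrow> q' - q \<le> h n ^ (2 * CARD('d)) \<longrightarrow> (\<forall>z\<in>X. \<bar>lin n u z\<bar> \<le> r/2) \<longrightarrow> \<delta>/2 \<le> L2_set u {..<K n} \<longrightarrow>
     (\<forall>i. (\<integral>\<^sup>+\<omega>. ennreal (excess T i \<omega>) \<partial>M) \<le> ennreal (C\<tau> * h n ^ (2 * CARD('d)))) \<longrightarrow>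
     measure M {\<omega>\<in>space M. (\<Sum>i<n. incr A n T q q' u (x i \<omega>, y i \<omega>)) \<le> real n * (b * h n ^ CARD('d))} \<le> exp (- a * (real n * h n ^ CARD('d) / T))"
    using increment_lower_tail[of A "\<delta>/2" C\<tau>] A \<delta>(1) C\<tau> by (elim meta_impE exE conjE) (auto intro: that)
  \<comment> \<open>Outside the bad event the total excess then costs at most a quarter of the
    guaranteed \<open>n * b * h ^ d\<close>.\<close>
  define \<kappa> where "\<kappa> = b / (4 * C)"
  have \<kappa>: "\<kappa> > 0" "C * \<kappa> = b / 4" using b C by (auto simp: \<kappa>_def)
  have union: "\<forall>\<^sub>F n in sequentially. ((qb - qa) / h n ^ (2 * ?dim) + 1) * (5 * (real n)\<^sup>2) ^ K n * exp (- a * (real n * h n ^ ?dim / T n)) \<le> e / 2"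
    using union_bound_vanishes[OF T1 R a, of "qb - qa" "e / 2"] qab e by simp
  \<comment> \<open>The first six entries serve, in this order, the net error, the grid error, the
    Markov bound, the distance of the centre from \<open>\<mu>0\<close>, the variation of
    \<open>\<beta>0\<close> within a grid cell, and the distance of the net from the sphere. The
    sixth is applied to \<open>1 / n\<close>, the others to the mesh.\<close>
  define e1 where "e1 = Min {b / (4 * (2 * C * Cp * sqrt CK)), b / (4 * C), e * \<kappa> / (2 * C\<tau>), r / (2 * (Ca + Cl)), (\<epsilon> / 2)\<^sup>2 / (4 * CB), \<delta> / (2 * sqrt CK), 1}"
  have e1: "e1 > 0" unfolding e1_def using b C Cp CK e \<kappa> C\<tau> r Ca Cl \<epsilon> CB \<delta> by (subst Min_gr_iff) auto
  have small_n: "\<forall>\<^sub>F n in sequentially. 1 / real n < e1"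
    using order_tendstoD(2)[OF lim_1_over_n e1] by simp
  show ?thesis
    using rate_facts[OF T1 R] tail Cp(2) Ca(2) CK(2) CB(2) lower union eventually_mesh_less[OF e1] small_n
  proof eventually_elim
    case (elim n)
    let ?d = "h n ^ ?dim" and ?g = "h n ^ (2 * ?dim)"
    have n: "n \<ge> 3" "ln (real n) \<ge> 1" "h n \<le> 1" "T n \<ge> 1" "T n \<le> real n * ?g" using elim(1) by auto
    have d: "?d > 0" "?g > 0" "?d \<le> 1" using mesh_pos[of n] n(3) by (auto simp: power_le_one)
    have hm: "h n ^ m \<le> h n" "?g \<le> h n" "?d \<le> h n" "h n ^ m > 0"
    proof -
      have "m > 0" using smooth by (cases m) auto
      then show "h n ^ m \<le> h n" "?g \<le> h n" "?d \<le> h n" "h n ^ m > 0"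
        using mesh_pos[of n] n(3) power_decreasing[of 1 _ "h n"] by (auto simp: Suc_le_eq)
    qed
    have pm: "?g \<le> ?d * h n" "h n ^ (2 * m) \<le> ?d * h n" using power_mesh_le[OF n(3)] by auto
    have he: "h n \<le> e1" using elim(9) by simp
    have e1s: "e1 \<le> b / (4 * (2 * C * Cp * sqrt CK))" "e1 \<le> b / (4 * C)" "e1 \<le> e * \<kappa> / (2 * C\<tau>)" "e1 \<le> r / (2 * (Ca + Cl))"
      "e1 \<le> (\<epsilon> / 2)\<^sup>2 / (4 * CB)" "e1 \<le> \<delta> / (2 * sqrt CK)"
      unfolding e1_def by (rule Min_le; simp)+
    have linb: "\<bar>lin n u z\<bar> \<le> Cp * L2_set u {..<K n}" if "z \<in> X" for u z
      using lin_bound[of n u z] elim(3) that by (meson L2_set_nonneg mult_right_mono order.trans)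
    \<comment> \<open>The scale is dictated by the Lipschitz factor
      \<open>T n + 1 \<le> 2 * n * h ^ (2 * d)\<close>: \<open>sqrt (K n)\<close> being
      \<open>O(n)\<close>, the net has radius \<open>O(1 / n)\<close>, and the product of the two is
      \<open>O(h ^ (2 * d))\<close>.\<close>
    obtain U where U: "finite U" "U \<subseteq> euclid (K n)" "real (card U) \<le> (5 * 1 / (1 / (real n)\<^sup>2)) ^ K n"
      and Unet: "\<And>u. L2_set u {..<K n} \<le> 1 \<Longrightarrow> \<exists>u'\<in>U. L2_set (\<lambda>k. u k - u' k) {..<K n} \<le> sqrt (K n) * (1 / (real n)\<^sup>2)"
      using euclid_ball_net[of "1 / (real n)\<^sup>2" 1 "K n"] n(1) by auto
    have sqrtK: "sqrt (K n) \<le> sqrt CK * real n"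
    proof -
      have "real (K n) \<le> CK / ?d" using elim(5) d by (simp add: pos_le_divide_eq)
      also have "\<dots> \<le> CK / ?g" using d CK(1) power_decreasing[of ?dim "2 * ?dim" "h n"] n(3) mesh_pos[of n] by (intro divide_left_mono) auto
      also have "\<dots> \<le> CK * real n" using n d CK(1) by (simp add: pos_divide_le_eq)
      also have "\<dots> \<le> CK * (real n)\<^sup>2" using n(1) CK(1) by (intro mult_left_mono) (auto simp: power2_eq_square)
      finally have "sqrt (K n) \<le> sqrt (CK * (real n)\<^sup>2)" by simp
      then show ?thesis by (simp add: real_sqrt_mult)
    qed
    have netr: "sqrt (K n) * (1 / (real n)\<^sup>2) \<le> sqrt CK / real n"
    proof -
      have "sqrt (K n) * (1 / (real n)\<^sup>2) \<le> (sqrt CK * real n) * (1 / (real n)\<^sup>2)" using sqrtK by (intro mult_right_mono) auto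
      then show ?thesis using n(1) by (simp add: power2_eq_square)
    qed
    \<comment> \<open>Net points close to the sphere belong to this annulus. The lower bound is what
      the tail inequality asks, the upper one keeps \<open>lin n u\<close> within
      \<open>r / 2\<close>.\<close>
    define U' where "U' = {u \<in> U. \<delta> / 2 \<le> L2_set u {..<K n} \<and> L2_set u {..<K n} \<le> 2 * \<delta>}"
    have U'fin: "finite U'" using U(1) by (simp add: U'_def)
    have U'b: "\<bar>lin n u z\<bar> \<le> r/2" if "u \<in> U'" "z \<in> X" for u z
    proof -
      have "\<bar>lin n u z\<bar> \<le> Cp * L2_set u {..<K n}" by (rule linb[OF that(2)])
      also have "\<dots> \<le> Cp * (2 * \<delta>)" using that(1) Cp(1) by (intro mult_left_mono) (auto simp: U'_def)
      finally show ?thesis using \<delta>(4) by simp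
    qed
    \<comment> \<open>Capping at \<open>qb\<close> keeps the grid inside \<open>Q\<close>; the right
      end of the cell with index \<open>J\<close> is then \<open>qb\<close> itself.\<close>
    define gq where "gq j = min qb (qa + real j * ?g)" for j
    define J where "J = nat \<lfloor>(qb - qa) / ?g\<rfloor>"
    have gqQ: "gq j \<in> Q" for j using qab d by (auto simp: gq_def Q)
    have gqmono: "gq j \<le> gq (Suc j)" "gq (Suc j) - gq j \<le> ?g" for j using d by (auto simp: gq_def distrib_right min_def)
    have gqcov: "\<exists>j\<le>J. gq j \<le> q \<and> q \<le> gq (Suc j)" if "q \<in> Q" for q
    proof -
      define j where "j = nat \<lfloor>(q - qa) / ?g\<rfloor>"
      have q: "qa \<le> q" "q \<le> qb" using that Q by auto
      have "\<lfloor>(q - qa) / ?g\<rfloor> \<ge> 0" using q d by simp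
      then have j: "real j \<le> (q - qa) / ?g" "(q - qa) / ?g \<le> real j + 1" unfolding j_def by (auto simp: of_nat_nat)
      then have "real j * ?g \<le> q - qa" "q - qa \<le> (real j + 1) * ?g" using d by (auto simp: field_simps)
      then have "gq j \<le> q" "q \<le> gq (Suc j)" using q by (auto simp: gq_def min_def algebra_simps)
      moreover have "j \<le> J" unfolding j_def J_def using q d by (intro nat_mono floor_mono divide_right_mono) auto
      ultimately show ?thesis by blast
    qed
    define Zs where "Zs j u \<omega> = (\<Sum>i<n. incr A n (T n) (gq j) (gq (Suc j)) u (x i \<omega>, y i \<omega>))" for j u \<omega>
    define bad where "bad j u = {\<omega>\<in>space M. Zs j u \<omega> \<le> real n * (b * ?d)}" for j u
    let ?t = "\<lambda>i \<omega>. excess (T n) i \<omega>"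
    \<comment> \<open>The excess depends neither on the cell nor on the direction, so Markov's
      inequality for its sum is used once, outside the union bound.\<close>
    define bad2 where "bad2 = {\<omega>\<in>space M. (\<Sum>i<n. ?t i \<omega>) \<ge> real n * (\<kappa> * ?d)}"
    define B where "B = (\<Union>(j, u)\<in>{..J} \<times> U'. bad j u) \<union> bad2"
    have [measurable]: "(\<lambda>\<omega>. incr A n (T n) (gq j) (gq (Suc j)) u (x i \<omega>, y i \<omega>)) \<in> borel_measurable M" for i j u
      by (rule measurable_compose[OF measurable_data incr_measurable[OF gqQ]])
    note [measurable] = psibar_data_measurable
    have badm: "bad j u \<in> sets M" for j u unfolding bad_def Zs_def by measurable
    have bad2m: "bad2 \<in> sets M" unfolding bad2_def by measurable
    have Bm: "B \<in> sets M" unfolding B_def using badm bad2m U'fin by (intro sets.Un sets.finite_UN) auto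
    have pbad: "measure M (bad j u) \<le> exp (- a * (real n * ?d / T n))" if "u \<in> U'" for j u
    proof -
      have uU: "u \<in> euclid (K n)" "\<delta> / 2 \<le> L2_set u {..<K n}" using that U(2) by (auto simp: U'_def)
      show ?thesis unfolding bad_def Zs_def
        using elim(7)[rule_format, OF n(4) gqQ gqQ uU(1) gqmono U'b[OF that] uU(2) elim(2)[rule_format]] .
    qed
    have p1: "measure M (\<Union>(j, u)\<in>{..J} \<times> U'. bad j u) \<le> e / 2"
    proof -
      have "measure M (\<Union>(j, u)\<in>{..J} \<times> U'. bad j u) \<le> (\<Sum>(j, u)\<in>{..J} \<times> U'. measure M (bad j u))"
        using M.finite_measure_subadditive_finite[of "{..J} \<times> U'" "\<lambda>(j, u). bad j u"] U'fin badm by (auto simp: case_prod_beta')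
      also have "\<dots> \<le> (\<Sum>(j, u)\<in>{..J} \<times> U'. exp (- a * (real n * ?d / T n)))"
        using pbad by (intro sum_mono) auto
      also have "\<dots> = (real J + 1) * real (card U') * exp (- a * (real n * ?d / T n))"
        by (simp add: card_cartesian_product case_prod_beta' distrib_right)
      also have "\<dots> \<le> ((qb - qa) / ?g + 1) * (5 * (real n)\<^sup>2) ^ K n * exp (- a * (real n * ?d / T n))"
      proof (intro mult_right_mono mult_mono)
        show "real J + 1 \<le> (qb - qa) / ?g + 1" using qab d unfolding J_def by (simp add: of_nat_nat)
        have "card U' \<le> card U" using U(1) by (intro card_mono) (auto simp: U'_def)
        then show "real (card U') \<le> (5 * (real n)\<^sup>2) ^ K n" using U(3) by simp
      qed (use qab d in auto)
      also have "\<dots> \<le> e / 2" by (rule elim(8))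
      finally show ?thesis .
    qed
    have p2: "measure M bad2 \<le> e / 2"
    proof -
      have tnn: "?t i \<omega> \<ge> 0" if "\<omega> \<in> space M" for i \<omega> using psibar_data_nonneg[OF that] by simp
      have it: "integrable M (?t i)" for i
        by (rule integrableI_nonneg) (auto intro: order.strict_trans1[OF elim(2)[rule_format]] simp: psibar_data_nonneg)
      have Et: "(\<integral>\<omega>. ?t i \<omega> \<partial>M) \<le> C\<tau> * ?g" for i
        using elim(2)[rule_format, of i] C\<tau> d by (subst (asm) nn_integral_eq_integral[OF it]) (auto simp: psibar_data_nonneg)
      have ts: "integrable M (\<lambda>\<omega>. \<Sum>i<n. ?t i \<omega>)" using it by (intro Bochner_Integration.integrable_sum) auto
      have tsnn: "AE \<omega> in M. 0 \<le> (\<Sum>i<n. ?t i \<omega>)" by (intro AE_I2 sum_nonneg tnn)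
      have pos: "real n * (\<kappa> * ?d) > 0" using n(1) \<kappa> d by simp
      have "measure M bad2 \<le> (\<integral>\<omega>. (\<Sum>i<n. ?t i \<omega>) \<partial>M) / (real n * (\<kappa> * ?d))"
        unfolding bad2_def
        by (rule integral_Markov_inequality_measure[where A="{}", OF ts]; (rule tsnn | rule pos | simp))
      also have "(\<integral>\<omega>. (\<Sum>i<n. ?t i \<omega>) \<partial>M) = (\<Sum>i<n. \<integral>\<omega>. ?t i \<omega> \<partial>M)"
        using it by (intro Bochner_Integration.integral_sum) auto
      also have "(\<Sum>i<n. \<integral>\<omega>. ?t i \<omega> \<partial>M) \<le> (\<Sum>i<n. C\<tau> * ?g)" using Et by (intro sum_mono) auto
      also have "(\<Sum>i<n. C\<tau> * ?g) = real n * (C\<tau> * ?g)" by simp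
      also have "real n * (C\<tau> * ?g) / (real n * (\<kappa> * ?d)) = C\<tau> * ?g / (\<kappa> * ?d)" using n(1) by simp
      also have "\<dots> \<le> C\<tau> * (?d * h n) / (\<kappa> * ?d)" using pm(1) C\<tau> \<kappa> d by (intro divide_right_mono mult_left_mono) auto
      also have "\<dots> = C\<tau> / \<kappa> * h n" using d by simp
      also have "\<dots> \<le> C\<tau> / \<kappa> * (e * \<kappa> / (2 * C\<tau>))" using he e1s(3) C\<tau> \<kappa> by (intro mult_left_mono) auto
      also have "\<dots> = e / 2" using C\<tau> \<kappa> by simp
      finally show ?thesis using pos by (simp add: divide_right_mono)
    qed
    have "measure M B \<le> e"
    proof -
      have "measure M B \<le> measure M (\<Union>(j, u)\<in>{..J} \<times> U'. bad j u) + measure M bad2"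
        unfolding B_def using badm bad2m U'fin by (intro measure_Un_le sets.finite_UN) auto
      then show ?thesis using p1 p2 by linarith
    qed
    moreover have "L2_set (\<lambda>k. bb k - \<beta>0 n q k) {..<K n} \<le> \<epsilon>"
      if \<omega>: "\<omega> \<in> space M - B" and q: "q \<in> Q" and est: "m_estimate \<rho> \<eta> n (\<lambda>i. x i \<omega>) (\<lambda>i. y i \<omega>) (K n) (p n) (euclid (K n)) q bb" for \<omega> q bb
    proof -
      obtain j where j: "j \<le> J" "gq j \<le> q" "q \<le> gq (Suc j)" using gqcov[OF q] by blast
      define q0 where "q0 = gq j"
      have q0: "q0 \<in> Q" "q0 \<le> q" "q - q0 \<le> ?g" using gqQ j gqmono(2)[of j] by (auto simp: q0_def)
      have xy: "x i \<omega> \<in> X" "y i \<omega> \<in> Y" for i using \<omega> dgp_facts(3) by auto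
      define F where "F c = (\<Sum>i<n. \<rho> (y i \<omega>) (\<eta> (lin n c (x i \<omega>))) q)" for c
      \<comment> \<open>The centre belongs to \<open>q0\<close> while the loss is taken at
        \<open>q\<close>: the distance is the approximation error plus the variation of
        \<open>\<mu>0\<close> over one grid cell.\<close>
      have near: "\<bar>lin n (\<beta>0 n q0) z - \<mu>0 z q0\<bar> \<le> r/2" "\<bar>lin n (\<beta>0 n q0) z - \<mu>0 z q\<bar> \<le> r/2" if "z \<in> X" for z
      proof -
        have hh: "(Ca + Cl) * h n \<le> r / 2"
        proof -
          have "(Ca + Cl) * h n \<le> (Ca + Cl) * (r / (2 * (Ca + Cl)))" using he e1s(4) Ca Cl by (intro mult_left_mono) auto
          also have "\<dots> = r / 2"
          proof -
            have "S * (r / (2 * S)) = r / 2" if "S > 0" for S :: real using that by simp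
            then show ?thesis using Ca(1) Cl(1) by (meson add_pos_pos)
          qed
          finally show ?thesis .
        qed
        have 1: "\<bar>lin n (\<beta>0 n q0) z - \<mu>0 z q0\<bar> \<le> Ca * h n"
          using elim(4)[rule_format, OF q0(1) that] mult_left_mono[OF hm(1), of Ca] Ca(1) by linarith
        have "\<bar>\<mu>0 z q0 - \<mu>0 z q\<bar> \<le> Cl * \<bar>q0 - q\<bar>" by (rule Cl(2)[OF that q0(1) q])
        also have "\<dots> \<le> Cl * h n" using q0 hm(2) Cl(1) by (intro mult_left_mono) auto
        finally have 2: "\<bar>\<mu>0 z q0 - \<mu>0 z q\<bar> \<le> Cl * h n" .
        have "Cl * h n \<ge> 0" using Cl(1) mesh_pos[of n] by simp
        then show "\<bar>lin n (\<beta>0 n q0) z - \<mu>0 z q0\<bar> \<le> r/2" "\<bar>lin n (\<beta>0 n q0) z - \<mu>0 z q\<bar> \<le> r/2"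
          using 1 2 hh unfolding distrib_right by linarith+
      qed
      have sphere: "F (\<lambda>k. \<beta>0 n q0 k + u k) > F (\<beta>0 n q0)" if u: "u \<in> euclid (K n)" "L2_set u {..<K n} = \<delta>" for u
      proof -
        obtain u' where u': "u' \<in> U" "L2_set (\<lambda>k. u k - u' k) {..<K n} \<le> sqrt CK / real n"
          using Unet[of u] u(2) \<delta>(2) netr by fastforce
        have close: "sqrt CK / real n \<le> \<delta> / 2"
        proof -
          have "sqrt CK / real n = sqrt CK * (1 / real n)" by simp
          also have "\<dots> \<le> sqrt CK * (\<delta> / (2 * sqrt CK))" using elim(10) e1s(6) CK(1) by (intro mult_left_mono) auto
          finally show ?thesis using CK(1) by simp
        qed
        have "u' \<in> U'"
        proof -
          have "L2_set u {..<K n} \<le> L2_set u' {..<K n} + L2_set (\<lambda>k. u k - u' k) {..<K n}" by (rule L2_set_le_add_diff)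
          moreover have "L2_set u' {..<K n} \<le> L2_set u {..<K n} + L2_set (\<lambda>k. u' k - u k) {..<K n}" by (rule L2_set_le_add_diff)
          moreover have "L2_set (\<lambda>k. u' k - u k) {..<K n} = L2_set (\<lambda>k. u k - u' k) {..<K n}" by (rule L2_set_diff_commute)
          ultimately have "\<delta> / 2 \<le> L2_set u' {..<K n}" "L2_set u' {..<K n} \<le> 2 * \<delta>"
            using u'(2) u(2) close \<delta>(1) by linarith+
          then show ?thesis using u'(1) by (simp add: U'_def)
        qed
        have lu: "\<bar>lin n u z\<bar> \<le> r/2" if "z \<in> X" for z
        proof -
          have "\<bar>lin n u z\<bar> \<le> Cp * \<delta>" using linb[OF that, of u] u(2) by simp
          also have "\<dots> \<le> Cp * (2 * \<delta>)" using Cp(1) \<delta>(1) by simp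
          finally show ?thesis using \<delta>(4) by simp
        qed
        have luu: "\<bar>lin n u z - lin n u' z\<bar> \<le> Cp * (sqrt CK / real n)" if "z \<in> X" for z
        proof -
          have "\<bar>lin n u z - lin n u' z\<bar> \<le> Cp * L2_set (\<lambda>k. u k - u' k) {..<K n}"
            unfolding lin_diff[symmetric] by (rule linb[OF that])
          also have "\<dots> \<le> Cp * (sqrt CK / real n)" using u'(2) Cp(1) by (intro mult_left_mono) auto
          finally show ?thesis .
        qed
        define e3 where "e3 = 2 * C * Cp * sqrt CK * ?g"
        have pos3: "2 * C * Cp * sqrt CK > 0" using C Cp(1) CK(1) by simp
        have net: "C * (T n + 1) * \<bar>lin n u z - lin n u' z\<bar> \<le> e3" if "z \<in> X" for z
        proof -
          have "C * (T n + 1) * \<bar>lin n u z - lin n u' z\<bar> \<le> C * (2 * (real n * ?g)) * (Cp * (sqrt CK / real n))"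
            using luu[OF that] n C Cp(1) by (intro mult_mono) auto
          also have "\<dots> = e3" using n(1) by (simp add: e3_def)
          finally show ?thesis .
        qed
        \<comment> \<open>Net and grid errors are now deterministic of order
          \<open>h ^ (2 * d)\<close>; the excess remains random and is controlled after
          summation.\<close>
        have point: "rdiff n q (\<beta>0 n q0) u (x i \<omega>, y i \<omega>) \<ge> incr A n (T n) (gq j) (gq (Suc j)) u' (x i \<omega>, y i \<omega>) - (e3 + C * ?g) - C * ?t i \<omega>" for i
        proof -
          have "C * (q - q0) \<le> C * ?g" using q0(3) C by (intro mult_left_mono) auto
          moreover note net[OF xy(1)[of i]]
          moreover have "rdiff n q (\<beta>0 n q0) u (x i \<omega>, y i \<omega>) \<ge> incr A n (T n) q0 (gq (Suc j)) u' (x i \<omega>, y i \<omega>)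
             - C * (T n + 1) * \<bar>lin n u (x i \<omega>) - lin n u' (x i \<omega>)\<bar> - C * ?t i \<omega> - C * (q - q0)"
            by (rule cmp[OF n(4) q0(1) q q0(2) j(3) xy near[OF xy(1)] lu[OF xy(1)] U'b[OF \<open>u' \<in> U'\<close> xy(1)]])
          ultimately show ?thesis unfolding q0_def by linarith
        qed
        have "\<omega> \<notin> bad j u'" "\<omega> \<notin> bad2" using \<omega> j(1) \<open>u' \<in> U'\<close> by (auto simp: B_def)
        then have Zlow: "Zs j u' \<omega> > real n * (b * ?d)" and tup: "(\<Sum>i<n. ?t i \<omega>) < real n * (\<kappa> * ?d)"
          using \<omega> by (auto simp: bad_def bad2_def not_le)
        have e3b: "e3 \<le> b / 4 * ?d"
        proof -
          have "e3 \<le> 2 * C * Cp * sqrt CK * (?d * h n)" unfolding e3_def using pm(1) pos3 by (intro mult_left_mono) auto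
          also have "\<dots> \<le> 2 * C * Cp * sqrt CK * (?d * (b / (4 * (2 * C * Cp * sqrt CK))))"
            using he e1s(1) pos3 d by (intro mult_left_mono) auto
          also have "\<dots> = b / 4 * ?d" using C Cp(1) CK(1) by simp
          finally show ?thesis .
        qed
        have Cgb: "C * ?g \<le> b / 4 * ?d"
        proof -
          have "C * ?g \<le> C * (?d * h n)" using pm(1) C by (intro mult_left_mono) auto
          also have "\<dots> \<le> C * (?d * (b / (4 * C)))" using he e1s(2) C d by (intro mult_left_mono) auto
          also have "\<dots> = b / 4 * ?d" using C by simp
          finally show ?thesis .
        qed
        have tup': "C * (\<Sum>i<n. ?t i \<omega>) \<le> real n * (b / 4 * ?d)"
        proof -
          have "C * (\<Sum>i<n. ?t i \<omega>) \<le> C * (real n * (\<kappa> * ?d))" using tup C by (intro mult_left_mono) auto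
          also have "\<dots> = real n * ((C * \<kappa>) * ?d)" by (simp add: mult_ac)
          finally show ?thesis by (simp only: \<kappa>(2))
        qed
        \<comment> \<open>Of the four quarters of \<open>n * b * h ^ d\<close>, the net and grid
          errors use one each and the excess a third; the last one is left over.\<close>
        have "real n * (b / 4 * ?d) > 0" using n(1) b d by simp
        moreover have "real n * (e3 + C * ?g) \<le> real n * (b / 4 * ?d) + real n * (b / 4 * ?d)"
          unfolding distrib_left[symmetric] using e3b Cgb by (intro mult_left_mono) auto
        moreover have "real n * (b * ?d) = real n * (b / 4 * ?d) + real n * (b / 4 * ?d) + real n * (b / 4 * ?d) + real n * (b / 4 * ?d)"
          by simp
        ultimately have "0 < Zs j u' \<omega> - real n * (e3 + C * ?g) - C * (\<Sum>i<n. ?t i \<omega>)"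
          using Zlow tup' by linarith
        also have "\<dots> = (\<Sum>i<n. incr A n (T n) (gq j) (gq (Suc j)) u' (x i \<omega>, y i \<omega>) - (e3 + C * ?g) - C * ?t i \<omega>)"
          by (simp only: Zs_def sum_subtractf sum_distrib_left[symmetric] sum_constant card_lessThan)
        also have "\<dots> \<le> (\<Sum>i<n. rdiff n q (\<beta>0 n q0) u (x i \<omega>, y i \<omega>))" using point by (intro sum_mono) auto
        also have "\<dots> = F (\<lambda>k. \<beta>0 n q0 k + u k) - F (\<beta>0 n q0)"
          by (simp add: F_def rdiff_def lin_add sum_subtractf)
        finally show ?thesis by simp
      qed
      have cvxF: "F (\<lambda>k. (1 - t) * a k + t * b k) \<le> (1 - t) * F a + t * F b" if "0 \<le> t" "t \<le> 1" for a b t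
      proof -
        have "F (\<lambda>k. (1 - t) * a k + t * b k) \<le> (\<Sum>i<n. (1 - t) * \<rho> (y i \<omega>) (\<eta> (lin n a (x i \<omega>))) q + t * \<rho> (y i \<omega>) (\<eta> (lin n b (x i \<omega>))) q)"
          unfolding F_def
        proof (rule sum_mono)
          fix i
          have "lin n (\<lambda>k. (1 - t) * a k + t * b k) (x i \<omega>) = (1 - t) * lin n a (x i \<omega>) + t * lin n b (x i \<omega>)"
            by (simp add: lin_add lin_scale)
          then show "\<rho> (y i \<omega>) (\<eta> (lin n (\<lambda>k. (1 - t) * a k + t * b k) (x i \<omega>))) q \<le> (1 - t) * \<rho> (y i \<omega>) (\<eta> (lin n a (x i \<omega>))) q + t * \<rho> (y i \<omega>) (\<eta> (lin n b (x i \<omega>))) q"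
            using convex_onD[OF cvx[OF xy(2) q] that] by simp
        qed
        also have "\<dots> = (1 - t) * F a + t * F b" by (simp add: F_def sum.distrib sum_distrib_left)
        finally show ?thesis .
      qed
      have minF: "is_arg_min F (\<lambda>b. b \<in> euclid (K n)) bb"
        using est unfolding m_estimate_def F_def[abs_def] lin_def .
      have "L2_set (\<lambda>k. bb k - \<beta>0 n q0 k) {..<K n} < \<delta>"
        by (rule convex_argmin_localized[OF cvxF minF beta0_euclid[OF q0(1)] \<delta>(1) sphere])
      \<comment> \<open>By \<open>power_mesh_le\<close> the right side of the modulus is
        \<open>O(h ^ d * h)\<close>, so that a factor \<open>h\<close> survives the division by
        \<open>h ^ d\<close>.\<close>
      moreover have "L2_set (\<lambda>k. \<beta>0 n q0 k - \<beta>0 n q k) {..<K n} \<le> \<epsilon> / 2"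
      proof -
        let ?l = "L2_set (\<lambda>k. \<beta>0 n q0 k - \<beta>0 n q k) {..<K n}"
        have "?l\<^sup>2 * ?d \<le> CB * (h n ^ m + \<bar>q0 - q\<bar>)\<^sup>2" using elim(6) q0(1) q by blast
        also have "\<dots> \<le> CB * (h n ^ m + ?g)\<^sup>2" using q0 hm(4) CB(1) by (intro mult_left_mono power_mono) auto
        also have "\<dots> \<le> CB * (4 * (?d * h n))"
        proof -
          have "(h n ^ m + ?g)\<^sup>2 \<le> 2 * (h n ^ m)\<^sup>2 + 2 * ?g\<^sup>2"
            using sum_squares_ge_zero[of "h n ^ m - ?g" 0] by (simp add: power2_eq_square algebra_simps)
          moreover have "(h n ^ m)\<^sup>2 \<le> ?d * h n" using pm(2) by (simp add: power_mult[symmetric] mult.commute)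
          moreover have "?g\<^sup>2 \<le> ?d * h n"
          proof -
            have "?g\<^sup>2 \<le> ?g" using d mesh_pos[of n] n(3) by (simp add: power2_eq_square mult_le_cancel_left1 power_le_one)
            then show ?thesis using pm(1) by linarith
          qed
          ultimately show ?thesis using CB(1) by (intro mult_left_mono) auto
        qed
        also have "\<dots> = (4 * CB * h n) * ?d" by simp
        finally have "?l\<^sup>2 \<le> 4 * CB * h n" using d by simp
        also have "\<dots> \<le> 4 * CB * ((\<epsilon> / 2)\<^sup>2 / (4 * CB))" using he e1s(5) CB(1) by (intro mult_left_mono) auto
        also have "\<dots> = (\<epsilon> / 2)\<^sup>2" using CB(1) by simp
        finally show ?thesis using \<epsilon> power2_le_imp_le[of ?l "\<epsilon> / 2"] by simp
      qed
      ultimately show ?thesis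
        using L2_set_diff_triangle[of bb "\<beta>0 n q" "{..<K n}" "\<beta>0 n q0"] \<delta>(3) by linarith
    qed
    ultimately show ?case using Bm by blast
  qed
qed

section \<open>Uniform and integrated errors\<close>

lemma cell_volume:
  assumes "\<delta> \<in> \<Delta> n"
  shows "measure lebesgue \<delta> \<le> unit_ball_vol (real CARD('d)) * h n ^ CARD('d)" "emeasure lebesgue \<delta> < \<infinity>"
proof -
  obtain c where c: "c \<in> \<delta>" using partition_facts(4)[OF assms] by blast
  have b: "bounded \<delta>" by (rule bounded_subset[OF X_bounded partition_facts(5)[OF assms]])
  have sub: "\<delta> \<subseteq> cball c (h n)"
    using diameter_bounded_bound[OF b c] diameter_le_mesh[OF assms] by force
  have o: "\<delta> \<in> sets borel" using partition_facts(3)[OF assms] by simp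
  have em: "emeasure lebesgue \<delta> \<le> ennreal (unit_ball_vol (real CARD('d)) * h n ^ CARD('d))"
  proof -
    have "emeasure lebesgue \<delta> = emeasure lborel \<delta>" using o by (simp add: emeasure_completion)
    also have "\<dots> \<le> emeasure lborel (cball c (h n))" using sub by (intro emeasure_mono) auto
    also have "\<dots> = ennreal (unit_ball_vol (real CARD('d)) * h n ^ CARD('d))"
      using mesh_pos[of n] by (subst emeasure_cball) auto
    finally show ?thesis .
  qed
  then show "emeasure lebesgue \<delta> < \<infinity>" by (rule order.strict_trans1) simp
  show "measure lebesgue \<delta> \<le> unit_ball_vol (real CARD('d)) * h n ^ CARD('d)"
    unfolding measure_def using em mesh_pos[of n] by (intro enn2real_leI) (auto intro!: mult_nonneg_nonneg)
qed

text \<open>Cells are interiors of polyhedra, hence convex, and the frontier of a convex set is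
  negligible. So the conventional values of the derivatives on the cell boundaries do not affect
  integrals.\<close>

lemma AE_in_cell: "AE z in lebesgue. z \<in> X \<longrightarrow> (\<exists>\<delta>\<in>\<Delta> n. z \<in> \<delta>)"
proof -
  have "negligible (\<Union>\<delta>\<in>\<Delta> n. frontier \<delta>)"
    using partition[of n] by (intro negligible_Union) (auto simp: polyhedral_partition_def intro!: negligible_convex_frontier convex_open_polyhedron)
  then have "AE z in lebesgue. z \<notin> (\<Union>\<delta>\<in>\<Delta> n. frontier \<delta>)"
    unfolding negligible_iff_null_sets by (rule AE_not_in)
  then show ?thesis
  proof eventually_elim
    case (elim z)
    show ?case
    proof
      assume "z \<in> X"
      then obtain \<delta> where d: "\<delta> \<in> \<Delta> n" "z \<in> closure \<delta>" using partition_facts(7)[of n] by auto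
      then have "z \<in> interior \<delta>" using elim by (auto simp: frontier_def)
      then show "\<exists>\<delta>\<in>\<Delta> n. z \<in> \<delta>" using d interior_subset by blast
    qed
  qed
qed

text \<open>On a cell only the basis functions active there contribute, whence the factor \<open>h ^ CARD('d)\<close>.\<close>

lemma derivative_gram_upper_bound:
  assumes u: "msize u \<le> s"
  shows "\<exists>C>0. \<forall>\<^sub>F n in sequentially. \<forall>a. \<exists>g. integrable lebesgue g \<and> (\<forall>z. g z \<ge> 0) \<and>
    (AE z in lebesgue. z \<in> X \<longrightarrow> (\<Sum>k<K n. dp n k u z * a k)\<^sup>2 \<le> g z) \<and>
    (\<integral>z. g z \<partial>lebesgue) \<le> C * h n ^ CARD('d) * (h n powi (- int (msize u)))\<^sup>2 * (L2_set a {..<K n})\<^sup>2"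
  (is "\<exists>C>0. \<forall>\<^sub>F n in sequentially. ?P C n")
proof -
  obtain C1 where C1: "C1 > 0" "\<forall>\<^sub>F n in sequentially. \<forall>z\<in>X. L2_set (\<lambda>k. dp n k u z) {..<K n} \<le> C1 * h n powi (- int (msize u))"
    using basis_derivative_bound[OF u] by blast
  obtain C2 where C2: "\<forall>\<^sub>F n in sequentially. \<forall>k<K n.
        card {\<delta> \<in> \<Delta> n. \<delta> \<subseteq> active_region (\<Delta> n) (p n k)} \<le> C2 \<and>
        card {j. j < K n \<and> active_on (p n j) (active_region (\<Delta> n) (p n k))} \<le> C2"
    using basis_facts(1) by blast
  define B where "B = unit_ball_vol (real CARD('d))"
  have B: "B > 0" by (simp add: B_def)
  define C where "C = B * C1\<^sup>2 * (real C2 + 1)"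
  have "\<forall>\<^sub>F n in sequentially. ?P C n"
    using C1(2) C2
  proof eventually_elim
    case (elim n)
    define H where "H = h n powi (- int (msize u))"
    have H: "H > 0" using mesh_pos[of n] by (simp add: H_def)
    have d: "h n ^ CARD('d) > 0" using mesh_pos[of n] by simp
    show ?case
    proof
      fix a :: "nat \<Rightarrow> real"
      define S where "S \<delta> = (\<Sum>k | k < K n \<and> active_on (p n k) \<delta>. (a k)\<^sup>2)" for \<delta>
      define c where "c \<delta> = (C1 * H)\<^sup>2 * S \<delta>" for \<delta>
      \<comment> \<open>A step function, constant on cells, hence integrable without any appeal to
        the measurability of the derivatives.\<close>
      define g where "g z = (\<Sum>\<delta>\<in>\<Delta> n. indicator \<delta> z * c \<delta>)" for z
      have c0: "c \<delta> \<ge> 0" for \<delta> by (auto simp: S_def c_def intro!: sum_nonneg mult_nonneg_nonneg)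
      have ind: "integrable lebesgue (indicator \<delta> :: _ \<Rightarrow> real)" if "\<delta> \<in> \<Delta> n" for \<delta>
        using cell_volume(2)[OF that] partition_facts(3)[OF that] by (intro integrable_real_indicator) auto
      have gi: "integrable lebesgue g" unfolding g_def[abs_def] using ind by (intro Bochner_Integration.integrable_sum integrable_mult_left) auto
      have g0: "g z \<ge> 0" for z unfolding g_def using c0 by (intro sum_nonneg) auto
      have "AE z in lebesgue. z \<in> X \<longrightarrow> (\<Sum>k<K n. dp n k u z * a k)\<^sup>2 \<le> g z"
        using AE_in_cell[of n]
      proof eventually_elim
        case (elim z)
        note ez = elim
        show ?case
        proof
          assume z: "z \<in> X"
          then obtain \<delta> where \<delta>: "\<delta> \<in> \<Delta> n" "z \<in> \<delta>" using ez by blast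
          let ?A = "{k. k < K n \<and> active_on (p n k) \<delta>}"
          have van: "dp n k u z = 0" if "k < K n" "\<not> active_on (p n k) \<delta>" for k
          proof (rule partials_vanish[OF partition_facts(3)[OF \<delta>(1)] dict_facts(3)[OF that(1) \<delta>(1)] _ u \<delta>(2)])
            fix z' assume "z' \<in> \<delta>"
            then show "dp n k (\<lambda>_. 0) z' = 0"
              using dict_facts(2)[OF that(1), of z'] partition_facts(5)[OF \<delta>(1)] that(2) by (auto simp: active_on_def)
          qed
          have "(\<Sum>k<K n. dp n k u z * a k) = (\<Sum>k\<in>?A. dp n k u z * a k)"
            using van by (intro sum.mono_neutral_right) auto
          also have "\<bar>\<dots>\<bar> \<le> (\<Sum>k\<in>?A. \<bar>dp n k u z\<bar> * \<bar>a k\<bar>)" unfolding abs_mult[symmetric] by (rule sum_abs)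
          also have "\<dots> \<le> L2_set (\<lambda>k. dp n k u z) ?A * L2_set a ?A" by (rule L2_set_mult_ineq)
          also have "\<dots> \<le> (C1 * H) * L2_set a ?A"
          proof (rule mult_right_mono)
            have "L2_set (\<lambda>k. dp n k u z) ?A \<le> L2_set (\<lambda>k. dp n k u z) {..<K n}"
              unfolding L2_set_def by (intro real_sqrt_le_mono sum_mono2) auto
            also have "\<dots> \<le> C1 * H" using \<open>\<forall>z\<in>X. L2_set (\<lambda>k. dp n k u z) {..<K n} \<le> C1 * h n powi (- int (msize u))\<close> z by (simp add: H_def)
            finally show "L2_set (\<lambda>k. dp n k u z) ?A \<le> C1 * H" .
          qed simp
          finally have "(\<Sum>k<K n. dp n k u z * a k)\<^sup>2 \<le> ((C1 * H) * L2_set a ?A)\<^sup>2"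
            by (rule abs_le_square_iff[THEN iffD1, OF order.trans[OF _ abs_ge_self]])
          also have "\<dots> = c \<delta>" by (simp add: c_def S_def L2_set_def power_mult_distrib sum_nonneg)
          also have "\<dots> = indicator \<delta> z * c \<delta>" using \<delta> by simp
          also have "\<dots> \<le> g z" unfolding g_def using \<delta> c0 partition_facts(1) by (intro member_le_sum) auto
          finally show "(\<Sum>k<K n. dp n k u z * a k)\<^sup>2 \<le> g z" .
        qed
      qed
      moreover have "(\<integral>z. g z \<partial>lebesgue) \<le> C * h n ^ CARD('d) * H\<^sup>2 * (L2_set a {..<K n})\<^sup>2"
      proof -
        have "(\<integral>z. g z \<partial>lebesgue) = (\<Sum>\<delta>\<in>\<Delta> n. measure lebesgue \<delta> * c \<delta>)"
          unfolding g_def using ind by (subst Bochner_Integration.integral_sum) (auto intro!: integrable_mult_left)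
        also have "\<dots> \<le> (\<Sum>\<delta>\<in>\<Delta> n. (B * h n ^ CARD('d)) * c \<delta>)"
          using cell_volume(1) c0 by (intro sum_mono mult_right_mono) (auto simp: B_def)
        also have "\<dots> = (B * h n ^ CARD('d)) * (C1 * H)\<^sup>2 * (\<Sum>\<delta>\<in>\<Delta> n. S \<delta>)"
          by (simp add: c_def sum_distrib_left mult.assoc)
        also have "\<dots> \<le> (B * h n ^ CARD('d)) * (C1 * H)\<^sup>2 * ((real C2 + 1) * (L2_set a {..<K n})\<^sup>2)"
        proof (rule mult_left_mono)
          \<comment> \<open>After exchanging the sums, each squared coefficient is counted once for
            every cell on which its basis function is active, thus at most \<open>C2\<close>
            times.\<close>
          have "(\<Sum>\<delta>\<in>\<Delta> n. S \<delta>) = (\<Sum>\<delta>\<in>\<Delta> n. \<Sum>k<K n. if active_on (p n k) \<delta> then (a k)\<^sup>2 else 0)"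
            unfolding S_def by (intro sum.cong[OF refl]) (simp add: sum.If_cases Int_def)
          also have "\<dots> = (\<Sum>k<K n. \<Sum>\<delta>\<in>\<Delta> n. if active_on (p n k) \<delta> then (a k)\<^sup>2 else 0)" by (rule sum.swap)
          also have "\<dots> \<le> (\<Sum>k<K n. (real C2 + 1) * (a k)\<^sup>2)"
          proof (rule sum_mono)
            fix k assume "k \<in> {..<K n}"
            then have k: "k < K n" by simp
            have "(\<Sum>\<delta>\<in>\<Delta> n. if active_on (p n k) \<delta> then (a k)\<^sup>2 else 0) = real (card {\<delta> \<in> \<Delta> n. active_on (p n k) \<delta>}) * (a k)\<^sup>2"
              using partition_facts(1) by (simp add: sum.If_cases Int_def)
            also have "\<dots> \<le> (real C2 + 1) * (a k)\<^sup>2"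
            proof (rule mult_right_mono)
              have "card {\<delta> \<in> \<Delta> n. active_on (p n k) \<delta>} \<le> card {\<delta> \<in> \<Delta> n. \<delta> \<subseteq> active_region (\<Delta> n) (p n k)}"
                using partition_facts(1) by (intro card_mono) (auto simp: active_region_def)
              also have "\<dots> \<le> C2" using elim(2) k by blast
              finally show "real (card {\<delta> \<in> \<Delta> n. active_on (p n k) \<delta>}) \<le> real C2 + 1" by simp
            qed simp
            finally show "(\<Sum>\<delta>\<in>\<Delta> n. if active_on (p n k) \<delta> then (a k)\<^sup>2 else 0) \<le> (real C2 + 1) * (a k)\<^sup>2" .
          qed
          also have "\<dots> = (real C2 + 1) * (L2_set a {..<K n})\<^sup>2" by (simp add: L2_set_def sum_nonneg sum_distrib_left)
          finally show "(\<Sum>\<delta>\<in>\<Delta> n. S \<delta>) \<le> (real C2 + 1) * (L2_set a {..<K n})\<^sup>2" .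
        qed (use B d in auto)
        finally show ?thesis by (simp add: C_def power_mult_distrib mult_ac)
      qed
      ultimately show "\<exists>g. integrable lebesgue g \<and> (\<forall>z. g z \<ge> 0) \<and>
    (AE z in lebesgue. z \<in> X \<longrightarrow> (\<Sum>k<K n. dp n k u z * a k)\<^sup>2 \<le> g z) \<and>
    (\<integral>z. g z \<partial>lebesgue) \<le> C * h n ^ CARD('d) * (h n powi (- int (msize u)))\<^sup>2 * (L2_set a {..<K n})\<^sup>2"
        using gi g0 unfolding H_def by blast
    qed
  qed
  moreover have "C > 0" using B C1(1) by (simp add: C_def)
  ultimately show ?thesis by blast
qed

lemma mesh_power_derivative:
  "h n ^ (m - msize v) = h n ^ m * h n powi (- int (msize v))"
  using basis_facts(3) mesh_pos[of n] by (simp add: power_int_minus power_diff divide_inverse)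

lemma mesh_power_m_le: "h n \<le> 1 \<Longrightarrow> h n ^ m \<le> h n"
  using smooth mesh_pos[of n] power_decreasing[of 1 m "h n"] by (cases m) auto

text \<open>Cauchy-Schwarz for the coefficient error and the approximation condition for the rest,
  where \<open>h ^ m \<le> h\<close>. The bound holds for every \<open>b\<close>, so the estimate
  may be inserted pointwise, for all \<open>q\<close> at once.\<close>

lemma uniform_error:
  "\<exists>C>0. \<forall>\<^sub>F n in sequentially. \<forall>q\<in>Q. \<forall>z\<in>X. \<forall>b.
     \<bar>(\<Sum>k<K n. dp n k v z * b k) - d\<mu> v z q\<bar> \<le> C * (L2_set (\<lambda>k. b k - \<beta>0 n q k) {..<K n} + h n) * h n powi (- int (msize v))"
  (is "\<exists>C>0. \<forall>\<^sub>F n in sequentially. ?P C n")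
proof -
  obtain C1 where C1: "C1 > 0" "\<forall>\<^sub>F n in sequentially. \<forall>z\<in>X. L2_set (\<lambda>k. dp n k v z) {..<K n} \<le> C1 * h n powi (- int (msize v))"
    using basis_derivative_bound[OF basis_facts(4)] by blast
  obtain C2 where C2: "C2 > 0" "\<forall>\<^sub>F n in sequentially. \<forall>q\<in>Q. \<forall>z\<in>X.
     \<bar>d\<mu> v z q - (\<Sum>k<K n. \<beta>0 n q k * dp n k v z)\<bar> \<le> C2 * h n ^ (m - msize v)"
    using approx_derivative[OF basis_facts(4)] by blast
  have "\<forall>\<^sub>F n in sequentially. ?P (C1 + C2) n"
    using C1(2) C2(2) eventually_mesh_less[OF zero_less_one]
  proof eventually_elim
    case (elim n)
    define H where "H = h n powi (- int (msize v))"
    have H: "H > 0" using mesh_pos[of n] by (simp add: H_def)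
    show ?case
    proof (intro ballI allI)
      fix q z and b :: "nat \<Rightarrow> real"
      assume q: "q \<in> Q" and z: "z \<in> X"
      let ?a = "\<lambda>k. b k - \<beta>0 n q k"
      have "\<bar>\<Sum>k<K n. dp n k v z * ?a k\<bar> \<le> (\<Sum>k<K n. \<bar>dp n k v z\<bar> * \<bar>?a k\<bar>)" unfolding abs_mult[symmetric] by (rule sum_abs)
      also have "\<dots> \<le> L2_set (\<lambda>k. dp n k v z) {..<K n} * L2_set ?a {..<K n}" by (rule L2_set_mult_ineq)
      also have "\<dots> \<le> (C1 * H) * L2_set ?a {..<K n}" using elim(1) z unfolding H_def by (intro mult_right_mono) auto
      finally have 1: "\<bar>\<Sum>k<K n. dp n k v z * ?a k\<bar> \<le> C1 * L2_set ?a {..<K n} * H" by (simp add: mult_ac)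
      have "\<bar>d\<mu> v z q - (\<Sum>k<K n. \<beta>0 n q k * dp n k v z)\<bar> \<le> C2 * h n ^ (m - msize v)" using elim(2) q z by blast
      also have "\<dots> \<le> C2 * (h n * H)"
        unfolding mesh_power_derivative H_def[symmetric] using mesh_power_m_le[of n] elim(3) H C2(1) by (intro mult_left_mono mult_right_mono) auto
      finally have 2: "\<bar>d\<mu> v z q - (\<Sum>k<K n. \<beta>0 n q k * dp n k v z)\<bar> \<le> C2 * h n * H" by simp
      have "(\<Sum>k<K n. dp n k v z * b k) - d\<mu> v z q = (\<Sum>k<K n. dp n k v z * ?a k) - (d\<mu> v z q - (\<Sum>k<K n. \<beta>0 n q k * dp n k v z))"
        by (simp add: algebra_simps sum_subtractf)
      then have "\<bar>(\<Sum>k<K n. dp n k v z * b k) - d\<mu> v z q\<bar> \<le> C1 * L2_set ?a {..<K n} * H + C2 * h n * H" using 1 2 by linarith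
      also have "\<dots> \<le> (C1 + C2) * (L2_set ?a {..<K n} + h n) * H"
      proof -
        have "C1 * (h n * H) \<ge> 0" "C2 * (L2_set ?a {..<K n} * H) \<ge> 0" using C1(1) C2(1) H mesh_pos[of n] by auto
        then show ?thesis by (simp add: algebra_simps)
      qed
      finally show "\<bar>(\<Sum>k<K n. dp n k v z * b k) - d\<mu> v z q\<bar> \<le> (C1 + C2) * (L2_set ?a {..<K n} + h n) * h n powi (- int (msize v))"
        by (simp only: H_def)
    qed
  qed
  moreover have "C1 + C2 > 0" using C1 C2 by simp
  ultimately show ?thesis by blast
qed

text \<open>The squared error is at most twice the sum of two squares. The coefficient part gains
  \<open>h ^ d\<close> from the Gram bound; the bias contributes \<open>h ^ (2 * m)\<close>, at most
  \<open>h ^ (d + 1)\<close>, with the same derivative factor.\<close>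

lemma integrated_error:
  "\<exists>C>0. \<forall>\<^sub>F n in sequentially. \<forall>q\<in>Q. \<forall>b.
     (LINT z:X|lebesgue. ((\<Sum>k<K n. dp n k v z * b k) - d\<mu> v z q)\<^sup>2 * fX z)
       \<le> C * ((L2_set (\<lambda>k. b k - \<beta>0 n q k) {..<K n})\<^sup>2 + h n) * h n powi (int CARD('d) - 2 * int (msize v))"
  (is "\<exists>C>0. \<forall>\<^sub>F n in sequentially. ?P C n")
proof -
  obtain C1 where C1: "C1 > 0" "\<forall>\<^sub>F n in sequentially. \<forall>a. \<exists>g. integrable lebesgue g \<and> (\<forall>z. g z \<ge> 0) \<and>
    (AE z in lebesgue. z \<in> X \<longrightarrow> (\<Sum>k<K n. dp n k v z * a k)\<^sup>2 \<le> g z) \<and>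
    (\<integral>z. g z \<partial>lebesgue) \<le> C1 * h n ^ CARD('d) * (h n powi (- int (msize v)))\<^sup>2 * (L2_set a {..<K n})\<^sup>2"
    using derivative_gram_upper_bound[OF basis_facts(4)] by blast
  obtain C2 where C2: "C2 > 0" "\<forall>\<^sub>F n in sequentially. \<forall>q\<in>Q. \<forall>z\<in>X.
     \<bar>d\<mu> v z q - (\<Sum>k<K n. \<beta>0 n q k * dp n k v z)\<bar> \<le> C2 * h n ^ (m - msize v)"
    using approx_derivative[OF basis_facts(4)] by blast
  have "compact (fX ` X)" using X_compact dgp_facts(6) by (intro compact_continuous_image)
  then obtain F0 where F0: "\<And>z. z \<in> X \<Longrightarrow> fX z \<le> F0"
    using compact_imp_bounded bounded_imp_bdd_above by (metis bdd_above.E imageI)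
  define F where "F = \<bar>F0\<bar> + 1"
  have F: "F > 0" "\<And>z. z \<in> X \<Longrightarrow> fX z \<le> F" using F0 unfolding F_def by force+
  define V where "V = measure lebesgue X"
  have Xfin: "emeasure lebesgue X < \<infinity>"
    using emeasure_bounded_finite[OF X_bounded] X_borel by (simp add: emeasure_completion)
  have V: "V \<ge> 0" by (simp add: V_def)
  have "\<forall>\<^sub>F n in sequentially. ?P (2 * F * C1 + 2 * F * C2\<^sup>2 * V) n"
    using C1(2) C2(2) eventually_mesh_less[OF zero_less_one]
  proof eventually_elim
    case (elim n)
    define H where "H = h n powi (- int (msize v))"
    have H: "H > 0" using mesh_pos[of n] by (simp add: H_def)
    let ?d = "h n ^ CARD('d)"
    have d: "?d > 0" using mesh_pos[of n] by simp
    have hn: "h n \<le> 1" using elim(3) by simp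
    have pw: "h n powi (int CARD('d) - 2 * int (msize v)) = ?d * H\<^sup>2"
    proof -
      have "h n powi (int CARD('d) - 2 * int (msize v)) = h n powi (int CARD('d)) * h n powi (- int (msize v) + - int (msize v))"
        using mesh_pos[of n] by (subst power_int_add[symmetric]) auto
      also have "h n powi (- int (msize v) + - int (msize v)) = H * H"
        unfolding H_def using mesh_pos[of n] by (intro power_int_add) simp
      finally show ?thesis by (simp add: power2_eq_square)
    qed
    show ?case
    proof (intro ballI allI)
      fix q and b :: "nat \<Rightarrow> real"
      assume q: "q \<in> Q"
      let ?a = "\<lambda>k. b k - \<beta>0 n q k"
      let ?L = "(L2_set ?a {..<K n})\<^sup>2"
      obtain g where g: "integrable lebesgue g" "\<forall>z. g z \<ge> 0" "AE z in lebesgue. z \<in> X \<longrightarrow> (\<Sum>k<K n. dp n k v z * ?a k)\<^sup>2 \<le> g z"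
        "(\<integral>z. g z \<partial>lebesgue) \<le> C1 * ?d * H\<^sup>2 * ?L"
        using elim(1)[rule_format, of ?a] unfolding H_def by blast
      define e where "e = (C2 * h n ^ (m - msize v))\<^sup>2"
      have e: "e \<le> C2\<^sup>2 * (?d * h n * H\<^sup>2)"
      proof -
        have "e = C2\<^sup>2 * (h n ^ (2 * m) * H\<^sup>2)"
          by (simp add: e_def mesh_power_derivative H_def power_mult_distrib power_mult[symmetric] mult.commute)
        also have "\<dots> \<le> C2\<^sup>2 * (?d * h n * H\<^sup>2)"
          using power_mesh_le(2)[OF hn] by (intro mult_left_mono mult_right_mono) auto
        finally show ?thesis .
      qed
      have indX: "integrable lebesgue (\<lambda>z. indicator X z * e)"
        using Xfin X_borel by (intro integrable_mult_left integrable_real_indicator) auto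
      have "(LINT z:X|lebesgue. ((\<Sum>k<K n. dp n k v z * b k) - d\<mu> v z q)\<^sup>2 * fX z) \<le> (\<integral>z. 2 * F * g z + 2 * F * (indicator X z * e) \<partial>lebesgue)"
        unfolding set_lebesgue_integral_def
      \<comment> \<open>This rule asks integrability of the nonnegative majorant only: if the left
        integrand were not integrable, its integral would be the default value 0.\<close>
      proof (rule integral_mono_AE')
        show "integrable lebesgue (\<lambda>z. 2 * F * g z + 2 * F * (indicator X z * e))"
          using g(1) indX by (intro Bochner_Integration.integrable_add integrable_mult_right)
        show "AE z in lebesgue. 0 \<le> 2 * F * g z + 2 * F * (indicator X z * e)"
          using g(2) F(1) by (intro AE_I2 add_nonneg_nonneg mult_nonneg_nonneg) (auto simp: e_def)
        show "AE z in lebesgue. indicator X z *\<^sub>R (((\<Sum>k<K n. dp n k v z * b k) - d\<mu> v z q)\<^sup>2 * fX z) \<le> 2 * F * g z + 2 * F * (indicator X z * e)"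
          using g(3)
        proof eventually_elim
          case (elim z)
          note gz = elim
          show ?case
          proof (cases "z \<in> X")
            case False then show ?thesis using g(2) F(1) by simp
          next
            case True
            define A where "A = (\<Sum>k<K n. dp n k v z * ?a k)"
            define D where "D = d\<mu> v z q - (\<Sum>k<K n. \<beta>0 n q k * dp n k v z)"
            have "\<bar>D\<bar> \<le> C2 * h n ^ (m - msize v)"
              using \<open>\<forall>q\<in>Q. \<forall>z\<in>X. \<bar>d\<mu> v z q - (\<Sum>k<K n. \<beta>0 n q k * dp n k v z)\<bar> \<le> C2 * h n ^ (m - msize v)\<close> q True unfolding D_def by blast
            then have D2: "D\<^sup>2 \<le> e" unfolding e_def by (rule abs_le_square_iff[THEN iffD1, OF order.trans[OF _ abs_ge_self]])
            have A2: "A\<^sup>2 \<le> g z" using gz True by (simp add: A_def)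
            have "(\<Sum>k<K n. dp n k v z * b k) - d\<mu> v z q = A - D"
              by (simp add: A_def D_def algebra_simps sum_subtractf)
            then have "((\<Sum>k<K n. dp n k v z * b k) - d\<mu> v z q)\<^sup>2 = (A - D)\<^sup>2" by simp
            also have "\<dots> \<le> 2 * A\<^sup>2 + 2 * D\<^sup>2" using sum_squares_ge_zero[of "A + D" 0] by (simp add: power2_eq_square algebra_simps)
            also have "\<dots> \<le> 2 * g z + 2 * e" using A2 D2 by linarith
            finally have "((\<Sum>k<K n. dp n k v z * b k) - d\<mu> v z q)\<^sup>2 * fX z \<le> (2 * g z + 2 * e) * F"
              using F True fX_nonneg[of z] g(2) by (intro mult_mono) (auto simp: e_def)
            then show ?thesis using True by (simp add: algebra_simps)
          qed
        qed
      qed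
      also have "\<dots> = 2 * F * (\<integral>z. g z \<partial>lebesgue) + 2 * F * (V * e)"
        using g(1) indX by (subst Bochner_Integration.integral_add) (auto simp: V_def)
      also have "\<dots> \<le> 2 * F * (C1 * ?d * H\<^sup>2 * ?L) + 2 * F * (V * (C2\<^sup>2 * (?d * h n * H\<^sup>2)))"
        using g(4) e F(1) V by (intro add_mono mult_left_mono) auto
      also have "\<dots> \<le> (2 * F * C1 + 2 * F * C2\<^sup>2 * V) * (?L + h n) * (?d * H\<^sup>2)"
      proof -
        have "0 \<le> 2 * F * C1 * (h n * (?d * H\<^sup>2))" "0 \<le> 2 * F * C2\<^sup>2 * V * (?L * (?d * H\<^sup>2))"
          using F(1) C1(1) V d mesh_pos[of n] by auto
        then show ?thesis by (simp add: algebra_simps)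
      qed
      finally show "(LINT z:X|lebesgue. ((\<Sum>k<K n. dp n k v z * b k) - d\<mu> v z q)\<^sup>2 * fX z)
       \<le> (2 * F * C1 + 2 * F * C2\<^sup>2 * V) * (?L + h n) * h n powi (int CARD('d) - 2 * int (msize v))"
        by (simp only: pw)
    qed
  qed
  moreover have "2 * F * C1 + 2 * F * C2\<^sup>2 * V > 0" using F(1) C1(1) V by (intro add_pos_nonneg) auto
  ultimately show ?thesis by blast
qed

end

theorem lemma1:
  fixes M :: "'w measure"
    and x :: "nat \<Rightarrow> 'w \<Rightarrow> real^'d::finite" and y :: "nat \<Rightarrow> 'w \<Rightarrow> real"
    and X :: "(real^'d) set" and Y E Q :: "real set"
    and \<rho> \<psi> :: "real \<Rightarrow> real \<Rightarrow> real \<Rightarrow> real" and \<eta> :: "real \<Rightarrow> real"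
    and \<mu>0 :: "real^'d \<Rightarrow> real \<Rightarrow> real" and d\<mu> :: "('d \<Rightarrow> nat) \<Rightarrow> real^'d \<Rightarrow> real \<Rightarrow> real"
    and fX :: "real^'d \<Rightarrow> real" and N :: "real measure" and fYX :: "real^'d \<Rightarrow> real \<Rightarrow> real"
    and \<psi>bar :: "real^'d \<Rightarrow> real \<Rightarrow> real" and r \<alpha> \<nu> :: real
    and m s :: nat and v :: "'d \<Rightarrow> nat"
    and K :: "nat \<Rightarrow> nat" and \<Delta> :: "nat \<Rightarrow> (real^'d) set set"
    and p :: "nat \<Rightarrow> nat \<Rightarrow> real^'d \<Rightarrow> real"
    and dp :: "nat \<Rightarrow> nat \<Rightarrow> ('d \<Rightarrow> nat) \<Rightarrow> real^'d \<Rightarrow> real"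
    and \<beta>0 :: "nat \<Rightarrow> real \<Rightarrow> nat \<Rightarrow> real" and \<beta>hat :: "nat \<Rightarrow> 'w \<Rightarrow> real \<Rightarrow> nat \<Rightarrow> real"
    and \<B> :: "nat \<Rightarrow> (nat \<Rightarrow> real) set"
    and h :: "nat \<Rightarrow> real" and \<mu>hat :: "nat \<Rightarrow> 'w \<Rightarrow> ('d \<Rightarrow> nat) \<Rightarrow> real^'d \<Rightarrow> real \<Rightarrow> real"
  assumes "Y \<in> sets borel" and "range \<eta> \<subseteq> E"
    and "\<And>n. polyhedral_partition X (\<Delta> n)"
    and "\<And>n. dictionary X (\<Delta> n) s (K n) (p n) (dp n)"
    and h: "\<And>n. h n = mesh (\<Delta> n)"
    and \<beta>hat: "\<And>n \<omega> q. \<omega> \<in> space M \<Longrightarrow> q \<in> Q \<Longrightarrow>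
      m_estimate \<rho> \<eta> n (\<lambda>i. x i \<omega>) (\<lambda>i. y i \<omega>) (K n) (p n) (\<B> n) q (\<beta>hat n \<omega> q)"
    and \<mu>hat: "\<And>n \<omega> u z q. \<mu>hat n \<omega> u z q = (\<Sum>k<K n. dp n k u z * \<beta>hat n \<omega> q k)"
    and "quasi_uniform_partition \<Delta>"
    and "local_basis m v s \<Delta> K p dp"
    and "data_generating_process M x y X Y Q \<rho> \<eta> m \<mu>0 d\<mu> fX N fYX"
    and "loss_function X Y E Q \<rho> \<psi> \<eta> \<mu>0 N (cond_law N Y fYX) \<psi>bar r \<alpha> \<nu>"
    and "simplified_setup X Y E Q \<rho> \<eta> \<mu>0 N fYX \<alpha> \<nu>"
    and "approximation_error X Q m s \<Delta> K dp d\<mu> \<beta>0"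
    and "\<And>t q. t \<in> Y \<Longrightarrow> q \<in> Q \<Longrightarrow> convex_on UNIV (\<lambda>\<theta>. \<rho> t (\<eta> \<theta>) q)"
    and "\<And>t q. t \<in> Y \<Longrightarrow> q \<in> Q \<Longrightarrow>
      (\<forall>\<theta>. ((\<lambda>\<theta>. \<rho> t (\<eta> \<theta>) q) has_real_derivative \<psi> t (\<eta> \<theta>) q * deriv \<eta> \<theta>) (at_left \<theta>)) \<or>
      (\<forall>\<theta>. ((\<lambda>\<theta>. \<rho> t (\<eta> \<theta>) q) has_real_derivative \<psi> t (\<eta> \<theta>) q * deriv \<eta> \<theta>) (at_right \<theta>))"
    and "\<And>n. \<B> n = euclid (K n)"
    and "real m > real CARD('d) / 2"
    and rate:
      "(\<lambda>n. ln (real n) powr (\<nu> / (\<nu> - 1)) / (real n * h n powr (2 * \<nu> / (\<nu> - 1) * real CARD('d))))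
         \<in> o(\<lambda>_. 1) \<or>
       (\<lambda>n. ln (real n) powr (3 / 2) / (real n * h n ^ (2 * CARD('d)))) \<in> o(\<lambda>_. 1) \<and>
         cond_sub_gaussian X (cond_law N Y fYX) \<psi>bar"
  shows "small_o_prob M (\<lambda>n \<omega>. SUP q\<in>Q. ereal (L2_set (\<lambda>k. \<beta>hat n \<omega> q k - \<beta>0 n q k) {..<K n}))
           (\<lambda>_. 1) \<and>
         small_o_prob M (\<lambda>n \<omega>. SUP z\<in>X. SUP q\<in>Q. ereal \<bar>\<mu>hat n \<omega> v z q - d\<mu> v z q\<bar>)
           (\<lambda>n. h n powi (- int (msize v))) \<and>
         small_o_prob M (\<lambda>n \<omega>. SUP q\<in>Q. ereal (LINT z:X|lebesgue. (\<mu>hat n \<omega> v z q - d\<mu> v z q)\<^sup>2 * fX z))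
           (\<lambda>n. h n powi (int CARD('d) - 2 * int (msize v)))"
proof -
  interpret partitioning_estimation M x y X Y E Q \<rho> \<psi> \<eta> \<mu>0 d\<mu> fX N fYX \<psi>bar r \<alpha> \<nu> m s v K \<Delta> p dp \<beta>0
    by unfold_locales (fact assms)+
  have ps: "prob_space M" by (rule dgp_facts)
  have est: "m_estimate \<rho> \<eta> n (\<lambda>i. x i \<omega>) (\<lambda>i. y i \<omega>) (K n) (p n) (euclid (K n)) q (\<beta>hat n \<omega> q)"
    if "\<omega> \<in> space M" "q \<in> Q" for n \<omega> q
    using \<beta>hat[OF that, of n] by (simp add: assms(16))
  let ?L = "\<lambda>n \<omega> q. L2_set (\<lambda>k. \<beta>hat n \<omega> q k - \<beta>0 n q k) {..<K n}"
  have cons: "\<forall>\<^sub>F n in sequentially. \<exists>B\<in>sets M. measure M B \<le> e \<and> (\<forall>\<omega>\<in>space M - B. \<forall>q\<in>Q. ?L n \<omega> q \<le> \<epsilon>)"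
    if "\<epsilon> > 0" "e > 0" for \<epsilon> e
    using consistency[OF rate[unfolded h] that]
  proof eventually_elim
    case (elim n)
    then obtain B where B: "B \<in> sets M" "measure M B \<le> e" "\<forall>\<omega>\<in>space M - B. \<forall>q\<in>Q. \<forall>b. m_estimate \<rho> \<eta> n (\<lambda>i. x i \<omega>) (\<lambda>i. y i \<omega>) (K n) (p n) (euclid (K n)) q b \<longrightarrow>
       L2_set (\<lambda>k. b k - \<beta>0 n q k) {..<K n} \<le> \<epsilon>" by blast
    then have "\<forall>\<omega>\<in>space M - B. \<forall>q\<in>Q. ?L n \<omega> q \<le> \<epsilon>" using est by blast
    with B show ?case by blast
  qed
  show ?thesis
  proof (intro conjI)
    show "small_o_prob M (\<lambda>n \<omega>. SUP q\<in>Q. ereal (?L n \<omega> q)) (\<lambda>_. 1)"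
    proof (rule small_o_probI[OF ps])
      fix \<epsilon> e :: real assume \<epsilon>: "\<epsilon> > 0" "e > 0"
      show "\<forall>\<^sub>F n in sequentially. \<exists>B\<in>sets M. measure M B \<le> e \<and> (\<forall>\<omega>\<in>space M - B. (SUP q\<in>Q. ereal (?L n \<omega> q)) \<le> ereal (\<epsilon> * 1))"
        using cons[OF \<epsilon>]
      proof eventually_elim
        case (elim n)
        then obtain B where B: "B \<in> sets M" "measure M B \<le> e" "\<forall>\<omega>\<in>space M - B. \<forall>q\<in>Q. ?L n \<omega> q \<le> \<epsilon>" by blast
        show ?case by (rule bexI[OF _ B(1)]) (use B(2,3) in \<open>auto intro!: SUP_least\<close>)
      qed
    qed
    show "small_o_prob M (\<lambda>n \<omega>. SUP z\<in>X. SUP q\<in>Q. ereal \<bar>\<mu>hat n \<omega> v z q - d\<mu> v z q\<bar>) (\<lambda>n. h n powi (- int (msize v)))"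
      unfolding h
    proof (rule small_o_probI[OF ps])
      fix \<epsilon> e :: real assume \<epsilon>: "\<epsilon> > 0" and e: "e > 0"
      obtain C where C: "C > 0" "\<forall>\<^sub>F n in sequentially. \<forall>q\<in>Q. \<forall>z\<in>X. \<forall>b.
         \<bar>(\<Sum>k<K n. dp n k v z * b k) - d\<mu> v z q\<bar> \<le> C * (L2_set (\<lambda>k. b k - \<beta>0 n q k) {..<K n} + mesh (\<Delta> n)) * mesh (\<Delta> n) powi (- int (msize v))"
        using uniform_error by blast
      \<comment> \<open>Half of the target is for the coefficient error, half for the mesh.\<close>
      have \<epsilon>': "\<epsilon> / (2 * C) > 0" using \<epsilon> C(1) by simp
      show "\<forall>\<^sub>F n in sequentially. \<exists>B\<in>sets M. measure M B \<le> e \<and> (\<forall>\<omega>\<in>space M - B. (SUP z\<in>X. SUP q\<in>Q. ereal \<bar>\<mu>hat n \<omega> v z q - d\<mu> v z q\<bar>) \<le> ereal (\<epsilon> * mesh (\<Delta> n) powi (- int (msize v))))"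
        using cons[OF \<epsilon>' e] C(2) eventually_mesh_less[OF \<epsilon>']
      proof eventually_elim
        case (elim n)
        let ?H = "mesh (\<Delta> n) powi (- int (msize v))"
        have H: "?H > 0" using mesh_pos[of n] by simp
        from elim(1) obtain B where B: "B \<in> sets M" "measure M B \<le> e" "\<forall>\<omega>\<in>space M - B. \<forall>q\<in>Q. ?L n \<omega> q \<le> \<epsilon> / (2 * C)" by blast
        have "\<bar>\<mu>hat n \<omega> v z q - d\<mu> v z q\<bar> \<le> \<epsilon> * ?H" if "\<omega> \<in> space M - B" "z \<in> X" "q \<in> Q" for \<omega> z q
        proof -
          have "\<bar>\<mu>hat n \<omega> v z q - d\<mu> v z q\<bar> \<le> C * (?L n \<omega> q + mesh (\<Delta> n)) * ?H"
            unfolding \<mu>hat using elim(2) that by blast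
          also have "\<dots> \<le> C * (\<epsilon> / (2 * C) + \<epsilon> / (2 * C)) * ?H"
            using B(3) that elim(3) C(1) H by (intro mult_right_mono mult_left_mono add_mono) auto
          also have "C * (\<epsilon> / (2 * C) + \<epsilon> / (2 * C)) = \<epsilon>" using C(1) by simp
          finally show ?thesis .
        qed
        then show ?case by (intro bexI[OF _ B(1)]) (use B(2) in \<open>auto intro!: SUP_least\<close>)
      qed
    qed
    show "small_o_prob M (\<lambda>n \<omega>. SUP q\<in>Q. ereal (LINT z:X|lebesgue. (\<mu>hat n \<omega> v z q - d\<mu> v z q)\<^sup>2 * fX z))
           (\<lambda>n. h n powi (int CARD('d) - 2 * int (msize v)))"
      unfolding h
    proof (rule small_o_probI[OF ps])
      fix \<epsilon> e :: real assume \<epsilon>: "\<epsilon> > 0" and e: "e > 0"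
      obtain C where C: "C > 0" "\<forall>\<^sub>F n in sequentially. \<forall>q\<in>Q. \<forall>b.
         (LINT z:X|lebesgue. ((\<Sum>k<K n. dp n k v z * b k) - d\<mu> v z q)\<^sup>2 * fX z)
           \<le> C * ((L2_set (\<lambda>k. b k - \<beta>0 n q k) {..<K n})\<^sup>2 + mesh (\<Delta> n)) * mesh (\<Delta> n) powi (int CARD('d) - 2 * int (msize v))"
        using integrated_error by blast
      \<comment> \<open>Here the coefficient error enters squared, so consistency is used at the
        level of the square root.\<close>
      have \<epsilon>': "\<epsilon> / (2 * C) > 0" "sqrt (\<epsilon> / (2 * C)) > 0" using \<epsilon> C(1) by auto
      show "\<forall>\<^sub>F n in sequentially. \<exists>B\<in>sets M. measure M B \<le> e \<and> (\<forall>\<omega>\<in>space M - B. (SUP q\<in>Q. ereal (LINT z:X|lebesgue. (\<mu>hat n \<omega> v z q - d\<mu> v z q)\<^sup>2 * fX z))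
          \<le> ereal (\<epsilon> * mesh (\<Delta> n) powi (int CARD('d) - 2 * int (msize v))))"
        using cons[OF \<epsilon>'(2) e] C(2) eventually_mesh_less[OF \<epsilon>'(1)]
      proof eventually_elim
        case (elim n)
        let ?H = "mesh (\<Delta> n) powi (int CARD('d) - 2 * int (msize v))"
        have H: "?H > 0" using mesh_pos[of n] by simp
        from elim(1) obtain B where B: "B \<in> sets M" "measure M B \<le> e" "\<forall>\<omega>\<in>space M - B. \<forall>q\<in>Q. ?L n \<omega> q \<le> sqrt (\<epsilon> / (2 * C))" by blast
        have "(LINT z:X|lebesgue. (\<mu>hat n \<omega> v z q - d\<mu> v z q)\<^sup>2 * fX z) \<le> \<epsilon> * ?H" if "\<omega> \<in> space M - B" "q \<in> Q" for \<omega> q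
        proof -
          have "(?L n \<omega> q)\<^sup>2 \<le> (sqrt (\<epsilon> / (2 * C)))\<^sup>2" using B(3) that by (intro power_mono) auto
          then have sq: "(?L n \<omega> q)\<^sup>2 \<le> \<epsilon> / (2 * C)" using \<epsilon>'(1) by simp
          have "(LINT z:X|lebesgue. (\<mu>hat n \<omega> v z q - d\<mu> v z q)\<^sup>2 * fX z) \<le> C * ((?L n \<omega> q)\<^sup>2 + mesh (\<Delta> n)) * ?H"
            unfolding \<mu>hat using elim(2) that by blast
          also have "\<dots> \<le> C * (\<epsilon> / (2 * C) + \<epsilon> / (2 * C)) * ?H"
            using sq elim(3) C(1) H by (intro mult_right_mono mult_left_mono add_mono) auto
          also have "C * (\<epsilon> / (2 * C) + \<epsilon> / (2 * C)) = \<epsilon>" using C(1) by simp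
          finally show ?thesis .
        qed
        then show ?case by (intro bexI[OF _ B(1)]) (use B(2) in \<open>auto intro!: SUP_least\<close>)
      qed
    qed
  qed
qed

end
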